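(* Let $N \in \{1,2,\dots\}$, $\alpha \in (0,N)$ and $p \in (1,\infty)$. If $$\frac{N-2}{N+\alpha} < \frac1p < \frac{N}{N+\alpha},$$ then there exists $u \in W^{1,2}(\mathbb{R}^N)$ such that $$-\Delta u + u = (I_\alpha * |u|^p)\,|u|^{p-2}u$$ weakly in $\mathbb{R}^N$. Moreover, $$E_{\alpha,p}(u) = \inf\Bigl\{ E_{\alpha,p}(v) : v \in W^{1,2}(\mathbb{R}^N)\setminus\{0\} \text{ and } \int_{\mathbb{R}^N} |\nabla v|^2 + |v|^2 = \int_{\mathbb{R}^N} (I_\alpha * |v|^p)|v|^p \Bigr\}.$$
   Context: Functions are real-valued. $I_\alpha:\mathbb{R}^N\to\mathbb{R}$ is the Riesz potential $I_\alpha(x)=\frac{\Gamma(\frac{N-\alpha}{2})}{\Gamma(\frac{\alpha}{2})\pi^{N/2}2^{\alpha}|x|^{N-\alpha}}$, where $\Gamma$ is the Gamma function. For $u\in W^{1,2}(\mathbb{R}^N)\cap L^{\frac{2Np}{N+\alpha}}(\mathbb{R}^N)$, $$E_{\alpha,p}(u)=\frac12\int_{\mathbb{R}^N}|\nabla u|^2+|u|^2-\frac1{2p}\int_{\mathbb{R}^N}(I_\alpha*|u|^p)|u|^p.$$ Under the stated condition on $p$, the Sobolev embedding gives $W^{1,2}(\mathbb{R}^N)\subset L^{\frac{2Np}{N+\alpha}}(\mathbb{R}^N)$, and $E_{\alpha,p}$ is well defined and finite by the Hardy–Littlewood–Sobolev inequality. The equation holds weakly in $\mathbb{R}^N$ if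 $\int \nabla u\cdot\nabla\varphi+u\varphi=\int (I_\alpha*|u|^p)|u|^{p-2}u\,\varphi$ for every $\varphi\in C_c^\infty(\mathbb{R}^N)$; $|u|^{p-2}u$ is understood as $0$ where $u=0$. *)

theory Defs
  imports "HOL-Analysis.Analysis"
begin

primrec C_k :: "nat \<Rightarrow> ('a::euclidean_space \<Rightarrow> real) \<Rightarrow> bool" where
  "C_k 0 f \<longleftrightarrow> continuous_on UNIV f"
| "C_k (Suc k) f \<longleftrightarrow>
     (\<forall>x. f differentiable (at x)) \<and> (\<forall>v. C_k k (\<lambda>x. frechet_derivative f (at x) v))"

definition test_functions :: "('a::euclidean_space \<Rightarrow> real) set" where
  "test_functions = {\<phi>. (\<forall>k. C_k k \<phi>) \<and> compact (closure {x. \<phi> x \<noteq> 0})}"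

definition gradient :: "('a::euclidean_space \<Rightarrow> real) \<Rightarrow> 'a \<Rightarrow> 'a" where
  "gradient f x = (\<Sum>b\<in>Basis. frechet_derivative f (at x) b *\<^sub>R b)"

definition locally_integrable :: "('a::euclidean_space \<Rightarrow> 'b::euclidean_space) \<Rightarrow> bool" where
  "locally_integrable f \<longleftrightarrow> (\<forall>K. compact K \<longrightarrow> set_integrable lebesgue K f)"

definition has_weak_gradient ::
    "('a::euclidean_space \<Rightarrow> real) \<Rightarrow> ('a \<Rightarrow> 'a) \<Rightarrow> bool" where
  "has_weak_gradient u g \<longleftrightarrow>
     locally_integrable u \<and> locally_integrable g \<and>
     (\<forall>\<phi>\<in>test_functions.
        (\<integral>x. u x *\<^sub>R gradient \<phi> x \<partial>lebesgue) = - (\<integral>x. \<phi> x *\<^sub>R g x \<partial>lebesgue))"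

(* A weak gradient is unique up to a null set, so integrals involving
   weak_gradient u do not depend on the representative chosen here. *)
definition weak_gradient :: "('a::euclidean_space \<Rightarrow> real) \<Rightarrow> 'a \<Rightarrow> 'a" where
  "weak_gradient u = (SOME g. has_weak_gradient u g)"

definition square_integrable :: "('a::euclidean_space \<Rightarrow> 'b::euclidean_space) \<Rightarrow> bool" where
  "square_integrable f \<longleftrightarrow>
     f \<in> borel_measurable lebesgue \<and> integrable lebesgue (\<lambda>x. (norm (f x))\<^sup>2)"

(* Elements are functions rather than classes modulo equality almost everywhere;
   accordingly, being the zero element means vanishing almost everywhere. *)
definition W12 :: "('a::euclidean_space \<Rightarrow> real) set" where
  "W12 = {u. square_integrable u \<and> (\<exists>g. has_weak_gradient u g \<and> square_integrable g)}"

(* The value at 0 is 0 rather than infinity; this is a null set. *)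
definition riesz_potential :: "real \<Rightarrow> 'a::euclidean_space \<Rightarrow> real" where
  "riesz_potential \<alpha> x =
     Gamma ((real DIM('a) - \<alpha>) / 2) /
     (Gamma (\<alpha> / 2) * pi powr (real DIM('a) / 2) * 2 powr \<alpha> * norm x powr (real DIM('a) - \<alpha>))"

definition convolution ::
    "('a::euclidean_space \<Rightarrow> real) \<Rightarrow> ('a \<Rightarrow> real) \<Rightarrow> 'a \<Rightarrow> real" where
  "convolution f g x = (\<integral>y. f (x - y) * g y \<partial>lebesgue)"

definition W12_norm_sq :: "('a::euclidean_space \<Rightarrow> real) \<Rightarrow> real" where
  "W12_norm_sq u = (\<integral>x. (norm (weak_gradient u x))\<^sup>2 + \<bar>u x\<bar>\<^sup>2 \<partial>lebesgue)"

definition choquard_term :: "real \<Rightarrow> real \<Rightarrow> ('a::euclidean_space \<Rightarrow> real) \<Rightarrow> real" where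
  "choquard_term \<alpha> p u =
     (\<integral>x. convolution (riesz_potential \<alpha>) (\<lambda>y. \<bar>u y\<bar> powr p) x * \<bar>u x\<bar> powr p \<partial>lebesgue)"

definition energy :: "real \<Rightarrow> real \<Rightarrow> ('a::euclidean_space \<Rightarrow> real) \<Rightarrow> real" where
  "energy \<alpha> p u = 1 / 2 * W12_norm_sq u - 1 / (2 * p) * choquard_term \<alpha> p u"

definition choquard_weak_solution ::
    "real \<Rightarrow> real \<Rightarrow> ('a::euclidean_space \<Rightarrow> real) \<Rightarrow> bool" where
  "choquard_weak_solution \<alpha> p u \<longleftrightarrow>
     (\<forall>\<phi>\<in>test_functions.
        (\<integral>x. weak_gradient u x \<bullet> gradient \<phi> x + u x * \<phi> x \<partial>lebesgue) =
        (\<integral>x. convolution (riesz_potential \<alpha>) (\<lambda>y. \<bar>u y\<bar> powr p) x *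
              (\<bar>u x\<bar> powr (p - 2) * u x) * \<phi> x \<partial>lebesgue))"

end

theory Submission
  imports Defs "HOL-Computational_Algebra.Polynomial" "HOL-Complex_Analysis.Great_Picard"
begin

text \<open>The Choquard term \<open>D\<close> is homogeneous of degree \<open>2 p\<close>, so a suitable multiple of a maximiser of
  \<open>D\<close> on the unit ball of \<open>W\<^sup>1\<^sup>,\<^sup>2\<close> is the groundstate. Splitting the Riesz potential into its parts
  near and away from the origin, Young's inequality bounds \<open>D\<close> by two \<open>L\<^sup>s\<close> norms with strictly
  subcritical \<open>s\<close>, so that the subcritical Sobolev embedding, Lions' lemma and the Rellich theorem
  suffice; all three come from the Poincare inequality on dyadic cubes, with averages in place of
  mollifiers.

  A maximising sequence \<open>u n\<close> is translated so that, by Lions' lemma, its weak limit \<open>u\<close> is not zero.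
  Strong convergence is not known at this stage, but \<open>D (u n + t \<phi>) \<le> S * norm (u n + t \<phi>) ^ (2 p)\<close>
  for the supremum \<open>S\<close> and all \<open>t\<close>. Passing to the limit in the terms of first order in \<open>t\<close> yields the
  Euler equation for \<open>u\<close>, and testing it with \<open>u\<close> itself shows that \<open>u\<close> has norm one and
  is a maximiser.\<close>


section \<open>Test functions\<close>

text \<open>Strict subcriticality comes from a gap in the hypotheses. For the
  Hardy-Littlewood-Sobolev exponent t = 2 N / (N + \<alpha>) they say that p t lies strictly between
  2 and the critical Sobolev exponent (infinite for N \<le> 2). So t can be moved slightly up for
  the part of the kernel near the origin and slightly down for the rest, and each part then has the
  integrability that Young's inequality asks of it.

  Translations destroy compactness, so \<open>D\<close> cannot simply be passed to the limit along
  the maximising sequence. The remedy is one-sided: convexity of the p-th power gives a lower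
  expansion of \<open>D\<close> at u n in the direction \<phi> whose error is C \<tau>^2 with C
  independent of n, and the upper bound S (1 + 2 \<tau> a + \<tau>^2 H)^p has the same value at
  \<tau> = 0. The difference of the two limits therefore has an interior minimum at 0, and its
  vanishing derivative is the Euler equation.

  A Bochner integral without integrability is 0 by convention, so identities between integrals are
  accompanied by proofs of integrability.\<close>

lemma C_k_Suc_imp: "C_k (Suc k) f \<Longrightarrow> C_k k f"
proof (induction k arbitrary: f)
  case 0
  then show ?case
    by (auto intro!: differentiable_imp_continuous_within continuous_at_imp_continuous_on)
next
  case (Suc k)
  then show ?case by (metis C_k.simps(2))
qed

lemma C_k_const: "C_k k (\<lambda>x::'a::euclidean_space. c)"
proof (induction k arbitrary: c)
  case (Suc k)
  have "frechet_derivative (\<lambda>x::'a. c) (at x) v = 0" for x v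
    by (simp add: frechet_derivative_const)
  with Suc show ?case by simp
qed simp

lemma C_k_add: "C_k k f \<Longrightarrow> C_k k g \<Longrightarrow> C_k k (\<lambda>x. f x + g x)"
proof (induction k arbitrary: f g)
  case (Suc k)
  have "frechet_derivative (\<lambda>x. f x + g x) (at x) v
      = frechet_derivative f (at x) v + frechet_derivative g (at x) v" for x v
    using Suc.prems
    by (intro frechet_derivative_at[symmetric, THEN fun_cong] has_derivative_add)
       (auto simp: frechet_derivative_works[symmetric])
  with Suc show ?case by simp
qed (auto intro: continuous_intros)

lemma C_k_mult: "C_k k f \<Longrightarrow> C_k k g \<Longrightarrow> C_k k (\<lambda>x. f x * g x)"
proof (induction k arbitrary: f g)
  case (Suc k)
  have "frechet_derivative (\<lambda>x. f x * g x) (at x) v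
      = f x * frechet_derivative g (at x) v + frechet_derivative f (at x) v * g x" for x v
    using Suc.prems
    by (intro frechet_derivative_at[symmetric, THEN fun_cong] has_derivative_mult)
       (auto simp: frechet_derivative_works[symmetric])
  with Suc C_k_Suc_imp show ?case by (auto intro!: C_k_add Suc.IH)
qed (auto intro: continuous_intros)

text \<open>The chain rule turns \<open>H j\<close> into \<open>H (Suc j)\<close>, so the induction
  on k closes only for the whole family of successive derivatives at once, with j arbitrary.\<close>

lemma C_k_comp:
  fixes H :: "nat \<Rightarrow> real \<Rightarrow> real"
  assumes H: "\<And>j x. (H j has_real_derivative H (Suc j) x) (at x)"
  shows "C_k k f \<Longrightarrow> C_k k (\<lambda>x. H j (f x))"
proof (induction k arbitrary: f j)
  case 0
  have "continuous_on UNIV (H j)"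
    using H DERIV_isCont continuous_at_imp_continuous_on by blast
  with 0 show ?case
    by (metis C_k.simps(1) UNIV_I continuous_on_compose2 subsetI)
next
  case (Suc k)
  have *: "((\<lambda>x. H j (f x)) has_derivative (\<lambda>v. H (Suc j) (f x) * frechet_derivative f (at x) v)) (at x)" for x
    using Suc.prems H[of j "f x"]
    by (intro has_derivative_compose[of f "frechet_derivative f (at x)" x UNIV "H j" "\<lambda>h. H (Suc j) (f x) * h"])
       (auto simp: frechet_derivative_works[symmetric] has_field_derivative_def)
  have "C_k k (\<lambda>x. H (Suc j) (f x) * frechet_derivative f (at x) v)" for v
    using Suc.prems C_k_Suc_imp by (intro C_k_mult Suc.IH) auto
  with * show ?case
    by (auto simp: frechet_derivative_at[OF *, symmetric] intro: differentiableI)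
qed

lemma C_k_linear:
  assumes "bounded_linear f" shows "C_k k (f :: 'a::euclidean_space \<Rightarrow> real)"
proof (cases k)
  case 0
  then show ?thesis using assms linear_continuous_on by auto
next
  case (Suc j)
  have *: "(f has_derivative f) (at x)" for x
    using assms by (rule bounded_linear.has_derivative) auto
  show ?thesis
    using * Suc by (auto simp: frechet_derivative_at[OF *, symmetric] C_k_const intro: differentiableI)
qed

lemma C_k_prod:
  "finite I \<Longrightarrow> (\<And>i. i \<in> I \<Longrightarrow> C_k k (f i)) \<Longrightarrow> C_k k (\<lambda>x. \<Prod>i\<in>I. f i x)"
  by (induction I rule: finite_induct) (auto intro: C_k_mult C_k_const)

lemma C_k_translate: "C_k k f \<Longrightarrow> C_k k (\<lambda>x. f (x + z))"
proof (induction k arbitrary: f)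
  case 0
  then show ?case by (auto intro!: continuous_intros elim: continuous_on_compose2)
next
  case (Suc k)
  have *: "((\<lambda>x. f (x + z)) has_derivative frechet_derivative f (at (x + z))) (at x)" for x
    using Suc.prems
    by (intro has_derivative_compose[of "\<lambda>x. x + z" "\<lambda>h. h" x UNIV f "frechet_derivative f (at (x+z))"])
       (auto simp: frechet_derivative_works[symmetric] intro!: derivative_eq_intros)
  with Suc show ?case
    by (auto simp: frechet_derivative_at[OF *, symmetric] intro: differentiableI)
qed

text \<open>The derivatives of \<open>exp (- 1 / t)\<close> on the positive axis are \<open>P (1 / t) * exp (- 1 / t)\<close>
  with polynomials \<open>P\<close> satisfying this recursion.\<close>

primrec flat_poly :: "nat \<Rightarrow> real poly" where
  "flat_poly 0 = 1"
| "flat_poly (Suc j) = monom 1 2 * (flat_poly j - pderiv (flat_poly j))"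

definition flat :: "nat \<Rightarrow> real \<Rightarrow> real" where
  "flat j t = (if t > 0 then poly (flat_poly j) (1 / t) * exp (- (1 / t)) else 0)"

lemma poly_exp_tendsto_0: "((\<lambda>y. poly P y * exp (- y)) \<longlongrightarrow> (0::real)) at_top"
proof -
  have "((\<lambda>y. \<Sum>i\<le>degree P. coeff P i * (y ^ i / exp y)) \<longlongrightarrow> (\<Sum>i\<le>degree P. coeff P i * 0)) at_top"
    by (intro tendsto_intros tendsto_power_div_exp_0)
  then show ?thesis
    by (simp add: poly_altdef sum_distrib_right exp_minus divide_inverse mult.assoc)
qed

lemma flat_deriv: "(flat j has_real_derivative flat (Suc j) t) (at t)"
proof -
  consider "t > 0" | "t < 0" | "t = 0" by linarith
  then show ?thesis
  proof cases
    case 1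
    have "((\<lambda>t. poly (flat_poly j) (1 / t) * exp (- (1 / t))) has_real_derivative flat (Suc j) t) (at t)"
      using 1 by (auto intro!: derivative_eq_intros DERIV_chain2[OF poly_DERIV]
          simp: flat_def poly_monom field_simps power2_eq_square)
    moreover have "\<forall>\<^sub>F s in nhds t. flat j s = poly (flat_poly j) (1 / s) * exp (- (1 / s))"
      using 1 order_tendstoD(1)[of "\<lambda>x. x" t "nhds t" 0]
      by (auto simp: flat_def filterlim_ident elim: eventually_mono)
    ultimately show ?thesis by (subst DERIV_cong_ev[OF refl _ refl])
  next
    case 2
    have "\<forall>\<^sub>F s in nhds t. flat j s = 0"
      using 2 order_tendstoD(2)[of "\<lambda>x. x" t "nhds t" 0]
      by (auto simp: flat_def filterlim_ident elim: eventually_mono)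
    then show ?thesis using 2 by (subst DERIV_cong_ev[OF refl _ refl]) (auto simp: flat_def)
  next
    case 3
    have R: "((\<lambda>h. flat j h / h) \<longlongrightarrow> 0) (at_right 0)"
    proof -
      \<comment> \<open>The factor 1/h of the difference quotient is absorbed into the polynomial:
        \<open>pCons 0 P\<close> is y P(y), taken at y = 1/h.\<close>
      have "((\<lambda>h. poly (pCons 0 (flat_poly j)) (inverse h) * exp (- inverse h)) \<longlongrightarrow> 0) (at_right (0::real))"
        by (rule filterlim_compose[OF poly_exp_tendsto_0 filterlim_inverse_at_top_right])
      moreover have "\<forall>\<^sub>F h in at_right (0::real). poly (pCons 0 (flat_poly j)) (inverse h) * exp (- inverse h) = flat j h / h"
        unfolding eventually_at_right_field
        by (auto simp: flat_def field_simps intro!: exI[of _ 1])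
      ultimately show ?thesis by (rule Lim_transform_eventually)
    qed
    have L: "((\<lambda>h. flat j h / h) \<longlongrightarrow> 0) (at_left 0)"
      by (rule Lim_transform_eventually[of "\<lambda>_. 0"])
        (auto simp: flat_def eventually_at_left_field intro!: exI[of _ "-1"])
    from L R show ?thesis
      using 3 by (simp add: has_field_derivative_iff filterlim_at_split flat_def)
  qed
qed

lemma flat_pos: "flat 0 t > 0 \<longleftrightarrow> t > 0" and flat_nonneg: "flat 0 t \<ge> 0"
  by (auto simp: flat_def)

section \<open>Test functions increasing to the indicator of a box\<close>

definition box_bump :: "'a::euclidean_space \<Rightarrow> 'a \<Rightarrow> 'a \<Rightarrow> real" where
  "box_bump a b x = (\<Prod>i\<in>Basis. flat 0 ((x - a) \<bullet> i) * flat 0 ((b - x) \<bullet> i))"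

lemma box_bump_nonneg: "box_bump a b x \<ge> 0"
  by (auto simp: box_bump_def intro!: prod_nonneg mult_nonneg_nonneg flat_nonneg)

lemma box_bump_pos_iff: "box_bump a b x > 0 \<longleftrightarrow> x \<in> box a b"
proof -
  have "box_bump a b x \<noteq> 0 \<longleftrightarrow> (\<forall>i\<in>Basis. flat 0 ((x - a) \<bullet> i) \<noteq> 0 \<and> flat 0 ((b - x) \<bullet> i) \<noteq> 0)"
    by (auto simp: box_bump_def)
  also have "\<dots> \<longleftrightarrow> x \<in> box a b"
    using flat_pos flat_nonneg by (auto simp: box_def inner_diff_left less_le)
  finally show ?thesis using box_bump_nonneg[of a b x] by auto
qed

lemma box_bump_smooth: "C_k k (box_bump a b)"
proof -
  have "C_k k (\<lambda>x. (x - a) \<bullet> i)" "C_k k (\<lambda>x. (b - x) \<bullet> i)" for i :: 'a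
  proof -
    have "C_k k (\<lambda>x. x \<bullet> i + - (a \<bullet> i))" "C_k k (\<lambda>x. (-1) * (x \<bullet> i) + b \<bullet> i)"
      by (intro C_k_add C_k_mult C_k_const C_k_linear bounded_linear_intros)+
    then show "C_k k (\<lambda>x. (x - a) \<bullet> i)" "C_k k (\<lambda>x. (b - x) \<bullet> i)"
      by (simp_all add: inner_diff_left)
  qed
  then show ?thesis
    unfolding box_bump_def
    by (intro C_k_prod C_k_mult C_k_comp[where H = flat, OF flat_deriv]) auto
qed

text \<open>As j grows this increases to 1 wherever the bump is positive and stays 0 elsewhere, so
  the support never leaves the box. Indicators of boxes are thus reached from test functions by
  dominated convergence.\<close>

definition box_approx :: "'a::euclidean_space \<Rightarrow> 'a \<Rightarrow> nat \<Rightarrow> 'a \<Rightarrow> real" where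
  "box_approx a b j x = 1 - exp (- (real j * box_bump a b x))"

lemma box_approx_test: "box_approx a b j \<in> test_functions"
proof -
  \<comment> \<open>\<open>H i\<close> is the i-th derivative of 1 - exp (- j t); the case i = 0 is
    separate because of the constant 1.\<close>
  define H where "H i t = (if i = 0 then 1 - exp (- (real j * t)) else - ((- real j) ^ i * exp (- (real j * t))))" for i :: nat and t :: real
  have "(H i has_real_derivative H (Suc i) t) (at t)" for i t
    by (cases "i = 0") (auto simp: H_def[abs_def] intro!: derivative_eq_intros)
  from C_k_comp[where H = H, OF this box_bump_smooth, of _ 0]
  have "C_k k (box_approx a b j)" for k
    by (simp add: H_def box_approx_def[abs_def])
  moreover have "{x. box_approx a b j x \<noteq> 0} \<subseteq> cbox a b"
  proof
    fix x assume "x \<in> {x. box_approx a b j x \<noteq> 0}"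
    then have "box_bump a b x \<noteq> 0" by (auto simp: box_approx_def)
    then have "x \<in> box a b" using box_bump_pos_iff[of a b x] box_bump_nonneg[of a b x] by linarith
    then show "x \<in> cbox a b" using box_subset_cbox[of a b] by blast
  qed
  then have "compact (closure {x. box_approx a b j x \<noteq> 0})"
    by (meson bounded_cbox bounded_subset compact_closure)
  ultimately show ?thesis by (auto simp: test_functions_def)
qed

lemma box_approx_bounds: "0 \<le> box_approx a b j x" "box_approx a b j x \<le> indicator (box a b) x"
  using box_bump_pos_iff[of a b x] box_bump_nonneg[of a b x]
  by (auto simp: box_approx_def less_le split: split_indicator)

lemma box_approx_tendsto: "(\<lambda>j. box_approx a b j x) \<longlonglongrightarrow> indicator (box a b) x"
proof (cases "x \<in> box a b")
  case True
  then have "box_bump a b x > 0" by (simp add: box_bump_pos_iff)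
  then have "filterlim (\<lambda>j. real j * box_bump a b x) at_top sequentially"
    using filterlim_tendsto_pos_mult_at_top[OF tendsto_const _ filterlim_real_sequentially, of "box_bump a b x"]
    by (simp add: mult.commute)
  then have "(\<lambda>j. exp (- (real j * box_bump a b x))) \<longlonglongrightarrow> 0"
    by (intro filterlim_compose[OF exp_at_bot]) (simp add: filterlim_uminus_at_bot)
  then have "(\<lambda>j. 1 - exp (- (real j * box_bump a b x))) \<longlonglongrightarrow> 1 - 0"
    by (intro tendsto_intros)
  then show ?thesis using True by (simp add: box_approx_def)
next
  case False
  then have "box_bump a b x = 0" using box_bump_pos_iff[of a b x] box_bump_nonneg[of a b x] by auto
  then show ?thesis using False by (simp add: box_approx_def)
qed

lemma test_translate: "\<phi> \<in> test_functions \<Longrightarrow> (\<lambda>x. \<phi> (x + z)) \<in> test_functions"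
proof -
  assume \<phi>: "\<phi> \<in> test_functions"
  have "{x. \<phi> (x + z) \<noteq> 0} \<subseteq> (\<lambda>y. y - z) ` closure {x. \<phi> x \<noteq> 0}"
  proof
    fix x assume "x \<in> {x. \<phi> (x + z) \<noteq> 0}"
    then have "x + z \<in> closure {x. \<phi> x \<noteq> 0}"
      using closure_subset[of "{x. \<phi> x \<noteq> 0}"] by blast
    then show "x \<in> (\<lambda>y. y - z) ` closure {x. \<phi> x \<noteq> 0}" by (rule rev_image_eqI) simp
  qed
  moreover have "compact ((\<lambda>y. y - z) ` closure {x. \<phi> x \<noteq> 0})"
    using \<phi> by (intro compact_continuous_image continuous_intros) (auto simp: test_functions_def)
  ultimately have "compact (closure {x. \<phi> (x + z) \<noteq> 0})"
    by (meson bounded_subset compact_closure compact_imp_bounded)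
  with \<phi> show ?thesis by (auto simp: test_functions_def intro: C_k_translate)
qed

section \<open>Square integrable functions\<close>

text \<open>The measure is a parameter because several occur: Lebesgue measure, product measures in
  the segment formula, and a finite weighted measure in \<open>rellich\<close>.\<close>

definition L2 :: "'x measure \<Rightarrow> ('x \<Rightarrow> 'b::euclidean_space) set" where
  "L2 M = {f. f \<in> borel_measurable M \<and> integrable M (\<lambda>x. (norm (f x))\<^sup>2)}"

lemma L2_measurable [measurable_dest]: "f \<in> L2 M \<Longrightarrow> f \<in> borel_measurable M"
  by (simp add: L2_def)

lemma L2_mult:
  fixes f :: "'x \<Rightarrow> real" and g :: "'x \<Rightarrow> 'b::euclidean_space"
  assumes f: "f \<in> L2 M" and g: "g \<in> L2 M"
  shows "integrable M (\<lambda>x. f x *\<^sub>R g x)"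
proof (rule Bochner_Integration.integrable_bound)
  show "integrable M (\<lambda>x. (norm (f x))\<^sup>2 + (norm (g x))\<^sup>2)"
    using f g by (auto simp: L2_def)
  show "(\<lambda>x. f x *\<^sub>R g x) \<in> borel_measurable M"
    using f g by measurable
  show "AE x in M. norm (f x *\<^sub>R g x) \<le> norm ((norm (f x))\<^sup>2 + (norm (g x))\<^sup>2)"
  proof (rule AE_I2)
    fix x
    have "2 * (norm (f x) * norm (g x)) \<le> (norm (f x))\<^sup>2 + (norm (g x))\<^sup>2"
      using sum_squares_bound[of "norm (f x)" "norm (g x)"] by simp
    moreover have "0 \<le> norm (f x) * norm (g x)" by simp
    ultimately have "norm (f x) * norm (g x) \<le> (norm (f x))\<^sup>2 + (norm (g x))\<^sup>2" by linarith
    then show "norm (f x *\<^sub>R g x) \<le> norm ((norm (f x))\<^sup>2 + (norm (g x))\<^sup>2)" by simp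
  qed
qed

lemma L2_norm: "f \<in> L2 M \<Longrightarrow> (\<lambda>x. norm (f x)) \<in> L2 M"
  by (auto simp: L2_def)

lemma L2_inner:
  fixes f g :: "'x \<Rightarrow> 'b::euclidean_space"
  assumes f: "f \<in> L2 M" and g: "g \<in> L2 M"
  shows "integrable M (\<lambda>x. f x \<bullet> g x)"
proof (rule Bochner_Integration.integrable_bound)
  show "integrable M (\<lambda>x. norm (f x) *\<^sub>R norm (g x))"
    by (intro L2_mult L2_norm f g)
  show "(\<lambda>x. f x \<bullet> g x) \<in> borel_measurable M"
    using f g by measurable
qed (auto intro: Cauchy_Schwarz_ineq2)

lemma L2_scaleR: "f \<in> L2 M \<Longrightarrow> (\<lambda>x. c *\<^sub>R f x) \<in> L2 M"
  by (auto simp: L2_def power_mult_distrib)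

lemma L2_add:
  assumes f: "f \<in> L2 M" and g: "g \<in> L2 M"
  shows "(\<lambda>x. f x + g x) \<in> L2 M"
proof -
  have "integrable M (\<lambda>x. (norm (f x))\<^sup>2 + 2 * (f x \<bullet> g x) + (norm (g x))\<^sup>2)"
    using f g L2_inner[OF f g] by (auto simp: L2_def)
  moreover have "(norm (f x + g x))\<^sup>2 = (norm (f x))\<^sup>2 + 2 * (f x \<bullet> g x) + (norm (g x))\<^sup>2" for x
    by (simp add: power2_norm_eq_inner inner_add_left inner_add_right inner_commute)
  moreover have "(\<lambda>x. f x + g x) \<in> borel_measurable M" using f g by measurable
  ultimately show ?thesis by (simp add: L2_def)
qed

lemma L2_diff: "f \<in> L2 M \<Longrightarrow> g \<in> L2 M \<Longrightarrow> (\<lambda>x. f x - g x) \<in> L2 M"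
  using L2_add[of f M "\<lambda>x. (-1) *\<^sub>R g x"] L2_scaleR[of g M "-1"] by simp

lemma L2_norm_integrable: "f \<in> L2 M \<Longrightarrow> integrable M (\<lambda>x. (norm (f x))\<^sup>2)"
  by (simp add: L2_def)

lemma L2_norm_lincomb:
  assumes f: "f \<in> L2 M" and g: "g \<in> L2 M"
  shows "(\<integral>x. (norm (f x + t *\<^sub>R g x))\<^sup>2 \<partial>M) =
    (\<integral>x. (norm (f x))\<^sup>2 \<partial>M) + 2 * t * (\<integral>x. f x \<bullet> g x \<partial>M) + t\<^sup>2 * (\<integral>x. (norm (g x))\<^sup>2 \<partial>M)"
proof -
  have "(norm (f x + t *\<^sub>R g x))\<^sup>2 = (norm (f x))\<^sup>2 + 2 * t * (f x \<bullet> g x) + t\<^sup>2 * (norm (g x))\<^sup>2" for x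
    unfolding power2_norm_eq_inner
    by (simp add: inner_add_left inner_add_right inner_commute power2_eq_square)
  then show ?thesis
    using L2_inner[OF f g] L2_norm_integrable[OF f] L2_norm_integrable[OF g] by simp
qed

lemma L2_Cauchy_Schwarz:
  assumes f: "f \<in> L2 M" and g: "g \<in> L2 M"
  shows "(\<integral>x. f x \<bullet> g x \<partial>M)\<^sup>2 \<le> (\<integral>x. (norm (f x))\<^sup>2 \<partial>M) * (\<integral>x. (norm (g x))\<^sup>2 \<partial>M)"
proof -
  define A B C where "A = (\<integral>x. (norm (f x))\<^sup>2 \<partial>M)" and "B = (\<integral>x. f x \<bullet> g x \<partial>M)"
    and "C = (\<integral>x. (norm (g x))\<^sup>2 \<partial>M)"
  have pos: "A + 2 * t * B + t\<^sup>2 * C \<ge> 0" for t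
  proof -
    have "0 \<le> (\<integral>x. (norm (f x + t *\<^sub>R g x))\<^sup>2 \<partial>M)" by simp
    then show ?thesis unfolding L2_norm_lincomb[OF f g] A_def B_def C_def .
  qed
  have C: "C \<ge> 0" unfolding C_def by simp
  show ?thesis
  proof (cases "C = 0")
    case True
    have "B = 0"
    proof (rule ccontr)
      assume "B \<noteq> 0"
      \<comment> \<open>At this t the quadratic, which is linear here, takes the value -1.\<close>
      then have "2 * (- (A + 1) / (2 * B)) * B = - (A + 1)" by simp
      with pos[of "- (A + 1) / (2 * B)"] True show False by simp
    qed
    then show ?thesis using True by (simp add: A_def B_def C_def)
  next
    case False
    with C have "C > 0" by simp
    moreover have "A + 2 * (- B / C) * B + (- B / C)\<^sup>2 * C = A - B\<^sup>2 / C"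
      using \<open>C > 0\<close> by (simp add: power2_eq_square field_simps)
    ultimately have "B\<^sup>2 / C \<le> A" using pos[of "- B / C"] by simp
    then show ?thesis using \<open>C > 0\<close>
      by (simp add: A_def[symmetric] B_def[symmetric] C_def[symmetric] pos_divide_le_eq)
  qed
qed

lemma L2_parallelogram:
  assumes f: "f \<in> L2 M" and g: "g \<in> L2 M"
  shows "(\<integral>x. (norm (f x - g x))\<^sup>2 \<partial>M) = 2 * (\<integral>x. (norm (f x))\<^sup>2 \<partial>M) + 2 * (\<integral>x. (norm (g x))\<^sup>2 \<partial>M)
     - 4 * (\<integral>x. (norm ((1/2) *\<^sub>R (f x + g x)))\<^sup>2 \<partial>M)"
proof -
  have "(\<integral>x. (norm ((1/2) *\<^sub>R (f x + g x)))\<^sup>2 \<partial>M) = (1/4) * (\<integral>x. (norm (f x + g x))\<^sup>2 \<partial>M)"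
    by (simp add: power_divide)
  then show ?thesis
    using L2_norm_lincomb[OF f g, of "-1"] L2_norm_lincomb[OF f g, of 1] by simp
qed

lemma L2_triangle:
  assumes f: "f \<in> L2 M" and g: "g \<in> L2 M"
  shows "(\<integral>x. (norm (f x + g x))\<^sup>2 \<partial>M) \<le> 2 * (\<integral>x. (norm (f x))\<^sup>2 \<partial>M) + 2 * (\<integral>x. (norm (g x))\<^sup>2 \<partial>M)"
proof -
  have "(\<integral>x. (norm (f x + g x))\<^sup>2 \<partial>M) + (\<integral>x. (norm (f x - g x))\<^sup>2 \<partial>M)
      = 2 * (\<integral>x. (norm (f x))\<^sup>2 \<partial>M) + 2 * (\<integral>x. (norm (g x))\<^sup>2 \<partial>M)"
    using L2_norm_lincomb[OF f g, of "-1"] L2_norm_lincomb[OF f g, of 1] by simp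
  moreover have "(\<integral>x. (norm (f x - g x))\<^sup>2 \<partial>M) \<ge> 0" by simp
  ultimately show ?thesis by linarith
qed

lemma ennreal_finite_real: "(a::ennreal) \<noteq> \<infinity> \<Longrightarrow> \<exists>C\<ge>0. a = ennreal C"
  by (cases a) auto

lemma ennreal_le_suminf: "a k \<le> (\<Sum>k. a k :: ennreal)"
  using sum_le_suminf[of a "{k}"] by simp

text \<open>The whole sequence converges in norm, a subsequence almost everywhere. Both modes are
  recorded, since the identification of weak limits combines them.\<close>

lemma L2_complete:
  fixes f :: "nat \<Rightarrow> 'x \<Rightarrow> 'b::euclidean_space"
  assumes f: "\<And>n. f n \<in> L2 M"
    and cauchy: "\<And>e. e > 0 \<Longrightarrow> \<exists>N. \<forall>m\<ge>N. \<forall>n\<ge>N. (\<integral>x. (norm (f m x - f n x))\<^sup>2 \<partial>M) < e"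
  obtains g r where "g \<in> L2 M" "(\<lambda>n. \<integral>x. (norm (f n x - g x))\<^sup>2 \<partial>M) \<longlonglongrightarrow> 0"
    "strict_mono (r :: nat \<Rightarrow> nat)" "AE x in M. (\<lambda>n. f (r n) x) \<longlonglongrightarrow> g x"
proof -
  have [measurable]: "f n \<in> borel_measurable M" for n using f by (simp add: L2_def)
  have int: "integrable M (\<lambda>x. (norm (f m x - f n x))\<^sup>2)" for m n
    using L2_norm_integrable[OF L2_diff[OF f f]] .
  have "\<exists>r. strict_mono r \<and> (\<forall>k. \<forall>m\<ge>r k. \<forall>n\<ge>r k. (\<integral>x. (norm (f m x - f n x))\<^sup>2 \<partial>M) < (1/8) ^ k)"
  proof -
    define Q where "Q k N \<longleftrightarrow> (\<forall>m\<ge>N. \<forall>n\<ge>N. (\<integral>x. (norm (f m x - f n x))\<^sup>2 \<partial>M) < (1/8) ^ k)" for k N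
    have "\<exists>r. \<forall>k. Q k (r k) \<and> r k < r (Suc k)"
    proof (rule dependent_nat_choice)
      show "\<exists>N. Q 0 N" using cauchy[of 1] by (auto simp: Q_def)
    next
      fix N k
      obtain N' where "Q (Suc k) N'" using cauchy[of "(1/8) ^ Suc k"] by (auto simp: Q_def)
      then show "\<exists>N''. Q (Suc k) N'' \<and> N < N''"
        by (intro exI[of _ "max N' (Suc N)"]) (auto simp: Q_def)
    qed
    then show ?thesis by (auto simp: Q_def strict_mono_Suc_iff)
  qed
  then obtain r :: "nat \<Rightarrow> nat" where r: "strict_mono r"
    and r8: "\<And>k m n. m \<ge> r k \<Longrightarrow> n \<ge> r k \<Longrightarrow> (\<integral>x. (norm (f m x - f n x))\<^sup>2 \<partial>M) < (1/8) ^ k"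
    by blast
  \<comment> \<open>Steps of squared norm below 8^-k leave room for the weight 4^k: the weighted sum
    has an integral of at most the sum of 2^-k, and where its value C is finite, each step is at
    most sqrt C 2^-k.\<close>
  define d where "d k x = norm (f (r (Suc k)) x - f (r k) x)" for k x
  have [measurable]: "d k \<in> borel_measurable M" for k unfolding d_def by measurable
  have fin: "(\<integral>\<^sup>+x. (\<Sum>k. ennreal (4 ^ k * (d k x)\<^sup>2)) \<partial>M) < \<infinity>"
  proof -
    have "(\<integral>\<^sup>+x. (\<Sum>k. ennreal (4 ^ k * (d k x)\<^sup>2)) \<partial>M) = (\<Sum>k. \<integral>\<^sup>+x. ennreal (4 ^ k * (d k x)\<^sup>2) \<partial>M)"
      by (intro nn_integral_suminf) auto
    also have "\<dots> \<le> (\<Sum>k. ennreal ((1/2) ^ k))"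
    proof (intro suminf_le)
      fix k
      have "(\<integral>\<^sup>+x. ennreal (4 ^ k * (d k x)\<^sup>2) \<partial>M) = ennreal (\<integral>x. 4 ^ k * (d k x)\<^sup>2 \<partial>M)"
        by (intro nn_integral_eq_integral integrable_mult_right) (auto simp: d_def int)
      also have "(\<integral>x. 4 ^ k * (d k x)\<^sup>2 \<partial>M) \<le> 4 ^ k * (1/8) ^ k"
        using r8[of k "r (Suc k)" "r k"] strict_monoD[OF r, of k "Suc k"]
        by (simp add: d_def)
      also have "4 ^ k * (1/8) ^ k = (1/2 :: real) ^ k"
        by (simp add: power_mult_distrib[symmetric])
      finally show "(\<integral>\<^sup>+x. ennreal (4 ^ k * (d k x)\<^sup>2) \<partial>M) \<le> ennreal ((1/2) ^ k)"
        by (simp add: ennreal_leI)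
    qed auto
    also have "\<dots> = ennreal (\<Sum>k. (1/2) ^ k)"
      by (intro suminf_ennreal2) (auto simp: summable_geometric)
    finally show ?thesis by (simp add: order_le_less_trans)
  qed
  have conv: "AE x in M. convergent (\<lambda>n. f (r n) x)"
  proof -
    have "AE x in M. (\<Sum>k. ennreal (4 ^ k * (d k x)\<^sup>2)) \<noteq> \<infinity>"
      using fin by (intro nn_integral_PInf_AE) auto
    then show ?thesis
    proof (rule AE_mp, intro AE_I2 impI)
      fix x assume "(\<Sum>k. ennreal (4 ^ k * (d k x)\<^sup>2)) \<noteq> \<infinity>"
      then obtain C where C: "C \<ge> 0" "(\<Sum>k. ennreal (4 ^ k * (d k x)\<^sup>2)) = ennreal C"
        using ennreal_finite_real by blast
      have bd: "d k x \<le> sqrt C * (1/2) ^ k" for k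
      proof -
        have "ennreal (4 ^ k * (d k x)\<^sup>2) \<le> (\<Sum>k. ennreal (4 ^ k * (d k x)\<^sup>2))"
          by (rule ennreal_le_suminf[of "\<lambda>k. ennreal (4 ^ k * (d k x)\<^sup>2)"])
        then have "ennreal (4 ^ k * (d k x)\<^sup>2) \<le> ennreal C" by (simp only: C(2))
        then have "4 ^ k * (d k x)\<^sup>2 \<le> C" using C(1) by (simp only: ennreal_le_iff)
        moreover have "(4::real) ^ k = (2 ^ k)\<^sup>2"
          by (simp add: power2_eq_square flip: power_mult_distrib)
        then have "4 ^ k * (d k x)\<^sup>2 = (2 ^ k * d k x)\<^sup>2"
          by (simp add: power_mult_distrib)
        ultimately have "2 ^ k * d k x \<le> sqrt C" by (simp add: real_le_rsqrt)
        then show ?thesis by (simp add: field_simps power_divide)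
      qed
      have "summable (\<lambda>k. f (r (Suc k)) x - f (r k) x)"
      proof (rule summable_comparison_test')
        show "summable (\<lambda>k. sqrt C * (1/2) ^ k)" by (intro summable_mult summable_geometric) simp
        show "norm (f (r (Suc k)) x - f (r k) x) \<le> sqrt C * (1 / 2) ^ k" for k
          using bd[of k] by (simp add: d_def)
      qed
      then have "convergent (\<lambda>n. \<Sum>k<n. f (r (Suc k)) x - f (r k) x)"
        by (simp add: summable_iff_convergent)
      then have "convergent (\<lambda>n. f (r n) x - f (r 0) x)"
        by (simp add: sum_lessThan_telescope[of "\<lambda>k. f (r k) x"])
      then show "convergent (\<lambda>n. f (r n) x)"
        using convergent_add[OF _ convergent_const[of "f (r 0) x"]] by fastforce
    qed
  qed
  define g where "g x = lim (\<lambda>n. f (r n) x)" for x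
  have g_meas [measurable]: "g \<in> borel_measurable M" unfolding g_def by measurable
  have g: "AE x in M. (\<lambda>n. f (r n) x) \<longlonglongrightarrow> g x"
    using conv by eventually_elim (simp add: g_def convergent_LIMSEQ_iff)
  \<comment> \<open>Fatou's lemma along the subsequence turns the Cauchy bound into a bound for the
    distance to the limit, valid for every n from \<open>r k\<close> on.\<close>
  have close: "(\<integral>\<^sup>+x. ennreal ((norm (f n x - g x))\<^sup>2) \<partial>M) \<le> ennreal ((1/8) ^ k)" if "n \<ge> r k" for n k
  proof -
    have "(\<integral>\<^sup>+x. ennreal ((norm (f n x - g x))\<^sup>2) \<partial>M)
        = (\<integral>\<^sup>+x. liminf (\<lambda>j. ennreal ((norm (f n x - f (r j) x))\<^sup>2)) \<partial>M)"
    proof (intro nn_integral_cong_AE)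
      show "AE x in M. ennreal ((norm (f n x - g x))\<^sup>2) = liminf (\<lambda>j. ennreal ((norm (f n x - f (r j) x))\<^sup>2))"
        using g
      proof eventually_elim
        case (elim x)
        then have "(\<lambda>j. ennreal ((norm (f n x - f (r j) x))\<^sup>2)) \<longlonglongrightarrow> ennreal ((norm (f n x - g x))\<^sup>2)"
          by (intro tendsto_ennrealI tendsto_intros)
        then show ?case by (intro lim_imp_Liminf[symmetric]) auto
      qed
    qed
    also have "\<dots> \<le> liminf (\<lambda>j. \<integral>\<^sup>+x. ennreal ((norm (f n x - f (r j) x))\<^sup>2) \<partial>M)"
      by (intro nn_integral_liminf) auto
    also have "\<dots> \<le> ennreal ((1/8) ^ k)"
    proof (intro Liminf_le)
      show "\<forall>\<^sub>F j in sequentially. (\<integral>\<^sup>+x. ennreal ((norm (f n x - f (r j) x))\<^sup>2) \<partial>M) \<le> ennreal ((1/8) ^ k)"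
        using eventually_ge_at_top[of k]
      proof eventually_elim
        case (elim j)
        then have "r j \<ge> r k" using r by (simp add: strict_mono_less_eq)
        then have "(\<integral>x. (norm (f n x - f (r j) x))\<^sup>2 \<partial>M) \<le> (1/8) ^ k"
          using r8[of k n "r j"] that by simp
        then show ?case
          by (subst nn_integral_eq_integral) (auto simp: int intro!: ennreal_leI)
      qed
    qed auto
    finally show ?thesis .
  qed
  have intg: "integrable M (\<lambda>x. (norm (f n x - g x))\<^sup>2)" if "n \<ge> r k" for n k
    using close[OF that] by (intro integrableI_bounded) (auto intro: order_le_less_trans)
  have gL2: "g \<in> L2 M"
  proof -
    have "(\<lambda>x. f (r 0) x - g x) \<in> L2 M" using intg[of 0 "r 0"] by (simp add: L2_def)
    from L2_diff[OF f[of "r 0"] this] show ?thesis by simp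
  qed
  have "(\<lambda>n. \<integral>x. (norm (f n x - g x))\<^sup>2 \<partial>M) \<longlonglongrightarrow> 0"
  proof (rule LIMSEQ_I)
    fix e :: real assume "e > 0"
    then obtain k where k: "(1/8) ^ k < e" using real_arch_pow_inv[of e "1/8"] by auto
    show "\<exists>no. \<forall>n\<ge>no. norm ((\<integral>x. (norm (f n x - g x))\<^sup>2 \<partial>M) - 0) < e"
    proof (intro exI[of _ "r k"] allI impI)
      fix n assume n: "n \<ge> r k"
      have "ennreal (\<integral>x. (norm (f n x - g x))\<^sup>2 \<partial>M) \<le> ennreal ((1/8) ^ k)"
        using close[OF n] nn_integral_eq_integral[OF intg[OF n]] by simp
      then show "norm ((\<integral>x. (norm (f n x - g x))\<^sup>2 \<partial>M) - 0) < e" using k by simp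
    qed
  qed
  with gL2 r g show ?thesis using that by blast
qed

text \<open>Closure under midpoints stands in for general convex combinations: it is what the
  parallelogram identity works with, and properties of a tail pass to its hull by rule
  induction.\<close>

inductive_set mid_hull :: "(nat \<Rightarrow> 'x \<Rightarrow> 'b::real_vector) \<Rightarrow> nat \<Rightarrow> ('x \<Rightarrow> 'b) set" for U m where
  base: "m \<le> n \<Longrightarrow> U n \<in> mid_hull U m"
| mid: "v \<in> mid_hull U m \<Longrightarrow> w \<in> mid_hull U m \<Longrightarrow> (\<lambda>x. (1/2) *\<^sub>R (v x + w x)) \<in> mid_hull U m"

lemma mid_hull_antimono: "v \<in> mid_hull U n \<Longrightarrow> m \<le> n \<Longrightarrow> v \<in> mid_hull U m"
  by (induction rule: mid_hull.induct) (auto intro: mid_hull.intros)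

text \<open>Mazur's lemma: near-minimal elements of the hulls of the tails form a Cauchy sequence by the
  parallelogram identity.\<close>

lemma L2_mazur:
  fixes U :: "nat \<Rightarrow> 'x \<Rightarrow> 'b::euclidean_space"
  assumes U: "\<And>n. U n \<in> L2 M" and bd: "\<And>n. (\<integral>x. (norm (U n x))\<^sup>2 \<partial>M) \<le> B"
  obtains V W where "V \<in> L2 M" "\<And>m. W m \<in> mid_hull U m" "\<And>m. W m \<in> L2 M"
    "(\<lambda>m. \<integral>x. (norm (W m x - V x))\<^sup>2 \<partial>M) \<longlonglongrightarrow> 0"
proof -
  define I where "I w = (\<integral>x. (norm (w x))\<^sup>2 \<partial>M)" for w :: "'x \<Rightarrow> 'b"
  have L2: "w \<in> L2 M" if "w \<in> mid_hull U m" for w m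
    using that by (induction rule: mid_hull.induct) (auto intro: U L2_add L2_scaleR)
  have I0: "I w \<ge> 0" for w by (simp add: I_def)
  define d where "d m = (INF w\<in>mid_hull U m. I w)" for m
  have ne: "mid_hull U m \<noteq> {}" for m using mid_hull.base[of m m U] by auto
  have bdd: "bdd_below (I ` mid_hull U m)" for m using I0 by (intro bdd_belowI[of _ 0]) auto
  have d_le: "d m \<le> I w" if "w \<in> mid_hull U m" for m w
    unfolding d_def using that bdd by (rule cINF_lower[rotated])
  \<comment> \<open>The hulls of later tails are smaller, so \<open>d\<close> increases; being
    bounded by B, it is Cauchy.\<close>
  have d_mono: "d m \<le> d n" if "m \<le> n" for m n
    unfolding d_def[of n] using ne that
    by (intro cINF_greatest d_le) (auto intro: mid_hull_antimono)
  have "d m \<le> B" for m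
    using d_le[OF mid_hull.base[of m m U]] bd[of m] by (simp add: I_def)
  then have "convergent d"
    using d_mono by (intro Bseq_mono_convergent BseqI'[of d "\<bar>d 0\<bar> + \<bar>B\<bar>"])
      (smt (verit, ccfv_SIG) le0 real_norm_def)+
  then have "Cauchy d" by (rule convergent_Cauchy)
  have "\<exists>w\<in>mid_hull U m. I w < d m + 1 / real (Suc m)" for m
    using cINF_less_iff[OF ne bdd, of m "d m + 1 / real (Suc m)"] unfolding d_def[symmetric] by simp
  then obtain W where W: "\<And>m. W m \<in> mid_hull U m" "\<And>m. I (W m) < d m + 1 / real (Suc m)"
    by metis
  \<comment> \<open>The midpoint of \<open>W m\<close> and \<open>W l\<close> still lies in the hull
    of tail m, so its squared norm is at least \<open>d m\<close>. The parallelogram identity then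
    leaves only the gap \<open>d l - d m\<close> and the two tolerances.\<close>
  have est: "(\<integral>x. (norm (W m x - W l x))\<^sup>2 \<partial>M) \<le> 2 * (d l - d m) + 4 * (1 / real (Suc m))" if "m \<le> l" for m l
  proof -
    have "d m \<le> I (\<lambda>x. (1/2) *\<^sub>R (W m x + W l x))"
      using W that by (intro d_le mid_hull.mid) (auto intro: mid_hull_antimono)
    moreover have "(\<integral>x. (norm (W m x - W l x))\<^sup>2 \<partial>M) = 2 * I (W m) + 2 * I (W l) - 4 * I (\<lambda>x. (1/2) *\<^sub>R (W m x + W l x))"
      unfolding I_def using W L2 by (intro L2_parallelogram) auto
    moreover have "I (W l) < d l + 1 / real (Suc m)"
      using W(2)[of l] that by (smt (verit, best) Suc_le_mono frac_le of_nat_0_less_iff of_nat_mono zero_less_Suc)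
    ultimately show ?thesis using W(2)[of m] by argo
  qed
  have "\<exists>N. \<forall>m\<ge>N. \<forall>n\<ge>N. (\<integral>x. (norm (W m x - W n x))\<^sup>2 \<partial>M) < e" if e: "e > 0" for e
  proof -
    obtain N1 where N1: "\<forall>m\<ge>N1. \<forall>n\<ge>N1. norm (d m - d n) < e / 4"
      using CauchyD[OF \<open>Cauchy d\<close>, of "e/4"] e by auto
    obtain N2 where N2: "4 / real (Suc N2) < e / 4"
      using reals_Archimedean[of "e / 16"] e by (auto simp: inverse_eq_divide field_simps)
    have *: "(\<integral>x. (norm (W m x - W n x))\<^sup>2 \<partial>M) < e" if "m \<ge> max N1 N2" "m \<le> n" for m n
    proof -
      have "4 * (1 / real (Suc m)) \<le> 4 / real (Suc N2)" using that by (simp add: field_simps)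
      moreover have "\<bar>d n - d m\<bar> < e / 4" using N1 that by auto
      then have "d n - d m < e / 4" by linarith
      ultimately show ?thesis using est[OF that(2)] N2 e by argo
    qed
    have "(\<integral>x. (norm (W m x - W n x))\<^sup>2 \<partial>M) < e" if "m \<ge> max N1 N2" "n \<ge> max N1 N2" for m n
    proof (cases "m \<le> n")
      case False
      have "(\<integral>x. (norm (W m x - W n x))\<^sup>2 \<partial>M) = (\<integral>x. (norm (W n x - W m x))\<^sup>2 \<partial>M)"
        by (subst norm_minus_commute) (rule refl)
      with *[of n m] that False show ?thesis by (metis nle_le)
    qed (use * that in blast)
    then show ?thesis by blast
  qed
  then show ?thesis
  proof (rule L2_complete[of W M, OF L2[OF W(1)]])
    fix V and r :: "nat \<Rightarrow> nat"
    assume "V \<in> L2 M" "(\<lambda>m. \<integral>x. (norm (W m x - V x))\<^sup>2 \<partial>M) \<longlonglongrightarrow> 0"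
    then show ?thesis using that[of V W] W(1) L2[OF W(1)] by blast
  qed
qed

section \<open>Calculus of test functions\<close>

lemma gradient_inner:
  assumes "f differentiable at x"
  shows "gradient f x \<bullet> v = frechet_derivative f (at x) v"
proof -
  interpret linear "frechet_derivative f (at x)"
    by (rule linear_frechet_derivative[OF assms])
  have "frechet_derivative f (at x) v = frechet_derivative f (at x) (\<Sum>b\<in>Basis. (v \<bullet> b) *\<^sub>R b)"
    by (simp add: euclidean_representation)
  also have "\<dots> = (\<Sum>b\<in>Basis. (v \<bullet> b) * frechet_derivative f (at x) b)"
    by (simp add: sum scaleR)
  finally show ?thesis
    unfolding gradient_def inner_sum_left inner_scaleR_left
    by (simp add: inner_commute mult.commute)
qed

lemma test_differentiable: "\<phi> \<in> test_functions \<Longrightarrow> \<phi> differentiable at x"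
  using C_k.simps(2)[of 0 \<phi>] by (auto simp: test_functions_def)

lemma test_has_derivative:
  "\<phi> \<in> test_functions \<Longrightarrow> (\<phi> has_derivative (\<lambda>v. gradient \<phi> x \<bullet> v)) (at x)"
  using test_differentiable[of \<phi> x] by (simp add: gradient_inner frechet_derivative_works)

lemma gradient_eqI: "(f has_derivative (\<lambda>v. g \<bullet> v)) (at x) \<Longrightarrow> gradient f x = g"
  using gradient_inner[OF differentiableI] frechet_derivative_at by (metis vector_eq_rdot)

lemma test_continuous: "\<phi> \<in> test_functions \<Longrightarrow> continuous_on UNIV \<phi>"
  using C_k.simps(1)[of \<phi>] by (auto simp: test_functions_def)

lemma gradient_continuous:
  assumes "\<phi> \<in> test_functions" shows "continuous_on UNIV (gradient \<phi>)"
proof -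
  have "C_k (Suc 0) \<phi>" using assms unfolding test_functions_def by blast
  then show ?thesis unfolding gradient_def by (intro continuous_intros) simp
qed

lemma test_support:
  assumes \<phi>: "\<phi> \<in> test_functions"
  obtains R where "R > 0" "\<And>x. norm x \<ge> R \<Longrightarrow> \<phi> x = 0" "\<And>x. norm x \<ge> R \<Longrightarrow> gradient \<phi> x = 0"
proof -
  let ?K = "closure {x. \<phi> x \<noteq> 0}"
  have "bounded ?K" using \<phi> by (auto simp: test_functions_def compact_imp_bounded)
  then obtain R where R: "R > 0" "\<And>x. x \<in> ?K \<Longrightarrow> norm x \<le> R" by (auto simp: bounded_pos)
  have out: "x \<notin> ?K" if "norm x \<ge> R + 1" for x using R(2)[of x] that by auto
  have 0: "\<phi> x = 0" if "x \<notin> ?K" for x using that closure_subset[of "{x. \<phi> x \<noteq> 0}"] by blast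
  have "gradient \<phi> x = 0" if "x \<notin> ?K" for x
  proof (rule gradient_eqI)
    have "(\<phi> has_derivative (\<lambda>_. 0)) (at x)"
    proof (rule has_derivative_transform_within_open[where f = "\<lambda>_. 0" and s = "- ?K"])
      show "open (- ?K)" by (intro open_Compl closed_closure)
      show "x \<in> - ?K" using that by simp
      show "0 = \<phi> y" if "y \<in> - ?K" for y using that 0[of y] by simp
    qed (rule has_derivative_const)
    moreover have "(\<bullet>) (0::'a) = (\<lambda>_. 0)" by (rule ext) simp
    ultimately show "(\<phi> has_derivative (\<bullet>) 0) (at x)" by simp
  qed
  then show ?thesis using that[of "R + 1"] R out 0 by (meson add_pos_pos zero_less_one)
qed

lemma compact_support_integrable:
  fixes f :: "'a::euclidean_space \<Rightarrow> 'b::euclidean_space"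
  assumes "continuous_on UNIV f" "\<And>x. norm x \<ge> R \<Longrightarrow> f x = 0"
  shows "integrable lborel f"
proof -
  have "integrable lborel (\<lambda>x. indicator (cball 0 R) x *\<^sub>R f x)"
    using assms(1) by (intro borel_integrable_compact) (auto intro: continuous_on_subset)
  also have "(\<lambda>x. indicator (cball 0 R) x *\<^sub>R f x) = f"
    using assms(2) by (auto split: split_indicator)
  finally show ?thesis .
qed

lemma compact_support_L2:
  fixes f :: "'a::euclidean_space \<Rightarrow> 'b::euclidean_space"
  assumes "continuous_on UNIV f" "\<And>x. norm x \<ge> R \<Longrightarrow> f x = 0"
  shows "f \<in> L2 lborel"
  unfolding L2_def
  using assms borel_measurable_continuous_onI[OF assms(1)]
  by (auto intro!: compact_support_integrable[where R = R] continuous_intros)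

lemma test_integrable: "\<phi> \<in> test_functions \<Longrightarrow> integrable lborel \<phi>"
  and test_L2: "\<phi> \<in> test_functions \<Longrightarrow> \<phi> \<in> L2 lborel"
  and gradient_integrable: "\<phi> \<in> test_functions \<Longrightarrow> integrable lborel (gradient \<phi>)"
  and gradient_L2: "\<phi> \<in> test_functions \<Longrightarrow> gradient \<phi> \<in> L2 lborel"
  by (metis test_support compact_support_integrable compact_support_L2 test_continuous gradient_continuous)+

lemma test_measurable: "\<phi> \<in> test_functions \<Longrightarrow> \<phi> \<in> borel_measurable borel"
  and gradient_measurable: "\<phi> \<in> test_functions \<Longrightarrow> gradient \<phi> \<in> borel_measurable borel"
  by (auto intro: borel_measurable_continuous_onI test_continuous gradient_continuous)

lemma test_mult: 
  assumes "\<phi> \<in> test_functions" "\<psi> \<in> test_functions"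
  shows "(\<lambda>x. \<phi> x * \<psi> x) \<in> test_functions"
proof -
  have "{x. \<phi> x * \<psi> x \<noteq> 0} \<subseteq> {x. \<phi> x \<noteq> 0}" by auto
  then have "closure {x. \<phi> x * \<psi> x \<noteq> 0} \<subseteq> closure {x. \<phi> x \<noteq> 0}" by (rule closure_mono)
  with assms have "compact (closure {x. \<phi> x * \<psi> x \<noteq> 0})"
    using closure_subset \<open>{x. \<phi> x * \<psi> x \<noteq> 0} \<subseteq> {x. \<phi> x \<noteq> 0}\<close>
    by (auto simp: test_functions_def intro: bounded_subset)
  with assms show ?thesis by (auto simp: test_functions_def intro: C_k_mult)
qed

lemma gradient_mult:
  assumes "\<phi> \<in> test_functions" "\<psi> \<in> test_functions"
  shows "gradient (\<lambda>x. \<phi> x * \<psi> x) x = \<phi> x *\<^sub>R gradient \<psi> x + \<psi> x *\<^sub>R gradient \<phi> x"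
  using has_derivative_mult[OF test_has_derivative[OF assms(1)] test_has_derivative[OF assms(2)], of x]
  by (intro gradient_eqI) (simp add: inner_add_left mult.commute)

lemma gradient_translate:
  assumes "\<phi> \<in> test_functions" shows "gradient (\<lambda>x. \<phi> (x + z)) x = gradient \<phi> (x + z)"
proof (rule gradient_eqI)
  have "((\<lambda>x. x + z) has_derivative (\<lambda>h. h)) (at x)" by (auto intro!: derivative_eq_intros)
  from has_derivative_compose[OF this test_has_derivative[OF assms]]
  show "((\<lambda>x. \<phi> (x + z)) has_derivative (\<bullet>) (gradient \<phi> (x + z))) (at x)" by simp
qed

text \<open>The integral runs over the whole line with an indicator, the form in which Fubini's
  theorem is applied below.\<close>

lemma test_FTC:
  assumes "\<phi> \<in> test_functions"
  shows "\<phi> (x + z) - \<phi> x = (\<integral>t. indicator {0..1} t *\<^sub>R (gradient \<phi> (x + t *\<^sub>R z) \<bullet> z) \<partial>lborel)"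
proof -
  have "((\<lambda>t. \<phi> (x + t *\<^sub>R z)) has_vector_derivative (gradient \<phi> (x + t *\<^sub>R z) \<bullet> z)) (at t within {0..1})" for t
  proof -
    have "((\<lambda>t. x + t *\<^sub>R z) has_derivative (\<lambda>h. h *\<^sub>R z)) (at t within {0..1})"
      by (auto intro!: derivative_eq_intros)
    from has_derivative_compose[OF this test_has_derivative[OF assms]]
    show ?thesis by (simp add: has_vector_derivative_def)
  qed
  moreover have "continuous_on {0..1} (\<lambda>t::real. gradient \<phi> (x + t *\<^sub>R z) \<bullet> z)"
    by (intro continuous_intros continuous_on_compose2[OF gradient_continuous[OF assms]]) auto
  ultimately show ?thesis
    by (subst integral_FTC_atLeastAtMost[where F = "\<lambda>t. \<phi> (x + t *\<^sub>R z)"]) auto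
qed

section \<open>Translations\<close>

lemma nn_integral_translate:
  fixes f :: "'a::euclidean_space \<Rightarrow> ennreal"
  assumes [measurable]: "f \<in> borel_measurable borel"
  shows "(\<integral>\<^sup>+x. f (x + z) \<partial>lborel) = (\<integral>\<^sup>+x. f x \<partial>lborel)"
  by (subst (2) lborel_distr_plus[of z, symmetric]) (simp add: nn_integral_distr add.commute)

lemma integral_translate:
  fixes f :: "'a::euclidean_space \<Rightarrow> 'b::{banach, second_countable_topology}"
  assumes [measurable]: "f \<in> borel_measurable borel"
  shows "(\<integral>x. f (x + z) \<partial>lborel) = (\<integral>x. f x \<partial>lborel)"
  by (subst (2) lborel_distr_plus[of z, symmetric]) (simp add: integral_distr add.commute)

lemma integrable_translate:
  fixes f :: "'a::euclidean_space \<Rightarrow> 'b::{banach, second_countable_topology}"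
  assumes f: "integrable lborel f"
  shows "integrable lborel (\<lambda>x. f (x + z))"
proof -
  have [measurable]: "f \<in> borel_measurable borel" using borel_measurable_integrable[OF f] by simp
  have "integrable (distr lborel borel ((+) z)) f" using f by (simp add: lborel_distr_plus)
  then show ?thesis by (subst (asm) integrable_distr_eq) (auto simp: add.commute)
qed

lemma L2_translate: "f \<in> L2 lborel \<Longrightarrow> (\<lambda>x. f (x + z)) \<in> L2 lborel"
  using integrable_translate[of "\<lambda>x. (norm (f x))\<^sup>2" z]
    measurable_compose[of "\<lambda>x. x + z" lborel borel f borel] by (auto simp: L2_def)

text \<open>For fixed t the integrand is a translate of g, so the integral of its norm is the same
  for every t in the unit interval.\<close>

lemma segment_integrable:
  fixes g :: "'a::euclidean_space \<Rightarrow> 'b::euclidean_space"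
  assumes g: "integrable lborel g"
  shows "integrable (lborel \<Otimes>\<^sub>M lborel) (\<lambda>(t, x). indicator {0..1::real} t *\<^sub>R g (x + t *\<^sub>R z))"
proof -
  have [measurable]: "g \<in> borel_measurable borel" using borel_measurable_integrable[OF g] by simp
  have 1: "(\<integral>x. norm (indicator {0..1::real} t *\<^sub>R g (x + t *\<^sub>R z)) \<partial>lborel)
      = indicator {0..1} t *\<^sub>R (\<integral>x. norm (g x) \<partial>lborel)" for t
    using integral_translate[of "\<lambda>x. norm (g x)" "t *\<^sub>R z"] by simp
  have 2: "integrable lborel (\<lambda>t. indicator {0..1::real} t *\<^sub>R (\<integral>x. norm (g x) \<partial>lborel))"
    by (intro integrable_scaleR_left) simp
  have 3: "integrable lborel (\<lambda>x. indicator {0..1::real} t *\<^sub>R g (x + t *\<^sub>R z))" for t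
    by (intro integrable_scaleR_right integrable_translate g)
  show ?thesis
    by (intro lborel_pair.Fubini_integrable) (simp_all only: prod.case 1 2 3 AE_I2, measurable)
qed

lemma segment_L2:
  fixes g :: "'a::euclidean_space \<Rightarrow> 'b::euclidean_space"
  assumes g: "g \<in> L2 lborel"
  shows "(\<lambda>(t, x). indicator {0..1::real} t *\<^sub>R g (x + t *\<^sub>R z)) \<in> L2 (lborel \<Otimes>\<^sub>M lborel)"
proof -
  have [measurable]: "g \<in> borel_measurable borel" using g by (simp add: L2_def)
  have "(norm (case p of (t, x) \<Rightarrow> indicator {0..1::real} t *\<^sub>R g (x + t *\<^sub>R z)))\<^sup>2
     = (case p of (t, x) \<Rightarrow> indicator {0..1::real} t *\<^sub>R (norm (g (x + t *\<^sub>R z)))\<^sup>2)" for p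
    by (cases p) (auto split: split_indicator)
  then show ?thesis
    using segment_integrable[OF L2_norm_integrable[OF g], of z] by (simp add: L2_def)
qed

text \<open>Translation invariance makes the integral of \<open>\<phi> (x + z) - \<phi> x\<close>
  vanish, while the fundamental theorem and Fubini turn it into the inner product of z with the
  integral of the gradient. This is the integration by parts behind
  \<open>wgrad_test\<close>.\<close>

lemma integral_gradient:
  assumes \<phi>: "\<phi> \<in> test_functions" shows "(\<integral>x. gradient \<phi> x \<partial>lborel) = 0"
proof -
  have [measurable]: "\<phi> \<in> borel_measurable borel" "gradient \<phi> \<in> borel_measurable borel"
    using \<phi> by (auto intro: test_measurable gradient_measurable)
  have "(\<integral>x. gradient \<phi> x \<partial>lborel) \<bullet> z = 0" for z
  proof -
    have int: "integrable lborel (\<lambda>x. gradient \<phi> x \<bullet> z)"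
      using gradient_integrable[OF \<phi>] by simp
    have "0 = (\<integral>x. \<phi> (x + z) - \<phi> x \<partial>lborel)"
      using integrable_translate[OF test_integrable[OF \<phi>], of z] test_integrable[OF \<phi>]
      by (simp add: integral_translate)
    also have "\<dots> = (\<integral>x. \<integral>t. indicator {0..1} t *\<^sub>R (gradient \<phi> (x + t *\<^sub>R z) \<bullet> z) \<partial>lborel \<partial>lborel)"
      by (simp add: test_FTC[OF \<phi>])
    also have "\<dots> = (\<integral>t. \<integral>x. indicator {0..1} t *\<^sub>R (gradient \<phi> (x + t *\<^sub>R z) \<bullet> z) \<partial>lborel \<partial>lborel)"
      by (rule lborel_pair.Fubini_integral[OF segment_integrable[OF int]])
    also have "\<dots> = (\<integral>t. indicator {0..1::real} t *\<^sub>R (\<integral>x. gradient \<phi> x \<bullet> z \<partial>lborel) \<partial>lborel)"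
      using integral_translate[of "\<lambda>x. gradient \<phi> x \<bullet> z"] by simp
    also have "\<dots> = (\<integral>x. gradient \<phi> x \<partial>lborel) \<bullet> z"
      using gradient_integrable[OF \<phi>] by simp
    finally show ?thesis by simp
  qed
  then show ?thesis using inner_eq_zero_iff by blast
qed

section \<open>Weak gradients\<close>

text \<open>Working with Borel representatives makes compositions such as \<open>u (x + t z)\<close> jointly
  measurable, which fails for Lebesgue measurable representatives.\<close>

definition wgrad :: "('a::euclidean_space \<Rightarrow> real) \<Rightarrow> ('a \<Rightarrow> 'a) \<Rightarrow> bool" where
  "wgrad u g \<longleftrightarrow> u \<in> L2 lborel \<and> g \<in> L2 lborel \<and>
     (\<forall>\<phi>\<in>test_functions. (\<integral>x. u x *\<^sub>R gradient \<phi> x \<partial>lborel) = - (\<integral>x. \<phi> x *\<^sub>R g x \<partial>lborel))"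

lemma wgradD:
  assumes "wgrad u g"
  shows "u \<in> L2 lborel" "g \<in> L2 lborel" "u \<in> borel_measurable borel" "g \<in> borel_measurable borel"
    "\<phi> \<in> test_functions \<Longrightarrow> (\<integral>x. u x *\<^sub>R gradient \<phi> x \<partial>lborel) = - (\<integral>x. \<phi> x *\<^sub>R g x \<partial>lborel)"
  using assms by (auto simp: wgrad_def L2_def)

lemma wgrad_test: 
  assumes "\<phi> \<in> test_functions" shows "wgrad \<phi> (gradient \<phi>)"
  unfolding wgrad_def
proof (intro conjI ballI)
  fix \<psi> :: "'a \<Rightarrow> real" assume \<psi>: "\<psi> \<in> test_functions"
  have "(\<integral>x. \<phi> x *\<^sub>R gradient \<psi> x + \<psi> x *\<^sub>R gradient \<phi> x \<partial>lborel) = 0"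
    using integral_gradient[OF test_mult[OF assms \<psi>]] by (simp add: gradient_mult[OF assms \<psi>])
  moreover have "integrable lborel (\<lambda>x. \<phi> x *\<^sub>R gradient \<psi> x)" "integrable lborel (\<lambda>x. \<psi> x *\<^sub>R gradient \<phi> x)"
    using assms \<psi> by (auto intro!: L2_mult test_L2 gradient_L2)
  ultimately show "(\<integral>x. \<phi> x *\<^sub>R gradient \<psi> x \<partial>lborel) = - (\<integral>x. \<psi> x *\<^sub>R gradient \<phi> x \<partial>lborel)"
    by (simp add: eq_neg_iff_add_eq_0)
qed (use assms in \<open>auto intro: test_L2 gradient_L2\<close>)

lemma wgrad_lincomb:
  assumes u: "wgrad u g" and v: "wgrad v h"
  shows "wgrad (\<lambda>x. a *\<^sub>R u x + b *\<^sub>R v x) (\<lambda>x. a *\<^sub>R g x + b *\<^sub>R h x)"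
  unfolding wgrad_def
proof (intro conjI ballI)
  fix \<phi> :: "'a \<Rightarrow> real" assume \<phi>: "\<phi> \<in> test_functions"
  have i: "integrable lborel (\<lambda>x. u x *\<^sub>R gradient \<phi> x)" "integrable lborel (\<lambda>x. v x *\<^sub>R gradient \<phi> x)"
    "integrable lborel (\<lambda>x. \<phi> x *\<^sub>R g x)" "integrable lborel (\<lambda>x. \<phi> x *\<^sub>R h x)"
    by (intro L2_mult gradient_L2 test_L2 \<phi> wgradD[OF u] wgradD[OF v])+
  have "(\<integral>x. (a *\<^sub>R u x + b *\<^sub>R v x) *\<^sub>R gradient \<phi> x \<partial>lborel)
      = (\<integral>x. a *\<^sub>R (u x *\<^sub>R gradient \<phi> x) + b *\<^sub>R (v x *\<^sub>R gradient \<phi> x) \<partial>lborel)"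
    by (simp add: algebra_simps)
  also have "\<dots> = a *\<^sub>R (\<integral>x. u x *\<^sub>R gradient \<phi> x \<partial>lborel) + b *\<^sub>R (\<integral>x. v x *\<^sub>R gradient \<phi> x \<partial>lborel)"
    using i by (simp del: scaleR_scaleR)
  also have "\<dots> = - (a *\<^sub>R (\<integral>x. \<phi> x *\<^sub>R g x \<partial>lborel) + b *\<^sub>R (\<integral>x. \<phi> x *\<^sub>R h x \<partial>lborel))"
    by (simp only: wgradD(5)[OF u \<phi>] wgradD(5)[OF v \<phi>]) simp
  also have "\<dots> = - (\<integral>x. a *\<^sub>R (\<phi> x *\<^sub>R g x) + b *\<^sub>R (\<phi> x *\<^sub>R h x) \<partial>lborel)"
    using i by (simp del: scaleR_scaleR)
  finally show "(\<integral>x. (a *\<^sub>R u x + b *\<^sub>R v x) *\<^sub>R gradient \<phi> x \<partial>lborel)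
      = - (\<integral>x. \<phi> x *\<^sub>R (a *\<^sub>R g x + b *\<^sub>R h x) \<partial>lborel)"
    by (simp add: algebra_simps)
qed (intro L2_add L2_scaleR wgradD(1,2)[OF u] wgradD(1,2)[OF v])+

lemma wgrad_translate:
  assumes u: "wgrad u g" shows "wgrad (\<lambda>x. u (x + z)) (\<lambda>x. g (x + z))"
  unfolding wgrad_def
proof (intro conjI ballI)
  fix \<phi> :: "'a \<Rightarrow> real" assume \<phi>: "\<phi> \<in> test_functions"
  note [measurable] = wgradD(3,4)[OF u] test_measurable[OF \<phi>] gradient_measurable[OF \<phi>]
  have "(\<integral>x. u (x + z) *\<^sub>R gradient \<phi> x \<partial>lborel) = (\<integral>x. u x *\<^sub>R gradient \<phi> (x - z) \<partial>lborel)"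
    using integral_translate[of "\<lambda>x. u x *\<^sub>R gradient \<phi> (x - z)" z] by simp
  also have "\<dots> = - (\<integral>x. \<phi> (x - z) *\<^sub>R g x \<partial>lborel)"
    using wgradD(5)[OF u test_translate[OF \<phi>, of "- z"]] gradient_translate[OF \<phi>, of "- z"] by simp
  also have "\<dots> = - (\<integral>x. \<phi> x *\<^sub>R g (x + z) \<partial>lborel)"
    using integral_translate[of "\<lambda>x. \<phi> (x - z) *\<^sub>R g x" z] by simp
  finally show "(\<integral>x. u (x + z) *\<^sub>R gradient \<phi> x \<partial>lborel) = - (\<integral>x. \<phi> x *\<^sub>R g (x + z) \<partial>lborel)" .
qed (use wgradD[OF u] in \<open>auto intro!: L2_translate\<close>)

text \<open>On a fixed box the positive and negative parts of f are densities of two measures that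
  agree on all boxes, an intersection-stable generator of the Borel sets; hence the densities agree
  almost everywhere. Restricting to \<open>Q n\<close> supplies the finiteness.\<close>

lemma AE_zero_if_box_integrals_zero:
  fixes f :: "'a::euclidean_space \<Rightarrow> real"
  assumes int: "\<And>a b. integrable lborel (\<lambda>x. indicator (box a b) x * f x)"
    and zero: "\<And>a b. (\<integral>x. indicator (box a b) x * f x \<partial>lborel) = 0"
    and [measurable]: "f \<in> borel_measurable borel"
  shows "AE x in lborel. f x = 0"
proof -
  define Q :: "nat \<Rightarrow> 'a set" where "Q n = box (- (real n *\<^sub>R One)) (real n *\<^sub>R One)" for n
  have "AE x in lborel. indicator (Q n) x * f x = 0" for n
  proof -
    define h where "h x = indicator (Q n) x * f x" for x
    have [measurable]: "h \<in> borel_measurable borel" by (simp add: h_def[abs_def] Q_def)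
    have hint: "integrable lborel h" unfolding h_def[abs_def] Q_def by (rule int)
    define P where "P s x = ennreal (max 0 (s * h x))" for s x
    have [measurable]: "P s \<in> borel_measurable borel" for s by (simp add: P_def[abs_def])
    have pint: "integrable lborel (\<lambda>x. max 0 (s * h x))" for s
      using hint by (intro integrable_max) auto
    have "density lborel (P 1) = density lborel (P (-1))"
    proof (rule measure_eqI_generator_eq)
      let ?E = "range (\<lambda>(a, b). box a b::'a set)"
      show "Int_stable ?E" by (auto simp: Int_stable_def box_Int_box)
      show "?E \<subseteq> Pow UNIV" "sets (density lborel (P 1)) = sigma_sets UNIV ?E"
        "sets (density lborel (P (-1))) = sigma_sets UNIV ?E"
        by (simp_all add: borel_eq_box)
      let ?A = "\<lambda>n::nat. box (- (real n *\<^sub>R One)) (real n *\<^sub>R One) :: 'a set"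
      show "range ?A \<subseteq> ?E" "(\<Union>i. ?A i) = UNIV" unfolding UN_box_eq_UNIV by auto
      have em: "emeasure (density lborel (P s)) (box a b)
          = ennreal (\<integral>x. indicator (box a b) x * max 0 (s * h x) \<partial>lborel)" for s a b
      proof -
        have "emeasure (density lborel (P s)) (box a b)
          = (\<integral>\<^sup>+x. ennreal (indicator (box a b) x * max 0 (s * h x)) \<partial>lborel)"
          by (subst emeasure_density) (auto simp: P_def intro!: nn_integral_cong split: split_indicator)
        also have "\<dots> = ennreal (\<integral>x. indicator (box a b) x * max 0 (s * h x) \<partial>lborel)"
          using integrable_mult_indicator[OF _ pint, of "box a b" s]
          by (intro nn_integral_eq_integral) (auto split: split_indicator)
        finally show ?thesis .
      qed
      show "emeasure (density lborel (P 1)) (?A i) \<noteq> \<infinity>" for i by (simp add: em)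
      fix X assume "X \<in> ?E"
      then obtain a b where X: "X = box a b" by auto
      have pi: "integrable lborel (\<lambda>x. indicator (box a b) x * max 0 (s * h x))" for s
        using integrable_mult_indicator[OF _ pint, of "box a b" s] by simp
      \<comment> \<open>The restriction to \<open>Q n\<close> does no harm: an intersection of two
        boxes is a box, so the hypothesis still applies.\<close>
      obtain a' b' where ab: "box a b \<inter> Q n = box a' b'" unfolding Q_def box_Int_box by blast
      have "(\<integral>x. indicator (box a b) x * max 0 (1 * h x) \<partial>lborel)
          - (\<integral>x. indicator (box a b) x * max 0 (-1 * h x) \<partial>lborel)
          = (\<integral>x. indicator (box a b) x * max 0 (1 * h x) - indicator (box a b) x * max 0 (-1 * h x) \<partial>lborel)"
        using pi[of 1] pi[of "-1"] by simp
      also have "\<dots> = (\<integral>x. indicator (box a' b') x * f x \<partial>lborel)"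
        unfolding ab[symmetric]
        by (intro Bochner_Integration.integral_cong) (auto simp: h_def max_def split: split_indicator)
      finally show "emeasure (density lborel (P 1)) X = emeasure (density lborel (P (-1))) X"
        using zero X by (simp add: em)
    qed
    then have "AE x in lborel. P 1 x = P (-1) x"
      by (intro sigma_finite_measure.density_unique[OF sigma_finite_lborel]) auto
    then show ?thesis
      by eventually_elim (auto simp: P_def h_def[symmetric] max_def split: if_splits)
  qed
  then have "AE x in lborel. \<forall>n. indicator (Q n) x * f x = 0"
    unfolding AE_all_countable by blast
  moreover have "\<exists>n. x \<in> Q n" for x
    using UN_box_eq_UNIV[where 'a='a] unfolding Q_def by blast
  ultimately show ?thesis
    by (elim eventually_mono) (metis indicator_simps(1) mult_1)
qed

text \<open>Boxes are reached from test functions through \<open>box_approx\<close>, and vector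
  values are treated one coordinate at a time.\<close>

lemma AE_zero_if_test_integrals_zero:
  fixes f :: "'a::euclidean_space \<Rightarrow> 'b::euclidean_space"
  assumes int: "\<And>a b. integrable lborel (\<lambda>x. indicator (box a b) x *\<^sub>R f x)"
    and zero: "\<And>\<phi>. \<phi> \<in> test_functions \<Longrightarrow> (\<integral>x. \<phi> x *\<^sub>R f x \<partial>lborel) = 0"
    and [measurable]: "f \<in> borel_measurable borel"
  shows "AE x in lborel. f x = 0"
proof -
  have "AE x in lborel. f x \<bullet> i = 0" for i
  proof (rule AE_zero_if_box_integrals_zero)
    fix a b
    show "integrable lborel (\<lambda>x. indicator (box a b) x * (f x \<bullet> i))"
      using integrable_inner_left[OF int[of a b], of i] by simp
    have "(\<lambda>j. \<integral>x. box_approx a b j x *\<^sub>R f x \<partial>lborel) \<longlonglongrightarrow> (\<integral>x. indicator (box a b) x *\<^sub>R f x \<partial>lborel)"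
    proof (rule integral_dominated_convergence)
      show "integrable lborel (\<lambda>x. norm (indicator (box a b) x *\<^sub>R f x))"
        using int by (rule integrable_norm)
      show "AE x in lborel. (\<lambda>j. box_approx a b j x *\<^sub>R f x) \<longlonglongrightarrow> indicator (box a b) x *\<^sub>R f x"
        by (intro AE_I2 tendsto_intros box_approx_tendsto)
      show "AE x in lborel. norm (box_approx a b j x *\<^sub>R f x) \<le> norm (indicator (box a b) x *\<^sub>R f x)" for j
        using box_approx_bounds[of a b j] by (auto intro!: mult_right_mono)
      have [measurable]: "box_approx a b j \<in> borel_measurable borel" for j
        by (rule test_measurable[OF box_approx_test])
      show "(\<lambda>x. box_approx a b j x *\<^sub>R f x) \<in> borel_measurable lborel" for j by simp
    qed simp
    then have "(\<integral>x. indicator (box a b) x *\<^sub>R f x \<partial>lborel) = 0"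
      using zero[OF box_approx_test] by (simp add: LIMSEQ_const_iff)
    then show "(\<integral>x. indicator (box a b) x * (f x \<bullet> i) \<partial>lborel) = 0"
      using integral_inner_left[OF int[of a b], of i] by simp
  qed simp
  then have "AE x in lborel. \<forall>i\<in>Basis. f x \<bullet> i = 0" by (intro AE_finite_allI) auto
  then show ?thesis by eventually_elim (auto intro: euclidean_eqI)
qed

text \<open>This is Cauchy-Schwarz against the indicator. Integrability is not assumed: where it
  fails, the Bochner integral on the left is 0 by convention and the bound is trivial.\<close>

lemma jensen_set:
  fixes f :: "'x \<Rightarrow> 'b::euclidean_space"
  assumes [measurable]: "f \<in> borel_measurable M" "A \<in> sets M"
  shows "ennreal ((norm (\<integral>x. indicator A x *\<^sub>R f x \<partial>M))\<^sup>2)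
    \<le> emeasure M A * (\<integral>\<^sup>+x. indicator A x * ennreal ((norm (f x))\<^sup>2) \<partial>M)"
proof (cases "integrable M (\<lambda>x. indicator A x *\<^sub>R f x)")
  case True
  have "ennreal ((norm (\<integral>x. indicator A x *\<^sub>R f x \<partial>M))\<^sup>2) = (ennreal (norm (\<integral>x. indicator A x *\<^sub>R f x \<partial>M)))\<^sup>2"
    by (simp add: ennreal_power)
  \<comment> \<open>The indicator is written twice, so that Cauchy-Schwarz leaves the measure of A
    in one factor and the restricted square integral in the other.\<close>
  also have "\<dots> \<le> (\<integral>\<^sup>+x. indicator A x * (indicator A x * ennreal (norm (f x))) \<partial>M)\<^sup>2"
  proof (intro power_mono)
    have "ennreal (norm (\<integral>x. indicator A x *\<^sub>R f x \<partial>M)) \<le> (\<integral>\<^sup>+x. norm (indicator A x *\<^sub>R f x) \<partial>M)"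
      by (rule integral_norm_bound_ennreal[OF True])
    also have "\<dots> = (\<integral>\<^sup>+x. indicator A x * (indicator A x * ennreal (norm (f x))) \<partial>M)"
      by (intro nn_integral_cong) (auto split: split_indicator)
    finally show "ennreal (norm (\<integral>x. indicator A x *\<^sub>R f x \<partial>M)) \<le> \<dots>" .
  qed simp
  also have "\<dots> \<le> (\<integral>\<^sup>+x. (indicator A x)\<^sup>2 \<partial>M) * (\<integral>\<^sup>+x. (indicator A x * ennreal (norm (f x)))\<^sup>2 \<partial>M)"
    by (rule Cauchy_Schwarz_nn_integral) auto
  also have "(\<integral>\<^sup>+x. (indicator A x)\<^sup>2 \<partial>M) = (\<integral>\<^sup>+x. indicator A x \<partial>M)"
    by (intro nn_integral_cong) (auto split: split_indicator)
  also have "(\<integral>\<^sup>+x. (indicator A x * ennreal (norm (f x)))\<^sup>2 \<partial>M) = (\<integral>\<^sup>+x. indicator A x * ennreal ((norm (f x))\<^sup>2) \<partial>M)"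
    by (intro nn_integral_cong) (auto simp: ennreal_power split: split_indicator)
  finally show ?thesis by simp
qed (simp add: not_integrable_integral_eq)

lemma indicator_L2: 
  assumes "A \<in> sets M" "emeasure M A < \<infinity>" shows "(indicator A :: _ \<Rightarrow> real) \<in> L2 M"
proof -
  have "(norm (indicator A x :: real))\<^sup>2 = indicator A x" for x by (auto split: split_indicator)
  then show ?thesis using assms by (simp add: L2_def)
qed

text \<open>For test functions this is the fundamental theorem of calculus. For u it follows by
  duality: paired with \<phi>, the difference is moved onto a translate of \<phi>, where the
  classical formula with -z applies, and the gradient is moved back to u by the definition of the
  weak gradient.\<close>

lemma segment_formula:
  assumes u: "wgrad u g"
  shows "AE x in lborel. u (x + z) - u x = (\<integral>t. indicator {0..1} t *\<^sub>R (g (x + t *\<^sub>R z) \<bullet> z) \<partial>lborel)"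
proof -
  note [measurable] = wgradD(3,4)[OF u]
  define G where "G x = (\<integral>t. indicator {0..1} t *\<^sub>R (g (x + t *\<^sub>R z) \<bullet> z) \<partial>lborel)" for x
  have [measurable]: "G \<in> borel_measurable borel" unfolding G_def[abs_def] by measurable
  have gz: "(\<lambda>x. g x \<bullet> z) \<in> L2 lborel"
  proof -
    have "integrable lborel (\<lambda>x. (norm (g x \<bullet> z))\<^sup>2)"
    proof (rule Bochner_Integration.integrable_bound)
      show "integrable lborel (\<lambda>x. (norm (g x))\<^sup>2 * (norm z)\<^sup>2)"
        using wgradD(2)[OF u] by (simp add: L2_def)
      show "AE x in lborel. norm ((norm (g x \<bullet> z))\<^sup>2) \<le> norm ((norm (g x))\<^sup>2 * (norm z)\<^sup>2)"
        using Cauchy_Schwarz_ineq[of _ z] by (auto simp: power2_norm_eq_inner)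
    qed simp
    then show ?thesis by (simp add: L2_def)
  qed
  have seg: "(\<lambda>(t, x). indicator {0..1::real} t *\<^sub>R (g (x + t *\<^sub>R z) \<bullet> z)) \<in> L2 (lborel \<Otimes>\<^sub>M lborel)"
    by (rule segment_L2[OF gz])
  have prod_int: "integrable (lborel \<Otimes>\<^sub>M lborel) (\<lambda>(t, x). indicator {0..1::real} t *\<^sub>R (\<phi> x * (g (x + t *\<^sub>R z) \<bullet> z)))"
    if \<phi>: "\<phi> \<in> L2 lborel" for \<phi> :: "'a \<Rightarrow> real"
  proof -
    have "(\<lambda>(t, x). indicator {0..1::real} t *\<^sub>R \<phi> x) \<in> L2 (lborel \<Otimes>\<^sub>M lborel)"
      using segment_L2[OF \<phi>, of 0] by simp
    from L2_mult[OF this seg] show ?thesis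
      by (rule Bochner_Integration.integrable_cong[OF refl, THEN iffD1, rotated]) (auto split: split_indicator)
  qed
  have G_int: "integrable lborel (\<lambda>x. \<phi> x * G x)" 
    and G_eq: "(\<integral>x. \<phi> x * G x \<partial>lborel) = (\<integral>t. indicator {0..1::real} t *\<^sub>R (\<integral>x. \<phi> x * (g (x + t *\<^sub>R z) \<bullet> z) \<partial>lborel) \<partial>lborel)"
    if \<phi>: "\<phi> \<in> L2 lborel" for \<phi> :: "'a \<Rightarrow> real"
  proof -
    have *: "\<phi> x * G x = (\<integral>t. indicator {0..1::real} t *\<^sub>R (\<phi> x * (g (x + t *\<^sub>R z) \<bullet> z)) \<partial>lborel)" for x
      unfolding G_def by (subst integral_mult_right_zero[symmetric]) (simp add: mult.left_commute)
    show "integrable lborel (\<lambda>x. \<phi> x * G x)"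
      unfolding * by (rule lborel_pair.integrable_snd[OF prod_int[OF \<phi>]])
    show "(\<integral>x. \<phi> x * G x \<partial>lborel) = (\<integral>t. indicator {0..1::real} t *\<^sub>R (\<integral>x. \<phi> x * (g (x + t *\<^sub>R z) \<bullet> z) \<partial>lborel) \<partial>lborel)"
      unfolding * using lborel_pair.Fubini_integral[OF prod_int[OF \<phi>]] by simp
  qed
  have ind_L2: "(indicator (box a b) :: 'a \<Rightarrow> real) \<in> L2 lborel" for a b :: 'a
    using emeasure_lborel_box_finite[of a b] by (intro indicator_L2) (simp_all add: less_top)
  have diff_L2: "(\<lambda>x. u (x + z) - u x) \<in> L2 lborel"
    by (intro L2_diff L2_translate wgradD[OF u])
  have "AE x in lborel. (u (x + z) - u x) - G x = 0"
  proof (rule AE_zero_if_test_integrals_zero)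
    fix a b :: 'a
    have "integrable lborel (\<lambda>x. indicator (box a b) x *\<^sub>R (u (x + z) - u x) - indicator (box a b) x * G x)"
      by (intro Bochner_Integration.integrable_diff L2_mult ind_L2 diff_L2 G_int)
    then show "integrable lborel (\<lambda>x. indicator (box a b) x *\<^sub>R ((u (x + z) - u x) - G x))"
      by (simp add: algebra_simps)
  next
    fix \<phi> :: "'a \<Rightarrow> real" assume \<phi>: "\<phi> \<in> test_functions"
    note [measurable] = test_measurable[OF \<phi>] gradient_measurable[OF \<phi>]
    have tr: "\<phi> \<in> L2 lborel" "(\<lambda>x. \<phi> (x - z)) \<in> L2 lborel"
      using test_L2[OF \<phi>] L2_translate[OF test_L2[OF \<phi>], of "-z"] by simp_all
    have i1: "integrable lborel (\<lambda>x. \<phi> x *\<^sub>R u (x + z))" "integrable lborel (\<lambda>x. \<phi> x *\<^sub>R u x)"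
      "integrable lborel (\<lambda>x. \<phi> (x - z) *\<^sub>R u x)"
      by (intro L2_mult tr L2_translate wgradD[OF u])+
    have "(\<integral>x. \<phi> x * (u (x + z) - u x) \<partial>lborel) = (\<integral>x. \<phi> x * u (x + z) \<partial>lborel) - (\<integral>x. \<phi> x * u x \<partial>lborel)"
      using i1 by (simp add: right_diff_distrib)
    also have "(\<integral>x. \<phi> x * u (x + z) \<partial>lborel) = (\<integral>x. \<phi> (x - z) * u x \<partial>lborel)"
      using integral_translate[of "\<lambda>x. \<phi> (x - z) * u x" z] by simp
    also have "\<dots> - (\<integral>x. \<phi> x * u x \<partial>lborel) = (\<integral>x. u x * (\<phi> (x + - z) - \<phi> x) \<partial>lborel)"
      using i1 by (simp add: right_diff_distrib mult.commute)
    also have "\<dots> = (\<integral>x. \<integral>t. indicator {0..1::real} t *\<^sub>R (u x * (gradient \<phi> (x + t *\<^sub>R - z) \<bullet> - z)) \<partial>lborel \<partial>lborel)"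
      unfolding test_FTC[OF \<phi>] by (subst integral_mult_right_zero[symmetric]) (simp add: mult.left_commute)
    also have "\<dots> = (\<integral>t. \<integral>x. indicator {0..1::real} t *\<^sub>R (u x * (gradient \<phi> (x + t *\<^sub>R - z) \<bullet> - z)) \<partial>lborel \<partial>lborel)"
    proof (rule lborel_pair.Fubini_integral)
      have 1: "(\<lambda>(t, x). indicator {0..1::real} t *\<^sub>R u x) \<in> L2 (lborel \<Otimes>\<^sub>M lborel)"
        using segment_L2[OF wgradD(1)[OF u], of 0] by simp
      have 2: "(\<lambda>(t, x). indicator {0..1::real} t *\<^sub>R gradient \<phi> (x + t *\<^sub>R - z)) \<in> L2 (lborel \<Otimes>\<^sub>M lborel)"
        by (rule segment_L2[OF gradient_L2[OF \<phi>]])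
      have "integrable (lborel \<Otimes>\<^sub>M lborel) (\<lambda>p. ((case p of (t, x) \<Rightarrow> indicator {0..1::real} t *\<^sub>R u x) *\<^sub>R
          (case p of (t, x) \<Rightarrow> indicator {0..1::real} t *\<^sub>R gradient \<phi> (x + t *\<^sub>R - z))) \<bullet> - z)"
        by (intro integrable_inner_left L2_mult 1 2)
      then show "integrable (lborel \<Otimes>\<^sub>M lborel) (\<lambda>(t, x). indicator {0..1::real} t *\<^sub>R (u x * (gradient \<phi> (x + t *\<^sub>R - z) \<bullet> - z)))"
        by (rule Bochner_Integration.integrable_cong[OF refl, THEN iffD1, rotated]) (auto split: split_indicator)
    qed
    also have "\<dots> = (\<integral>t. indicator {0..1::real} t *\<^sub>R (\<integral>x. \<phi> x * (g (x + t *\<^sub>R z) \<bullet> z) \<partial>lborel) \<partial>lborel)"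
    proof (intro Bochner_Integration.integral_cong refl)
      fix t :: real
      define \<psi> where "\<psi> x = \<phi> (x + t *\<^sub>R - z)" for x
      have \<psi>: "\<psi> \<in> test_functions" unfolding \<psi>_def[abs_def] by (rule test_translate[OF \<phi>])
      have gr: "gradient \<psi> x = gradient \<phi> (x + t *\<^sub>R - z)" for x
        unfolding \<psi>_def[abs_def] by (rule gradient_translate[OF \<phi>])
      have iu: "integrable lborel (\<lambda>x. u x *\<^sub>R gradient \<psi> x)" and ig: "integrable lborel (\<lambda>x. \<psi> x *\<^sub>R g x)"
        by (intro L2_mult gradient_L2 test_L2 wgradD[OF u] \<psi>)+
      have "(\<integral>x. u x * (gradient \<psi> x \<bullet> - z) \<partial>lborel) = (\<integral>x. u x *\<^sub>R gradient \<psi> x \<partial>lborel) \<bullet> - z"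
        using integral_inner_left[OF iu, of "- z"] by simp
      also have "\<dots> = (\<integral>x. \<psi> x *\<^sub>R g x \<partial>lborel) \<bullet> z"
        by (simp add: wgradD(5)[OF u \<psi>])
      also have "\<dots> = (\<integral>x. \<psi> x * (g x \<bullet> z) \<partial>lborel)"
        using integral_inner_left[OF ig, of z] by simp
      also have "\<dots> = (\<integral>x. \<phi> x * (g (x + t *\<^sub>R z) \<bullet> z) \<partial>lborel)"
        using integral_translate[of "\<lambda>x. \<psi> x * (g x \<bullet> z)" "t *\<^sub>R z"] by (simp add: \<psi>_def)
      finally show "(\<integral>x. indicator {0..1} t *\<^sub>R (u x * (gradient \<phi> (x + t *\<^sub>R - z) \<bullet> - z)) \<partial>lborel)
        = indicator {0..1} t *\<^sub>R (\<integral>x. \<phi> x * (g (x + t *\<^sub>R z) \<bullet> z) \<partial>lborel)"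
        unfolding gr by (simp only: integral_scaleR_right)
    qed
    also have "\<dots> = (\<integral>x. \<phi> x * G x \<partial>lborel)"
      by (rule G_eq[OF tr(1), symmetric])
    finally have "(\<integral>x. \<phi> x * (u (x + z) - u x) \<partial>lborel) = (\<integral>x. \<phi> x * G x \<partial>lborel)" .
    moreover have "integrable lborel (\<lambda>x. \<phi> x * (u (x + z) - u x))"
      using L2_mult[OF tr(1) diff_L2] by simp
    ultimately show "(\<integral>x. \<phi> x *\<^sub>R ((u (x + z) - u x) - G x) \<partial>lborel) = 0"
      using G_int[OF tr(1)] by (simp add: right_diff_distrib)
  qed simp
  then show ?thesis by (simp add: G_def)
qed

text \<open>Convexity keeps the segment from x to x + z inside S, so that only the gradient on S
  enters. Jensen's inequality on the unit interval and translation invariance for each t do the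
  rest.\<close>

lemma translation_estimate:
  assumes u: "wgrad u g" and [measurable]: "S \<in> sets borel" and S: "convex S"
  shows "(\<integral>\<^sup>+x. indicator S x * indicator S (x + z) * ennreal ((u (x + z) - u x)\<^sup>2) \<partial>lborel)
    \<le> ennreal ((norm z)\<^sup>2) * (\<integral>\<^sup>+x. indicator S x * ennreal ((norm (g x))\<^sup>2) \<partial>lborel)"
proof -
  note [measurable] = wgradD(3,4)[OF u]
  have "(\<integral>\<^sup>+x. indicator S x * indicator S (x + z) * ennreal ((u (x + z) - u x)\<^sup>2) \<partial>lborel)
      \<le> (\<integral>\<^sup>+x. \<integral>\<^sup>+t. indicator {0..1::real} t * (ennreal ((norm z)\<^sup>2) * (indicator S (x + t *\<^sub>R z) * ennreal ((norm (g (x + t *\<^sub>R z)))\<^sup>2))) \<partial>lborel \<partial>lborel)"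
  proof (rule nn_integral_mono_AE)
    show "AE x in lborel. indicator S x * indicator S (x + z) * ennreal ((u (x + z) - u x)\<^sup>2)
      \<le> (\<integral>\<^sup>+t. indicator {0..1::real} t * (ennreal ((norm z)\<^sup>2) * (indicator S (x + t *\<^sub>R z) * ennreal ((norm (g (x + t *\<^sub>R z)))\<^sup>2))) \<partial>lborel)"
      using segment_formula[OF u, of z]
    proof eventually_elim
      case (elim x)
      show ?case
      proof (cases "x \<in> S \<and> x + z \<in> S")
        case True
        have inS: "x + t *\<^sub>R z \<in> S" if "t \<in> {0..1}" for t
          using convexD[OF S, of x "x + z" "1 - t" t] True that by (simp add: algebra_simps)
        have "ennreal ((u (x + z) - u x)\<^sup>2) \<le> (\<integral>\<^sup>+t. indicator {0..1::real} t * ennreal ((norm (g (x + t *\<^sub>R z) \<bullet> z))\<^sup>2) \<partial>lborel)"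
          using jensen_set[of "\<lambda>t. g (x + t *\<^sub>R z) \<bullet> z" lborel "{0..1::real}"] by (simp add: elim)
        also have "\<dots> \<le> (\<integral>\<^sup>+t. indicator {0..1::real} t * (ennreal ((norm z)\<^sup>2) * (indicator S (x + t *\<^sub>R z) * ennreal ((norm (g (x + t *\<^sub>R z)))\<^sup>2))) \<partial>lborel)"
        proof (intro nn_integral_mono)
          fix t
          have "(norm (g (x + t *\<^sub>R z) \<bullet> z))\<^sup>2 \<le> (norm z)\<^sup>2 * (norm (g (x + t *\<^sub>R z)))\<^sup>2"
            using Cauchy_Schwarz_ineq[of "g (x + t *\<^sub>R z)" z]
            by (simp add: power2_norm_eq_inner mult.commute)
          then show "indicator {0..1::real} t * ennreal ((norm (g (x + t *\<^sub>R z) \<bullet> z))\<^sup>2)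
            \<le> indicator {0..1::real} t * (ennreal ((norm z)\<^sup>2) * (indicator S (x + t *\<^sub>R z) * ennreal ((norm (g (x + t *\<^sub>R z)))\<^sup>2)))"
            using inS[of t] by (auto simp: ennreal_mult[symmetric] intro!: ennreal_leI split: split_indicator)
        qed
        finally show ?thesis using True by simp
      qed auto
    qed
  qed
  also have "\<dots> = (\<integral>\<^sup>+t. \<integral>\<^sup>+x. indicator {0..1::real} t * (ennreal ((norm z)\<^sup>2) * (indicator S (x + t *\<^sub>R z) * ennreal ((norm (g (x + t *\<^sub>R z)))\<^sup>2))) \<partial>lborel \<partial>lborel)"
    by (rule lborel_pair.Fubini') measurable
  also have "\<dots> = (\<integral>\<^sup>+t. indicator {0..1::real} t * (ennreal ((norm z)\<^sup>2) * (\<integral>\<^sup>+x. indicator S x * ennreal ((norm (g x))\<^sup>2) \<partial>lborel)) \<partial>lborel)"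
  proof (intro nn_integral_cong)
    fix t :: real
    show "(\<integral>\<^sup>+x. indicator {0..1::real} t * (ennreal ((norm z)\<^sup>2) * (indicator S (x + t *\<^sub>R z) * ennreal ((norm (g (x + t *\<^sub>R z)))\<^sup>2))) \<partial>lborel)
      = indicator {0..1::real} t * (ennreal ((norm z)\<^sup>2) * (\<integral>\<^sup>+x. indicator S x * ennreal ((norm (g x))\<^sup>2) \<partial>lborel))"
      using nn_integral_translate[of "\<lambda>x. indicator S x * ennreal ((norm (g x))\<^sup>2)" "t *\<^sub>R z"]
      by (simp add: nn_integral_cmult)
  qed
  also have "\<dots> = ennreal ((norm z)\<^sup>2) * (\<integral>\<^sup>+x. indicator S x * ennreal ((norm (g x))\<^sup>2) \<partial>lborel)"
    by (subst nn_integral_multc) auto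
  finally show ?thesis .
qed

section \<open>Dyadic averages and the subcritical Sobolev embedding\<close>

text \<open>Cubes are the classes of an equivalence relation instead of a family indexed by lattice
  points. The relation is jointly measurable in its two points, as Fubini requires, and its
  half-open classes partition the space.\<close>

definition same_cube :: "nat \<Rightarrow> 'a::euclidean_space \<Rightarrow> 'a \<Rightarrow> bool" where
  "same_cube k x y \<longleftrightarrow> (\<forall>b\<in>Basis. \<lfloor>2 ^ k * (x \<bullet> b)\<rfloor> = \<lfloor>2 ^ k * (y \<bullet> b)\<rfloor>)"

definition cube_of :: "nat \<Rightarrow> 'a::euclidean_space \<Rightarrow> 'a set" where
  "cube_of k x = {y. same_cube k x y}"

definition avg :: "nat \<Rightarrow> ('a::euclidean_space \<Rightarrow> real) \<Rightarrow> 'a \<Rightarrow> real" where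
  "avg k u x = 2 ^ (k * DIM('a)) * (\<integral>y. indicator (cube_of k x) y *\<^sub>R u y \<partial>lborel)"

lemma same_cube_Suc: "same_cube (Suc k) x y \<Longrightarrow> same_cube k x y"
proof -
  have "\<lfloor>2 ^ k * t\<rfloor> = \<lfloor>2 ^ Suc k * t\<rfloor> div 2" for t :: real
    using floor_divide_real_eq_div[of 2 "2 ^ Suc k * t"] by simp
  then show "same_cube (Suc k) x y \<Longrightarrow> same_cube k x y" by (simp add: same_cube_def)
qed

lemma same_cube_0: "same_cube k x y \<Longrightarrow> same_cube 0 x y"
  by (induction k) (auto dest: same_cube_Suc)

lemma cube_of_eq: "same_cube k x y \<Longrightarrow> cube_of k x = cube_of k y"
  by (auto simp: cube_of_def same_cube_def)

lemma same_cube_pred [measurable]: "Measurable.pred (borel \<Otimes>\<^sub>M borel) (\<lambda>p. same_cube k (fst p) (snd p :: 'a::euclidean_space))"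
  unfolding same_cube_def by measurable

lemma cube_of_sets [measurable]: "cube_of k x \<in> sets borel"
proof -
  have "Measurable.pred borel (\<lambda>y. same_cube k x y)" unfolding same_cube_def by measurable
  then show ?thesis by (simp add: cube_of_def pred_def)
qed

lemma avg_cong: "same_cube k x y \<Longrightarrow> avg k u x = avg k u y"
  by (simp add: avg_def cube_of_eq)

text \<open>The half-open cube lies between the open and the closed box with the same corners, which
  have equal measure.\<close>

lemma emeasure_cube_of: "emeasure lborel (cube_of k x) = ennreal ((1 / 2 ^ k) ^ DIM('a))"
  for x :: "'a::euclidean_space"
proof -
  define l u where "l = (\<Sum>b\<in>Basis. (of_int \<lfloor>2 ^ k * (x \<bullet> b)\<rfloor> / 2 ^ k) *\<^sub>R b)"
    and "u = (\<Sum>b\<in>Basis. ((of_int \<lfloor>2 ^ k * (x \<bullet> b)\<rfloor> + 1) / 2 ^ k) *\<^sub>R b)"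
  have lu: "l \<bullet> b = of_int \<lfloor>2 ^ k * (x \<bullet> b)\<rfloor> / 2 ^ k" "u \<bullet> b = (of_int \<lfloor>2 ^ k * (x \<bullet> b)\<rfloor> + 1) / 2 ^ k"
    if "b \<in> Basis" for b using that by (simp_all add: l_def u_def)
  have iff: "\<lfloor>2 ^ k * (x \<bullet> b)\<rfloor> = \<lfloor>2 ^ k * (y \<bullet> b)\<rfloor> \<longleftrightarrow> l \<bullet> b \<le> y \<bullet> b \<and> y \<bullet> b < u \<bullet> b" if "b \<in> Basis" for b y
  proof -
    have "\<lfloor>2 ^ k * (y \<bullet> b)\<rfloor> = \<lfloor>2 ^ k * (x \<bullet> b)\<rfloor> \<longleftrightarrow>
      of_int \<lfloor>2 ^ k * (x \<bullet> b)\<rfloor> \<le> 2 ^ k * (y \<bullet> b) \<and> 2 ^ k * (y \<bullet> b) < of_int \<lfloor>2 ^ k * (x \<bullet> b)\<rfloor> + 1"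
      by (rule floor_eq_iff)
    moreover have "l \<bullet> b \<le> y \<bullet> b \<longleftrightarrow> of_int \<lfloor>2 ^ k * (x \<bullet> b)\<rfloor> \<le> 2 ^ k * (y \<bullet> b)"
      "y \<bullet> b < u \<bullet> b \<longleftrightarrow> 2 ^ k * (y \<bullet> b) < of_int \<lfloor>2 ^ k * (x \<bullet> b)\<rfloor> + 1"
      by (simp_all add: lu[OF that] pos_divide_le_eq pos_less_divide_eq mult.commute)
    ultimately show ?thesis by metis
  qed
  have le: "l \<bullet> b \<le> u \<bullet> b" and diff: "(u - l) \<bullet> b = 1 / 2 ^ k" if "b \<in> Basis" for b
    by (simp_all add: lu that divide_right_mono inner_diff_left diff_divide_distrib[symmetric])
  have "(\<Prod>b\<in>Basis. (u - l) \<bullet> b) = (1 / 2 ^ k) ^ DIM('a)"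
    using diff by simp
  then have "emeasure lborel (box l u) = ennreal ((1 / 2 ^ k) ^ DIM('a))" "emeasure lborel (cbox l u) = ennreal ((1 / 2 ^ k) ^ DIM('a))"
    using emeasure_lborel_box[of l u] emeasure_lborel_cbox[of l u] le by simp_all
  moreover have "box l u \<subseteq> cube_of k x" "cube_of k x \<subseteq> cbox l u"
    by (auto simp: cube_of_def same_cube_def iff box_def cbox_def)
  then have "emeasure lborel (box l u) \<le> emeasure lborel (cube_of k x)"
    "emeasure lborel (cube_of k x) \<le> emeasure lborel (cbox l u)"
    by (auto intro!: emeasure_mono)
  ultimately show ?thesis by simp
qed

lemma cube_of_dist:
  assumes "same_cube k x y" "b \<in> Basis" shows "\<bar>(y - x) \<bullet> b\<bar> \<le> 1 / 2 ^ k"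
proof -
  have "\<lfloor>2 ^ k * (x \<bullet> b)\<rfloor> = \<lfloor>2 ^ k * (y \<bullet> b)\<rfloor>" using assms by (auto simp: same_cube_def)
  then have "\<bar>2 ^ k * (y \<bullet> b) - 2 ^ k * (x \<bullet> b)\<bar> \<le> 1" by linarith
  then show ?thesis by (simp add: inner_diff_left field_simps abs_le_iff)
qed

section \<open>Jensen and Poincare inequalities on dyadic cubes\<close>

lemma cube_L2: "(indicator (cube_of k x) :: _ \<Rightarrow> real) \<in> L2 lborel"
  by (rule indicator_L2) (simp_all add: emeasure_cube_of)

lemma integral_cube_of: "(\<integral>y. indicator (cube_of k x) y *\<^sub>R (c::real) \<partial>lborel) = c / 2 ^ (k * DIM('a))"
  for x :: "'a::euclidean_space"
proof -
  have "measure lborel (cube_of k x) = (1 / 2 ^ k) ^ DIM('a)"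
    by (simp add: measure_def emeasure_cube_of)
  then show ?thesis by (simp add: emeasure_cube_of power_mult power_one_over field_simps)
qed

lemma avg_measurable [measurable]:
  assumes [measurable]: "u \<in> borel_measurable borel" shows "avg k u \<in> borel_measurable borel"
proof -
  have "(\<lambda>x. \<integral>y. indicator (cube_of k x) y *\<^sub>R u y \<partial>lborel) = (\<lambda>x. \<integral>y. of_bool (same_cube k x y) * u y \<partial>lborel)"
    by (simp add: cube_of_def indicator_def)
  moreover have "\<dots> \<in> borel_measurable borel"
    by measurable
  ultimately have "(\<lambda>x. \<integral>y. indicator (cube_of k x) y *\<^sub>R u y \<partial>lborel) \<in> borel_measurable borel"
    by (simp only:)
  then show ?thesis unfolding avg_def[abs_def] by (intro borel_measurable_times borel_measurable_const)
qed

lemma cube_jensen: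
  fixes f :: "'a::euclidean_space \<Rightarrow> real"
  assumes [measurable]: "f \<in> borel_measurable borel"
  shows "ennreal ((2 ^ (k * DIM('a)) * (\<integral>y. indicator (cube_of k x) y *\<^sub>R f y \<partial>lborel))\<^sup>2)
    \<le> ennreal (2 ^ (k * DIM('a))) * (\<integral>\<^sup>+y. indicator (cube_of k x) y * ennreal ((f y)\<^sup>2) \<partial>lborel)"
proof -
  let ?c = "2 ^ (k * DIM('a)) :: real"
  have "ennreal ((?c * (\<integral>y. indicator (cube_of k x) y *\<^sub>R f y \<partial>lborel))\<^sup>2)
    = ennreal (?c\<^sup>2) * ennreal ((norm (\<integral>y. indicator (cube_of k x) y *\<^sub>R f y \<partial>lborel))\<^sup>2)"
    by (simp add: power_mult_distrib ennreal_mult)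
  also have "\<dots> \<le> ennreal (?c\<^sup>2) * (emeasure lborel (cube_of k x) * (\<integral>\<^sup>+y. indicator (cube_of k x) y * ennreal ((norm (f y))\<^sup>2) \<partial>lborel))"
    by (intro mult_left_mono jensen_set) auto
  also have "\<dots> = (ennreal (?c\<^sup>2) * ennreal (1 / ?c)) * (\<integral>\<^sup>+y. indicator (cube_of k x) y * ennreal ((f y)\<^sup>2) \<partial>lborel)"
    by (simp add: emeasure_cube_of power_mult power_one_over mult.assoc)
  also have "ennreal (?c\<^sup>2) * ennreal (1 / ?c) = ennreal ?c"
    by (simp add: ennreal_mult[symmetric] power2_eq_square)
  finally show ?thesis .
qed

text \<open>A constant equals its own average, so the difference is an average of differences. The
  lemma is applied with c depending on x: c = u x in the Poincare inequality, and c the coarser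
  average in \<open>avg_step\<close>.\<close>

lemma diff_avg:
  fixes x :: "'a::euclidean_space"
  assumes u: "u \<in> L2 lborel"
  shows "c - avg k u x = 2 ^ (k * DIM('a)) * (\<integral>y. indicator (cube_of k x) y *\<^sub>R (c - u y) \<partial>lborel)"
proof -
  have 1: "integrable lborel (\<lambda>y. indicator (cube_of k x) y *\<^sub>R u y)"
    by (intro L2_mult cube_L2 u)
  have 2: "integrable lborel (\<lambda>y. indicator (cube_of k x) y *\<^sub>R c)"
    by (intro integrable_scaleR_left) (simp add: emeasure_cube_of)
  have "(\<integral>y. indicator (cube_of k x) y *\<^sub>R (c - u y) \<partial>lborel)
      = (\<integral>y. indicator (cube_of k x) y *\<^sub>R c - indicator (cube_of k x) y *\<^sub>R u y \<partial>lborel)"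
    by (simp add: right_diff_distrib)
  also have "\<dots> = c / 2 ^ (k * DIM('a)) - (\<integral>y. indicator (cube_of k x) y *\<^sub>R u y \<partial>lborel)"
    unfolding integral_cube_of[symmetric, of c k x] by (rule Bochner_Integration.integral_diff[OF 2 1])
  finally show ?thesis by (simp add: avg_def right_diff_distrib)
qed

text \<open>Jensen bounds the square by the mean of (u x - u y)^2 over the cube of x. With y = x + z
  every z lies in a box of side 2^(1-k), and after Fubini \<open>translation_estimate\<close>
  applies to each z. S will be the unit cube or the whole space: convexity serves the translation
  estimate, and the last assumption puts the dyadic cubes of points of S inside S.\<close>

lemma poincare_avg:
  fixes u :: "'a::euclidean_space \<Rightarrow> real"
  assumes u: "wgrad u g" and S[measurable]: "S \<in> sets borel" and conv: "convex S"
    and cl: "\<And>x y. x \<in> S \<Longrightarrow> same_cube 0 x y \<Longrightarrow> y \<in> S"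
  shows "(\<integral>\<^sup>+x. indicator S x * ennreal ((u x - avg k u x)\<^sup>2) \<partial>lborel)
    \<le> ennreal (2 ^ DIM('a) * real DIM('a) * (1/4) ^ k) * (\<integral>\<^sup>+x. indicator S x * ennreal ((norm (g x))\<^sup>2) \<partial>lborel)"
proof -
  note [measurable] = wgradD(3,4)[OF u]
  define I where "I = (\<integral>\<^sup>+x. indicator S x * ennreal ((norm (g x))\<^sup>2) \<partial>lborel)"
  let ?c = "2 ^ (k * DIM('a)) :: real" and ?h = "1 / 2 ^ k :: real"
  let ?D = "cbox (- (?h *\<^sub>R One)) (?h *\<^sub>R One) :: 'a set"
  have [measurable]: "(\<lambda>p. indicator (cube_of k (fst p)) (snd p) :: ennreal) \<in> borel_measurable (borel \<Otimes>\<^sub>M (borel :: 'a measure))"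
    unfolding cube_of_def indicator_def mem_Collect_eq by measurable
  have "(\<integral>\<^sup>+x. indicator S x * ennreal ((u x - avg k u x)\<^sup>2) \<partial>lborel)
    \<le> (\<integral>\<^sup>+x. indicator S x * (ennreal ?c * (\<integral>\<^sup>+y. indicator (cube_of k x) y * ennreal ((u x - u y)\<^sup>2) \<partial>lborel)) \<partial>lborel)"
    unfolding diff_avg[OF wgradD(1)[OF u]] by (intro nn_integral_mono mult_left_mono cube_jensen) auto
  also have "\<dots> = (\<integral>\<^sup>+x. \<integral>\<^sup>+z. ennreal ?c * (indicator S x * (indicator (cube_of k x) (x + z) * ennreal ((u x - u (x + z))\<^sup>2))) \<partial>lborel \<partial>lborel)"
  proof (intro nn_integral_cong)
    fix x
    have "(\<integral>\<^sup>+y. indicator (cube_of k x) y * ennreal ((u x - u y)\<^sup>2) \<partial>lborel)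
        = (\<integral>\<^sup>+z. indicator (cube_of k x) (x + z) * ennreal ((u x - u (x + z))\<^sup>2) \<partial>lborel)"
      using nn_integral_translate[of "\<lambda>y. indicator (cube_of k x) y * ennreal ((u x - u y)\<^sup>2)" x]
      by (simp add: add.commute)
    then show "indicator S x * (ennreal ?c * (\<integral>\<^sup>+y. indicator (cube_of k x) y * ennreal ((u x - u y)\<^sup>2) \<partial>lborel))
      = (\<integral>\<^sup>+z. ennreal ?c * (indicator S x * (indicator (cube_of k x) (x + z) * ennreal ((u x - u (x + z))\<^sup>2))) \<partial>lborel)"
      by (simp add: nn_integral_cmult) (simp only: mult.left_commute)
  qed
  also have "\<dots> = (\<integral>\<^sup>+z. \<integral>\<^sup>+x. ennreal ?c * (indicator S x * (indicator (cube_of k x) (x + z) * ennreal ((u x - u (x + z))\<^sup>2))) \<partial>lborel \<partial>lborel)"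
    unfolding cube_of_def indicator_def mem_Collect_eq same_cube_def
    by (rule lborel_pair.Fubini'[symmetric]) measurable
  also have "\<dots> \<le> (\<integral>\<^sup>+z. ennreal ?c * (indicator ?D z * (ennreal ((norm z)\<^sup>2) * I)) \<partial>lborel)"
  proof (intro nn_integral_mono)
    fix z :: 'a
    have "(\<integral>\<^sup>+x. ennreal ?c * (indicator S x * (indicator (cube_of k x) (x + z) * ennreal ((u x - u (x + z))\<^sup>2))) \<partial>lborel)
      \<le> (\<integral>\<^sup>+x. ennreal ?c * (indicator ?D z * (indicator S x * indicator S (x + z) * ennreal ((u (x + z) - u x)\<^sup>2))) \<partial>lborel)"
    proof (intro nn_integral_mono mult_left_mono)
      fix x
      show "indicator S x * (indicator (cube_of k x) (x + z) * ennreal ((u x - u (x + z))\<^sup>2))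
         \<le> indicator ?D z * (indicator S x * indicator S (x + z) * ennreal ((u (x + z) - u x)\<^sup>2))"
      proof (cases "x \<in> S \<and> same_cube k x (x + z)")
        case True
        then have "x + z \<in> S" using cl same_cube_0 by blast
        moreover have "z \<in> ?D"
          using cube_of_dist[of k x "x + z"] True by (auto simp: mem_box abs_le_iff minus_le_iff)
        ultimately show ?thesis using True by (simp add: power2_commute cube_of_def)
      qed (auto simp: cube_of_def)
    qed simp
    also have "\<dots> = ennreal ?c * (indicator ?D z * (\<integral>\<^sup>+x. indicator S x * indicator S (x + z) * ennreal ((u (x + z) - u x)\<^sup>2) \<partial>lborel))"
      by (simp add: nn_integral_cmult)
    also have "\<dots> \<le> ennreal ?c * (indicator ?D z * (ennreal ((norm z)\<^sup>2) * I))"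
      unfolding I_def by (intro mult_left_mono translation_estimate[OF u S conv]) auto
    finally show "(\<integral>\<^sup>+x. ennreal ?c * (indicator S x * (indicator (cube_of k x) (x + z) * ennreal ((u x - u (x + z))\<^sup>2))) \<partial>lborel)
      \<le> ennreal ?c * (indicator ?D z * (ennreal ((norm z)\<^sup>2) * I))" .
  qed
  also have "\<dots> \<le> (\<integral>\<^sup>+z. (ennreal ?c * (ennreal (real DIM('a) * ?h\<^sup>2) * I)) * indicator ?D z \<partial>lborel)"
  proof (intro nn_integral_mono)
    fix z :: 'a
    show "ennreal ?c * (indicator ?D z * (ennreal ((norm z)\<^sup>2) * I)) \<le> (ennreal ?c * (ennreal (real DIM('a) * ?h\<^sup>2) * I)) * indicator ?D z"
    proof (cases "z \<in> ?D")
      case True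
      have "(norm z)\<^sup>2 = (\<Sum>b\<in>Basis. (z \<bullet> b)\<^sup>2)" unfolding power2_norm_eq_inner euclidean_inner[of z z] by (simp add: power2_eq_square)
      also have "\<dots> \<le> (\<Sum>b\<in>(Basis::'a set). ?h\<^sup>2)"
        using True by (intro sum_mono) (auto simp: cbox_def power2_le_iff_abs_le abs_le_iff)
      finally show ?thesis using True by (auto intro!: mult_left_mono mult_right_mono ennreal_leI)
    qed simp
  qed
  also have "\<dots> = (ennreal ?c * (ennreal (real DIM('a) * ?h\<^sup>2) * I)) * ennreal ((2 * ?h) ^ DIM('a))"
  proof -
    have "emeasure lborel ?D = ennreal ((2 * ?h) ^ DIM('a))"
    proof -
      have "(\<Prod>b\<in>Basis. (?h *\<^sub>R One - (- (?h *\<^sub>R One))) \<bullet> (b :: 'a)) = (\<Prod>b\<in>(Basis::'a set). 2 * ?h)"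
        by (intro prod.cong refl) (simp add: inner_diff_left inner_add_left inner_sum_left inner_Basis)
      then show ?thesis by (subst emeasure_lborel_cbox) simp_all
    qed
    then show ?thesis by (simp add: nn_integral_cmult_indicator)
  qed
  also have "\<dots> = (ennreal ?c * ennreal (real DIM('a) * ?h\<^sup>2) * ennreal ((2 * ?h) ^ DIM('a))) * I"
    by (simp add: mult_ac)
  also have "ennreal ?c * ennreal (real DIM('a) * ?h\<^sup>2) * ennreal ((2 * ?h) ^ DIM('a)) = ennreal (?c * (real DIM('a) * ?h\<^sup>2) * (2 * ?h) ^ DIM('a))"
    by (simp add: ennreal_mult)
  \<comment> \<open>The reciprocal volume of a cube, times the bound for the squared norm of z,
    times the volume of the range of z: the volumes cancel up to 2^N, and 4^-k remains.\<close>
  also have "?c * (real DIM('a) * ?h\<^sup>2) * (2 * ?h) ^ DIM('a) = 2 ^ DIM('a) * real DIM('a) * (1/4) ^ k"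
  proof -
    have "?h\<^sup>2 = (1/4) ^ k" by (simp add: power2_eq_square power_one_over flip: power_mult_distrib)
    moreover have "?c * (2 * ?h) ^ DIM('a) = 2 ^ DIM('a)"
      by (simp add: power_mult power_mult_distrib[symmetric])
    moreover have "?c * (real DIM('a) * ?h\<^sup>2) * (2 * ?h) ^ DIM('a) = (?c * (2 * ?h) ^ DIM('a)) * (real DIM('a) * ?h\<^sup>2)"
      by (simp only: mult_ac)
    ultimately show ?thesis by (simp only: mult.assoc)
  qed
  finally show ?thesis unfolding I_def .
qed

lemma avg_sq_le:
  fixes u :: "'a::euclidean_space \<Rightarrow> real"
  assumes [measurable]: "u \<in> borel_measurable borel" and x: "x \<in> S"
    and cl: "\<And>x y. x \<in> S \<Longrightarrow> same_cube 0 x y \<Longrightarrow> y \<in> S"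
  shows "ennreal ((avg k u x)\<^sup>2) \<le> ennreal (2 ^ (k * DIM('a))) * (\<integral>\<^sup>+y. indicator S y * ennreal ((u y)\<^sup>2) \<partial>lborel)"
proof -
  have "ennreal ((avg k u x)\<^sup>2) \<le> ennreal (2 ^ (k * DIM('a))) * (\<integral>\<^sup>+y. indicator (cube_of k x) y * ennreal ((u y)\<^sup>2) \<partial>lborel)"
    unfolding avg_def by (rule cube_jensen) fact
  also have "\<dots> \<le> ennreal (2 ^ (k * DIM('a))) * (\<integral>\<^sup>+y. indicator S y * ennreal ((u y)\<^sup>2) \<partial>lborel)"
    using cl[OF x] same_cube_0[of k x]
    by (intro mult_left_mono nn_integral_mono mult_right_mono) (auto simp: cube_of_def split: split_indicator)
  finally show ?thesis .
qed

text \<open>The coarser average is constant on the finer cube, so the difference is an average of u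
  minus that constant. Jensen costs the factor 2^((k+1) N), the Poincare inequality returns 4^-k,
  and the square root grows like 2^(k (N/2 - 1)).\<close>

lemma avg_step:
  fixes u :: "'a::euclidean_space \<Rightarrow> real"
  assumes u: "wgrad u g" and S[measurable]: "S \<in> sets borel" and conv: "convex S"
    and cl: "\<And>x y. x \<in> S \<Longrightarrow> same_cube 0 x y \<Longrightarrow> y \<in> S" and x: "x \<in> S"
    and I: "(\<integral>\<^sup>+x. indicator S x * ennreal ((norm (g x))\<^sup>2) \<partial>lborel) \<le> ennreal h" "h \<ge> 0"
  shows "\<bar>avg (Suc k) u x - avg k u x\<bar> \<le> 2 ^ DIM('a) * sqrt (real DIM('a) * h) * 2 powr (real k * (real DIM('a) / 2 - 1))"
proof -
  note [measurable] = wgradD(3)[OF u]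
  define N where "N = DIM('a)"
  have eq: "avg k u x - avg (Suc k) u x
      = 2 ^ (Suc k * DIM('a)) * (\<integral>y. indicator (cube_of (Suc k) x) y *\<^sub>R (avg k u y - u y) \<partial>lborel)"
  proof -
    have "indicator (cube_of (Suc k) x) y *\<^sub>R (avg k u x - u y) = indicator (cube_of (Suc k) x) y *\<^sub>R (avg k u y - u y)" for y
      using avg_cong[OF same_cube_Suc, of k x y u] by (auto simp: cube_of_def split: split_indicator)
    then show ?thesis unfolding diff_avg[OF wgradD(1)[OF u]] by (simp only:)
  qed
  have "ennreal ((avg k u x - avg (Suc k) u x)\<^sup>2)
    \<le> ennreal (2 ^ (Suc k * DIM('a))) * (\<integral>\<^sup>+y. indicator (cube_of (Suc k) x) y * ennreal ((avg k u y - u y)\<^sup>2) \<partial>lborel)"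
    unfolding eq by (rule cube_jensen) measurable
  also have "\<dots> \<le> ennreal (2 ^ (Suc k * DIM('a))) * (\<integral>\<^sup>+y. indicator S y * ennreal ((u y - avg k u y)\<^sup>2) \<partial>lborel)"
    using cl[OF x] same_cube_0[of "Suc k" x]
    by (intro mult_left_mono nn_integral_mono) (auto simp: cube_of_def power2_commute split: split_indicator)
  also have "\<dots> \<le> ennreal (2 ^ (Suc k * DIM('a))) * (ennreal (2 ^ DIM('a) * real DIM('a) * (1/4) ^ k) * ennreal h)"
    by (intro mult_left_mono order_trans[OF poincare_avg[OF u S conv cl]] I) auto
  also have "\<dots> = ennreal (2 ^ (Suc k * N) * (2 ^ N * real N * (1/4) ^ k * h))"
    using I(2) by (simp add: ennreal_mult[symmetric] N_def)
  also have "2 ^ (Suc k * N) * (2 ^ N * real N * (1/4) ^ k * h)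
      = (2 ^ N * sqrt (real N * h) * 2 powr (real k * (real N / 2 - 1)))\<^sup>2"
  proof -
    have "(2 powr (real k * (real N / 2 - 1)))\<^sup>2 = 2 powr (real (k * N) - 2 * real k)"
      by (simp add: powr_power algebra_simps)
    also have "\<dots> = 2 ^ (k * N) * (1/4) ^ k"
    proof -
      have "2 powr real (k * N) = (2::real) ^ (k * N)" by (rule powr_realpow) simp
      moreover have "2 powr (2 * real k) = (4::real) ^ k"
        by (simp add: powr_powr[symmetric] powr_realpow)
      ultimately show ?thesis by (simp only: powr_diff power_one_over) (simp add: divide_inverse)
    qed
    finally show ?thesis using I(2)
      by (simp add: power_mult_distrib power_add power2_eq_square field_simps)
  qed
  finally have "(avg (Suc k) u x - avg k u x)\<^sup>2 \<le> (2 ^ N * sqrt (real N * h) * 2 powr (real k * (real N / 2 - 1)))\<^sup>2"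
    by (simp add: power2_commute)
  then show ?thesis
    unfolding N_def by (rule abs_le_square_iff[THEN iffD2, THEN order_trans]) (use I(2) in simp)
qed

text \<open>Telescoping \<open>avg_step\<close> leads to a geometric sum with ratio 2^(N/2 - 1),
  which is at most 1 for N \<le> 2. A ratio 2^\<beta> > 1 that is at least as large makes the
  induction uniform in the dimension.\<close>

lemma avg_growth:
  assumes \<beta>: "\<beta> > 0" "\<beta> \<ge> real DIM('a) / 2 - 1"
  obtains M where "M \<ge> 1" "\<And>(u :: 'a::euclidean_space \<Rightarrow> real) g S h x k.
    wgrad u g \<Longrightarrow> S \<in> sets borel \<Longrightarrow> convex S \<Longrightarrow> (\<And>x y. x \<in> S \<Longrightarrow> same_cube 0 x y \<Longrightarrow> y \<in> S) \<Longrightarrow>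
    (\<integral>\<^sup>+x. indicator S x * ennreal ((u x)\<^sup>2) \<partial>lborel) \<le> ennreal h \<Longrightarrow>
    (\<integral>\<^sup>+x. indicator S x * ennreal ((norm (g x))\<^sup>2) \<partial>lborel) \<le> ennreal h \<Longrightarrow> h \<ge> 0 \<Longrightarrow>
    x \<in> S \<Longrightarrow> \<bar>avg k u x\<bar> \<le> M * sqrt h * 2 powr (real k * \<beta>)"
proof -
  define B where "B = 2 ^ DIM('a) * sqrt (real DIM('a))"
  \<comment> \<open>Up to the factor sqrt h, one step is at most B 2^(k \<beta>) and fits into the
    increase from M 2^(k \<beta>) to M 2^((k+1) \<beta>). The entry 1 covers level 0, where cubes
    have volume 1.\<close>
  define M where "M = max 1 (B / (2 powr \<beta> - 1))"
  have b1: "2 powr \<beta> > 1" using \<beta>(1) by simp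
  have BM: "B \<le> M * (2 powr \<beta> - 1)"
    using b1 by (simp add: M_def pos_divide_le_eq[symmetric])
  show ?thesis
  proof (rule that[of M])
    fix u :: "'a \<Rightarrow> real" and g S h x k
    assume u: "wgrad u g" and S: "S \<in> sets borel" "convex S" "\<And>x y. x \<in> S \<Longrightarrow> same_cube 0 x y \<Longrightarrow> y \<in> S"
      and hu: "(\<integral>\<^sup>+x. indicator S x * ennreal ((u x)\<^sup>2) \<partial>lborel) \<le> ennreal h"
      and hg: "(\<integral>\<^sup>+x. indicator S x * ennreal ((norm (g x))\<^sup>2) \<partial>lborel) \<le> ennreal h"
      and h: "h \<ge> 0" and x: "x \<in> S"
    show "\<bar>avg k u x\<bar> \<le> M * sqrt h * 2 powr (real k * \<beta>)"
    proof (induction k)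
      case 0
      have "ennreal ((avg 0 u x)\<^sup>2) \<le> ennreal h"
        using order_trans[OF avg_sq_le[OF wgradD(3)[OF u] x S(3), where k = 0]] hu by simp
      then have "\<bar>avg 0 u x\<bar> \<le> sqrt h" using h by (simp add: real_le_rsqrt)
      also have "\<dots> \<le> M * sqrt h" using h by (simp add: M_def mult_le_cancel_right1)
      finally show ?case by simp
    next
      case (Suc k)
      have "\<bar>avg (Suc k) u x\<bar> \<le> \<bar>avg k u x\<bar> + \<bar>avg (Suc k) u x - avg k u x\<bar>" by linarith
      also have "\<dots> \<le> M * sqrt h * 2 powr (real k * \<beta>) + B * sqrt h * 2 powr (real k * (real DIM('a) / 2 - 1))"
      proof (rule add_mono[OF Suc])
        have "\<bar>avg (Suc k) u x - avg k u x\<bar> \<le> 2 ^ DIM('a) * sqrt (real DIM('a) * h) * 2 powr (real k * (real DIM('a) / 2 - 1))"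
          by (rule avg_step[OF u S(1,2) _ x hg h]) (rule S(3))
        then show "\<bar>avg (Suc k) u x - avg k u x\<bar> \<le> B * sqrt h * 2 powr (real k * (real DIM('a) / 2 - 1))"
          by (simp add: B_def real_sqrt_mult)
      qed
      also have "\<dots> \<le> M * sqrt h * 2 powr (real k * \<beta>) + (M * (2 powr \<beta> - 1)) * sqrt h * 2 powr (real k * \<beta>)"
      proof (intro add_left_mono mult_mono)
        show "2 powr (real k * (real DIM('a) / 2 - 1)) \<le> 2 powr (real k * \<beta>)"
          using \<beta>(2) by (intro powr_mono mult_left_mono) auto
        have "0 \<le> B" by (simp add: B_def)
        then show "0 \<le> M * (2 powr \<beta> - 1) * sqrt h" "0 \<le> M * (2 powr \<beta> - 1)" using BM h by auto
      qed (use BM h in auto)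
      also have "\<dots> = M * sqrt h * 2 powr (real (Suc k) * \<beta>)"
        by (simp add: algebra_simps powr_add)
      finally show ?case .
    qed
  qed (simp add: M_def)
qed

text \<open>The pointwise inequality behind the embedding: at the level \<open>k\<close> where \<open>\<bar>v\<bar>\<close> first drops below
  twice the bound for the averages, the oscillation \<open>\<bar>v - e k\<bar>\<close> is comparable to \<open>\<bar>v\<bar>\<close>.\<close>

lemma powr_le_oscillation_sum:
  fixes v :: real
  assumes s: "s > 2" and A: "A > 0" and \<beta>: "\<beta> > 0" and e: "\<And>k. \<bar>e k\<bar> \<le> A * 2 powr (real k * \<beta>)"
  shows "ennreal (\<bar>v\<bar> powr s) \<le> ennreal ((2 * A) powr (s - 2) * v\<^sup>2)
    + (\<Sum>k. ennreal ((2 * A * 2 powr (real (Suc k) * \<beta>)) powr (s - 2) * (4 * (v - e k)\<^sup>2)))"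
proof -
  have vs: "\<bar>v\<bar> powr s \<le> c powr (s - 2) * v\<^sup>2" if "\<bar>v\<bar> \<le> c" for c
  proof (cases "v = 0")
    case False
    then have "\<bar>v\<bar> powr s = \<bar>v\<bar> powr (s - 2) * v\<^sup>2"
      by (simp add: powr_diff powr_numeral)
    also have "\<dots> \<le> c powr (s - 2) * v\<^sup>2"
      using that s by (intro mult_right_mono powr_mono2) auto
    finally show ?thesis .
  qed simp
  show ?thesis
  proof (cases "\<bar>v\<bar> \<le> 2 * A")
    case True
    show ?thesis
      by (intro order_trans[OF ennreal_leI[OF vs[OF True]]] ) simp
  next
    case False
    define P where "P k \<longleftrightarrow> \<bar>v\<bar> \<le> 2 * A * 2 powr (real (Suc k) * \<beta>)" for k
    have "\<exists>k. P k"
    proof -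
      obtain k where k: "\<bar>v\<bar> / (2 * A) < (2 powr \<beta>) ^ k"
        using real_arch_pow[of "2 powr \<beta>"] \<beta> by auto
      have "(2 powr \<beta>) ^ k \<le> 2 powr (real (Suc k) * \<beta>)"
        using \<beta> by (simp add: powr_power mult.commute)
      then show ?thesis using k A unfolding P_def
        by (intro exI[of _ k]) (simp add: pos_divide_less_eq mult.commute, smt (verit) mult_left_mono)
    qed
    define k where "k = (LEAST k. P k)"
    have Pk: "P k" unfolding k_def using \<open>\<exists>k. P k\<close> by (rule LeastI_ex)
    \<comment> \<open>At level 0 this is the failure of the first case; at level j + 1 it is the
      minimality of k, since \<open>P j\<close> compares with the bound for level j + 1.\<close>
    have "2 * (A * 2 powr (real k * \<beta>)) \<le> \<bar>v\<bar>"
    proof (cases k)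
      case 0
      then show ?thesis using False by simp
    next
      case (Suc j)
      then have "\<not> P j" unfolding k_def using not_less_Least[of j P] by simp
      then show ?thesis using Suc by (simp add: P_def)
    qed
    moreover have "\<bar>v\<bar> \<le> \<bar>v - e k\<bar> + \<bar>e k\<bar>" by linarith
    ultimately have "\<bar>v\<bar> \<le> 2 * \<bar>v - e k\<bar>" using e[of k] by argo
    then have "\<bar>v\<bar>\<^sup>2 \<le> (2 * \<bar>v - e k\<bar>)\<^sup>2" by (intro power_mono) auto
    then have v2: "v\<^sup>2 \<le> 4 * (v - e k)\<^sup>2" by (simp add: power_mult_distrib)
    have "\<bar>v\<bar> powr s \<le> (2 * A * 2 powr (real (Suc k) * \<beta>)) powr (s - 2) * v\<^sup>2"
      using Pk unfolding P_def by (rule vs)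
    also have "\<dots> \<le> (2 * A * 2 powr (real (Suc k) * \<beta>)) powr (s - 2) * (4 * (v - e k)\<^sup>2)"
      by (intro mult_left_mono v2) auto
    finally have "ennreal (\<bar>v\<bar> powr s) \<le> ennreal ((2 * A * 2 powr (real (Suc k) * \<beta>)) powr (s - 2) * (4 * (v - e k)\<^sup>2))"
      by (rule ennreal_leI)
    also have "\<dots> \<le> (\<Sum>k. ennreal ((2 * A * 2 powr (real (Suc k) * \<beta>)) powr (s - 2) * (4 * (v - e k)\<^sup>2)))"
      by (rule ennreal_le_suminf[of "\<lambda>k. ennreal ((2 * A * 2 powr (real (Suc k) * \<beta>)) powr (s - 2) * (4 * (v - e k)\<^sup>2))"])
    finally show ?thesis by (simp add: add_increasing)
  qed
qed

section \<open>The embedding on the unit cube and on the whole space\<close>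

definition energy_on :: "'a::euclidean_space set \<Rightarrow> ('a \<Rightarrow> real) \<Rightarrow> ('a \<Rightarrow> 'a) \<Rightarrow> ennreal" where
  "energy_on S u g = (\<integral>\<^sup>+x. indicator S x * ennreal ((u x)\<^sup>2 + (norm (g x))\<^sup>2) \<partial>lborel)"

abbreviation unit_cube :: "'a::euclidean_space set" where "unit_cube \<equiv> cube_of 0 0"

lemma mem_unit_cube: "x \<in> unit_cube \<longleftrightarrow> (\<forall>b\<in>Basis. 0 \<le> b \<bullet> x \<and> b \<bullet> x < 1)"
proof -
  have "0 = \<lfloor>t\<rfloor> \<longleftrightarrow> 0 \<le> t \<and> t < 1" for t :: real by linarith
  then show ?thesis by (simp add: cube_of_def same_cube_def inner_commute)
qed

lemma convex_unit_cube: "convex (unit_cube :: 'a::euclidean_space set)"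
proof -
  have "unit_cube = (\<Inter>b\<in>Basis. {x::'a. 0 \<le> b \<bullet> x} \<inter> {x. b \<bullet> x < 1})"
    using mem_unit_cube by blast
  moreover have "convex \<dots>"
    by (intro convex_INT convex_Int convex_halfspace_ge convex_halfspace_lt)
  ultimately show ?thesis by simp
qed

lemma unit_cube_closed: "x \<in> unit_cube \<Longrightarrow> same_cube 0 x y \<Longrightarrow> y \<in> unit_cube"
  by (auto simp: cube_of_def same_cube_def)

text \<open>The pointwise inequality is integrated over the unit cube. Level k contributes 2^(k
  \<beta> (s - 2)) from the powers and 4^-k from the Poincare inequality, so the series converges if
  \<beta> (s - 2) < 2; for \<beta> = N/2 - 1 that is (N - 2) s < 2 N, subcriticality itself. The
  factor with h is kept apart from the energy because \<open>lions_lemma\<close> takes h once as the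
  energy of the cube itself and once as a global bound.\<close>

lemma local_sobolev:
  assumes s: "s > 2" "(real DIM('a) - 2) * s < 2 * real DIM('a)"
  obtains C where "C \<ge> 0" "\<And>(u :: 'a::euclidean_space \<Rightarrow> real) g h.
    wgrad u g \<Longrightarrow> h > 0 \<Longrightarrow> energy_on unit_cube u g \<le> ennreal h \<Longrightarrow>
    (\<integral>\<^sup>+x. indicator unit_cube x * ennreal (\<bar>u x\<bar> powr s) \<partial>lborel) \<le> ennreal (C * h powr (s / 2 - 1)) * energy_on unit_cube u g"
proof -
  define N where "N = real DIM('a)"
  \<comment> \<open>The second entry keeps \<beta> positive when N \<le> 2; multiplied by s - 2 it
    gives 1, safely below the limit 2.\<close>
  define \<beta> where "\<beta> = max (N / 2 - 1) (1 / (s - 2))"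
  have \<beta>: "\<beta> > 0" "\<beta> \<ge> real DIM('a) / 2 - 1" using s by (auto simp: \<beta>_def N_def less_max_iff_disj)
  have \<beta>s: "\<beta> * (s - 2) < 2"
  proof -
    have "(N / 2 - 1) * (s - 2) < 2" using s by (simp add: N_def algebra_simps)
    moreover have "1 / (s - 2) * (s - 2) < 2" using s by simp
    ultimately show ?thesis unfolding \<beta>_def by (metis max_def)
  qed
  \<comment> \<open>The ratio of the geometric series over the levels.\<close>
  define \<rho> where "\<rho> = 2 powr (\<beta> * (s - 2)) / 4"
  have \<rho>: "0 < \<rho>" "\<rho> < 1"
    using powr_less_mono[OF \<beta>s, of 2] by (auto simp: \<rho>_def powr_numeral)
  obtain M where M: "M \<ge> 1" "\<And>(u :: 'a \<Rightarrow> real) g S h x k.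
    wgrad u g \<Longrightarrow> S \<in> sets borel \<Longrightarrow> convex S \<Longrightarrow> (\<And>x y. x \<in> S \<Longrightarrow> same_cube 0 x y \<Longrightarrow> y \<in> S) \<Longrightarrow>
    (\<integral>\<^sup>+x. indicator S x * ennreal ((u x)\<^sup>2) \<partial>lborel) \<le> ennreal h \<Longrightarrow>
    (\<integral>\<^sup>+x. indicator S x * ennreal ((norm (g x))\<^sup>2) \<partial>lborel) \<le> ennreal h \<Longrightarrow> h \<ge> 0 \<Longrightarrow>
    x \<in> S \<Longrightarrow> \<bar>avg k u x\<bar> \<le> M * sqrt h * 2 powr (real k * \<beta>)"
    using avg_growth[OF \<beta>] by blast
  define D where "D = 2 ^ DIM('a) * N"
  \<comment> \<open>In 16 D \<rho> one factor 4 comes from the oscillation inequality and 4 \<rho>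
    from its shift to level \<open>Suc k\<close>.\<close>
  define C where "C = (2 * M) powr (s - 2) * (1 + 16 * D * \<rho> / (1 - \<rho>))"
  have D0: "D \<ge> 0" by (simp add: D_def N_def)
  show ?thesis
  proof (rule that[of C])
    show "C \<ge> 0" using \<rho> D0 by (simp add: C_def)
  next
    fix u :: "'a \<Rightarrow> real" and g h
    assume u: "wgrad u g" and h: "h > 0" and E: "energy_on unit_cube u g \<le> ennreal h"
    note [measurable] = wgradD(3,4)[OF u]
    define H where "H = energy_on unit_cube u g"
    have Hu: "(\<integral>\<^sup>+x. indicator unit_cube x * ennreal ((u x)\<^sup>2) \<partial>lborel) \<le> H"
      and Hg: "(\<integral>\<^sup>+x. indicator unit_cube x * ennreal ((norm (g x))\<^sup>2) \<partial>lborel) \<le> H"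
      unfolding H_def energy_on_def by (intro nn_integral_mono mult_left_mono ennreal_leI; simp)+
    define A where "A = M * sqrt h"
    have A: "A > 0" using M(1) h by (simp add: A_def)
    let ?c = "\<lambda>k. (2 * A * 2 powr (real (Suc k) * \<beta>)) powr (s - 2)"
    have bound: "\<bar>avg k u x\<bar> \<le> A * 2 powr (real k * \<beta>)" if "x \<in> unit_cube" for k x
      unfolding A_def using Hu Hg E h that
      by (intro M(2)[OF u cube_of_sets convex_unit_cube unit_cube_closed]) (auto simp: H_def)
    have "(\<integral>\<^sup>+x. indicator unit_cube x * ennreal (\<bar>u x\<bar> powr s) \<partial>lborel)
      \<le> (\<integral>\<^sup>+x. ennreal ((2 * A) powr (s - 2)) * (indicator unit_cube x * ennreal ((u x)\<^sup>2))
        + (\<Sum>k. ennreal (4 * ?c k) * (indicator unit_cube x * ennreal ((u x - avg k u x)\<^sup>2))) \<partial>lborel)"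
    proof (intro nn_integral_mono)
      fix x
      show "indicator unit_cube x * ennreal (\<bar>u x\<bar> powr s) \<le> ennreal ((2 * A) powr (s - 2)) * (indicator unit_cube x * ennreal ((u x)\<^sup>2))
        + (\<Sum>k. ennreal (4 * ?c k) * (indicator unit_cube x * ennreal ((u x - avg k u x)\<^sup>2)))"
      proof (cases "x \<in> unit_cube")
        case True
        have "ennreal (?c k * (4 * (u x - avg k u x)\<^sup>2)) = ennreal (4 * ?c k) * ennreal ((u x - avg k u x)\<^sup>2)" for k
          by (simp add: ennreal_mult[symmetric] mult_ac)
        moreover have "ennreal ((2 * A) powr (s - 2) * (u x)\<^sup>2) = ennreal ((2 * A) powr (s - 2)) * ennreal ((u x)\<^sup>2)"
          by (simp add: ennreal_mult)
        ultimately show ?thesis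
          using powr_le_oscillation_sum[OF s(1) A \<beta>(1) bound[OF True], of "u x"] True by simp
      qed simp
    qed
    also have "\<dots> = ennreal ((2 * A) powr (s - 2)) * (\<integral>\<^sup>+x. indicator unit_cube x * ennreal ((u x)\<^sup>2) \<partial>lborel)
        + (\<Sum>k. ennreal (4 * ?c k) * (\<integral>\<^sup>+x. indicator unit_cube x * ennreal ((u x - avg k u x)\<^sup>2) \<partial>lborel))"
      by (simp add: nn_integral_add nn_integral_cmult nn_integral_suminf)
    also have "\<dots> \<le> ennreal ((2 * A) powr (s - 2)) * H + (\<Sum>k. ennreal (4 * ?c k) * (ennreal (D * (1/4) ^ k) * H))"
      unfolding D_def N_def
      by (intro add_mono mult_left_mono Hu suminf_le allI summableI
          order_trans[OF poincare_avg[OF u cube_of_sets convex_unit_cube unit_cube_closed]] Hg) auto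
    also have "\<dots> = ennreal ((2 * A) powr (s - 2)) * H + (\<Sum>k. ennreal ((2 * A) powr (s - 2) * (16 * D * \<rho>) * \<rho> ^ k) * H)"
    proof -
      have "ennreal (4 * ?c k) * (ennreal (D * (1/4) ^ k) * H) = ennreal ((2 * A) powr (s - 2) * (16 * D * \<rho>) * \<rho> ^ k) * H" for k
      proof -
        have "?c k = (2 * A) powr (s - 2) * 2 powr (real (Suc k) * (\<beta> * (s - 2)))"
          using A by (simp add: powr_mult powr_powr mult.assoc)
        also have "2 powr (real (Suc k) * (\<beta> * (s - 2))) = (4 * \<rho>) powr real (Suc k)"
          by (simp add: \<rho>_def powr_powr mult.commute)
        also have "\<dots> = (4 * \<rho>) ^ Suc k"
          using \<rho> by (intro powr_realpow) simp
        finally have "4 * ?c k * (D * (1/4) ^ k) = (2 * A) powr (s - 2) * (16 * D * \<rho>) * \<rho> ^ k"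
          by (simp add: power_mult_distrib power_one_over field_simps)
        moreover have "ennreal (4 * ?c k) * (ennreal (D * (1/4) ^ k) * H) = ennreal (4 * ?c k * (D * (1/4) ^ k)) * H"
          by (subst ennreal_mult) (auto simp: D0 mult.assoc)
        ultimately show ?thesis by (simp only:)
      qed
      then show ?thesis by simp
    qed
    also have "\<dots> = (ennreal ((2 * A) powr (s - 2)) + (\<Sum>k. ennreal ((2 * A) powr (s - 2) * (16 * D * \<rho>) * \<rho> ^ k))) * H"
      by (simp add: distrib_right)
    also have "(\<Sum>k. ennreal ((2 * A) powr (s - 2) * (16 * D * \<rho>) * \<rho> ^ k)) = ennreal ((2 * A) powr (s - 2) * (16 * D * \<rho>) * (1 / (1 - \<rho>)))"
      using \<rho> D0 geometric_sums[of \<rho>] by (intro suminf_ennreal_eq sums_mult) auto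
    also have "ennreal ((2 * A) powr (s - 2)) + \<dots> = ennreal ((2 * A) powr (s - 2) * (1 + 16 * D * \<rho> / (1 - \<rho>)))"
      using \<rho> D0 by (simp add: ennreal_plus[symmetric] distrib_left del: ennreal_plus)
    also have "(2 * A) powr (s - 2) = (2 * M) powr (s - 2) * h powr (s / 2 - 1)"
    proof -
      have "(2 * A) powr (s - 2) = (2 * M) powr (s - 2) * (sqrt h) powr (s - 2)"
        using M(1) h by (simp add: A_def powr_mult[symmetric] mult.assoc)
      also have "(sqrt h) powr (s - 2) = h powr (s / 2 - 1)"
        using h by (simp add: powr_half_sqrt[symmetric] powr_powr diff_divide_distrib)
      finally show ?thesis .
    qed
    finally show "(\<integral>\<^sup>+x. indicator unit_cube x * ennreal (\<bar>u x\<bar> powr s) \<partial>lborel) \<le> ennreal (C * h powr (s / 2 - 1)) * energy_on unit_cube u g"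
      by (simp add: C_def H_def mult_ac)
  qed
qed

text \<open>An integral over all translates stands in for the tiling of the space by lattice cubes:
  by Tonelli each point is counted with the volume 1 of the unit cube.\<close>

lemma nn_integral_unit_cube_average:
  fixes F :: "'a::euclidean_space \<Rightarrow> ennreal"
  assumes [measurable]: "F \<in> borel_measurable borel"
  shows "(\<integral>\<^sup>+c. \<integral>\<^sup>+x. indicator unit_cube x * F (x + c) \<partial>lborel \<partial>lborel) = (\<integral>\<^sup>+x. F x \<partial>lborel)"
proof -
  have "(\<integral>\<^sup>+c. \<integral>\<^sup>+x. indicator unit_cube x * F (x + c) \<partial>lborel \<partial>lborel)
    = (\<integral>\<^sup>+x. \<integral>\<^sup>+c. indicator unit_cube x * F (x + c) \<partial>lborel \<partial>lborel)"
    by (rule lborel_pair.Fubini') measurable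
  also have "\<dots> = (\<integral>\<^sup>+x. indicator (unit_cube :: 'a set) x * (\<integral>\<^sup>+c. F c \<partial>lborel) \<partial>lborel)"
    using nn_integral_translate[of F] by (simp add: nn_integral_cmult add.commute)
  also have "\<dots> = emeasure lborel (unit_cube :: 'a set) * (\<integral>\<^sup>+c. F c \<partial>lborel)"
    by (subst nn_integral_multc) auto
  finally show ?thesis by (simp add: emeasure_cube_of)
qed

text \<open>The square of the norm.\<close>

definition hnorm :: "('a::euclidean_space \<Rightarrow> real) \<Rightarrow> ('a \<Rightarrow> 'a) \<Rightarrow> real" where
  "hnorm u g = (\<integral>x. (u x)\<^sup>2 + (norm (g x))\<^sup>2 \<partial>lborel)"

lemma hnorm_integrable: "wgrad u g \<Longrightarrow> integrable lborel (\<lambda>x. (u x)\<^sup>2 + (norm (g x))\<^sup>2)"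
  using wgradD(1,2)[of u g] by (auto simp: L2_def)

lemma hnorm_nonneg: "hnorm u g \<ge> 0"
  by (simp add: hnorm_def)

lemma energy_on_UNIV: "wgrad u g \<Longrightarrow> energy_on UNIV u g = ennreal (hnorm u g)"
  unfolding energy_on_def hnorm_def
  by (subst nn_integral_eq_integral[symmetric]) (auto simp: hnorm_integrable)

lemma energy_on_cube_le: "wgrad u g \<Longrightarrow> energy_on S u g \<le> ennreal (hnorm u g)"
  unfolding energy_on_UNIV[symmetric] unfolding energy_on_def
  by (intro nn_integral_mono mult_right_mono) (auto split: split_indicator)

lemma hnorm_translate: "wgrad u g \<Longrightarrow> hnorm (\<lambda>x. u (x + c)) (\<lambda>x. g (x + c)) = hnorm u g"
  using integral_translate[of "\<lambda>x. (u x)\<^sup>2 + (norm (g x))\<^sup>2" c] wgradD(3,4)[of u g]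
  by (simp add: hnorm_def)

lemma energy_on_average:
  assumes u: "wgrad u g"
  shows "(\<integral>\<^sup>+c. energy_on unit_cube (\<lambda>x. u (x + c)) (\<lambda>x. g (x + c)) \<partial>lborel) = ennreal (hnorm u g)"
proof -
  note [measurable] = wgradD(3,4)[OF u]
  show ?thesis
    unfolding energy_on_UNIV[OF u, symmetric]
    using nn_integral_unit_cube_average[of "\<lambda>x. ennreal ((u x)\<^sup>2 + (norm (g x))\<^sup>2)"]
    by (simp add: energy_on_def)
qed

text \<open>The local embedding reads \<open>m \<le> C * E powr (s / 2)\<close> for the \<open>L\<^sup>s\<close> mass \<open>m\<close> and the energy \<open>E\<close> of a
  cube. Keeping \<open>m powr (2 / s)\<close> and bounding the other factor \<open>m powr (1 - 2 / s)\<close> by \<open>\<eta>\<close> makes the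
  estimate linear in \<open>E\<close>, hence summable over all cubes.\<close>

lemma lions_lemma:
  assumes s: "s > 2" "(real DIM('a) - 2) * s < 2 * real DIM('a)"
  obtains C where "C > 0" "\<And>(u :: 'a::euclidean_space \<Rightarrow> real) g \<eta>.
    wgrad u g \<Longrightarrow> \<eta> > 0 \<Longrightarrow> (\<And>c. (\<integral>\<^sup>+x. indicator unit_cube x * ennreal (\<bar>u (x + c)\<bar> powr s) \<partial>lborel) \<le> ennreal \<eta>) \<Longrightarrow>
    (\<integral>\<^sup>+x. ennreal (\<bar>u x\<bar> powr s) \<partial>lborel) \<le> ennreal (C * \<eta> powr (1 - 2 / s) * hnorm u g)"
    "\<And>(u :: 'a::euclidean_space \<Rightarrow> real) g h.
    wgrad u g \<Longrightarrow> hnorm u g \<le> h \<Longrightarrow> h > 0 \<Longrightarrow> (\<integral>\<^sup>+x. ennreal (\<bar>u x\<bar> powr s) \<partial>lborel) \<le> ennreal (C * h powr (s / 2))"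
proof -
  obtain C where C: "C \<ge> 0" and loc: "\<And>(u :: 'a \<Rightarrow> real) g h. 
    wgrad u g \<Longrightarrow> h > 0 \<Longrightarrow> energy_on unit_cube u g \<le> ennreal h \<Longrightarrow>
    (\<integral>\<^sup>+x. indicator unit_cube x * ennreal (\<bar>u x\<bar> powr s) \<partial>lborel) \<le> ennreal (C * h powr (s / 2 - 1)) * energy_on unit_cube u g"
    using local_sobolev[OF s] by blast
  define m where "m u c = (\<integral>\<^sup>+x. indicator unit_cube x * ennreal (\<bar>u (x + c)\<bar> powr s) \<partial>lborel)" for u :: "'a \<Rightarrow> real" and c
  define E where "E u g c = energy_on unit_cube (\<lambda>x. u (x + c)) (\<lambda>x. g (x + c))" for u :: "'a \<Rightarrow> real" and g c
  have Em [measurable]: "E u g \<in> borel_measurable borel" if u: "wgrad u g" for u g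
  proof -
    note [measurable] = wgradD(3,4)[OF u]
    show ?thesis unfolding E_def[abs_def] energy_on_def by measurable
  qed
  have avg_E: "(\<integral>\<^sup>+c. E u g c \<partial>lborel) = ennreal (hnorm u g)" if "wgrad u g" for u g
    unfolding E_def by (rule energy_on_average[OF that])
  have avg_m: "(\<integral>\<^sup>+c. m u c \<partial>lborel) = (\<integral>\<^sup>+x. ennreal (\<bar>u x\<bar> powr s) \<partial>lborel)" if "wgrad u g" for u g
    unfolding m_def using wgradD(3)[OF that] by (intro nn_integral_unit_cube_average) measurable
  have loc': "m u c \<le> ennreal (C * h powr (s / 2 - 1)) * E u g c"
    if "wgrad u g" "h > 0" "E u g c \<le> ennreal h" for u g h c
    using loc[OF wgrad_translate[OF that(1)] that(2), of c] that(3) by (simp add: m_def E_def)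
  show ?thesis
  \<comment> \<open>Large enough for both estimates; the entry 1 makes it positive, as C may be
    0.\<close>
  proof (rule that[of "max 1 (max C (C powr (2 / s)))"])
    fix u :: "'a \<Rightarrow> real" and g \<eta>
    assume u: "wgrad u g" and \<eta>: "\<eta> > 0"
      and "\<And>c. (\<integral>\<^sup>+x. indicator unit_cube x * ennreal (\<bar>u (x + c)\<bar> powr s) \<partial>lborel) \<le> ennreal \<eta>"
    then have m\<eta>: "m u c \<le> ennreal \<eta>" for c by (simp add: m_def)
    have "m u c \<le> ennreal (C powr (2 / s) * \<eta> powr (1 - 2 / s)) * E u g c" for c
    proof -
      have "E u g c \<le> ennreal (hnorm u g)"
        unfolding E_def using energy_on_cube_le[OF wgrad_translate[OF u]] hnorm_translate[OF u] by simp
      then obtain e where e: "E u g c = ennreal e" "e \<ge> 0"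
        by (metis ennreal_cases ennreal_less_top infinity_ennreal_def leD)
      obtain a where a: "m u c = ennreal a" "a \<ge> 0" "a \<le> \<eta>"
        using m\<eta>[of c] \<eta> by (metis ennreal_cases ennreal_le_iff ennreal_less_top infinity_ennreal_def leD less_imp_le)
      show ?thesis
      proof (cases "a = 0")
        case True
        then show ?thesis using a by simp
      next
        case False
        then have "a > 0" using a by simp
        \<comment> \<open>With zero energy the local estimate, used with h = 1, would force zero
          mass.\<close>
        have "e > 0"
        proof (rule ccontr)
          assume "\<not> e > 0"
          then show False using loc'[OF u, of 1 c] e a \<open>a > 0\<close> by simp
        qed
        \<comment> \<open>The local estimate is used with h equal to the energy of this very
          cube.\<close>
        then have "m u c \<le> ennreal (C * e powr (s / 2 - 1) * e)"
          using loc'[OF u, of e c] e C by (simp add: ennreal_mult)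
        also have "e powr (s / 2 - 1) * e = e powr (s / 2)"
          using \<open>e > 0\<close> by (simp add: powr_diff)
        then have "C * e powr (s / 2 - 1) * e = C * e powr (s / 2)" by (simp add: mult.assoc)
        finally have "a \<le> C * e powr (s / 2)" using a C by simp
        then have "a powr (2 / s) \<le> (C * e powr (s / 2)) powr (2 / s)"
          using \<open>a > 0\<close> s by (intro powr_mono2) auto
        also have "\<dots> = C powr (2 / s) * e"
          using C \<open>e > 0\<close> s by (simp add: powr_mult powr_powr)
        finally have "a powr (1 - 2 / s) * a powr (2 / s) \<le> \<eta> powr (1 - 2 / s) * (C powr (2 / s) * e)"
          using a s \<open>a > 0\<close> by (intro mult_mono powr_mono2) auto
        moreover have "a powr (1 - 2 / s) * a powr (2 / s) = a"
          using \<open>a > 0\<close> by (simp flip: powr_add)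
        ultimately show ?thesis using a e
          by (simp add: ennreal_mult[symmetric] mult_ac)
      qed
    qed
    then have "(\<integral>\<^sup>+c. m u c \<partial>lborel) \<le> (\<integral>\<^sup>+c. ennreal (C powr (2 / s) * \<eta> powr (1 - 2 / s)) * E u g c \<partial>lborel)"
      by (intro nn_integral_mono)
    also have "\<dots> = ennreal (C powr (2 / s) * \<eta> powr (1 - 2 / s) * hnorm u g)"
      using avg_E[OF u] Em[OF u] by (simp add: nn_integral_cmult ennreal_mult hnorm_nonneg)
    also have "\<dots> \<le> ennreal (max 1 (max C (C powr (2 / s))) * \<eta> powr (1 - 2 / s) * hnorm u g)"
      by (intro ennreal_leI mult_right_mono hnorm_nonneg) auto
    finally show "(\<integral>\<^sup>+x. ennreal (\<bar>u x\<bar> powr s) \<partial>lborel) \<le> \<dots>"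
      by (simp add: avg_m[OF u])
  next
    fix u :: "'a \<Rightarrow> real" and g h
    assume u: "wgrad u g" and h: "hnorm u g \<le> h" "h > 0"
    have "m u c \<le> ennreal (C * h powr (s / 2 - 1)) * E u g c" for c
    proof (rule loc'[OF u h(2)])
      have "E u g c \<le> ennreal (hnorm u g)"
        unfolding E_def using energy_on_cube_le[OF wgrad_translate[OF u]] hnorm_translate[OF u] by simp
      also have "\<dots> \<le> ennreal h" by (intro ennreal_leI h)
      finally show "E u g c \<le> ennreal h" .
    qed
    then have "(\<integral>\<^sup>+c. m u c \<partial>lborel) \<le> (\<integral>\<^sup>+c. ennreal (C * h powr (s / 2 - 1)) * E u g c \<partial>lborel)"
      by (intro nn_integral_mono)
    also have "\<dots> = ennreal (C * h powr (s / 2 - 1) * hnorm u g)"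
      using avg_E[OF u] Em[OF u] C by (simp add: nn_integral_cmult ennreal_mult hnorm_nonneg)
    also have "\<dots> \<le> ennreal (max 1 (max C (C powr (2 / s))) * h powr (s / 2))"
    proof (intro ennreal_leI)
      have "C * h powr (s / 2 - 1) * hnorm u g \<le> max 1 (max C (C powr (2 / s))) * h powr (s / 2 - 1) * h"
        using h C by (intro mult_mono hnorm_nonneg) auto
      also have "h powr (s / 2 - 1) * h = h powr (s / 2)"
        using h by (simp add: powr_diff)
      then have "max 1 (max C (C powr (2 / s))) * h powr (s / 2 - 1) * h = max 1 (max C (C powr (2 / s))) * h powr (s / 2)"
        by (simp add: mult.assoc)
      finally show "C * h powr (s / 2 - 1) * hnorm u g \<le> max 1 (max C (C powr (2 / s))) * h powr (s / 2)" .
    qed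
    finally show "(\<integral>\<^sup>+x. ennreal (\<bar>u x\<bar> powr s) \<partial>lborel) \<le> ennreal (max 1 (max C (C powr (2 / s))) * h powr (s / 2))"
      by (simp add: avg_m[OF u])
  qed auto
qed

section \<open>Weak compactness\<close>

definition hinner :: "('a::euclidean_space \<Rightarrow> real) \<Rightarrow> ('a \<Rightarrow> 'a) \<Rightarrow> ('a \<Rightarrow> real) \<Rightarrow> ('a \<Rightarrow> 'a) \<Rightarrow> real" where
  "hinner u g v h = (\<integral>x. u x * v x + g x \<bullet> h x \<partial>lborel)"

text \<open>A function and its weak gradient become one square integrable map into a product space,
  with inner product \<open>hinner\<close>. The Hilbert space arguments are then made for the pair
  as a whole.\<close>

lemma pair_L2:
  assumes "u \<in> L2 M" "g \<in> L2 M" shows "(\<lambda>x. (u x, g x)) \<in> L2 M"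
  using assms by (auto simp: L2_def norm_Pair intro: borel_measurable_Pair)

lemma fst_L2:
  fixes V :: "'x \<Rightarrow> 'b::euclidean_space \<times> 'c::euclidean_space"
  assumes "V \<in> L2 M" shows "(\<lambda>x. fst (V x)) \<in> L2 M"
proof -
  have V [measurable]: "V \<in> borel_measurable M" using assms by (simp add: L2_def)
  have [measurable]: "(\<lambda>x. fst (V x)) \<in> borel_measurable M"
    by (rule measurable_compose[OF V borel_measurable_continuous_onI[OF continuous_on_fst[OF continuous_on_id]]])
  have "integrable M (\<lambda>x. (norm (fst (V x)))\<^sup>2)"
  proof (rule Bochner_Integration.integrable_bound[OF L2_norm_integrable[OF assms]])
    have "(norm (fst (V x)))\<^sup>2 \<le> (norm (V x))\<^sup>2" for x
      using norm_fst_le[of "fst (V x)" "snd (V x)"] by (intro power_mono) simp_all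
    then show "AE x in M. norm ((norm (fst (V x)))\<^sup>2) \<le> norm ((norm (V x))\<^sup>2)" by simp
  qed simp
  then show ?thesis by (simp add: L2_def)
qed

lemma snd_L2:
  fixes V :: "'x \<Rightarrow> 'b::euclidean_space \<times> 'c::euclidean_space"
  assumes "V \<in> L2 M" shows "(\<lambda>x. snd (V x)) \<in> L2 M"
proof -
  have V [measurable]: "V \<in> borel_measurable M" using assms by (simp add: L2_def)
  have [measurable]: "(\<lambda>x. snd (V x)) \<in> borel_measurable M"
    by (rule measurable_compose[OF V borel_measurable_continuous_onI[OF continuous_on_snd[OF continuous_on_id]]])
  have "integrable M (\<lambda>x. (norm (snd (V x)))\<^sup>2)"
  proof (rule Bochner_Integration.integrable_bound[OF L2_norm_integrable[OF assms]])
    have "(norm (snd (V x)))\<^sup>2 \<le> (norm (V x))\<^sup>2" for x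
      using norm_snd_le[of "snd (V x)" "fst (V x)"] by (intro power_mono) simp_all
    then show "AE x in M. norm ((norm (snd (V x)))\<^sup>2) \<le> norm ((norm (V x))\<^sup>2)" by simp
  qed simp
  then show ?thesis by (simp add: L2_def)
qed

lemma wgrad_unique:
  assumes u: "wgrad u g" and v: "wgrad v h" and eq: "AE x in lborel. u x = v x"
  shows "AE x in lborel. g x = h x"
proof -
  have gh: "(\<lambda>x. g x - h x) \<in> L2 lborel" using u v by (intro L2_diff wgradD)
  have "AE x in lborel. g x - h x = 0"
  proof (rule AE_zero_if_test_integrals_zero)
    fix a b :: 'a
    have "(indicator (box a b) :: 'a \<Rightarrow> real) \<in> L2 lborel"
      using emeasure_lborel_box_finite[of a b] by (intro indicator_L2) (simp_all add: less_top)
    then show "integrable lborel (\<lambda>x. indicator (box a b) x *\<^sub>R (g x - h x))"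
      using gh by (rule L2_mult)
  next
    fix \<phi> :: "'a \<Rightarrow> real" assume \<phi>: "\<phi> \<in> test_functions"
    note [measurable] = wgradD(3)[OF u] wgradD(3)[OF v] gradient_measurable[OF \<phi>]
    have i: "integrable lborel (\<lambda>x. \<phi> x *\<^sub>R g x)" "integrable lborel (\<lambda>x. \<phi> x *\<^sub>R h x)"
      by (intro L2_mult test_L2 \<phi> wgradD[OF u] wgradD[OF v])+
    have "(\<integral>x. \<phi> x *\<^sub>R (g x - h x) \<partial>lborel) = (\<integral>x. \<phi> x *\<^sub>R g x \<partial>lborel) - (\<integral>x. \<phi> x *\<^sub>R h x \<partial>lborel)"
      using i by (simp add: scaleR_diff_right)
    also have "\<dots> = - (\<integral>x. u x *\<^sub>R gradient \<phi> x \<partial>lborel) + (\<integral>x. v x *\<^sub>R gradient \<phi> x \<partial>lborel)"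
      by (simp add: wgradD(5)[OF u \<phi>] wgradD(5)[OF v \<phi>])
    also have "(\<integral>x. v x *\<^sub>R gradient \<phi> x \<partial>lborel) = (\<integral>x. u x *\<^sub>R gradient \<phi> x \<partial>lborel)"
      using eq by (intro integral_cong_AE) (measurable, auto elim: eventually_mono)
    finally show "(\<integral>x. \<phi> x *\<^sub>R (g x - h x) \<partial>lborel) = 0" by simp
  qed (use gh in \<open>simp add: L2_def\<close>)
  then show ?thesis by simp
qed

lemma L2_inner_tendsto:
  assumes W: "\<And>m. W m \<in> L2 M" and V: "V \<in> L2 M" and F: "F \<in> L2 M"
    and lim: "(\<lambda>m. \<integral>x. (norm (W m x - V x))\<^sup>2 \<partial>M) \<longlonglongrightarrow> 0"
  shows "(\<lambda>m. \<integral>x. W m x \<bullet> F x \<partial>M) \<longlonglongrightarrow> (\<integral>x. V x \<bullet> F x \<partial>M)"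
proof -
  have "(\<lambda>m. (\<integral>x. (W m x - V x) \<bullet> F x \<partial>M)\<^sup>2) \<longlonglongrightarrow> 0"
  proof (rule tendsto_sandwich[OF _ _ tendsto_const])
    show "\<forall>\<^sub>F m in sequentially. (\<integral>x. (W m x - V x) \<bullet> F x \<partial>M)\<^sup>2
      \<le> (\<integral>x. (norm (W m x - V x))\<^sup>2 \<partial>M) * (\<integral>x. (norm (F x))\<^sup>2 \<partial>M)"
      by (intro always_eventually allI L2_Cauchy_Schwarz L2_diff W V F)
    show "(\<lambda>m. (\<integral>x. (norm (W m x - V x))\<^sup>2 \<partial>M) * (\<integral>x. (norm (F x))\<^sup>2 \<partial>M)) \<longlonglongrightarrow> 0"
      using tendsto_mult[OF lim tendsto_const] by simp
  qed simp
  then have "(\<lambda>m. \<integral>x. (W m x - V x) \<bullet> F x \<partial>M) \<longlonglongrightarrow> 0"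
    using tendsto_real_sqrt[of _ 0] by (fastforce simp: tendsto_rabs_zero_iff)
  moreover have "(\<integral>x. (W m x - V x) \<bullet> F x \<partial>M) = (\<integral>x. W m x \<bullet> F x \<partial>M) - (\<integral>x. V x \<bullet> F x \<partial>M)" for m
    using L2_inner[OF W F] L2_inner[OF V F] by (simp add: inner_diff_left)
  ultimately show ?thesis by (simp add: LIM_zero_iff)
qed

text \<open>The diagonal selection in \<open>rellich\<close> runs over all cubes of all levels. A
  cube is determined by one integer for each coordinate.\<close>

lemma countable_dyadic_cubes: "countable (range (cube_of k :: 'a::euclidean_space \<Rightarrow> 'a set))"
proof (rule countable_subset)
  let ?P = "\<Pi>\<^sub>E b\<in>(Basis :: 'a set). (UNIV :: int set)"
  show "range (cube_of k) \<subseteq> (\<lambda>F. {y. \<forall>b\<in>Basis. F b = \<lfloor>2 ^ k * (y \<bullet> b)\<rfloor>}) ` ?P"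
  proof
    fix C :: "'a set" assume "C \<in> range (cube_of k)"
    then obtain x where C: "C = cube_of k x" by auto
    show "C \<in> (\<lambda>F. {y. \<forall>b\<in>Basis. F b = \<lfloor>2 ^ k * (y \<bullet> b)\<rfloor>}) ` ?P"
      by (rule image_eqI[where x = "restrict (\<lambda>b. \<lfloor>2 ^ k * (x \<bullet> b)\<rfloor>) Basis"])
         (auto simp: C cube_of_def same_cube_def)
  qed
  show "countable ((\<lambda>F. {y. \<forall>b\<in>Basis. F b = \<lfloor>2 ^ k * (y \<bullet> b)\<rfloor>}) ` ?P)"
    by (intro countable_image countable_PiE) auto
qed

lemma avg_bound:
  fixes u :: "'a::euclidean_space \<Rightarrow> real"
  assumes u: "wgrad u g" and B: "hnorm u g \<le> B"
  shows "\<bar>avg k u x\<bar> \<le> sqrt (2 ^ (k * DIM('a)) * B)"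
proof -
  have B0: "B \<ge> 0" using B hnorm_nonneg[of u g] by linarith
  have "ennreal ((avg k u x)\<^sup>2) \<le> ennreal (2 ^ (k * DIM('a))) * (\<integral>\<^sup>+y. indicator UNIV y * ennreal ((u y)\<^sup>2) \<partial>lborel)"
    using wgradD(3)[OF u] by (intro avg_sq_le) auto
  also have "\<dots> \<le> ennreal (2 ^ (k * DIM('a))) * energy_on UNIV u g"
    unfolding energy_on_def by (intro mult_left_mono nn_integral_mono ennreal_leI) auto
  also have "\<dots> \<le> ennreal (2 ^ (k * DIM('a))) * ennreal B"
    unfolding energy_on_UNIV[OF u] by (intro mult_left_mono ennreal_leI B) auto
  also have "\<dots> = ennreal (2 ^ (k * DIM('a)) * B)" using B0 by (simp add: ennreal_mult)
  finally have "(avg k u x)\<^sup>2 \<le> 2 ^ (k * DIM('a)) * B" using B0 by simp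
  then show ?thesis by (metis real_sqrt_abs real_sqrt_le_iff)
qed

lemma diff_avg_L2:
  fixes u :: "'a::euclidean_space \<Rightarrow> real"
  assumes u: "wgrad u g" and B: "hnorm u g \<le> B"
  shows "(\<lambda>x. u x - avg k u x) \<in> L2 lborel"
    "(\<integral>x. (norm (u x - avg k u x))\<^sup>2 \<partial>lborel) \<le> 2 ^ DIM('a) * real DIM('a) * (1/4) ^ k * B"
proof -
  note [measurable] = wgradD(3)[OF u]
  have B0: "B \<ge> 0" using B hnorm_nonneg[of u g] by linarith
  have "(\<integral>\<^sup>+x. ennreal ((norm (u x - avg k u x))\<^sup>2) \<partial>lborel)
     = (\<integral>\<^sup>+x. indicator UNIV x * ennreal ((u x - avg k u x)\<^sup>2) \<partial>lborel)" by simp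
  also have "\<dots> \<le> ennreal (2 ^ DIM('a) * real DIM('a) * (1/4) ^ k) * (\<integral>\<^sup>+x. indicator UNIV x * ennreal ((norm (g x))\<^sup>2) \<partial>lborel)"
    by (intro poincare_avg[OF u]) auto
  also have "\<dots> \<le> ennreal (2 ^ DIM('a) * real DIM('a) * (1/4) ^ k) * energy_on UNIV u g"
    unfolding energy_on_def by (intro mult_left_mono nn_integral_mono ennreal_leI) auto
  also have "\<dots> \<le> ennreal (2 ^ DIM('a) * real DIM('a) * (1/4) ^ k) * ennreal B"
    unfolding energy_on_UNIV[OF u] by (intro mult_left_mono ennreal_leI B) auto
  also have "\<dots> = ennreal (2 ^ DIM('a) * real DIM('a) * (1/4) ^ k * B)" using B0 by (simp add: ennreal_mult)
  finally have le: "(\<integral>\<^sup>+x. ennreal ((norm (u x - avg k u x))\<^sup>2) \<partial>lborel) \<le> ennreal (2 ^ DIM('a) * real DIM('a) * (1/4) ^ k * B)" .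
  then have int: "integrable lborel (\<lambda>x. (norm (u x - avg k u x))\<^sup>2)"
    by (intro integrableI_bounded) (auto intro: order_le_less_trans)
  then show "(\<lambda>x. u x - avg k u x) \<in> L2 lborel" by (simp add: L2_def)
  show "(\<integral>x. (norm (u x - avg k u x))\<^sup>2 \<partial>lborel) \<le> 2 ^ DIM('a) * real DIM('a) * (1/4) ^ k * B"
    using le B0 unfolding nn_integral_eq_integral[OF int AE_I2[OF zero_le_power2]] by simp
qed

text \<open>With this density the space has finite measure and the same null sets, and the Lebesgue
  L2 norm dominates the weighted one. Convergence in the weighted space plays the part of
  convergence on bounded sets.\<close>

lemma finite_weight:
  obtains w :: "'a::euclidean_space \<Rightarrow> real" where "w \<in> borel_measurable borel" "\<And>x. 0 < w x" "\<And>x. w x \<le> 1" "integrable lborel w"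
proof -
  obtain h where h: "h \<in> borel_measurable (lborel :: 'a measure)" "integral\<^sup>N lborel h \<noteq> \<infinity>" "\<And>x. 0 < h x" "\<And>x. h x < \<infinity>"
    using sigma_finite_measure.Ex_finite_integrable_function[OF sigma_finite_lborel] by (auto simp: less_top)
  define w where "w x = min 1 (enn2real (h x))" for x
  have [measurable]: "h \<in> borel_measurable borel" using h(1) by simp
  have w: "w \<in> borel_measurable borel" unfolding w_def[abs_def] by measurable
  have "ennreal (w x) \<le> h x" for x
    using h(4)[of x] by (simp add: w_def min_def ennreal_enn2real_if ennreal_leI split: if_splits)
      (metis ennreal_enn2real ennreal_leI ennreal_1 nle_le less_top)
  then have "(\<integral>\<^sup>+x. ennreal (w x) \<partial>lborel) \<le> integral\<^sup>N lborel h" by (intro nn_integral_mono)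
  also have "\<dots> < \<infinity>" using h(2) by (simp add: less_top)
  finally have "integrable lborel w" using w
    by (intro integrableI_nonneg) (auto simp: w_def)
  moreover have "0 < w x" for x
    using h(3,4)[of x] by (simp add: w_def enn2real_positive_iff less_top)
  ultimately show ?thesis using that[of w] w by (simp add: w_def)
qed

text \<open>Each u n splits into dyadic averages and oscillations. At each level the averages are
  bounded and take one value per cube, so a diagonal subsequence converges on all cubes of all
  levels, and then in L2 of the finite measure M by dominated convergence. The oscillations are
  uniformly small for large k by the Poincare inequality, so the subsequence is Cauchy.\<close>

lemma rellich:
  fixes u :: "nat \<Rightarrow> 'a::euclidean_space \<Rightarrow> real"
  assumes u: "\<And>n. wgrad (u n) (g n)" and B: "\<And>n. hnorm (u n) (g n) \<le> B"
  obtains M :: "'a measure" and v r where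
    "\<And>f :: 'a \<Rightarrow> real. f \<in> L2 lborel \<Longrightarrow> f \<in> L2 M"
    "\<And>f :: 'a \<Rightarrow> real. f \<in> L2 lborel \<Longrightarrow> (\<integral>x. (norm (f x))\<^sup>2 \<partial>M) \<le> (\<integral>x. (norm (f x))\<^sup>2 \<partial>lborel)"
    "\<And>P. (AE x in M. P x) \<longleftrightarrow> (AE x in lborel. P x)"
    "v \<in> L2 M" "strict_mono (r :: nat \<Rightarrow> nat)" "(\<lambda>n. \<integral>x. (norm (u (r n) x - v x))\<^sup>2 \<partial>M) \<longlonglongrightarrow> 0"
    "AE x in lborel. (\<lambda>n. u (r n) x) \<longlonglongrightarrow> v x"
proof -
  obtain w :: "'a \<Rightarrow> real" where w [measurable]: "w \<in> borel_measurable borel" and w01: "\<And>x. 0 < w x" "\<And>x. w x \<le> 1"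
    and w_int: "integrable lborel w" using finite_weight by blast
  have w0: "0 \<le> w x" for x using w01(1)[of x] by simp
  define M where "M = density lborel w"
  have sets_M [measurable_cong]: "sets M = sets borel" by (simp add: M_def)
  have M_L2: "f \<in> L2 M" and M_le: "(\<integral>x. (norm (f x))\<^sup>2 \<partial>M) \<le> (\<integral>x. (norm (f x))\<^sup>2 \<partial>lborel)"
    if f: "f \<in> L2 lborel" for f :: "'a \<Rightarrow> real"
  proof -
    have [measurable]: "f \<in> borel_measurable borel" using f by (simp add: L2_def)
    have i: "integrable lborel (\<lambda>x. w x *\<^sub>R (norm (f x))\<^sup>2)"
      by (rule Bochner_Integration.integrable_bound[OF L2_norm_integrable[OF f]])
         (use w0 w01(2) in \<open>auto intro!: mult_left_le_one_le\<close>)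
    then show "f \<in> L2 M"
      by (simp add: L2_def M_def integrable_density w0 measurable_cong_sets[OF sets_density])
    have "(\<integral>x. (norm (f x))\<^sup>2 \<partial>M) = (\<integral>x. w x *\<^sub>R (norm (f x))\<^sup>2 \<partial>lborel)"
      unfolding M_def by (rule integral_density) (auto simp: w0)
    also have "\<dots> \<le> (\<integral>x. (norm (f x))\<^sup>2 \<partial>lborel)"
      using i L2_norm_integrable[OF f] by (intro integral_mono) (auto intro!: mult_left_le_one_le w0 w01(2))
    finally show "(\<integral>x. (norm (f x))\<^sup>2 \<partial>M) \<le> (\<integral>x. (norm (f x))\<^sup>2 \<partial>lborel)" .
  qed
  have M_AE: "(AE x in M. P x) \<longleftrightarrow> (AE x in lborel. P x)" for P
    unfolding M_def by (subst AE_density) (auto simp: w01)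
  have M_fin: "integrable M (\<lambda>x. c :: real)" for c
    unfolding M_def by (subst integrable_density) (auto simp: w0 w_int)
  define J where "J = (SIGMA k:(UNIV :: nat set). range (cube_of k :: 'a \<Rightarrow> 'a set))"
  have J: "countable J" unfolding J_def by (intro countable_SIGMA countable_dyadic_cubes) auto
  \<comment> \<open>The averages are divided by their bounds, which depend on the level, because the
    diagonal selection needs one common bound, here 1. The summand 1 keeps the divisor positive when
    B = 0.\<close>
  define f where "f n p = (case p of (k, C) \<Rightarrow> (2 ^ (k * DIM('a)) * (\<integral>y. indicator C y *\<^sub>R u n y \<partial>lborel)) / (sqrt (2 ^ (k * DIM('a)) * B) + 1))" for n and p :: "nat \<times> 'a set"
  have B0: "B \<ge> 0" using B[of 0] hnorm_nonneg[of "u 0" "g 0"] by linarith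
  have f_avg: "f n (k, cube_of k x) = avg k (u n) x / (sqrt (2 ^ (k * DIM('a)) * B) + 1)" for n k x
    by (simp add: f_def avg_def)
  have pos: "sqrt (2 ^ (k * DIM('a)) * B) + 1 > 0" for k
    using B0 by (smt (verit) real_sqrt_ge_zero zero_le_mult_iff zero_le_power)
  have "norm (f n p) \<le> 1" if "p \<in> J" for n p
  proof -
    obtain k C where kC: "p = (k, C)" by (cases p)
    with that have "C \<in> range (cube_of k)" by (simp add: J_def)
    then obtain x where p: "p = (k, cube_of k x)" using kC by blast
    show ?thesis
      unfolding p f_avg using avg_bound[OF u B, of k n x] pos[of k] by (simp add: abs_div pos_divide_le_eq)
  qed
  then obtain q :: "nat \<Rightarrow> nat" where q: "strict_mono q" and qf: "\<And>p. p \<in> J \<Longrightarrow> \<exists>l. (\<lambda>n. f (q n) p) \<longlonglongrightarrow> l"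
    using function_convergent_subsequence[OF J, of f 1] by blast
  have "\<exists>l. (\<lambda>n. avg k (u (q n)) x) \<longlonglongrightarrow> l" for k x
  proof -
    obtain l where "(\<lambda>n. f (q n) (k, cube_of k x)) \<longlonglongrightarrow> l"
      using qf[of "(k, cube_of k x)"] by (auto simp: J_def)
    then have "(\<lambda>n. f (q n) (k, cube_of k x) * (sqrt (2 ^ (k * DIM('a)) * B) + 1)) \<longlonglongrightarrow> l * (sqrt (2 ^ (k * DIM('a)) * B) + 1)"
      by (intro tendsto_intros)
    then show ?thesis unfolding f_avg using pos[of k] by auto
  qed
  then obtain a where a: "\<And>k x. (\<lambda>n. avg k (u (q n)) x) \<longlonglongrightarrow> a k x" by metis
  have um [measurable]: "u n \<in> borel_measurable borel" for n by (rule wgradD(3)[OF u])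
  have am [measurable]: "a k \<in> borel_measurable borel" for k
    by (rule borel_measurable_LIMSEQ_metric[where f = "\<lambda>n. avg k (u (q n))"]) (auto intro: a)
  have avg_lim: "(\<lambda>n. \<integral>x. (norm (avg k (u (q n)) x - a k x))\<^sup>2 \<partial>M) \<longlonglongrightarrow> 0" and aL2: "a k \<in> L2 M" for k
  proof -
    let ?b = "sqrt (2 ^ (k * DIM('a)) * B)"
    have ab: "\<bar>a k x\<bar> \<le> ?b" for x
      using a[of k x] avg_bound[OF u B] by (intro LIMSEQ_le_const2[OF tendsto_rabs]) auto
    have "(\<lambda>n. \<integral>x. (norm (avg k (u (q n)) x - a k x))\<^sup>2 \<partial>M) \<longlonglongrightarrow> (\<integral>x. 0 \<partial>M)"
    proof (rule integral_dominated_convergence[where w = "\<lambda>_. (2 * ?b)\<^sup>2"])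
      show "AE x in M. (\<lambda>n. (norm (avg k (u (q n)) x - a k x))\<^sup>2) \<longlonglongrightarrow> 0"
        using tendsto_norm_zero[OF LIM_zero[OF a]] by (intro AE_I2 tendsto_null_power) auto
      have "\<bar>avg k (u (q n)) x - a k x\<bar> \<le> 2 * ?b" for n x
        using avg_bound[OF u B, of k "q n" x] ab[of x] by linarith
      then have "(norm (avg k (u (q n)) x - a k x))\<^sup>2 \<le> (2 * ?b)\<^sup>2" for n x
        by (intro power_mono) auto
      then show "AE x in M. norm ((norm (avg k (u (q n)) x - a k x))\<^sup>2) \<le> (2 * ?b)\<^sup>2" for n by simp
    qed (auto intro: M_fin)
    then show "(\<lambda>n. \<integral>x. (norm (avg k (u (q n)) x - a k x))\<^sup>2 \<partial>M) \<longlonglongrightarrow> 0" by simp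
    have "integrable M (\<lambda>x. (norm (a k x))\<^sup>2)"
    proof (rule Bochner_Integration.integrable_bound[OF M_fin[of "?b\<^sup>2"]])
      show "AE x in M. norm ((norm (a k x))\<^sup>2) \<le> norm (?b\<^sup>2)"
        using ab power_mono[of "\<bar>a k x\<bar>" ?b 2 for x] by (intro AE_I2) auto
    qed measurable
    then show "a k \<in> L2 M" by (simp add: L2_def)
  qed
  have uL2: "u n \<in> L2 lborel" for n by (rule wgradD[OF u])
  have avgL2: "avg k (u n) \<in> L2 lborel" for k n
    using L2_diff[OF uL2[of n] diff_avg_L2(1)[OF u B, of n k]] by simp
  have "\<exists>N. \<forall>m\<ge>N. \<forall>n\<ge>N. (\<integral>x. (norm (u (q m) x - u (q n) x))\<^sup>2 \<partial>M) < e" if e: "e > 0" for e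
  proof -
    \<comment> \<open>Below, each of the two oscillations and each of the two errors of the averages
      is counted 4 times; together they give at most D 4^-k < e / 2 and 8 e / 16 = e / 2.\<close>
    define D where "D = 8 * (2 ^ DIM('a) * real DIM('a) * B)"
    have "(\<lambda>k. D * (1/4) ^ k) \<longlonglongrightarrow> D * 0" by (intro tendsto_intros LIMSEQ_power_zero) simp
    then obtain k where k: "D * (1/4) ^ k < e / 2"
      using order_tendstoD(2)[of "\<lambda>k. D * (1/4) ^ k" 0 sequentially "e / 2"] e by (auto simp: eventually_sequentially)
    obtain N where N: "\<And>n. n \<ge> N \<Longrightarrow> (\<integral>x. (norm (avg k (u (q n)) x - a k x))\<^sup>2 \<partial>M) < e / 16"
      using order_tendstoD(2)[OF avg_lim[of k], of "e / 16"] e by (auto simp: eventually_sequentially)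
    show ?thesis
    proof (intro exI[of _ N] allI impI)
      fix m n assume mn: "m \<ge> N" "n \<ge> N"
      define A where "A n x = u (q n) x - avg k (u (q n)) x" for n x
      define E where "E n x = avg k (u (q n)) x - a k x" for n x
      have AL: "A n \<in> L2 M" for n unfolding A_def[abs_def] by (intro M_L2 diff_avg_L2(1)[OF u B])
      have EL: "E n \<in> L2 M" for n unfolding E_def[abs_def] by (intro L2_diff M_L2 avgL2 aL2)
      have AI: "(\<integral>x. (norm (A n x))\<^sup>2 \<partial>M) \<le> D / 8 * (1/4) ^ k" for n
        using order_trans[OF M_le[OF diff_avg_L2(1)[OF u B]] diff_avg_L2(2)[OF u B], of "q n" k]
        by (simp add: A_def D_def mult_ac)
      have neg: "(\<integral>x. (norm (- F x))\<^sup>2 \<partial>M) = (\<integral>x. (norm (F x))\<^sup>2 \<partial>M)" for F :: "'a \<Rightarrow> real" by simp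
      have mL: "(\<lambda>x. - F x) \<in> L2 M" if "F \<in> L2 M" for F :: "'a \<Rightarrow> real"
        using L2_scaleR[OF that, of "-1"] by simp
      \<comment> \<open>The limits \<open>a k\<close> cancel in the difference of the two errors, so
        the sum is the difference of two members of the sequence.\<close>
      have "(\<integral>x. (norm ((A m x + - A n x) + (E m x + - E n x)))\<^sup>2 \<partial>M)
        \<le> 2 * (\<integral>x. (norm (A m x + - A n x))\<^sup>2 \<partial>M) + 2 * (\<integral>x. (norm (E m x + - E n x))\<^sup>2 \<partial>M)"
        by (intro L2_triangle L2_add mL AL EL)
      also have "\<dots> \<le> 2 * (2 * (\<integral>x. (norm (A m x))\<^sup>2 \<partial>M) + 2 * (\<integral>x. (norm (- A n x))\<^sup>2 \<partial>M))
         + 2 * (2 * (\<integral>x. (norm (E m x))\<^sup>2 \<partial>M) + 2 * (\<integral>x. (norm (- E n x))\<^sup>2 \<partial>M))"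
        by (intro add_mono mult_left_mono L2_triangle mL AL EL) auto
      also have "\<dots> < e"
      proof -
        have "(\<integral>x. (norm (E m x))\<^sup>2 \<partial>M) < e / 16" "(\<integral>x. (norm (E n x))\<^sup>2 \<partial>M) < e / 16"
          using N mn by (auto simp: E_def)
        then show ?thesis unfolding neg using AI[of m] AI[of n] k by argo
      qed
      finally show "(\<integral>x. (norm (u (q m) x - u (q n) x))\<^sup>2 \<partial>M) < e"
        by (simp add: A_def E_def)
    qed
  qed
  then show ?thesis
  proof (rule L2_complete[of "\<lambda>n. u (q n)" M, OF M_L2[OF uL2]])
    fix v and r :: "nat \<Rightarrow> nat"
    assume v: "v \<in> L2 M" "(\<lambda>n. \<integral>x. (norm (u (q n) x - v x))\<^sup>2 \<partial>M) \<longlonglongrightarrow> 0" and r: "strict_mono r"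
      and ae: "AE x in M. (\<lambda>n. u (q (r n)) x) \<longlonglongrightarrow> v x"
    show ?thesis
    proof (rule that[of M v "q \<circ> r"])
      show "strict_mono (q \<circ> r)" using q r by (rule strict_mono_o)
      show "(\<lambda>n. \<integral>x. (norm (u ((q \<circ> r) n) x - v x))\<^sup>2 \<partial>M) \<longlonglongrightarrow> 0"
        using LIMSEQ_subseq_LIMSEQ[OF v(2) r] by (simp add: o_def)
      show "AE x in lborel. (\<lambda>n. u ((q \<circ> r) n) x) \<longlonglongrightarrow> v x"
        using ae unfolding M_AE by simp
    qed (use M_L2 M_le M_AE v in auto)
  qed
qed

section \<open>Weak limits through midpoint hulls\<close>

lemma mid_hull_wgrad:
  assumes U: "\<And>n. wgrad (\<lambda>x. fst (U n x)) (\<lambda>x. snd (U n x))" and w: "w \<in> mid_hull U m"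
  shows "wgrad (\<lambda>x. fst (w x)) (\<lambda>x. snd (w x))"
  using w
proof induction
  case (mid v w)
  from wgrad_lincomb[OF mid.IH, of "1/2" "1/2"] show ?case
    by (simp add: scaleR_add_right add_divide_distrib)
qed (rule U)

text \<open>Closed balls of L2 are stable under midpoints, so closeness of a tail to v passes to its
  hull.\<close>

lemma mid_hull_L2_close:
  fixes v :: "'a \<Rightarrow> real"
  assumes U: "\<And>n. (\<lambda>x. fst (U n x) - v x) \<in> L2 M" "\<And>n. n \<ge> m \<Longrightarrow> (\<integral>x. (norm (fst (U n x) - v x))\<^sup>2 \<partial>M) \<le> e"
    and w: "w \<in> mid_hull U m"
  shows "(\<lambda>x. fst (w x) - v x) \<in> L2 M \<and> (\<integral>x. (norm (fst (w x) - v x))\<^sup>2 \<partial>M) \<le> e"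
  using w
proof induction
  case (mid y z)
  let ?y = "\<lambda>x. (1/2) *\<^sub>R (fst (y x) - v x)" and ?z = "\<lambda>x. (1/2) *\<^sub>R (fst (z x) - v x)"
  have L: "?y \<in> L2 M" "?z \<in> L2 M" using mid.IH by (intro L2_scaleR; simp)+
  have eq: "fst ((1/2) *\<^sub>R (y x + z x)) - v x = ?y x + ?z x" for x
    by (simp add: field_simps)
  have "(\<integral>x. (norm (?y x + ?z x))\<^sup>2 \<partial>M) \<le> 2 * (\<integral>x. (norm (?y x))\<^sup>2 \<partial>M) + 2 * (\<integral>x. (norm (?z x))\<^sup>2 \<partial>M)"
    by (rule L2_triangle[OF L])
  also have "\<dots> = (1/2) * (\<integral>x. (norm (fst (y x) - v x))\<^sup>2 \<partial>M) + (1/2) * (\<integral>x. (norm (fst (z x) - v x))\<^sup>2 \<partial>M)"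
    by (simp add: power_mult_distrib power_divide)
  also have "\<dots> \<le> e" using mid.IH by linarith
  finally show ?case unfolding eq using L2_add[OF L] by blast
qed (use U in auto)

lemma mid_hull_inner_close:
  fixes F :: "'x \<Rightarrow> 'b::euclidean_space"
  assumes U: "\<And>n. U n \<in> L2 M" "\<And>n. n \<ge> m \<Longrightarrow> \<bar>(\<integral>x. U n x \<bullet> F x \<partial>M) - l\<bar> \<le> e" and F: "F \<in> L2 M"
    and w: "w \<in> mid_hull U m"
  shows "w \<in> L2 M \<and> \<bar>(\<integral>x. w x \<bullet> F x \<partial>M) - l\<bar> \<le> e"
  using w
proof induction
  case (mid y z)
  have L: "y \<in> L2 M" "z \<in> L2 M" using mid.IH by auto
  have "(\<integral>x. (1/2) *\<^sub>R (y x + z x) \<bullet> F x \<partial>M) = (1/2) * (\<integral>x. y x \<bullet> F x \<partial>M) + (1/2) * (\<integral>x. z x \<bullet> F x \<partial>M)"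
    using L2_inner[OF L(1) F] L2_inner[OF L(2) F] by (simp add: inner_add_left add_divide_distrib)
  then have "\<bar>(\<integral>x. (1/2) *\<^sub>R (y x + z x) \<bullet> F x \<partial>M) - l\<bar> \<le> e" using mid.IH by argo
  then show ?case using L2_scaleR[OF L2_add[OF L], of "1/2"] by simp
qed (use U in auto)

text \<open>Tested with \<phi> and a fixed vector z, the defining identity consists of two inner
  products of the pair, with \<open>(gradient \<phi> x \<bullet> z, 0)\<close> and with
  \<open>(0, \<phi> x *\<^sub>R z)\<close>; each of them passes to the L2 limit.\<close>

lemma wgrad_closed:
  assumes W: "\<And>m. wgrad (\<lambda>x. fst (W m x)) (\<lambda>x. snd (W m x))" "\<And>m. W m \<in> L2 lborel" and V: "V \<in> L2 lborel"
    and lim: "(\<lambda>m. \<integral>x. (norm (W m x - V x))\<^sup>2 \<partial>lborel) \<longlonglongrightarrow> 0"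
  shows "wgrad (\<lambda>x. fst (V x)) (\<lambda>x. snd (V x :: real \<times> 'a::euclidean_space))"
  unfolding wgrad_def
proof (intro conjI ballI fst_L2 snd_L2 V)
  fix \<phi> :: "'a \<Rightarrow> real" assume \<phi>: "\<phi> \<in> test_functions"
  have zero: "(\<lambda>x. 0) \<in> L2 lborel" by (simp add: L2_def)
  have iV: "integrable lborel (\<lambda>x. fst (V x) *\<^sub>R gradient \<phi> x)" "integrable lborel (\<lambda>x. \<phi> x *\<^sub>R snd (V x))"
    by (intro L2_mult fst_L2 snd_L2 V test_L2 gradient_L2 \<phi>)+
  have iW: "integrable lborel (\<lambda>x. fst (W m x) *\<^sub>R gradient \<phi> x)" "integrable lborel (\<lambda>x. \<phi> x *\<^sub>R snd (W m x))" for m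
    by (intro L2_mult fst_L2 snd_L2 W test_L2 gradient_L2 \<phi>)+
  have "(\<integral>x. fst (V x) *\<^sub>R gradient \<phi> x \<partial>lborel) \<bullet> z = (- (\<integral>x. \<phi> x *\<^sub>R snd (V x) \<partial>lborel)) \<bullet> z" for z
  proof -
    have gz: "(\<lambda>x. gradient \<phi> x \<bullet> z) \<in> L2 lborel"
    proof -
      obtain R where "\<And>x. norm x \<ge> R \<Longrightarrow> gradient \<phi> x = 0" using test_support[OF \<phi>] by metis
      then show ?thesis
        by (intro compact_support_L2[where R = R] continuous_intros gradient_continuous \<phi>) auto
    qed
    have pz: "(\<lambda>x. \<phi> x *\<^sub>R z) \<in> L2 lborel"
    proof -
      obtain R where "\<And>x. norm x \<ge> R \<Longrightarrow> \<phi> x = 0" using test_support[OF \<phi>] by metis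
      then show ?thesis
        by (intro compact_support_L2[where R = R] continuous_intros test_continuous \<phi>) auto
    qed
    have 1: "(\<lambda>m. \<integral>x. W m x \<bullet> (gradient \<phi> x \<bullet> z, 0) \<partial>lborel) \<longlonglongrightarrow> (\<integral>x. V x \<bullet> (gradient \<phi> x \<bullet> z, 0) \<partial>lborel)"
      by (intro L2_inner_tendsto W V lim pair_L2 gz) (rule zero)
    have 2: "(\<lambda>m. \<integral>x. W m x \<bullet> (0, \<phi> x *\<^sub>R z) \<partial>lborel) \<longlonglongrightarrow> (\<integral>x. V x \<bullet> (0, \<phi> x *\<^sub>R z) \<partial>lborel)"
      by (intro L2_inner_tendsto W V lim pair_L2 pz) (rule zero)
    have e1: "(\<integral>x. Y x \<bullet> (gradient \<phi> x \<bullet> z, 0) \<partial>lborel) = (\<integral>x. fst (Y x) *\<^sub>R gradient \<phi> x \<partial>lborel) \<bullet> z"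
      if "integrable lborel (\<lambda>x. fst (Y x) *\<^sub>R gradient \<phi> x)" for Y :: "'a \<Rightarrow> real \<times> 'a"
      using integral_inner_left[OF that, of z] by (simp add: inner_prod_def)
    have e2: "(\<integral>x. Y x \<bullet> (0, \<phi> x *\<^sub>R z) \<partial>lborel) = (\<integral>x. \<phi> x *\<^sub>R snd (Y x) \<partial>lborel) \<bullet> z"
      if "integrable lborel (\<lambda>x. \<phi> x *\<^sub>R snd (Y x))" for Y :: "'a \<Rightarrow> real \<times> 'a"
      using integral_inner_left[OF that, of z] by (simp add: inner_prod_def)
    have "(\<lambda>m. (\<integral>x. fst (W m x) *\<^sub>R gradient \<phi> x \<partial>lborel) \<bullet> z) \<longlonglongrightarrow> (\<integral>x. fst (V x) *\<^sub>R gradient \<phi> x \<partial>lborel) \<bullet> z"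
      using 1 unfolding e1[OF iV(1)] e1[OF iW(1)] .
    moreover have "(\<lambda>m. - ((\<integral>x. \<phi> x *\<^sub>R snd (W m x) \<partial>lborel) \<bullet> z)) \<longlonglongrightarrow> - ((\<integral>x. \<phi> x *\<^sub>R snd (V x) \<partial>lborel) \<bullet> z)"
      using 2 unfolding e2[OF iV(2)] e2[OF iW(2)] by (rule tendsto_minus)
    ultimately show ?thesis
      unfolding wgradD(5)[OF W(1) \<phi>] inner_minus_left by (rule LIMSEQ_unique)
  qed
  then show "(\<integral>x. fst (V x) *\<^sub>R gradient \<phi> x \<partial>lborel) = - (\<integral>x. \<phi> x *\<^sub>R snd (V x) \<partial>lborel)"
    using vector_eq_rdot by blast
qed

lemma real_tendsto_by_subseq:
  fixes a :: "nat \<Rightarrow> real"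
  assumes bd: "\<And>n. \<bar>a n\<bar> \<le> K" and sub: "\<And>q l. strict_mono (q :: nat \<Rightarrow> nat) \<Longrightarrow> (\<lambda>n. a (q n)) \<longlonglongrightarrow> l \<Longrightarrow> l = L"
  shows "a \<longlonglongrightarrow> L"
proof (rule ccontr)
  assume "\<not> a \<longlonglongrightarrow> L"
  then obtain e where e: "e > 0" "\<And>N. \<exists>n\<ge>N. \<not> norm (a n - L) < e" unfolding LIMSEQ_iff by blast
  then have "infinite {n. \<not> norm (a n - L) < e}" by (simp add: infinite_nat_iff_unbounded_le)
  then obtain q :: "nat \<Rightarrow> nat" where q: "strict_mono q" "\<And>n. q n \<in> {n. \<not> norm (a n - L) < e}"
    using infinite_enumerate by blast
  have "bounded (range (\<lambda>n. a (q n)))" using bd by (auto simp: bounded_iff intro!: exI[of _ K])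
  from bounded_imp_convergent_subsequence[OF this] obtain l and r :: "nat \<Rightarrow> nat"
    where r: "strict_mono r" "(\<lambda>n. a (q (r n))) \<longlonglongrightarrow> l" by (auto simp: o_def)
  have "l = L" using sub[of "q \<circ> r" l] q(1) r by (simp add: o_def strict_mono_o[unfolded o_def])
  with r(2) e(1) obtain N where "norm (a (q (r N)) - L) < e" unfolding LIMSEQ_iff by blast
  with q(2)[of "r N"] show False by simp
qed

text \<open>Rellich fixes a limit v0 almost everywhere. Along any further subsequence Mazur's lemma
  gives midpoints converging in norm; the first component of their limit is v0, and its gradient is
  then determined by \<open>wgrad_unique\<close>. Hence the inner products with a fixed pair have a
  single cluster value, which is weak convergence along the subsequence that Rellich
  selects.\<close>

lemma weak_compactness:
  fixes u :: "nat \<Rightarrow> 'a::euclidean_space \<Rightarrow> real"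
  assumes u: "\<And>n. wgrad (u n) (g n)" and B: "\<And>n. hnorm (u n) (g n) \<le> B"
  obtains r v h where "strict_mono (r :: nat \<Rightarrow> nat)" "wgrad v h" "AE x in lborel. (\<lambda>n. u (r n) x) \<longlonglongrightarrow> v x"
    "hnorm v h \<le> B" "\<And>\<phi> \<psi>. wgrad \<phi> \<psi> \<Longrightarrow> (\<lambda>n. hinner (u (r n)) (g (r n)) \<phi> \<psi>) \<longlonglongrightarrow> hinner v h \<phi> \<psi>"
proof -
  show ?thesis
  proof (rule rellich[of u g B, OF u B])
  fix M :: "'a measure" and v0 and r :: "nat \<Rightarrow> nat"
  assume M_L2: "\<And>f :: 'a \<Rightarrow> real. f \<in> L2 lborel \<Longrightarrow> f \<in> L2 M"
    and M_le: "\<And>f :: 'a \<Rightarrow> real. f \<in> L2 lborel \<Longrightarrow> (\<integral>x. (norm (f x))\<^sup>2 \<partial>M) \<le> (\<integral>x. (norm (f x))\<^sup>2 \<partial>lborel)"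
    and M_AE: "\<And>P. (AE x in M. P x) \<longleftrightarrow> (AE x in lborel. P x)"
    and v0: "v0 \<in> L2 M" and r: "strict_mono r"
    and v0_lim: "(\<lambda>n. \<integral>x. (norm (u (r n) x - v0 x))\<^sup>2 \<partial>M) \<longlonglongrightarrow> 0"
    and v0_ae: "AE x in lborel. (\<lambda>n. u (r n) x) \<longlonglongrightarrow> v0 x"
  define U where "U n x = (u (r n) x, g (r n) x)" for n x
  have UL: "U n \<in> L2 lborel" for n unfolding U_def[abs_def] by (intro pair_L2 wgradD[OF u])
  have Uw: "wgrad (\<lambda>x. fst (U n x)) (\<lambda>x. snd (U n x))" for n by (simp add: U_def u)
  have U_norm: "(\<integral>x. (norm (U n x))\<^sup>2 \<partial>lborel) \<le> B" for n
    using B[of "r n"] by (simp add: U_def norm_Pair hnorm_def)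
  have hin: "hinner (u (r n)) (g (r n)) \<phi> \<psi> = (\<integral>x. U n x \<bullet> (\<phi> x, \<psi> x) \<partial>lborel)" for n \<phi> \<psi>
    by (simp add: hinner_def U_def)
  have identify: "\<exists>V W. V \<in> L2 lborel \<and> wgrad (\<lambda>x. fst (V x)) (\<lambda>x. snd (V x)) \<and> (AE x in lborel. fst (V x) = v0 x)
      \<and> (\<forall>m. W m \<in> mid_hull (\<lambda>n. U (q n)) m) \<and> (\<forall>m. W m \<in> L2 lborel) \<and> (\<lambda>m. \<integral>x. (norm (W m x - V x))\<^sup>2 \<partial>lborel) \<longlonglongrightarrow> 0"
    if q: "strict_mono q" for q :: "nat \<Rightarrow> nat"
  proof -
    obtain V W where V: "V \<in> L2 lborel" and W: "\<And>m. W m \<in> mid_hull (\<lambda>n. U (q n)) m" "\<And>m. W m \<in> L2 lborel"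
      and lim: "(\<lambda>m. \<integral>x. (norm (W m x - V x))\<^sup>2 \<partial>lborel) \<longlonglongrightarrow> 0"
      using L2_mazur[of "\<lambda>n. U (q n)" lborel B, OF UL U_norm] by blast
    have Ww: "wgrad (\<lambda>x. fst (W m x)) (\<lambda>x. snd (W m x))" for m
      by (rule mid_hull_wgrad[OF Uw W(1)])
    have Vw: "wgrad (\<lambda>x. fst (V x)) (\<lambda>x. snd (V x))"
      by (rule wgrad_closed[OF Ww W(2) V lim])
    have fV: "(\<lambda>x. fst (V x) - v0 x) \<in> L2 M" by (intro L2_diff M_L2 fst_L2 V v0)
    have "(\<integral>x. (norm (fst (V x) - v0 x))\<^sup>2 \<partial>M) \<le> e" if e: "e > 0" for e
    proof -
      obtain N where N: "\<And>n. n \<ge> N \<Longrightarrow> (\<integral>x. (norm (u (r n) x - v0 x))\<^sup>2 \<partial>M) < e / 4"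
        using order_tendstoD(2)[OF v0_lim, of "e / 4"] e by (auto simp: eventually_sequentially)
      obtain N' where N': "\<And>m. m \<ge> N' \<Longrightarrow> (\<integral>x. (norm (W m x - V x))\<^sup>2 \<partial>lborel) < e / 4"
        using order_tendstoD(2)[OF lim, of "e / 4"] e by (auto simp: eventually_sequentially)
      define m where "m = max N N'"
      have Wm: "(\<lambda>x. fst (W m x) - v0 x) \<in> L2 M \<and> (\<integral>x. (norm (fst (W m x) - v0 x))\<^sup>2 \<partial>M) \<le> e / 4"
      proof (rule mid_hull_L2_close[OF _ _ W(1)])
        show "(\<lambda>x. fst (U (q n) x) - v0 x) \<in> L2 M" for n by (intro L2_diff M_L2 fst_L2 UL v0)
        fix n assume "n \<ge> m"
        then have "q n \<ge> N" using seq_suble[OF q, of n] by (simp add: m_def)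
        then show "(\<integral>x. (norm (fst (U (q n) x) - v0 x))\<^sup>2 \<partial>M) \<le> e / 4"
          using N[of "q n"] by (simp add: U_def)
      qed
      have WV: "(\<lambda>x. fst (V x) - fst (W m x)) \<in> L2 lborel" by (intro L2_diff fst_L2 V W)
      have "(\<integral>x. (norm (fst (V x) - fst (W m x)))\<^sup>2 \<partial>M) \<le> (\<integral>x. (norm (fst (V x) - fst (W m x)))\<^sup>2 \<partial>lborel)"
        by (rule M_le[OF WV])
      also have "\<dots> \<le> (\<integral>x. (norm (W m x - V x))\<^sup>2 \<partial>lborel)"
      proof (rule integral_mono[OF L2_norm_integrable[OF WV] L2_norm_integrable[OF L2_diff[OF W(2) V]]])
        fix x
        have "norm (fst (V x) - fst (W m x)) = norm (fst (W m x - V x))" by (simp add: norm_minus_commute)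
        also have "\<dots> \<le> norm (W m x - V x)" by (metis norm_fst_le prod.collapse)
        finally show "(norm (fst (V x) - fst (W m x)))\<^sup>2 \<le> (norm (W m x - V x))\<^sup>2" by (intro power_mono) auto
      qed
      also have "\<dots> < e / 4" using N' by (simp add: m_def)
      finally have le1: "(\<integral>x. (norm (fst (V x) - fst (W m x)))\<^sup>2 \<partial>M) < e / 4" .
      have "(\<integral>x. (norm ((fst (V x) - fst (W m x)) + (fst (W m x) - v0 x)))\<^sup>2 \<partial>M)
        \<le> 2 * (\<integral>x. (norm (fst (V x) - fst (W m x)))\<^sup>2 \<partial>M) + 2 * (\<integral>x. (norm (fst (W m x) - v0 x))\<^sup>2 \<partial>M)"
        using Wm by (intro L2_triangle M_L2[OF WV]) auto
      also have "\<dots> \<le> e" using le1 Wm by argo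
      finally show ?thesis by simp
    qed
    then have "(\<integral>x. (norm (fst (V x) - v0 x))\<^sup>2 \<partial>M) \<le> 0" by (rule field_le_epsilon[of _ 0, simplified])
    then have "(\<integral>x. (norm (fst (V x) - v0 x))\<^sup>2 \<partial>M) = 0" by (simp add: order_antisym)
    then have "AE x in M. (norm (fst (V x) - v0 x))\<^sup>2 = 0"
      by (subst (asm) integral_nonneg_eq_0_iff_AE[OF L2_norm_integrable[OF fV]]) auto
    then have "AE x in lborel. fst (V x) = v0 x" unfolding M_AE by simp
    with V Vw W lim show ?thesis by blast
  qed
  obtain V where V: "V \<in> L2 lborel" "wgrad (\<lambda>x. fst (V x)) (\<lambda>x. snd (V x))" "AE x in lborel. fst (V x) = v0 x"
    using identify[OF strict_mono_id] by blast
  define v h where "v x = fst (V x)" and "h x = snd (V x)" for x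
  have vw: "wgrad v h" using V(2) by (simp add: v_def[abs_def] h_def[abs_def])
  have weak: "(\<lambda>n. hinner (u (r n)) (g (r n)) \<phi> \<psi>) \<longlonglongrightarrow> hinner v h \<phi> \<psi>" if \<phi>: "wgrad \<phi> \<psi>" for \<phi> \<psi>
  proof (rule real_tendsto_by_subseq)
    have FL: "(\<lambda>x. (\<phi> x, \<psi> x)) \<in> L2 lborel" by (intro pair_L2 wgradD[OF \<phi>])
    show "\<bar>hinner (u (r n)) (g (r n)) \<phi> \<psi>\<bar> \<le> sqrt (B * (\<integral>x. (norm (\<phi> x, \<psi> x))\<^sup>2 \<partial>lborel))" for n
    proof -
      have "(\<integral>x. U n x \<bullet> (\<phi> x, \<psi> x) \<partial>lborel)\<^sup>2 \<le> (\<integral>x. (norm (U n x))\<^sup>2 \<partial>lborel) * (\<integral>x. (norm (\<phi> x, \<psi> x))\<^sup>2 \<partial>lborel)"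
        by (rule L2_Cauchy_Schwarz[OF UL FL])
      also have "\<dots> \<le> B * (\<integral>x. (norm (\<phi> x, \<psi> x))\<^sup>2 \<partial>lborel)"
        by (intro mult_right_mono U_norm) auto
      finally have "sqrt ((\<integral>x. U n x \<bullet> (\<phi> x, \<psi> x) \<partial>lborel)\<^sup>2) \<le> sqrt (B * (\<integral>x. (norm (\<phi> x, \<psi> x))\<^sup>2 \<partial>lborel))"
        by (rule real_sqrt_le_mono)
      then show ?thesis unfolding hin real_sqrt_abs .
    qed
    fix q :: "nat \<Rightarrow> nat" and l
    assume q: "strict_mono q" and l: "(\<lambda>n. hinner (u (r (q n))) (g (r (q n))) \<phi> \<psi>) \<longlonglongrightarrow> l"
    obtain V' W where V': "V' \<in> L2 lborel" "wgrad (\<lambda>x. fst (V' x)) (\<lambda>x. snd (V' x))" "AE x in lborel. fst (V' x) = v0 x"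
      and W: "\<And>m. W m \<in> mid_hull (\<lambda>n. U (q n)) m" "\<And>m. W m \<in> L2 lborel"
      and lim: "(\<lambda>m. \<integral>x. (norm (W m x - V' x))\<^sup>2 \<partial>lborel) \<longlonglongrightarrow> 0"
      using identify[OF q] by blast
    have "AE x in lborel. fst (V' x) = v x" using V'(3) V(3) by eventually_elim (simp add: v_def)
    moreover from this have "AE x in lborel. snd (V' x) = h x"
      by (rule wgrad_unique[OF V'(2) vw])
    moreover have [measurable]: "V' \<in> borel_measurable borel" "v \<in> borel_measurable borel" "h \<in> borel_measurable borel"
      "\<phi> \<in> borel_measurable borel" "\<psi> \<in> borel_measurable borel"
      using V'(1) wgradD(3,4)[OF vw] wgradD(3,4)[OF \<phi>] by (simp_all add: L2_def)
    have m1: "(\<lambda>x. V' x \<bullet> (\<phi> x, \<psi> x)) \<in> borel_measurable lborel"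
      using L2_inner[OF V'(1) FL] by (rule borel_measurable_integrable)
    ultimately have "(\<integral>x. V' x \<bullet> (\<phi> x, \<psi> x) \<partial>lborel) = hinner v h \<phi> \<psi>"
      unfolding hinner_def using m1 by (intro integral_cong_AE) (auto simp: inner_prod_def elim: eventually_elim2)
    with L2_inner_tendsto[OF W(2) V'(1) FL lim]
    have 1: "(\<lambda>m. \<integral>x. W m x \<bullet> (\<phi> x, \<psi> x) \<partial>lborel) \<longlonglongrightarrow> hinner v h \<phi> \<psi>" by simp
    have "(\<lambda>m. \<integral>x. W m x \<bullet> (\<phi> x, \<psi> x) \<partial>lborel) \<longlonglongrightarrow> l"
    proof (rule LIMSEQ_I)
      fix e :: real assume e: "e > 0"
      obtain N where N: "\<And>n. n \<ge> N \<Longrightarrow> \<bar>hinner (u (r (q n))) (g (r (q n))) \<phi> \<psi> - l\<bar> < e / 2"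
        using LIMSEQ_D[OF l, of "e / 2"] e by auto
      show "\<exists>N. \<forall>m\<ge>N. norm ((\<integral>x. W m x \<bullet> (\<phi> x, \<psi> x) \<partial>lborel) - l) < e"
      proof (intro exI[of _ N] allI impI)
        fix m assume m: "m \<ge> N"
        have "W m \<in> L2 lborel \<and> \<bar>(\<integral>x. W m x \<bullet> (\<phi> x, \<psi> x) \<partial>lborel) - l\<bar> \<le> e / 2"
        proof (rule mid_hull_inner_close[OF UL _ FL W(1)])
          fix n assume "n \<ge> m"
          then show "\<bar>(\<integral>x. U (q n) x \<bullet> (\<phi> x, \<psi> x) \<partial>lborel) - l\<bar> \<le> e / 2"
            using N[of n] m unfolding hin by simp
        qed
        then show "norm ((\<integral>x. W m x \<bullet> (\<phi> x, \<psi> x) \<partial>lborel) - l) < e" using e by simp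
      qed
    qed
    with 1 show "l = hinner v h \<phi> \<psi>" using LIMSEQ_unique by blast
  qed
  \<comment> \<open>Lower semicontinuity of the norm: testing the weak convergence with the limit
    itself gives H^2 \<le> B H.\<close>
  have "hnorm v h \<le> B"
  proof -
    define H where "H = hnorm v h"
    have FL: "(\<lambda>x. (v x, h x)) \<in> L2 lborel" by (intro pair_L2 wgradD[OF vw])
    have H: "H = (\<integral>x. (norm (v x, h x))\<^sup>2 \<partial>lborel)" by (simp add: H_def hnorm_def norm_Pair)
    have "(hinner (u (r n)) (g (r n)) v h)\<^sup>2 \<le> B * H" for n
    proof -
      have "(\<integral>x. U n x \<bullet> (v x, h x) \<partial>lborel)\<^sup>2 \<le> (\<integral>x. (norm (U n x))\<^sup>2 \<partial>lborel) * H"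
        unfolding H by (rule L2_Cauchy_Schwarz[OF UL FL])
      also have "\<dots> \<le> B * H" using hnorm_nonneg by (intro mult_right_mono U_norm) (simp add: H_def)
      finally show ?thesis unfolding hin .
    qed
    moreover have "hinner v h v h = H"
      by (simp add: hinner_def H_def hnorm_def power2_norm_eq_inner power2_eq_square[of "v _"])
    ultimately have "H\<^sup>2 \<le> B * H"
      using LIMSEQ_le_const2[OF tendsto_power[OF weak[OF vw], of 2], of "B * H"] by simp
    then show ?thesis using hnorm_nonneg[of v h] B[of 0] hnorm_nonneg[of "u 0" "g 0"]
      by (cases "H = 0") (auto simp: H_def power2_eq_square)
  qed
  moreover have "AE x in lborel. (\<lambda>n. u (r n) x) \<longlonglongrightarrow> v x"
    using v0_ae V(3) by eventually_elim (simp add: v_def)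
  ultimately show thesis using that r vw weak by blast
  qed
qed

section \<open>The Young inequality for the double integral\<close>

text \<open>The product is a weighted geometric mean of the three terms X, Y, Z with weights 2/t -
  1, 1 - 1/t and 1 - 1/t, which sum to 1; each base is then enlarged to X + Y + Z. Every term
  couples only two of the three factors, which lets the double integral split.\<close>

lemma young_pointwise:
  fixes a b c t :: real
  assumes "a \<ge> 0" "b \<ge> 0" "c \<ge> 0" and t: "1 < t" "t < 2"
  shows "a * c * b \<le> a powr t * b powr t + a powr t * c powr (t / (2 * t - 2)) + b powr t * c powr (t / (2 * t - 2))"
proof (cases "a = 0 \<or> b = 0 \<or> c = 0")
  case False
  then have pos: "a > 0" "b > 0" "c > 0" using assms by auto
  define r where "r = t / (2 * t - 2)"
  define X Y Z where "X = a powr t * b powr t" and "Y = a powr t * c powr r" and "Z = b powr t * c powr r"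
  define w1 w2 where "w1 = 2 / t - 1" and "w2 = 1 - 1 / t"
  have w: "0 \<le> w1" "0 \<le> w2" "w1 + w2 + w2 = 1" using t by (auto simp: w1_def w2_def field_simps)
  have tw: "t * w1 + t * w2 = 1"
    using t by (auto simp: w1_def w2_def field_simps)
  have "w2 = (t - 1) / t" using t by (simp add: w2_def diff_divide_distrib)
  then have "r * w2 = (t - 1) / (2 * (t - 1))" using t by (simp add: r_def)
  then have rw: "r * w2 + r * w2 = 1" using t by simp
  have "X powr w1 * Y powr w2 * Z powr w2
    = (a powr (t * w1) * a powr (t * w2)) * (c powr (r * w2) * c powr (r * w2)) * (b powr (t * w1) * b powr (t * w2))"
    using pos by (simp add: X_def Y_def Z_def powr_mult powr_powr mult_ac)
  also have "\<dots> = a * c * b"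
    using pos by (simp only: powr_add[symmetric] tw rw) simp
  finally have "a * c * b = X powr w1 * Y powr w2 * Z powr w2" ..
  have XYZ: "0 < X" "0 < Y" "0 < Z" using pos by (simp_all add: X_def Y_def Z_def)
  note \<open>a * c * b = X powr w1 * Y powr w2 * Z powr w2\<close>
  also have "X powr w1 * Y powr w2 * Z powr w2 \<le> (X + Y + Z) powr w1 * (X + Y + Z) powr w2 * (X + Y + Z) powr w2"
    using w XYZ by (intro mult_mono powr_mono2) auto
  also have "\<dots> = X + Y + Z"
    using XYZ by (simp only: powr_add[symmetric] w(3)) simp
  finally show ?thesis by (simp add: X_def Y_def Z_def r_def)
qed auto

text \<open>The exponent \<open>t / (2 * t - 2)\<close> is the one which Young's convolution inequality requires of the
  kernel when both other factors are in \<open>L\<^sup>t\<close>.\<close>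

definition young_kernel :: "real \<Rightarrow> ('a::euclidean_space \<Rightarrow> real) \<Rightarrow> bool" where
  "young_kernel t k \<longleftrightarrow> 1 < t \<and> t < 2 \<and> k \<in> borel_measurable borel \<and> (\<forall>z. 0 \<le> k z) \<and>
     integrable lborel (\<lambda>z. k z powr (t / (2 * t - 2)))"

abbreviation lborel2 :: "('a::euclidean_space \<times> 'a) measure" where
  "lborel2 \<equiv> lborel \<Otimes>\<^sub>M lborel"

text \<open>Any two of x, y and x - y serve as coordinates of the product space up to a
  volume-preserving change. This separates the three terms of
  \<open>young_pointwise\<close>.\<close>

lemma nn_integral_prod_mult:
  fixes f g :: "'a::euclidean_space \<Rightarrow> ennreal"
  assumes [measurable]: "f \<in> borel_measurable borel" "g \<in> borel_measurable borel"
  shows "(\<integral>\<^sup>+p. f (fst p) * g (snd p) \<partial>lborel2) = (\<integral>\<^sup>+x. f x \<partial>lborel) * (\<integral>\<^sup>+x. g x \<partial>lborel)"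
    and "(\<integral>\<^sup>+p. f (fst p) * g (fst p - snd p) \<partial>lborel2) = (\<integral>\<^sup>+x. f x \<partial>lborel) * (\<integral>\<^sup>+x. g x \<partial>lborel)"
    and "(\<integral>\<^sup>+p. f (snd p) * g (fst p - snd p) \<partial>lborel2) = (\<integral>\<^sup>+x. f x \<partial>lborel) * (\<integral>\<^sup>+x. g x \<partial>lborel)"
proof -
  show "(\<integral>\<^sup>+p. f (fst p) * g (snd p) \<partial>lborel2) = (\<integral>\<^sup>+x. f x \<partial>lborel) * (\<integral>\<^sup>+x. g x \<partial>lborel)"
    by (subst lborel.nn_integral_fst[symmetric]) (simp_all add: nn_integral_cmult nn_integral_multc)
  have refl: "(\<integral>\<^sup>+y. g (x - y) \<partial>lborel) = (\<integral>\<^sup>+y. g y \<partial>lborel)" for x :: 'a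
  proof -
    have "(\<integral>\<^sup>+y. g y \<partial>lborel) = (\<integral>\<^sup>+y. g y \<partial>distr lborel borel (\<lambda>y. x + (-1) *\<^sub>R y))"
      by (subst lborel_affine[of "-1" x]) (simp_all add: density_1)
    also have "\<dots> = (\<integral>\<^sup>+y. g (x - y) \<partial>lborel)" by (simp add: nn_integral_distr)
    finally show ?thesis by simp
  qed
  show "(\<integral>\<^sup>+p. f (fst p) * g (fst p - snd p) \<partial>lborel2) = (\<integral>\<^sup>+x. f x \<partial>lborel) * (\<integral>\<^sup>+x. g x \<partial>lborel)"
    by (subst lborel.nn_integral_fst[symmetric]) (simp_all add: nn_integral_cmult nn_integral_multc refl)
  show "(\<integral>\<^sup>+p. f (snd p) * g (fst p - snd p) \<partial>lborel2) = (\<integral>\<^sup>+x. f x \<partial>lborel) * (\<integral>\<^sup>+x. g x \<partial>lborel)"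
    using nn_integral_translate[of g "- y" for y]
    by (subst lborel_pair.nn_integral_snd[symmetric]) (simp_all add: nn_integral_cmult nn_integral_multc)
qed

text \<open>The bound is not homogeneous in the three masses. That suffices for integrability and
  uniform bounds; where the smallness of a single factor matters, that factor is rescaled first, as
  in \<open>bform_convergence\<close>.\<close>

lemma young_nn_integral:
  fixes f g k :: "'a::euclidean_space \<Rightarrow> real"
  assumes [measurable]: "f \<in> borel_measurable borel" "g \<in> borel_measurable borel" "k \<in> borel_measurable borel"
    and nn: "\<And>x. f x \<ge> 0" "\<And>x. g x \<ge> 0" "\<And>x. k x \<ge> 0" and t: "1 < t" "t < 2"
    and A: "(\<integral>\<^sup>+x. ennreal (f x powr t) \<partial>lborel) \<le> ennreal A" "A \<ge> 0"
    and B: "(\<integral>\<^sup>+x. ennreal (g x powr t) \<partial>lborel) \<le> ennreal B" "B \<ge> 0"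
    and K: "(\<integral>\<^sup>+x. ennreal (k x powr (t / (2 * t - 2))) \<partial>lborel) \<le> ennreal K" "K \<ge> 0"
  shows "(\<integral>\<^sup>+p. ennreal (f (fst p) * k (fst p - snd p) * g (snd p)) \<partial>lborel2) \<le> ennreal (A * B + A * K + B * K)"
proof -
  let ?r = "t / (2 * t - 2)"
  have "(\<integral>\<^sup>+p. ennreal (f (fst p) * k (fst p - snd p) * g (snd p)) \<partial>lborel2)
    \<le> (\<integral>\<^sup>+p. ennreal (f (fst p) powr t) * ennreal (g (snd p) powr t)
        + ennreal (f (fst p) powr t) * ennreal (k (fst p - snd p) powr ?r)
        + ennreal (g (snd p) powr t) * ennreal (k (fst p - snd p) powr ?r) \<partial>lborel2)"
  proof (intro nn_integral_mono)
    fix p :: "'a \<times> 'a"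
    show "ennreal (f (fst p) * k (fst p - snd p) * g (snd p)) \<le> ennreal (f (fst p) powr t) * ennreal (g (snd p) powr t)
        + ennreal (f (fst p) powr t) * ennreal (k (fst p - snd p) powr ?r)
        + ennreal (g (snd p) powr t) * ennreal (k (fst p - snd p) powr ?r)"
      using young_pointwise[OF nn(1)[of "fst p"] nn(2)[of "snd p"] nn(3)[of "fst p - snd p"] t]
      by (simp add: ennreal_mult[symmetric] ennreal_plus[symmetric] ennreal_leI del: ennreal_plus)
  qed
  also have "\<dots> = (\<integral>\<^sup>+p. ennreal (f (fst p) powr t) * ennreal (g (snd p) powr t) \<partial>lborel2)
        + (\<integral>\<^sup>+p. ennreal (f (fst p) powr t) * ennreal (k (fst p - snd p) powr ?r) \<partial>lborel2)
        + (\<integral>\<^sup>+p. ennreal (g (snd p) powr t) * ennreal (k (fst p - snd p) powr ?r) \<partial>lborel2)"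
    by (simp add: nn_integral_add)
  also have "\<dots> = (\<integral>\<^sup>+x. ennreal (f x powr t) \<partial>lborel) * (\<integral>\<^sup>+x. ennreal (g x powr t) \<partial>lborel)
        + (\<integral>\<^sup>+x. ennreal (f x powr t) \<partial>lborel) * (\<integral>\<^sup>+x. ennreal (k x powr ?r) \<partial>lborel)
        + (\<integral>\<^sup>+x. ennreal (g x powr t) \<partial>lborel) * (\<integral>\<^sup>+x. ennreal (k x powr ?r) \<partial>lborel)"
    using nn_integral_prod_mult(1)[of "\<lambda>x. ennreal (f x powr t)" "\<lambda>x. ennreal (g x powr t)"]
      nn_integral_prod_mult(2)[of "\<lambda>x. ennreal (f x powr t)" "\<lambda>x. ennreal (k x powr ?r)"]
      nn_integral_prod_mult(3)[of "\<lambda>x. ennreal (g x powr t)" "\<lambda>x. ennreal (k x powr ?r)"]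
    by simp
  also have "\<dots> \<le> ennreal A * ennreal B + ennreal A * ennreal K + ennreal B * ennreal K"
    by (intro add_mono mult_mono A B K) auto
  also have "\<dots> = ennreal (A * B + A * K + B * K)"
    using A(2) B(2) K(2) by (simp add: ennreal_mult)
  finally show ?thesis .
qed

definition bform :: "('a::euclidean_space \<Rightarrow> real) \<Rightarrow> ('a \<Rightarrow> real) \<Rightarrow> ('a \<Rightarrow> real) \<Rightarrow> real" where
  "bform k f g = (\<integral>p. f (fst p) * k (fst p - snd p) * g (snd p) \<partial>lborel2)"

lemma young_kernel_bound:
  assumes "young_kernel t k"
  obtains K where "K \<ge> 0" "(\<integral>\<^sup>+x. ennreal (k x powr (t / (2 * t - 2))) \<partial>lborel) \<le> ennreal K"
  using assms that[of "\<integral>x. k x powr (t / (2 * t - 2)) \<partial>lborel"]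
  by (auto simp: young_kernel_def nn_integral_eq_integral)

lemma young_integrable:
  fixes f g k :: "'a::euclidean_space \<Rightarrow> real"
  assumes k: "young_kernel t k" and [measurable]: "f \<in> borel_measurable borel" "g \<in> borel_measurable borel"
    and f: "(\<integral>\<^sup>+x. ennreal (\<bar>f x\<bar> powr t) \<partial>lborel) < \<infinity>" and g: "(\<integral>\<^sup>+x. ennreal (\<bar>g x\<bar> powr t) \<partial>lborel) < \<infinity>"
  shows "integrable lborel2 (\<lambda>p. f (fst p) * k (fst p - snd p) * g (snd p))"
proof (rule integrableI_bounded)
  have [measurable]: "k \<in> borel_measurable borel" and k0: "\<And>z. 0 \<le> k z" and t: "1 < t" "t < 2"
    using k by (auto simp: young_kernel_def)
  obtain K where K: "K \<ge> 0" "(\<integral>\<^sup>+x. ennreal (k x powr (t / (2 * t - 2))) \<partial>lborel) \<le> ennreal K"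
    using young_kernel_bound[OF k] .
  obtain A where A: "A \<ge> 0" "(\<integral>\<^sup>+x. ennreal (\<bar>f x\<bar> powr t) \<partial>lborel) = ennreal A"
    using f ennreal_finite_real by (metis less_irrefl)
  obtain B where B: "B \<ge> 0" "(\<integral>\<^sup>+x. ennreal (\<bar>g x\<bar> powr t) \<partial>lborel) = ennreal B"
    using g ennreal_finite_real by (metis less_irrefl)
  show "(\<lambda>p. f (fst p) * k (fst p - snd p) * g (snd p)) \<in> borel_measurable lborel2" by measurable
  have "(\<integral>\<^sup>+p. ennreal (\<bar>f (fst p)\<bar> * k (fst p - snd p) * \<bar>g (snd p)\<bar>) \<partial>lborel2) \<le> ennreal (A * B + A * K + B * K)"
    using A B K k0 t by (intro young_nn_integral) auto
  then show "(\<integral>\<^sup>+p. ennreal (norm (f (fst p) * k (fst p - snd p) * g (snd p))) \<partial>lborel2) < \<infinity>"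
    using k0 by (auto simp: abs_mult intro: order_le_less_trans)
qed

section \<open>A convergence theorem of Vitali type\<close>

lemma clip_bounds:
  fixes h w :: real
  assumes "w \<ge> 0"
  shows "\<bar>max (- w) (min h w)\<bar> \<le> w" "\<bar>h - max (- w) (min h w)\<bar> = max 0 (\<bar>h\<bar> - w)"
  using assms by (auto simp: max_def min_def)

text \<open>Uniform integrability is expressed as domination up to a small excess:
  \<open>ennreal\<close> cuts |F n x| - W x off at 0, and what remains has integral at most e.
  Functions clipped to the range from -W to W converge by dominated convergence, and the excess of
  the limit is controlled by Fatou's lemma.\<close>

lemma vitali_convergence:
  fixes F :: "nat \<Rightarrow> 'x \<Rightarrow> real"
  assumes F: "\<And>n. integrable M (F n)" and G[measurable]: "G \<in> borel_measurable M"
    and ae: "AE x in M. (\<lambda>n. F n x) \<longlonglongrightarrow> G x"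
    and ui: "\<And>e. e > 0 \<Longrightarrow> \<exists>W. integrable M W \<and> (\<forall>x. W x \<ge> 0) \<and> (\<forall>n. (\<integral>\<^sup>+x. ennreal (\<bar>F n x\<bar> - W x) \<partial>M) \<le> ennreal e)"
  shows "integrable M G" "(\<lambda>n. \<integral>x. F n x \<partial>M) \<longlonglongrightarrow> (\<integral>x. G x \<partial>M)"
proof -
  have Fm [measurable]: "F n \<in> borel_measurable M" for n using F by (rule borel_measurable_integrable)
  have fatou: "(\<integral>\<^sup>+x. ennreal (\<bar>G x\<bar> - W x) \<partial>M) \<le> ennreal e"
    if W: "W \<in> borel_measurable M" "\<And>n. (\<integral>\<^sup>+x. ennreal (\<bar>F n x\<bar> - W x) \<partial>M) \<le> ennreal e" for W e
  proof -
    note W(1)[measurable]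
    have "(\<integral>\<^sup>+x. ennreal (\<bar>G x\<bar> - W x) \<partial>M) = (\<integral>\<^sup>+x. liminf (\<lambda>n. ennreal (\<bar>F n x\<bar> - W x)) \<partial>M)"
    proof (rule nn_integral_cong_AE)
      show "AE x in M. ennreal (\<bar>G x\<bar> - W x) = liminf (\<lambda>n. ennreal (\<bar>F n x\<bar> - W x))"
        using ae
      proof eventually_elim
        case (elim x)
        then have "(\<lambda>n. ennreal (\<bar>F n x\<bar> - W x)) \<longlonglongrightarrow> ennreal (\<bar>G x\<bar> - W x)"
          by (intro tendsto_ennrealI tendsto_intros)
        then show ?case by (intro lim_imp_Liminf[symmetric]) auto
      qed
    qed
    also have "\<dots> \<le> liminf (\<lambda>n. \<integral>\<^sup>+x. ennreal (\<bar>F n x\<bar> - W x) \<partial>M)"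
      by (intro nn_integral_liminf) measurable
    also have "\<dots> \<le> ennreal e"
      by (intro Liminf_le always_eventually allI W) auto
    finally show ?thesis .
  qed
  have split_int: "integrable M H" "integrable M (\<lambda>x. max (- W x) (min (H x) (W x)))"
    "\<bar>(\<integral>x. H x \<partial>M) - (\<integral>x. max (- W x) (min (H x) (W x)) \<partial>M)\<bar> \<le> e"
    if W: "integrable M W" "\<And>x. W x \<ge> 0" and H[measurable]: "H \<in> borel_measurable M"
      and le: "(\<integral>\<^sup>+x. ennreal (\<bar>H x\<bar> - W x) \<partial>M) \<le> ennreal e" and e: "e > 0" for W H e
  proof -
    have [measurable]: "W \<in> borel_measurable M" using W(1) by (rule borel_measurable_integrable)
    let ?c = "\<lambda>x. max (- W x) (min (H x) (W x))"
    show c: "integrable M ?c"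
    proof (rule Bochner_Integration.integrable_bound[OF W(1)])
      show "AE x in M. norm (?c x) \<le> norm (W x)"
        using clip_bounds(1)[OF W(2)] W(2) unfolding real_norm_def by (intro AE_I2) (metis abs_of_nonneg)
    qed measurable
    have eq: "ennreal (\<bar>H x\<bar> - W x) = ennreal (norm (H x - ?c x))" for x
      unfolding real_norm_def clip_bounds(2)[OF W(2)] by (simp add: max_def ennreal_neg)
    have d: "integrable M (\<lambda>x. H x - ?c x)"
      using le unfolding eq by (intro integrableI_bounded) (auto intro: order_le_less_trans)
    show H_int: "integrable M H"
      using Bochner_Integration.integrable_add[OF d c] by simp
    have "ennreal (norm (\<integral>x. H x - ?c x \<partial>M)) \<le> (\<integral>\<^sup>+x. ennreal (norm (H x - ?c x)) \<partial>M)"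
      by (rule integral_norm_bound_ennreal[OF d])
    also have "\<dots> \<le> ennreal e" using le unfolding eq .
    finally have "norm (\<integral>x. H x - ?c x \<partial>M) \<le> e" using e by simp
    then show "\<bar>(\<integral>x. H x \<partial>M) - (\<integral>x. ?c x \<partial>M)\<bar> \<le> e"
      unfolding Bochner_Integration.integral_diff[OF H_int c] real_norm_def .
  qed
  obtain W1 where "integrable M W1" "\<forall>x. W1 x \<ge> 0" "\<forall>n. (\<integral>\<^sup>+x. ennreal (\<bar>F n x\<bar> - W1 x) \<partial>M) \<le> ennreal 1"
    using ui[of 1] by auto
  then show "integrable M G"
    using split_int(1)[of W1 G 1] fatou[of W1 1] by auto
  show "(\<lambda>n. \<integral>x. F n x \<partial>M) \<longlonglongrightarrow> (\<integral>x. G x \<partial>M)"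
  proof (rule LIMSEQ_I)
    fix e :: real assume e: "e > 0"
    then obtain W where W: "integrable M W" "\<And>x. W x \<ge> 0" "\<And>n. (\<integral>\<^sup>+x. ennreal (\<bar>F n x\<bar> - W x) \<partial>M) \<le> ennreal (e / 4)"
      using ui[of "e / 4"] by auto
    have [measurable]: "W \<in> borel_measurable M" using W(1) by (rule borel_measurable_integrable)
    let ?c = "\<lambda>H x. max (- W x) (min (H x) (W x))"
    have "(\<lambda>n. \<integral>x. ?c (F n) x \<partial>M) \<longlonglongrightarrow> (\<integral>x. ?c G x \<partial>M)"
    proof (rule integral_dominated_convergence[OF _ _ W(1)])
      show "AE x in M. (\<lambda>n. ?c (F n) x) \<longlonglongrightarrow> ?c G x"
        using ae by eventually_elim (intro tendsto_intros)
      show "AE x in M. norm (?c (F n) x) \<le> W x" for n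
        unfolding real_norm_def by (intro AE_I2 clip_bounds(1) W(2))
    qed auto
    from LIMSEQ_D[OF this, of "e / 4"] e
    obtain N where N: "\<And>n. n \<ge> N \<Longrightarrow> norm ((\<integral>x. ?c (F n) x \<partial>M) - (\<integral>x. ?c G x \<partial>M)) < e / 4"
      by auto
    show "\<exists>N. \<forall>n\<ge>N. norm ((\<integral>x. F n x \<partial>M) - (\<integral>x. G x \<partial>M)) < e"
    proof (intro exI[of _ N] allI impI)
      fix n assume "n \<ge> N"
      then have "norm ((\<integral>x. ?c (F n) x \<partial>M) - (\<integral>x. ?c G x \<partial>M)) < e / 4" by (rule N)
      moreover have "\<bar>(\<integral>x. F n x \<partial>M) - (\<integral>x. ?c (F n) x \<partial>M)\<bar> \<le> e / 4"
        using e W by (intro split_int(3)) auto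
      moreover have "\<bar>(\<integral>x. G x \<partial>M) - (\<integral>x. ?c G x \<partial>M)\<bar> \<le> e / 4"
        using e W fatou[of W "e / 4"] by (intro split_int(3)) auto
      ultimately show "norm ((\<integral>x. F n x \<partial>M) - (\<integral>x. G x \<partial>M)) < e"
        using e unfolding real_norm_def abs_le_iff abs_less_iff by argo
    qed
  qed
qed

lemma tail_small:
  fixes h v :: "'a::euclidean_space \<Rightarrow> real"
  assumes h: "integrable lborel h" "\<And>x. h x \<ge> 0" and [measurable]: "v \<in> borel_measurable borel" and e: "e > 0"
  obtains m where "m \<ge> 1" "(\<integral>\<^sup>+x. ennreal (h x * (if norm x \<le> m \<and> v x \<le> m then 0 else 1)) \<partial>lborel) \<le> ennreal e"
proof -
  have [measurable]: "h \<in> borel_measurable borel" using borel_measurable_integrable[OF h(1)] by simp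
  define T where "T n x = h x * (if norm x \<le> real n \<and> v x \<le> real n then 0 else 1)" for n x
  have "(\<lambda>n. \<integral>x. T n x \<partial>lborel) \<longlonglongrightarrow> (\<integral>x. (0::real) \<partial>(lborel :: 'a measure))"
  proof (rule integral_dominated_convergence[OF _ _ h(1)])
    show "AE x in lborel. (\<lambda>n. T n x) \<longlonglongrightarrow> 0"
    proof (intro AE_I2 tendsto_eventually)
      fix x
      obtain n0 where "max (norm x) (v x) \<le> real n0" using real_arch_simple by blast
      then show "\<forall>\<^sub>F n in sequentially. T n x = 0"
        unfolding eventually_sequentially T_def by (intro exI[of _ n0]) (auto intro: order_trans)
    qed
    show "AE x in lborel. norm (T n x) \<le> h x" for n using h(2) by (auto simp: T_def)
    show "T n \<in> borel_measurable lborel" for n unfolding T_def[abs_def] by measurable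
  qed simp
  then obtain n0 where n0: "\<And>n. n \<ge> n0 \<Longrightarrow> (\<integral>x. T n x \<partial>lborel) < e"
    using order_tendstoD(2)[of _ 0 sequentially e] e by (fastforce simp: eventually_sequentially)
  have T0: "T n x \<ge> 0" for n x using h(2) by (simp add: T_def)
  have "integrable lborel (T n)" for n
    by (rule Bochner_Integration.integrable_bound[OF h(1)]) (use h(2) in \<open>auto simp: T_def[abs_def]\<close>)
  then have "(\<integral>\<^sup>+x. ennreal (T n x) \<partial>lborel) = ennreal (\<integral>x. T n x \<partial>lborel)" for n
    using T0 by (intro nn_integral_eq_integral) auto
  then show ?thesis
    using n0[of "max 1 n0"] by (intro that[of "real (max 1 n0)"]) (auto simp: T_def[abs_def] intro!: ennreal_leI)
qed

lemma AE_lborel2_fst: "AE x in lborel. P x \<Longrightarrow> AE p in lborel2. P (fst p)"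
  and AE_lborel2_snd: "AE x in lborel. P x \<Longrightarrow> AE p in lborel2. P (snd p)"
proof -
  assume "AE x in lborel. P x"
  then obtain N where N: "{x \<in> space lborel. \<not> P x} \<subseteq> N" "emeasure lborel N = 0" "N \<in> sets lborel" by (rule AE_E)
  have "emeasure lborel2 (N \<times> UNIV) = 0"
    using N by (subst lborel.emeasure_pair_measure_Times) auto
  then show "AE p in lborel2. P (fst p)"
    using N by (intro AE_I[of _ _ "N \<times> UNIV"]) (auto simp: space_pair_measure)
  have "emeasure lborel2 (UNIV \<times> N) = 0"
    using N by (subst lborel.emeasure_pair_measure_Times) auto
  then show "AE p in lborel2. P (snd p)"
    using N by (intro AE_I[of _ _ "UNIV \<times> N"]) (auto simp: space_pair_measure)
qed

section \<open>Inequalities for powers, and convergence of the double integral\<close>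

lemma powr_absorb:
  fixes p s \<delta> :: real
  assumes p: "0 < p" "p < s" and \<delta>: "\<delta> > 0"
  obtains C where "C \<ge> 0" "\<And>X. X \<ge> 0 \<Longrightarrow> X powr p \<le> \<delta> * X powr s + C"
proof -
  \<comment> \<open>The threshold at which \<delta> L^(s - p) = 1: below it the constant dominates,
    above it the higher power.\<close>
  define L where "L = (1 / \<delta>) powr (1 / (s - p))"
  have L: "L > 0" "L powr (s - p) = 1 / \<delta>" using \<delta> p by (simp_all add: L_def powr_powr)
  show ?thesis
  proof (rule that[of "L powr p"])
    fix X :: real assume X: "X \<ge> 0"
    show "X powr p \<le> \<delta> * X powr s + L powr p"
    proof (cases "X \<le> L")
      case True
      then have "X powr p \<le> L powr p" using X p by (intro powr_mono2) auto
      then show ?thesis using \<delta> by (smt (verit) mult_nonneg_nonneg powr_ge_zero)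
    next
      case False
      then have "L powr (s - p) \<le> X powr (s - p)" using L p by (intro powr_mono2) auto
      then have "1 \<le> \<delta> * X powr (s - p)" using L \<delta> by (simp add: field_simps)
      then have "X powr p * 1 \<le> X powr p * (\<delta> * X powr (s - p))" by (intro mult_left_mono) auto
      also have "\<dots> = \<delta> * X powr s" by (simp flip: powr_add)
      finally show ?thesis by (smt (verit) powr_ge_zero)
    qed
  qed simp
qed

lemma powr_max_le: "0 \<le> a \<Longrightarrow> 0 \<le> b \<Longrightarrow> max a b powr s \<le> a powr s + b powr (s::real)"
  by (auto simp: max_def)

lemma powr_mult_max:
  fixes b c p :: real
  assumes "b \<ge> 0" "c \<ge> 0" "p > 1"
  shows "b powr (p - 1) * c \<le> max b c powr p"
proof (cases "max b c = 0")
  case False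
  then have "max b c > 0" using assms by (auto simp: max_def)
  have "b powr (p - 1) * c \<le> max b c powr (p - 1) * max b c"
    using assms by (intro mult_mono powr_mono2) auto
  also have "\<dots> = max b c powr p" using \<open>max b c > 0\<close> by (simp add: powr_diff)
  finally show ?thesis .
next
  case True
  then have "c = 0" using assms by (auto simp: max_def split: if_splits)
  then show ?thesis by simp
qed

text \<open>At t = 0 both sides are 0, since \<open>0 powr a = 0\<close> for every a; for other t
  the exponents add, also when p - 2 is negative.\<close>

lemma abs_signed_powr: "\<bar>\<bar>t\<bar> powr (p - 2) * t\<bar> = \<bar>t\<bar> powr (p - 1 :: real)"
proof (cases "t = 0")
  case False
  have "\<bar>\<bar>t\<bar> powr (p - 2) * t\<bar> = \<bar>t\<bar> powr (p - 2) * \<bar>t\<bar> powr 1" using False by (simp add: abs_mult)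
  also have "\<dots> = \<bar>t\<bar> powr (p - 1)" by (simp only: powr_add[symmetric]) simp
  finally show ?thesis .
qed simp

lemma abs_signed_powr_mult: "\<bar>\<bar>t\<bar> powr (p - 2) * t * c\<bar> = \<bar>t\<bar> powr (p - 1 :: real) * \<bar>c\<bar>"
  by (subst abs_mult) (simp only: abs_signed_powr)

lemma tendsto_abs_powr:
  assumes "a \<longlonglongrightarrow> (l::real)" "p > 0" shows "(\<lambda>n. \<bar>a n\<bar> powr p) \<longlonglongrightarrow> \<bar>l\<bar> powr p"
  using assms by (intro tendsto_powr' tendsto_intros) auto

text \<open>At l = 0 the factor with exponent p - 2 may blow up, so the limit is read off from the
  modulus, which has the positive exponent p - 1.\<close>

lemma tendsto_signed_powr:
  assumes a: "a \<longlonglongrightarrow> (l::real)" and p: "p > 1"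
  shows "(\<lambda>n. \<bar>a n\<bar> powr (p - 2) * a n) \<longlonglongrightarrow> \<bar>l\<bar> powr (p - 2) * l"
proof (cases "l = 0")
  case True
  have "(\<lambda>n. \<bar>a n\<bar> powr (p - 1)) \<longlonglongrightarrow> \<bar>l\<bar> powr (p - 1)" by (rule tendsto_abs_powr[OF a]) (use p in simp)
  then have "(\<lambda>n. \<bar>\<bar>a n\<bar> powr (p - 2) * a n\<bar>) \<longlonglongrightarrow> 0" using True by (simp add: abs_signed_powr)
  then show ?thesis using True by (simp add: tendsto_rabs_zero_iff)
next
  case False
  then show ?thesis using a by (intro tendsto_intros) auto
qed

text \<open>Boundedness of u n in L^(p t) alone gives no uniform integrability; it comes from the
  fixed factors. Where \<phi> or k is large or its argument far out, Young's inequality makes the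
  integral small. In the remaining region x, y, \<phi> and k are bounded, and the power p is
  absorbed by a small multiple of the power s = p t plus a constant, which supplies the dominating
  function.\<close>

lemma bform_convergence:
  fixes u :: "nat \<Rightarrow> 'a::euclidean_space \<Rightarrow> real"
  assumes k: "young_kernel t k" and p: "p > 1"
    and um [measurable]: "\<And>n. u n \<in> borel_measurable borel" "v \<in> borel_measurable borel" "\<phi> \<in> borel_measurable borel"
    and A: "\<And>n. (\<integral>\<^sup>+x. ennreal (\<bar>u n x\<bar> powr (p * t)) \<partial>lborel) \<le> ennreal A"
    and \<Phi>: "(\<integral>\<^sup>+x. ennreal (\<bar>\<phi> x\<bar> powr (p * t)) \<partial>lborel) < \<infinity>"
    and ae: "AE x in lborel. (\<lambda>n. u n x) \<longlonglongrightarrow> v x"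
  shows "(\<lambda>n. bform k (\<lambda>x. \<bar>u n x\<bar> powr p) (\<lambda>x. \<bar>u n x\<bar> powr (p - 2) * u n x * \<phi> x))
     \<longlonglongrightarrow> bform k (\<lambda>x. \<bar>v x\<bar> powr p) (\<lambda>x. \<bar>v x\<bar> powr (p - 2) * v x * \<phi> x)"
  unfolding bform_def
proof (rule vitali_convergence(2))
  have km [measurable]: "k \<in> borel_measurable borel" and k0: "\<And>z. 0 \<le> k z" and t: "1 < t" "t < 2"
    using k by (auto simp: young_kernel_def)
  define s where "s = p * t"
  define r where "r = t / (2 * t - 2)"
  have s: "p < s" "s > 0" using p t by (simp_all add: s_def)
  have r: "r > 0" using t by (simp add: r_def)
  define A' where "A' = max 0 A"
  have A': "A' \<ge> 0" "\<And>n. (\<integral>\<^sup>+x. ennreal (\<bar>u n x\<bar> powr s) \<partial>lborel) \<le> ennreal A'"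
    unfolding A'_def s_def by (simp, rule order_trans[OF A ennreal_leI], simp)
  obtain K where K: "K \<ge> 0" "(\<integral>\<^sup>+x. ennreal (k x powr r) \<partial>lborel) \<le> ennreal K"
    using young_kernel_bound[OF k] unfolding r_def .
  obtain P where P: "P \<ge> 0" "(\<integral>\<^sup>+x. ennreal (\<bar>\<phi> x\<bar> powr s) \<partial>lborel) = ennreal P"
    using \<Phi> ennreal_finite_real unfolding s_def by (metis less_irrefl)
  have pt: "(\<bar>y\<bar> powr p) powr t = \<bar>y\<bar> powr s" for y :: real by (simp add: powr_powr s_def)
  have max_int: "(\<integral>\<^sup>+x. ennreal ((max \<bar>u n x\<bar> (w x) powr p) powr t) \<partial>lborel) \<le> ennreal (A' + Q)"
    if [measurable]: "w \<in> borel_measurable borel" and w: "\<And>x. w x \<ge> 0" "(\<integral>\<^sup>+x. ennreal (w x powr s) \<partial>lborel) \<le> ennreal Q" "Q \<ge> 0"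
    for n w Q
  proof -
    have "(\<integral>\<^sup>+x. ennreal ((max \<bar>u n x\<bar> (w x) powr p) powr t) \<partial>lborel)
      \<le> (\<integral>\<^sup>+x. ennreal (\<bar>u n x\<bar> powr s) + ennreal (w x powr s) \<partial>lborel)"
      using powr_max_le[of "\<bar>u n x\<bar>" "w x" s for x] w(1)
      by (intro nn_integral_mono) (simp add: powr_powr s_def[symmetric] ennreal_plus[symmetric] ennreal_leI del: ennreal_plus)
    also have "\<dots> \<le> ennreal A' + ennreal Q"
      using A'(2)[of n] w(2) by (simp add: nn_integral_add add_mono)
    finally show ?thesis using A' w by simp
  qed
  let ?F = "\<lambda>n z. \<bar>u n (fst z)\<bar> powr p * k (fst z - snd z) * (\<bar>u n (snd z)\<bar> powr (p - 2) * u n (snd z) * \<phi> (snd z))"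
  have absF: "\<bar>?F n z\<bar> = \<bar>u n (fst z)\<bar> powr p * k (fst z - snd z) * (\<bar>u n (snd z)\<bar> powr (p - 1) * \<bar>\<phi> (snd z)\<bar>)" for n z
  proof -
    have "\<bar>a * b * c\<bar> = a * b * \<bar>c\<bar>" if "a \<ge> 0" "b \<ge> 0" for a b c :: real
      using that by (simp add: abs_mult)
    from this[OF powr_ge_zero k0] show ?thesis by (simp only: abs_signed_powr_mult)
  qed
  show "integrable lborel2 (?F n)" for n
  proof (rule young_integrable[OF k])
    show "(\<integral>\<^sup>+x. ennreal (\<bar>\<bar>u n x\<bar> powr p\<bar> powr t) \<partial>lborel) < \<infinity>"
      using A'(2)[of n] by (simp add: pt order_le_less_trans)
    have "(\<integral>\<^sup>+x. ennreal (\<bar>\<bar>u n x\<bar> powr (p - 2) * u n x * \<phi> x\<bar> powr t) \<partial>lborel)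
      \<le> (\<integral>\<^sup>+x. ennreal ((max \<bar>u n x\<bar> \<bar>\<phi> x\<bar> powr p) powr t) \<partial>lborel)"
      using powr_mult_max[OF abs_ge_zero abs_ge_zero p] t
      by (intro nn_integral_mono ennreal_leI powr_mono2) (simp_all add: abs_signed_powr_mult)
    also have "\<dots> \<le> ennreal (A' + P)" using P by (intro max_int) auto
    finally show "(\<integral>\<^sup>+x. ennreal (\<bar>\<bar>u n x\<bar> powr (p - 2) * u n x * \<phi> x\<bar> powr t) \<partial>lborel) < \<infinity>"
      by (simp add: order_le_less_trans)
  qed measurable
  show "AE z in lborel2. (\<lambda>n. ?F n z) \<longlonglongrightarrow> \<bar>v (fst z)\<bar> powr p * k (fst z - snd z) * (\<bar>v (snd z)\<bar> powr (p - 2) * v (snd z) * \<phi> (snd z))"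
    using AE_lborel2_fst[OF ae] AE_lborel2_snd[OF ae]
    by eventually_elim (intro tendsto_mult tendsto_const tendsto_abs_powr tendsto_signed_powr; use p in simp)
  show "(\<lambda>z. \<bar>v (fst z)\<bar> powr p * k (fst z - snd z) * (\<bar>v (snd z)\<bar> powr (p - 2) * v (snd z) * \<phi> (snd z))) \<in> borel_measurable lborel2"
    by measurable
  fix e :: real assume e: "e > 0"
  \<comment> \<open>Q1 is the Young bound for \<open>R1\<close> without its factor l1: mass A' for u
    n, K for the kernel, A' + 1 for the maximum of u n and the rescaled tail of \<phi>. In Q2 the
    rescaled tail of the kernel, of mass at most 1, takes the place of K, and \<phi> itself, of mass
    P, that of its tail.\<close>
  define Q1 where "Q1 = A' * (A' + 1) + A' * K + (A' + 1) * K"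
  define l1 where "l1 = e / (4 * (Q1 + 1))"
  have Q1: "Q1 \<ge> 0" using A' K by (simp add: Q1_def)
  have l1: "l1 > 0" "l1 * Q1 \<le> e / 4" using e Q1 by (simp_all add: l1_def field_simps)
  define Q2 where "Q2 = A' * (A' + P) + A' * 1 + (A' + P) * 1"
  define l2 where "l2 = e / (4 * (Q2 + 1))"
  have Q2: "Q2 \<ge> 0" using A' P by (simp add: Q2_def)
  have l2: "l2 > 0" "l2 * Q2 \<le> e / 4" using e Q2 by (simp_all add: l2_def field_simps)
  have \<phi>_int: "integrable lborel (\<lambda>x. \<bar>\<phi> x\<bar> powr s)"
    using P by (intro integrableI_bounded) auto
  obtain m1 where m1: "m1 \<ge> 1" "(\<integral>\<^sup>+x. ennreal (\<bar>\<phi> x\<bar> powr s * (if norm x \<le> m1 \<and> \<bar>\<phi> x\<bar> \<le> m1 then 0 else 1)) \<partial>lborel) \<le> ennreal (l1 powr s)"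
    by (rule tail_small[OF \<phi>_int, of "\<lambda>x. \<bar>\<phi> x\<bar>" "l1 powr s"]) (use l1 in auto)
  have k_int: "integrable lborel (\<lambda>x. k x powr r)" using k by (simp add: young_kernel_def r_def)
  obtain m2 where m2: "m2 \<ge> 1" "(\<integral>\<^sup>+x. ennreal (k x powr r * (if norm x \<le> m2 \<and> k x \<le> m2 then 0 else 1)) \<partial>lborel) \<le> ennreal (l2 powr r)"
    by (rule tail_small[OF k_int, of k "l2 powr r"]) (use l2 in auto)
  \<comment> \<open>The tails are divided by l1 and l2 and still have mass at most 1: the Young
    bound is not homogeneous, and the small factor is to stand in front of it.\<close>
  define \<phi>1 where "\<phi>1 y = (if norm y \<le> m1 \<and> \<bar>\<phi> y\<bar> \<le> m1 then 0 else \<bar>\<phi> y\<bar>) / l1" for y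
  define k1 where "k1 y = (if norm y \<le> m2 \<and> k y \<le> m2 then 0 else k y) / l2" for y
  have [measurable]: "\<phi>1 \<in> borel_measurable borel" "k1 \<in> borel_measurable borel"
    unfolding \<phi>1_def[abs_def] k1_def[abs_def] by measurable
  have \<phi>10: "\<phi>1 y \<ge> 0" and k10: "k1 y \<ge> 0" for y using l1 l2 k0 by (simp_all add: \<phi>1_def k1_def)
  have \<phi>1_int: "(\<integral>\<^sup>+x. ennreal (\<phi>1 x powr s) \<partial>lborel) \<le> ennreal 1"
  proof -
    have "(\<integral>\<^sup>+x. ennreal (\<phi>1 x powr s) \<partial>lborel)
       = (\<integral>\<^sup>+x. ennreal (1 / l1 powr s) * ennreal (\<bar>\<phi> x\<bar> powr s * (if norm x \<le> m1 \<and> \<bar>\<phi> x\<bar> \<le> m1 then 0 else 1)) \<partial>lborel)"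
      using l1 by (intro nn_integral_cong) (auto simp: \<phi>1_def powr_divide ennreal_mult[symmetric])
    also have "\<dots> \<le> ennreal (1 / l1 powr s) * ennreal (l1 powr s)"
      by (subst nn_integral_cmult) (auto intro!: mult_left_mono m1)
    also have "\<dots> = ennreal 1" using l1 by (simp add: ennreal_mult[symmetric])
    finally show ?thesis .
  qed
  have k1_int: "(\<integral>\<^sup>+x. ennreal (k1 x powr r) \<partial>lborel) \<le> ennreal 1"
  proof -
    have "(\<integral>\<^sup>+x. ennreal (k1 x powr r) \<partial>lborel)
       = (\<integral>\<^sup>+x. ennreal (1 / l2 powr r) * ennreal (k x powr r * (if norm x \<le> m2 \<and> k x \<le> m2 then 0 else 1)) \<partial>lborel)"
      using l2 k0 by (intro nn_integral_cong) (auto simp: k1_def powr_divide ennreal_mult[symmetric])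
    also have "\<dots> \<le> ennreal (1 / l2 powr r) * ennreal (l2 powr r)"
      by (subst nn_integral_cmult) (auto intro!: mult_left_mono m2)
    also have "\<dots> = ennreal 1" using l2 by (simp add: ennreal_mult[symmetric])
    finally show ?thesis .
  qed
  define V where "V = measure lborel (cball (0::'a) m1)"
  have V: "emeasure lborel (cball (0::'a) m1) = ennreal V"
    unfolding V_def by (rule emeasure_eq_ennreal_measure) (use emeasure_lborel_cball_finite[of "0::'a" m1] in \<open>simp add: less_top\<close>)
  have V0: "V \<ge> 0" by (simp add: V_def)
  have [measurable]: "cball (0::'a) m \<in> sets borel" for m by simp
  define Q3 where "Q3 = m1 * m2 * (A' * V + A' * A')"
  have Q3: "Q3 \<ge> 0" using A' V0 m1(1) m2(1) by (simp add: Q3_def)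
  define \<delta> where "\<delta> = e / (4 * (Q3 + 1))"
  have \<delta>: "\<delta> > 0" "\<delta> * Q3 \<le> e / 4" using e Q3 by (simp_all add: \<delta>_def field_simps)
  obtain C where C: "C \<ge> 0" "\<And>X. X \<ge> 0 \<Longrightarrow> X powr p \<le> \<delta> * X powr s + C"
    using powr_absorb[of p s \<delta>] p s \<delta> by (metis less_trans zero_less_one)
  \<comment> \<open>Once the powers have gone into \<open>R3\<close>, only the constants of
    \<open>powr_absorb\<close> are left, on a product of two balls. C occurs twice because
    \<open>b powr (p - 1)\<close> is bounded by 1 + b^p, which makes two terms.\<close>
  define W where "W z = m1 * m2 * (2 * C) * (indicator (cball 0 (m1 + m2)) (fst z) * indicator (cball 0 m1) (snd z))" for z :: "'a \<times> 'a"
  define R1 where "R1 n z = l1 * (\<bar>u n (fst z)\<bar> powr p * k (fst z - snd z) * (max \<bar>u n (snd z)\<bar> (\<phi>1 (snd z)) powr p))" for n and z :: "'a \<times> 'a"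
  define R2 where "R2 n z = l2 * (\<bar>u n (fst z)\<bar> powr p * k1 (fst z - snd z) * (max \<bar>u n (snd z)\<bar> \<bar>\<phi> (snd z)\<bar> powr p))" for n and z :: "'a \<times> 'a"
  define R3 where "R3 n z = m1 * m2 * \<delta> * (\<bar>u n (fst z)\<bar> powr s * indicator (cball 0 m1) (snd z) + \<bar>u n (fst z)\<bar> powr s * \<bar>u n (snd z)\<bar> powr s)" for n and z :: "'a \<times> 'a"
  have R_nonneg: "R1 n z \<ge> 0" "R2 n z \<ge> 0" "R3 n z \<ge> 0" for n z
    using l1(1) l2(1) k0 k10 \<delta>(1) m1(1) m2(1) by (simp_all add: R1_def R2_def R3_def)
  have key: "\<bar>?F n z\<bar> - W z \<le> R1 n z + R2 n z + R3 n z" for n z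
  proof -
    define x y where "x = fst z" and "y = snd z"
    have W0: "W z \<ge> 0" using C m1 m2 by (simp add: W_def)
    consider "\<not> (norm y \<le> m1 \<and> \<bar>\<phi> y\<bar> \<le> m1)" | "\<not> (norm (x - y) \<le> m2 \<and> k (x - y) \<le> m2)"
      | "norm y \<le> m1" "\<bar>\<phi> y\<bar> \<le> m1" "norm (x - y) \<le> m2" "k (x - y) \<le> m2" by blast
    then show ?thesis
    proof cases
      case 1
      then have "\<bar>\<phi> y\<bar> = l1 * \<phi>1 y" using l1 by (auto simp: \<phi>1_def)
      then have "\<bar>?F n z\<bar> = l1 * (\<bar>u n x\<bar> powr p * k (x - y) * (\<bar>u n y\<bar> powr (p - 1) * \<phi>1 y))"
        unfolding absF unfolding x_def[symmetric] y_def[symmetric] by simp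
      also have "\<dots> \<le> l1 * (\<bar>u n x\<bar> powr p * k (x - y) * (max \<bar>u n y\<bar> (\<phi>1 y) powr p))"
        using l1 k0 by (intro mult_left_mono powr_mult_max p \<phi>10) auto
      also have "\<dots> = R1 n z" by (simp add: R1_def x_def y_def)
      finally show ?thesis using R_nonneg[of n z] W0 by linarith
    next
      case 2
      then have "k (x - y) = l2 * k1 (x - y)" using l2 by (auto simp: k1_def)
      then have "\<bar>?F n z\<bar> = l2 * (\<bar>u n x\<bar> powr p * k1 (x - y) * (\<bar>u n y\<bar> powr (p - 1) * \<bar>\<phi> y\<bar>))"
        unfolding absF unfolding x_def[symmetric] y_def[symmetric] by simp
      also have "\<dots> \<le> l2 * (\<bar>u n x\<bar> powr p * k1 (x - y) * (max \<bar>u n y\<bar> \<bar>\<phi> y\<bar> powr p))"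
        using l2 k10 by (intro mult_left_mono powr_mult_max p) auto
      also have "\<dots> = R2 n z" by (simp add: R2_def x_def y_def)
      finally show ?thesis using R_nonneg[of n z] W0 by linarith
    next
      case 3
      have "norm x \<le> m1 + m2" using norm_triangle_ineq[of "x - y" y] 3 by simp
      define a b where "a = \<bar>u n x\<bar>" and "b = \<bar>u n y\<bar>"
      have ab: "a \<ge> 0" "b \<ge> 0" by (simp_all add: a_def b_def)
      have "b powr (p - 1) \<le> 1 + b powr p"
      proof (cases "b \<le> 1")
        case True
        then have "b powr (p - 1) \<le> 1" using ab p by (intro powr_le1) auto
        then show ?thesis by (smt (verit) powr_ge_zero)
      next
        case False
        then have "b powr (p - 1) \<le> b powr p" by (intro powr_mono) auto
        then show ?thesis by linarith
      qed
      then have "a powr p * b powr (p - 1) \<le> a powr p * (1 + b powr p)" by (intro mult_left_mono) auto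
      also have "\<dots> = a powr p + (a * b) powr p" using ab by (simp add: powr_mult distrib_left)
      also have "\<dots> \<le> (\<delta> * a powr s + C) + (\<delta> * (a * b) powr s + C)"
        using ab by (intro add_mono C) auto
      also have "\<dots> = \<delta> * (a powr s + a powr s * b powr s) + 2 * C" using ab by (simp add: powr_mult algebra_simps)
      finally have *: "a powr p * b powr (p - 1) \<le> \<delta> * (a powr s + a powr s * b powr s) + 2 * C" .
      have "\<bar>?F n z\<bar> = a powr p * k (x - y) * (b powr (p - 1) * \<bar>\<phi> y\<bar>)"
        unfolding absF by (simp add: a_def b_def x_def y_def)
      also have "\<dots> \<le> a powr p * m2 * (b powr (p - 1) * m1)"
        using 3 k0 m1(1) m2(1) by (intro mult_mono mult_left_mono mult_nonneg_nonneg) auto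
      also have "\<dots> = m1 * m2 * (a powr p * b powr (p - 1))" by simp
      also have "\<dots> \<le> m1 * m2 * (\<delta> * (a powr s + a powr s * b powr s) + 2 * C)"
        using * m1(1) m2(1) by (intro mult_left_mono) auto
      also have "\<dots> = R3 n z + W z"
        using 3 \<open>norm x \<le> m1 + m2\<close> by (simp add: R3_def W_def a_def b_def x_def y_def algebra_simps)
      finally show ?thesis using R_nonneg[of n z] by linarith
    qed
  qed
  have I1: "(\<integral>\<^sup>+z. ennreal (R1 n z) \<partial>lborel2) \<le> ennreal (e / 4)" for n
  proof -
    have "(\<integral>\<^sup>+z. ennreal (R1 n z) \<partial>lborel2)
      = ennreal l1 * (\<integral>\<^sup>+z. ennreal (\<bar>u n (fst z)\<bar> powr p * k (fst z - snd z) * (max \<bar>u n (snd z)\<bar> (\<phi>1 (snd z)) powr p)) \<partial>lborel2)"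
      using l1 k0 unfolding R1_def by (subst nn_integral_cmult[symmetric]) (auto simp: ennreal_mult)
    also have "\<dots> \<le> ennreal l1 * ennreal Q1"
      unfolding Q1_def
    proof (rule mult_left_mono[OF young_nn_integral[where t = t]])
      show "(\<integral>\<^sup>+x. ennreal ((max \<bar>u n x\<bar> (\<phi>1 x) powr p) powr t) \<partial>lborel) \<le> ennreal (A' + 1)"
        by (intro max_int \<phi>1_int \<phi>10) auto
    qed (use A' K k0 t in \<open>auto simp: pt r_def[symmetric]\<close>)
    also have "\<dots> \<le> ennreal (e / 4)" using l1 Q1 by (simp add: ennreal_mult[symmetric] ennreal_leI)
    finally show ?thesis .
  qed
  have I2: "(\<integral>\<^sup>+z. ennreal (R2 n z) \<partial>lborel2) \<le> ennreal (e / 4)" for n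
  proof -
    have "(\<integral>\<^sup>+z. ennreal (R2 n z) \<partial>lborel2)
      = ennreal l2 * (\<integral>\<^sup>+z. ennreal (\<bar>u n (fst z)\<bar> powr p * k1 (fst z - snd z) * (max \<bar>u n (snd z)\<bar> \<bar>\<phi> (snd z)\<bar> powr p)) \<partial>lborel2)"
      using l2 k10 unfolding R2_def by (subst nn_integral_cmult[symmetric]) (auto simp: ennreal_mult)
    also have "\<dots> \<le> ennreal l2 * ennreal Q2"
      unfolding Q2_def
    proof (rule mult_left_mono[OF young_nn_integral[where t = t]])
      show "(\<integral>\<^sup>+x. ennreal ((max \<bar>u n x\<bar> \<bar>\<phi> x\<bar> powr p) powr t) \<partial>lborel) \<le> ennreal (A' + P)"
        using P by (intro max_int) auto
    qed (use A' P k1_int k10 t in \<open>auto simp: pt r_def[symmetric]\<close>)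
    also have "\<dots> \<le> ennreal (e / 4)" using l2 Q2 by (simp add: ennreal_mult[symmetric] ennreal_leI)
    finally show ?thesis .
  qed
  have I3: "(\<integral>\<^sup>+z. ennreal (R3 n z) \<partial>lborel2) \<le> ennreal (e / 4)" for n
  proof -
    have "(\<integral>\<^sup>+z. ennreal (R3 n z) \<partial>lborel2) = ennreal (m1 * m2 * \<delta>) *
       (\<integral>\<^sup>+z. ennreal (\<bar>u n (fst z)\<bar> powr s) * indicator (cball 0 m1) (snd z) + ennreal (\<bar>u n (fst z)\<bar> powr s) * ennreal (\<bar>u n (snd z)\<bar> powr s) \<partial>lborel2)"
      using m1(1) m2(1) \<delta>(1) unfolding R3_def
      by (subst nn_integral_cmult[symmetric], measurable)
         (auto simp: ennreal_mult[symmetric] ennreal_indicator[symmetric] ennreal_plus[symmetric] simp del: ennreal_plus intro!: nn_integral_cong)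
    also have "(\<integral>\<^sup>+z. ennreal (\<bar>u n (fst z)\<bar> powr s) * indicator (cball 0 m1) (snd z) + ennreal (\<bar>u n (fst z)\<bar> powr s) * ennreal (\<bar>u n (snd z)\<bar> powr s) \<partial>lborel2)
      = (\<integral>\<^sup>+x. ennreal (\<bar>u n x\<bar> powr s) \<partial>lborel) * ennreal V + (\<integral>\<^sup>+x. ennreal (\<bar>u n x\<bar> powr s) \<partial>lborel) * (\<integral>\<^sup>+x. ennreal (\<bar>u n x\<bar> powr s) \<partial>lborel)"
      using nn_integral_prod_mult(1)[of "\<lambda>x. ennreal (\<bar>u n x\<bar> powr s)" "\<lambda>x. ennreal (\<bar>u n x\<bar> powr s)"]
        nn_integral_prod_mult(1)[of "\<lambda>x. ennreal (\<bar>u n x\<bar> powr s)" "indicator (cball 0 m1)"]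
      by (simp add: nn_integral_add V)
    also have "ennreal (m1 * m2 * \<delta>) * \<dots> \<le> ennreal (m1 * m2 * \<delta>) * (ennreal A' * ennreal V + ennreal A' * ennreal A')"
      by (intro mult_left_mono add_mono mult_mono A') auto
    also have "\<dots> = ennreal (\<delta> * Q3)"
      using A' V0 m1(1) m2(1) \<delta>(1) by (simp add: Q3_def ennreal_mult[symmetric] ennreal_plus[symmetric] mult_ac del: ennreal_plus)
    also have "\<dots> \<le> ennreal (e / 4)" using \<delta> by (intro ennreal_leI)
    finally show ?thesis .
  qed
  show "\<exists>W. integrable lborel2 W \<and> (\<forall>z. W z \<ge> 0) \<and> (\<forall>n. (\<integral>\<^sup>+z. ennreal (\<bar>?F n z\<bar> - W z) \<partial>lborel2) \<le> ennreal e)"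
  proof (intro exI[of _ W] conjI allI)
    show "W z \<ge> 0" for z using C m1 m2 by (simp add: W_def)
    have "integrable lborel2 (\<lambda>z. indicator (cball (0::'a) (m1 + m2) \<times> cball (0::'a) m1) z :: real)"
      using emeasure_lborel_cball_finite[of "0::'a" "m1 + m2"] emeasure_lborel_cball_finite[of "0::'a" m1]
      by (intro integrable_real_indicator) (auto simp: lborel.emeasure_pair_measure_Times ennreal_mult_less_top)
    then have "integrable lborel2 (\<lambda>z. m1 * m2 * (2 * C) * (indicator (cball (0::'a) (m1 + m2) \<times> cball (0::'a) m1) z :: real))"
      by (rule integrable_mult_right)
    also have "(\<lambda>z. m1 * m2 * (2 * C) * (indicator (cball (0::'a) (m1 + m2) \<times> cball (0::'a) m1) z :: real)) = W"
      by (rule ext) (simp add: W_def indicator_times)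
    finally show "integrable lborel2 W" .
    fix n
    have "(\<integral>\<^sup>+z. ennreal (\<bar>?F n z\<bar> - W z) \<partial>lborel2) \<le> (\<integral>\<^sup>+z. ennreal (R1 n z) + ennreal (R2 n z) + ennreal (R3 n z) \<partial>lborel2)"
      using key R_nonneg by (intro nn_integral_mono) (simp add: ennreal_plus[symmetric] ennreal_leI del: ennreal_plus)
    also have "\<dots> = (\<integral>\<^sup>+z. ennreal (R1 n z) \<partial>lborel2) + (\<integral>\<^sup>+z. ennreal (R2 n z) \<partial>lborel2) + (\<integral>\<^sup>+z. ennreal (R3 n z) \<partial>lborel2)"
      unfolding R1_def R2_def R3_def by (simp add: nn_integral_add)
    also have "\<dots> \<le> ennreal (e / 4) + ennreal (e / 4) + ennreal (e / 4)"
      by (intro add_mono I1 I2 I3)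
    also have "\<dots> \<le> ennreal e" using e by (simp add: ennreal_plus[symmetric] ennreal_leI del: ennreal_plus)
    finally show "(\<integral>\<^sup>+z. ennreal (\<bar>?F n z\<bar> - W z) \<partial>lborel2) \<le> ennreal e" .
  qed
qed

section \<open>The Choquard functional\<close>

text \<open>Convexity of the power in tangent form, read off from Young's inequality for a and b^(p
  - 1) with conjugate exponents p and p / (p - 1).\<close>

lemma powr_tangent:
  fixes a b p :: real
  assumes "a \<ge> 0" "b \<ge> 0" "p > 1"
  shows "b powr p + p * b powr (p - 1) * (a - b) \<le> a powr p"
proof -
  define q where "q = p / (p - 1)"
  have q: "q > 1" "1 / p + 1 / q = 1" using assms(3) by (auto simp: q_def field_simps)
  have "a * b powr (p - 1) \<le> a powr p / p + (b powr (p - 1)) powr q / q"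
    by (rule Youngs_inequality) (use assms q in auto)
  also have "(b powr (p - 1)) powr q = b powr p" using assms(3) by (simp add: powr_powr q_def)
  also have "b powr p / q = b powr p * (p - 1) / p" by (simp add: q_def)
  finally have "a * b powr (p - 1) * p \<le> a powr p + b powr p * (p - 1)"
    using assms(3) by (simp add: field_simps)
  moreover have "b powr (p - 1) * b = b powr p"
    using assms by (cases "b = 0") (simp_all add: powr_diff)
  then have "p * b powr (p - 1) * (a - b) = a * b powr (p - 1) * p - b powr p * p"
    by (simp add: algebra_simps)
  ultimately show ?thesis by (simp only: right_diff_distrib mult_1_right)
qed

text \<open>The tangent inequality at the modulus, combined with x (x + h) \<le> |x| |x + h|. It
  bounds the first order term of \<open>D\<close> from one side without any smallness of h.\<close>

lemma abs_powr_convex: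
  fixes x h p :: real
  assumes p: "p > 1"
  shows "\<bar>x\<bar> powr p + p * (\<bar>x\<bar> powr (p - 2) * x * h) \<le> \<bar>x + h\<bar> powr p"
proof -
  have "\<bar>x\<bar> powr (p - 2) * x * h \<le> \<bar>x\<bar> powr (p - 1) * (\<bar>x + h\<bar> - \<bar>x\<bar>)"
  proof (cases "x = 0")
    case False
    have e: "\<bar>x\<bar> powr (p - 1) = \<bar>x\<bar> powr (p - 2) * \<bar>x\<bar>"
      using abs_signed_powr[of x p] by (simp add: abs_mult)
    have "x * (x + h) \<le> \<bar>x\<bar> * \<bar>x + h\<bar>" by (metis abs_ge_self abs_mult)
    then have "x * h \<le> \<bar>x\<bar> * (\<bar>x + h\<bar> - \<bar>x\<bar>)" by (simp add: algebra_simps)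
    then have "\<bar>x\<bar> powr (p - 2) * (x * h) \<le> \<bar>x\<bar> powr (p - 2) * (\<bar>x\<bar> * (\<bar>x + h\<bar> - \<bar>x\<bar>))"
      by (intro mult_left_mono) auto
    then show ?thesis by (simp add: e mult.assoc)
  qed simp
  then have "p * (\<bar>x\<bar> powr (p - 2) * x * h) \<le> p * (\<bar>x\<bar> powr (p - 1) * (\<bar>x + h\<bar> - \<bar>x\<bar>))"
    using p by (intro mult_left_mono) auto
  then have "\<bar>x\<bar> powr p + p * (\<bar>x\<bar> powr (p - 2) * x * h) \<le> \<bar>x\<bar> powr p + p * \<bar>x\<bar> powr (p - 1) * (\<bar>x + h\<bar> - \<bar>x\<bar>)"
    by (simp only: mult.assoc add_le_cancel_left)
  also have "\<dots> \<le> \<bar>x + h\<bar> powr p" using p by (intro powr_tangent) auto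
  finally show ?thesis .
qed

text \<open>Two tangent inequalities, at x and at x + h. This yields the second order error in
  \<open>D_expansion\<close>.\<close>

lemma abs_powr_lipschitz:
  fixes x h p :: real
  assumes p: "p > 1"
  shows "\<bar>\<bar>x + h\<bar> powr p - \<bar>x\<bar> powr p\<bar> \<le> p * \<bar>h\<bar> * (\<bar>x\<bar> + \<bar>h\<bar>) powr (p - 1)"
proof -
  define m where "m = (\<bar>x\<bar> + \<bar>h\<bar>) powr (p - 1)"
  have m: "\<bar>x + h\<bar> powr (p - 1) \<le> m" "\<bar>x\<bar> powr (p - 1) \<le> m"
    unfolding m_def using p by (intro powr_mono2; simp)+
  have *: "p * b * (c - d) \<le> p * \<bar>h\<bar> * m" if "0 \<le> b" "b \<le> m" "c - d \<le> \<bar>h\<bar>" for b c d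
  proof -
    have "b * (c - d) \<le> b * \<bar>h\<bar>" using that by (intro mult_left_mono) auto
    also have "\<dots> \<le> m * \<bar>h\<bar>" using that by (intro mult_right_mono) auto
    finally have "p * (b * (c - d)) \<le> p * (m * \<bar>h\<bar>)" using p by (intro mult_left_mono) auto
    then show ?thesis by (simp add: mult_ac)
  qed
  have i1: "p * \<bar>x + h\<bar> powr (p - 1) * (\<bar>x + h\<bar> - \<bar>x\<bar>) \<le> p * \<bar>h\<bar> * m"
    using m by (intro *) auto
  have i2: "p * \<bar>x\<bar> powr (p - 1) * (\<bar>x\<bar> - \<bar>x + h\<bar>) \<le> p * \<bar>h\<bar> * m"
    using m by (intro *) auto
  have t1: "\<bar>x + h\<bar> powr p - \<bar>x\<bar> powr p \<le> p * \<bar>x + h\<bar> powr (p - 1) * (\<bar>x + h\<bar> - \<bar>x\<bar>)"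
    using powr_tangent[of "\<bar>x\<bar>" "\<bar>x + h\<bar>" p] p by (simp add: right_diff_distrib)
  have t2: "\<bar>x\<bar> powr p - \<bar>x + h\<bar> powr p \<le> p * \<bar>x\<bar> powr (p - 1) * (\<bar>x\<bar> - \<bar>x + h\<bar>)"
    using powr_tangent[of "\<bar>x + h\<bar>" "\<bar>x\<bar>" p] p by (simp add: right_diff_distrib)
  from order_trans[OF t1 i1] order_trans[OF t2 i2] show ?thesis
    unfolding m_def[symmetric] by (simp add: abs_le_iff)
qed

lemma powr_sum_le:
  fixes a b s :: real
  assumes "a \<ge> 0" "b \<ge> 0" "s > 0" shows "(a + b) powr s \<le> 2 powr s * (a powr s + b powr s)"
proof -
  have "(a + b) powr s \<le> (2 * max a b) powr s" using assms by (intro powr_mono2) auto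
  also have "\<dots> = 2 powr s * max a b powr s" using assms by (simp add: powr_mult)
  also have "\<dots> \<le> 2 powr s * (a powr s + b powr s)"
    using powr_max_le[OF assms(1,2)] by (intro mult_left_mono) auto
  finally show ?thesis .
qed

text \<open>The properties of the Riesz potential on which the variational argument rests. The
  exponents p t1 and p t2 are strictly between 2 and the critical Sobolev exponent; positivity off
  the origin makes \<open>D\<close> nontrivial, and symmetry merges the two first order terms of
  \<open>D\<close> into one.\<close>

locale choquard_kernel =
  fixes k k1 k2 :: "'a::euclidean_space \<Rightarrow> real" and t1 t2 p :: real
  assumes p: "1 < p" and k1: "young_kernel t1 k1" and k2: "young_kernel t2 k2"
    and k_split: "\<And>z. k z = k1 z + k2 z" and k_sym: "\<And>z. k (- z) = k z" and k_pos: "\<And>z. z \<noteq> 0 \<Longrightarrow> 0 < k z"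
    and s1: "2 < p * t1" "(real DIM('a) - 2) * (p * t1) < 2 * real DIM('a)"
    and s2: "2 < p * t2" "(real DIM('a) - 2) * (p * t2) < 2 * real DIM('a)"
begin

text \<open>One constant bounds both masses, so that estimates in terms of A are uniform over
  bounded sets of the Sobolev space, see \<open>sobolev_adm\<close>.\<close>

definition adm :: "real \<Rightarrow> ('a \<Rightarrow> real) \<Rightarrow> bool" where
  "adm A u \<longleftrightarrow> A \<ge> 0 \<and> u \<in> borel_measurable borel \<and>
     (\<integral>\<^sup>+x. ennreal (\<bar>u x\<bar> powr (p * t1)) \<partial>lborel) \<le> ennreal A \<and>
     (\<integral>\<^sup>+x. ennreal (\<bar>u x\<bar> powr (p * t2)) \<partial>lborel) \<le> ennreal A"

definition D :: "('a \<Rightarrow> real) \<Rightarrow> real" where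
  "D u = bform k (\<lambda>x. \<bar>u x\<bar> powr p) (\<lambda>x. \<bar>u x\<bar> powr p)"

definition K :: real where
  "K = max (\<integral>x. k1 x powr (t1 / (2 * t1 - 2)) \<partial>lborel) (\<integral>x. k2 x powr (t2 / (2 * t2 - 2)) \<partial>lborel)"

lemma kernel_facts:
  "k1 \<in> borel_measurable borel" "k2 \<in> borel_measurable borel" "k \<in> borel_measurable borel"
  "0 \<le> k1 z" "0 \<le> k2 z" "0 \<le> k z" "1 < t1" "t1 < 2" "1 < t2" "t2 < 2"
  "0 \<le> K" "(\<integral>\<^sup>+x. ennreal (k1 x powr (t1 / (2 * t1 - 2))) \<partial>lborel) \<le> ennreal K"
  "(\<integral>\<^sup>+x. ennreal (k2 x powr (t2 / (2 * t2 - 2))) \<partial>lborel) \<le> ennreal K"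
proof -
  show m: "k1 \<in> borel_measurable borel" "k2 \<in> borel_measurable borel"
    and nn: "0 \<le> k1 z" "0 \<le> k2 z" and "1 < t1" "t1 < 2" "1 < t2" "t2 < 2" for z
    using k1 k2 by (auto simp: young_kernel_def)
  show "0 \<le> k z" using nn by (simp add: k_split)
  have "k = (\<lambda>z. k1 z + k2 z)" using k_split by blast
  then show "k \<in> borel_measurable borel" using m by simp
  have i: "integrable lborel (\<lambda>x. k1 x powr (t1 / (2 * t1 - 2)))" "integrable lborel (\<lambda>x. k2 x powr (t2 / (2 * t2 - 2)))"
    using k1 k2 by (auto simp: young_kernel_def)
  have "0 \<le> (\<integral>x. k1 x powr (t1 / (2 * t1 - 2)) \<partial>lborel)" by simp
  then show "0 \<le> K" unfolding K_def by linarith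
  show "(\<integral>\<^sup>+x. ennreal (k1 x powr (t1 / (2 * t1 - 2))) \<partial>lborel) \<le> ennreal K"
    "(\<integral>\<^sup>+x. ennreal (k2 x powr (t2 / (2 * t2 - 2))) \<partial>lborel) \<le> ennreal K"
    using nn_integral_eq_integral[OF i(1)] nn_integral_eq_integral[OF i(2)] by (simp_all add: K_def ennreal_leI)
qed

lemmas kernel_measurable [measurable] = kernel_facts(1-3)

lemma admD [measurable_dest]: "adm A u \<Longrightarrow> u \<in> borel_measurable borel"
  by (simp add: adm_def)

lemma abs_powr_powr: "(\<bar>y\<bar> powr p) powr t = \<bar>y\<bar> powr (p * t)" for y t :: real
  by (simp add: powr_powr)

text \<open>The forms below have factors dominated by p-th powers of admissible functions; their
  integrability, the splitting over k1 and k2 and their size are settled here together. The scalars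
  c and d carry the powers of \<tau> in \<open>D_expansion\<close>.\<close>

lemma bform_dominated:
  assumes [measurable]: "f \<in> borel_measurable borel" "g \<in> borel_measurable borel"
    and a: "adm A a" and b: "adm B b"
    and f: "\<And>x. \<bar>f x\<bar> \<le> c * \<bar>a x\<bar> powr p" and g: "\<And>x. \<bar>g x\<bar> \<le> d * \<bar>b x\<bar> powr p" and cd: "c \<ge> 0" "d \<ge> 0"
  shows "integrable lborel2 (\<lambda>z. f (fst z) * k1 (fst z - snd z) * g (snd z))"
    "integrable lborel2 (\<lambda>z. f (fst z) * k2 (fst z - snd z) * g (snd z))"
    "integrable lborel2 (\<lambda>z. f (fst z) * k (fst z - snd z) * g (snd z))"
    "bform k f g = bform k1 f g + bform k2 f g"
    "\<bar>bform k f g\<bar> \<le> c * d * (2 * (A * B + A * K + B * K))"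
proof -
  note [measurable] = admD[OF a] admD[OF b]
  have AB: "A \<ge> 0" "B \<ge> 0" using a b by (auto simp: adm_def)
  have main: "integrable lborel2 (\<lambda>z. f (fst z) * h (fst z - snd z) * g (snd z)) \<and>
      \<bar>bform h f g\<bar> \<le> c * d * (A * B + A * K + B * K)"
    if h [measurable]: "h \<in> borel_measurable borel" and h0: "\<And>z. 0 \<le> h z" and t: "1 < t" "t < 2"
      and hK: "(\<integral>\<^sup>+x. ennreal (h x powr (t / (2 * t - 2))) \<partial>lborel) \<le> ennreal K"
      and at: "(\<integral>\<^sup>+x. ennreal (\<bar>a x\<bar> powr (p * t)) \<partial>lborel) \<le> ennreal A"
      and bt: "(\<integral>\<^sup>+x. ennreal (\<bar>b x\<bar> powr (p * t)) \<partial>lborel) \<le> ennreal B" for h t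
  proof -
    let ?F = "\<lambda>z. f (fst z) * h (fst z - snd z) * g (snd z)"
    have "(\<integral>\<^sup>+z. ennreal (norm (?F z)) \<partial>lborel2)
      \<le> (\<integral>\<^sup>+z. ennreal (c * d) * ennreal (\<bar>a (fst z)\<bar> powr p * h (fst z - snd z) * \<bar>b (snd z)\<bar> powr p) \<partial>lborel2)"
    proof (intro nn_integral_mono)
      fix z :: "'a \<times> 'a"
      have "norm (?F z) = \<bar>f (fst z)\<bar> * h (fst z - snd z) * \<bar>g (snd z)\<bar>" using h0 by (simp add: abs_mult)
      also have "\<dots> \<le> (c * \<bar>a (fst z)\<bar> powr p) * h (fst z - snd z) * (d * \<bar>b (snd z)\<bar> powr p)"
        using h0 cd by (intro mult_mono f g mult_nonneg_nonneg) auto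
      also have "\<dots> = c * d * (\<bar>a (fst z)\<bar> powr p * h (fst z - snd z) * \<bar>b (snd z)\<bar> powr p)" by simp
      finally show "ennreal (norm (?F z)) \<le> ennreal (c * d) * ennreal (\<bar>a (fst z)\<bar> powr p * h (fst z - snd z) * \<bar>b (snd z)\<bar> powr p)"
        using cd h0 by (simp add: ennreal_mult[symmetric] ennreal_leI)
    qed
    also have "\<dots> = ennreal (c * d) * (\<integral>\<^sup>+z. ennreal (\<bar>a (fst z)\<bar> powr p * h (fst z - snd z) * \<bar>b (snd z)\<bar> powr p) \<partial>lborel2)"
      by (rule nn_integral_cmult) measurable
    also have "\<dots> \<le> ennreal (c * d) * ennreal (A * B + A * K + B * K)"
      using at bt hK h0 AB t kernel_facts(11)
      by (intro mult_left_mono young_nn_integral[where t = t]) (auto simp: abs_powr_powr)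
    also have "\<dots> = ennreal (c * d * (A * B + A * K + B * K))"
      using cd AB kernel_facts(11) by (intro ennreal_mult[symmetric]) auto
    finally have le: "(\<integral>\<^sup>+z. ennreal (norm (?F z)) \<partial>lborel2) \<le> ennreal (c * d * (A * B + A * K + B * K))" .
    have int: "integrable lborel2 ?F"
      using le by (intro integrableI_bounded) (auto intro: order_le_less_trans)
    have "ennreal (norm (bform h f g)) \<le> ennreal (c * d * (A * B + A * K + B * K))"
      unfolding bform_def by (rule order_trans[OF integral_norm_bound_ennreal[OF int] le])
    then have "norm (bform h f g) \<le> c * d * (A * B + A * K + B * K)"
      using cd AB kernel_facts(11) by (subst (asm) ennreal_le_iff) auto
    with int show ?thesis by simp
  qed
  have 1: "integrable lborel2 (\<lambda>z. f (fst z) * k1 (fst z - snd z) * g (snd z)) \<and>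
      \<bar>bform k1 f g\<bar> \<le> c * d * (A * B + A * K + B * K)"
    by (rule main[of k1 t1]) (use kernel_facts a b in \<open>auto simp: adm_def\<close>)
  have 2: "integrable lborel2 (\<lambda>z. f (fst z) * k2 (fst z - snd z) * g (snd z)) \<and>
      \<bar>bform k2 f g\<bar> \<le> c * d * (A * B + A * K + B * K)"
    by (rule main[of k2 t2]) (use kernel_facts a b in \<open>auto simp: adm_def\<close>)
  show "integrable lborel2 (\<lambda>z. f (fst z) * k1 (fst z - snd z) * g (snd z))"
    "integrable lborel2 (\<lambda>z. f (fst z) * k2 (fst z - snd z) * g (snd z))" using 1 2 by auto
  have eq: "f (fst z) * k (fst z - snd z) * g (snd z)
     = f (fst z) * k1 (fst z - snd z) * g (snd z) + f (fst z) * k2 (fst z - snd z) * g (snd z)" for z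
    by (simp add: k_split algebra_simps)
  show "integrable lborel2 (\<lambda>z. f (fst z) * k (fst z - snd z) * g (snd z))"
    unfolding eq using 1 2 by auto
  show b: "bform k f g = bform k1 f g + bform k2 f g"
    unfolding bform_def eq using 1 2 by simp
  show "\<bar>bform k f g\<bar> \<le> c * d * (2 * (A * B + A * K + B * K))"
    using 1 2 unfolding b by (auto simp: algebra_simps abs_le_iff)
qed

lemma bform_sym:
  assumes [measurable]: "f \<in> borel_measurable borel" "g \<in> borel_measurable borel"
  shows "bform k f g = bform k g f"
proof -
  have "bform k g f = (\<integral>(x, y). (\<lambda>z. f (fst z) * k (fst z - snd z) * g (snd z)) (y, x) \<partial>lborel2)"
    unfolding bform_def using k_sym[of "x - y" for x y :: 'a]
    by (intro Bochner_Integration.integral_cong) (auto simp: mult_ac)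
  also have "\<dots> = (\<integral>z. f (fst z) * k (fst z - snd z) * g (snd z) \<partial>lborel2)"
    by (rule lborel_pair.integral_product_swap) measurable
  finally show ?thesis by (simp add: bform_def)
qed

text \<open>The shift by (c, c) preserves the product measure and the difference of the two
  points.\<close>

lemma bform_translate:
  assumes [measurable]: "f \<in> borel_measurable borel" "g \<in> borel_measurable borel"
  shows "bform k (\<lambda>x. f (x + c)) (\<lambda>x. g (x + c)) = bform k f g"
proof -
  have "(\<lambda>z. f (fst z) * k (fst z - snd z) * g (snd z)) \<in> borel_measurable lborel2" by measurable
  then have "(\<lambda>z. f (fst z) * k (fst z - snd z) * g (snd z)) \<in> borel_measurable borel"
    by (simp add: lborel_prod)
  from integral_translate[OF this, of "(c, c)"] show ?thesis
    by (simp add: bform_def lborel_prod)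
qed

lemma bform_cong_AE:
  assumes [measurable]: "f \<in> borel_measurable borel" "g \<in> borel_measurable borel"
    "f' \<in> borel_measurable borel" "g' \<in> borel_measurable borel"
    and "AE x in lborel. f x = f' x" "AE x in lborel. g x = g' x"
  shows "bform k f g = bform k f' g'"
  unfolding bform_def
  by (rule integral_cong_AE, measurable) (use AE_lborel2_fst[OF assms(5)] AE_lborel2_snd[OF assms(6)] in eventually_elim, simp)

lemma D_nonneg: "D u \<ge> 0"
  unfolding D_def bform_def by (intro integral_nonneg_AE AE_I2 mult_nonneg_nonneg kernel_facts) auto

lemma D_bound: "adm A u \<Longrightarrow> D u \<le> 2 * (A * A + A * K + A * K)"
  using bform_dominated(5)[of "\<lambda>x. \<bar>u x\<bar> powr p" "\<lambda>x. \<bar>u x\<bar> powr p" A u A u 1 1] unfolding D_def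
  by (simp add: adm_def abs_le_iff)

lemma D_scale: "D (\<lambda>x. c * u x) = \<bar>c\<bar> powr (2 * p) * D u"
proof -
  have "\<bar>c\<bar> powr p * \<bar>c\<bar> powr p = \<bar>c\<bar> powr (2 * p)" by (simp flip: powr_add)
  moreover have "D (\<lambda>x. c * u x) = (\<integral>z. (\<bar>c\<bar> powr p * \<bar>c\<bar> powr p) * (\<bar>u (fst z)\<bar> powr p * k (fst z - snd z) * \<bar>u (snd z)\<bar> powr p) \<partial>lborel2)"
    unfolding D_def bform_def by (intro Bochner_Integration.integral_cong) (auto simp: abs_mult powr_mult mult_ac)
  ultimately show ?thesis by (simp add: D_def bform_def)
qed

lemma sobolev_adm:
  assumes "h > 0"
  obtains A where "\<And>(u :: 'a \<Rightarrow> real) g. wgrad u g \<Longrightarrow> hnorm u g \<le> h \<Longrightarrow> adm A u"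
proof -
  obtain C1 where C1: "C1 > 0" "\<And>(u :: 'a \<Rightarrow> real) g h. wgrad u g \<Longrightarrow> hnorm u g \<le> h \<Longrightarrow> h > 0 \<Longrightarrow>
     (\<integral>\<^sup>+x. ennreal (\<bar>u x\<bar> powr (p * t1)) \<partial>lborel) \<le> ennreal (C1 * h powr (p * t1 / 2))"
    by (rule lions_lemma[OF s1]) blast
  obtain C2 where C2: "C2 > 0" "\<And>(u :: 'a \<Rightarrow> real) g h. wgrad u g \<Longrightarrow> hnorm u g \<le> h \<Longrightarrow> h > 0 \<Longrightarrow>
     (\<integral>\<^sup>+x. ennreal (\<bar>u x\<bar> powr (p * t2)) \<partial>lborel) \<le> ennreal (C2 * h powr (p * t2 / 2))"
    by (rule lions_lemma[OF s2]) blast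
  show ?thesis
  proof (rule that[of "max (C1 * h powr (p * t1 / 2)) (C2 * h powr (p * t2 / 2))"])
    fix u :: "'a \<Rightarrow> real" and g assume u: "wgrad u g" "hnorm u g \<le> h"
    show "adm (max (C1 * h powr (p * t1 / 2)) (C2 * h powr (p * t2 / 2))) u"
      unfolding adm_def
      using wgradD(3)[OF u(1)] C1(1) order_trans[OF C1(2)[OF u assms] ennreal_leI] order_trans[OF C2(2)[OF u assms] ennreal_leI]
      by (auto simp: le_max_iff_disj)
  qed
qed

lemma adm_limit:
  assumes u: "\<And>n. adm A (u n)" and [measurable]: "v \<in> borel_measurable borel"
    and ae: "AE x in lborel. (\<lambda>n. u n x) \<longlonglongrightarrow> v x"
  shows "adm A v"
proof -
  have [measurable]: "u n \<in> borel_measurable borel" for n using u by (rule admD)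
  have "(\<integral>\<^sup>+x. ennreal (\<bar>v x\<bar> powr s) \<partial>lborel) \<le> ennreal A"
    if s: "s > 0" and le: "\<And>n. (\<integral>\<^sup>+x. ennreal (\<bar>u n x\<bar> powr s) \<partial>lborel) \<le> ennreal A" for s
  proof -
    have "(\<integral>\<^sup>+x. ennreal (\<bar>v x\<bar> powr s) \<partial>lborel) = (\<integral>\<^sup>+x. liminf (\<lambda>n. ennreal (\<bar>u n x\<bar> powr s)) \<partial>lborel)"
    proof (rule nn_integral_cong_AE)
      show "AE x in lborel. ennreal (\<bar>v x\<bar> powr s) = liminf (\<lambda>n. ennreal (\<bar>u n x\<bar> powr s))"
        using ae
      proof eventually_elim
        case (elim x)
        then have "(\<lambda>n. ennreal (\<bar>u n x\<bar> powr s)) \<longlonglongrightarrow> ennreal (\<bar>v x\<bar> powr s)"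
          using s by (intro tendsto_ennrealI tendsto_abs_powr)
        then show ?case by (intro lim_imp_Liminf[symmetric]) auto
      qed
    qed
    also have "\<dots> \<le> liminf (\<lambda>n. \<integral>\<^sup>+x. ennreal (\<bar>u n x\<bar> powr s) \<partial>lborel)"
      by (intro nn_integral_liminf) measurable
    also have "\<dots> \<le> ennreal A" by (intro Liminf_le always_eventually allI le) auto
    finally show ?thesis .
  qed
  then show ?thesis using u s1 s2 unfolding adm_def by auto
qed

text \<open>The majorant for mixed products: |w|^(p - 1) |\<phi>| is at most the p-th power of this
  maximum, by \<open>powr_mult_max\<close>.\<close>

lemma adm_max:
  assumes w: "adm A w" and \<phi>: "adm B \<phi>"
  shows "adm (A + B) (\<lambda>x. max \<bar>w x\<bar> \<bar>\<phi> x\<bar>)"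
proof -
  note [measurable] = admD[OF w] admD[OF \<phi>]
  have nn: "A \<ge> 0" "B \<ge> 0" using w \<phi> by (auto simp: adm_def)
  have "(\<integral>\<^sup>+x. ennreal (\<bar>max \<bar>w x\<bar> \<bar>\<phi> x\<bar>\<bar> powr s) \<partial>lborel) \<le> ennreal (A + B)"
    if "(\<integral>\<^sup>+x. ennreal (\<bar>w x\<bar> powr s) \<partial>lborel) \<le> ennreal A" "(\<integral>\<^sup>+x. ennreal (\<bar>\<phi> x\<bar> powr s) \<partial>lborel) \<le> ennreal B" for s
  proof -
    have "(\<integral>\<^sup>+x. ennreal (\<bar>max \<bar>w x\<bar> \<bar>\<phi> x\<bar>\<bar> powr s) \<partial>lborel) \<le> (\<integral>\<^sup>+x. ennreal (\<bar>w x\<bar> powr s) + ennreal (\<bar>\<phi> x\<bar> powr s) \<partial>lborel)"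
      using powr_max_le[of "\<bar>w x\<bar>" "\<bar>\<phi> x\<bar>" s for x]
      by (intro nn_integral_mono) (simp add: ennreal_plus[symmetric] ennreal_leI del: ennreal_plus)
    also have "\<dots> \<le> ennreal A + ennreal B" using that by (simp add: nn_integral_add add_mono)
    finally show ?thesis using nn by simp
  qed
  then show ?thesis using w \<phi> unfolding adm_def by auto
qed

lemma signed_integrable:
  assumes w: "adm A w" and \<phi>: "adm A \<phi>"
  shows "integrable lborel2 (\<lambda>z. (\<bar>w (fst z)\<bar> powr (p - 2) * w (fst z) * \<phi> (fst z)) * k (fst z - snd z) * \<bar>w (snd z)\<bar> powr p)"
proof -
  note [measurable] = admD[OF w] admD[OF \<phi>]
  show ?thesis
  proof (rule bform_dominated(3)[OF _ _ adm_max[OF w \<phi>] w, where c = 1 and d = 1])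
    show "\<bar>\<bar>w x\<bar> powr (p - 2) * w x * \<phi> x\<bar> \<le> 1 * \<bar>max \<bar>w x\<bar> \<bar>\<phi> x\<bar>\<bar> powr p" for x
      using powr_mult_max[of "\<bar>w x\<bar>" "\<bar>\<phi> x\<bar>" p] p by (simp add: abs_signed_powr_mult)
  qed auto
qed

lemma D_convergence:
  assumes u: "\<And>n. adm A (u n)" and \<phi>: "adm B \<phi>" and v [measurable]: "v \<in> borel_measurable borel"
    and ae: "AE x in lborel. (\<lambda>n. u n x) \<longlonglongrightarrow> v x"
  shows "(\<lambda>n. bform k (\<lambda>x. \<bar>u n x\<bar> powr p) (\<lambda>x. \<bar>u n x\<bar> powr (p - 2) * u n x * \<phi> x))
     \<longlonglongrightarrow> bform k (\<lambda>x. \<bar>v x\<bar> powr p) (\<lambda>x. \<bar>v x\<bar> powr (p - 2) * v x * \<phi> x)"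
proof -
  have [measurable]: "\<phi> \<in> borel_measurable borel" using \<phi> by (rule admD)
  have split: "bform k (\<lambda>x. \<bar>w x\<bar> powr p) (\<lambda>x. \<bar>w x\<bar> powr (p - 2) * w x * \<phi> x)
     = bform k1 (\<lambda>x. \<bar>w x\<bar> powr p) (\<lambda>x. \<bar>w x\<bar> powr (p - 2) * w x * \<phi> x)
     + bform k2 (\<lambda>x. \<bar>w x\<bar> powr p) (\<lambda>x. \<bar>w x\<bar> powr (p - 2) * w x * \<phi> x)"
    if w: "adm A w" for w
  proof -
    note [measurable] = admD[OF w]
    have m: "adm (A + B) (\<lambda>x. max \<bar>w x\<bar> \<bar>\<phi> x\<bar>)" by (rule adm_max[OF w \<phi>])
    show ?thesis
    proof (rule bform_dominated(4)[OF _ _ w m, where c = 1 and d = 1])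
      show "\<bar>\<bar>w x\<bar> powr (p - 2) * w x * \<phi> x\<bar> \<le> 1 * \<bar>max \<bar>w x\<bar> \<bar>\<phi> x\<bar>\<bar> powr p" for x
        using powr_mult_max[of "\<bar>w x\<bar>" "\<bar>\<phi> x\<bar>" p] p by (simp add: abs_signed_powr_mult)
    qed auto
  qed
  have lim: "(\<lambda>n. bform h (\<lambda>x. \<bar>u n x\<bar> powr p) (\<lambda>x. \<bar>u n x\<bar> powr (p - 2) * u n x * \<phi> x))
     \<longlonglongrightarrow> bform h (\<lambda>x. \<bar>v x\<bar> powr p) (\<lambda>x. \<bar>v x\<bar> powr (p - 2) * v x * \<phi> x)"
    if "young_kernel t h" "\<And>n. (\<integral>\<^sup>+x. ennreal (\<bar>u n x\<bar> powr (p * t)) \<partial>lborel) \<le> ennreal A"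
      "(\<integral>\<^sup>+x. ennreal (\<bar>\<phi> x\<bar> powr (p * t)) \<partial>lborel) \<le> ennreal B" for h t
    using admD[OF u] that
    by (intro bform_convergence[OF that(1) p _ _ _ that(2) _ ae]) (auto intro: order_le_less_trans)
  show ?thesis
    unfolding split[OF u] split[OF adm_limit[OF u v ae]]
    using u \<phi> by (intro tendsto_add lim[OF k1] lim[OF k2]) (auto simp: adm_def)
qed

text \<open>With f = |u|^p and d its increment, \<open>D\<close> expands into \<open>D u\<close>,
  twice \<open>bform k f d\<close> and \<open>bform k d d\<close>. Convexity bounds d below by its
  tangent in the mixed term, where f and k are nonnegative, and the Lipschitz bound makes the last
  term of order \<tau>^2. C depends on u and \<phi> only through A and B, so the estimate survives a
  limit along a bounded sequence.\<close>

lemma D_expansion: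
  obtains C where "C \<ge> 0" "\<And>u \<phi> (\<tau> :: real). adm A u \<Longrightarrow> adm B \<phi> \<Longrightarrow> \<bar>\<tau>\<bar> \<le> 1 \<Longrightarrow>
    D u + 2 * p * \<tau> * bform k (\<lambda>x. \<bar>u x\<bar> powr p) (\<lambda>x. \<bar>u x\<bar> powr (p - 2) * u x * \<phi> x) - C * \<tau>\<^sup>2 \<le> D (\<lambda>x. u x + \<tau> * \<phi> x)"
proof -
  \<comment> \<open>The admissibility constant of |u| + |\<phi>| by \<open>powr_sum_le\<close>;
    \<open>max 0\<close> keeps E nonnegative for arbitrary A and B.\<close>
  define E where "E = max 0 ((2 powr (p * t1) + 2 powr (p * t2)) * (A + B))"
  define C where "C = p * p * (2 * (E * E + E * K + E * K))"
  have E0: "E \<ge> 0" by (simp add: E_def)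
  show ?thesis
  proof (rule that[of C])
    show "C \<ge> 0" using E0 kernel_facts(11) p by (simp add: C_def)
    fix u \<phi> and \<tau> :: real assume u: "adm A u" and \<phi>: "adm B \<phi>" and \<tau>: "\<bar>\<tau>\<bar> \<le> 1"
    note [measurable] = admD[OF u] admD[OF \<phi>]
    have nn: "A \<ge> 0" "B \<ge> 0" using u \<phi> by (auto simp: adm_def)
    define w where "w x = \<bar>u x\<bar> + \<bar>\<phi> x\<bar>" for x
    have w0: "w x \<ge> 0" for x by (simp add: w_def)
    have w: "adm E w"
    proof -
      have "(\<integral>\<^sup>+x. ennreal (\<bar>w x\<bar> powr s) \<partial>lborel) \<le> ennreal E"
        if "(\<integral>\<^sup>+x. ennreal (\<bar>u x\<bar> powr s) \<partial>lborel) \<le> ennreal A" "(\<integral>\<^sup>+x. ennreal (\<bar>\<phi> x\<bar> powr s) \<partial>lborel) \<le> ennreal B"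
          "s > 0" "2 powr s \<le> 2 powr (p * t1) + 2 powr (p * t2)" for s
      proof -
        have "(\<integral>\<^sup>+x. ennreal (\<bar>w x\<bar> powr s) \<partial>lborel) \<le> (\<integral>\<^sup>+x. ennreal (2 powr s) * (ennreal (\<bar>u x\<bar> powr s) + ennreal (\<bar>\<phi> x\<bar> powr s)) \<partial>lborel)"
          using powr_sum_le[of "\<bar>u x\<bar>" "\<bar>\<phi> x\<bar>" s for x] that(3)
          by (intro nn_integral_mono) (simp add: w_def ennreal_plus[symmetric] ennreal_mult[symmetric] ennreal_leI del: ennreal_plus)
        also have "\<dots> = ennreal (2 powr s) * ((\<integral>\<^sup>+x. ennreal (\<bar>u x\<bar> powr s) \<partial>lborel) + (\<integral>\<^sup>+x. ennreal (\<bar>\<phi> x\<bar> powr s) \<partial>lborel))"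
          by (simp add: nn_integral_cmult nn_integral_add)
        also have "\<dots> \<le> ennreal (2 powr s) * (ennreal A + ennreal B)"
          using that by (intro mult_left_mono add_mono) auto
        also have "\<dots> = ennreal (2 powr s * (A + B))" using nn by (simp add: ennreal_mult)
        also have "\<dots> \<le> ennreal E"
          unfolding E_def using nn that(4) by (intro ennreal_leI) (auto intro!: mult_right_mono simp: le_max_iff_disj)
        finally show ?thesis .
      qed
      moreover have "w \<in> borel_measurable borel" unfolding w_def[abs_def] by measurable
      ultimately show ?thesis using u \<phi> E0 s1(1) s2(1) unfolding adm_def by auto
    qed
    define f d g where "f x = \<bar>u x\<bar> powr p" and "d x = \<bar>u x + \<tau> * \<phi> x\<bar> powr p - \<bar>u x\<bar> powr p"
      and "g x = \<bar>u x\<bar> powr (p - 2) * u x * \<phi> x" for x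
    have [measurable]: "f \<in> borel_measurable borel" "d \<in> borel_measurable borel" "g \<in> borel_measurable borel"
      unfolding f_def[abs_def] d_def[abs_def] g_def[abs_def] by measurable
    have f_le: "\<bar>f x\<bar> \<le> 1 * \<bar>u x\<bar> powr p" for x by (simp add: f_def)
    have g_le: "\<bar>g x\<bar> \<le> 1 * \<bar>w x\<bar> powr p" for x
    proof -
      have "\<bar>g x\<bar> \<le> max \<bar>u x\<bar> \<bar>\<phi> x\<bar> powr p"
        using powr_mult_max[of "\<bar>u x\<bar>" "\<bar>\<phi> x\<bar>" p] p by (simp add: g_def abs_signed_powr_mult)
      also have "\<dots> \<le> \<bar>w x\<bar> powr p" using p by (intro powr_mono2) (auto simp: w_def)
      finally show ?thesis by simp
    qed
    have d_le: "\<bar>d x\<bar> \<le> (p * \<bar>\<tau>\<bar>) * \<bar>w x\<bar> powr p" for x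
    proof -
      have h: "\<bar>\<tau> * \<phi> x\<bar> \<le> \<bar>\<phi> x\<bar>" using \<tau> by (simp add: abs_mult mult_left_le_one_le)
      have "\<bar>d x\<bar> \<le> p * \<bar>\<tau> * \<phi> x\<bar> * (\<bar>u x\<bar> + \<bar>\<tau> * \<phi> x\<bar>) powr (p - 1)"
        unfolding d_def by (rule abs_powr_lipschitz[OF p])
      also have "\<dots> \<le> p * \<bar>\<tau> * \<phi> x\<bar> * w x powr (p - 1)"
        using p h by (intro mult_left_mono powr_mono2) (auto simp: w_def)
      also have "\<dots> = p * \<bar>\<tau>\<bar> * (\<bar>\<phi> x\<bar> * w x powr (p - 1))" by (simp add: abs_mult)
      also have "\<bar>\<phi> x\<bar> * w x powr (p - 1) \<le> w x * w x powr (p - 1)"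
        by (intro mult_right_mono) (auto simp: w_def)
      also have "w x * w x powr (p - 1) = \<bar>w x\<bar> powr p"
        using w0[of x] by (cases "w x = 0") (simp_all add: powr_diff)
      finally show ?thesis using p by (simp add: mult_left_mono)
    qed
    have pt0: "0 \<le> p * \<bar>\<tau>\<bar>" using p by simp
    note i_ff = bform_dominated(3)[OF _ _ u u f_le f_le, simplified]
    note i_fd = bform_dominated(3)[OF _ _ u w f_le d_le zero_le_one pt0, simplified]
    note i_df = bform_dominated(3)[OF _ _ w u d_le f_le pt0 zero_le_one, simplified]
    note i_dd = bform_dominated(3)[OF _ _ w w d_le d_le pt0 pt0, simplified]
    note i_fg = bform_dominated(3)[OF _ _ u w f_le g_le zero_le_one zero_le_one, simplified]
    have "D (\<lambda>x. u x + \<tau> * \<phi> x) = (\<integral>z. (f (fst z) * k (fst z - snd z) * f (snd z) + f (fst z) * k (fst z - snd z) * d (snd z))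
       + (d (fst z) * k (fst z - snd z) * f (snd z) + d (fst z) * k (fst z - snd z) * d (snd z)) \<partial>lborel2)"
      unfolding D_def bform_def by (intro Bochner_Integration.integral_cong refl) (simp add: f_def d_def algebra_simps)
    also have "\<dots> = (bform k f f + bform k f d) + (bform k d f + bform k d d)"
      unfolding bform_def
      by (subst Bochner_Integration.integral_add Bochner_Integration.integrable_add, (intro Bochner_Integration.integrable_add i_ff i_fd i_df i_dd; measurable)+)+ simp
    also have "bform k d f = bform k f d" by (rule bform_sym) measurable
    finally have D_eq: "D (\<lambda>x. u x + \<tau> * \<phi> x) = D u + 2 * bform k f d + bform k d d"
      by (simp add: D_def f_def[abs_def])
    have "bform k f d \<ge> (p * \<tau>) * bform k f g"
    proof -
      have "(p * \<tau>) * bform k f g = (\<integral>z. (p * \<tau>) * (f (fst z) * k (fst z - snd z) * g (snd z)) \<partial>lborel2)"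
        by (simp add: bform_def)
      also have "\<dots> \<le> bform k f d"
        unfolding bform_def
      proof (rule integral_mono)
        show "integrable lborel2 (\<lambda>z. (p * \<tau>) * (f (fst z) * k (fst z - snd z) * g (snd z)))"
          by (intro integrable_mult_right i_fg) measurable
        show "integrable lborel2 (\<lambda>z. f (fst z) * k (fst z - snd z) * d (snd z))"
          by (intro i_fd) measurable
        fix z :: "'a \<times> 'a"
        have "(p * \<tau>) * g y \<le> d y" for y
          using abs_powr_convex[OF p, of "u y" "\<tau> * \<phi> y"] by (simp add: g_def d_def mult_ac)
        then have "f (fst z) * k (fst z - snd z) * ((p * \<tau>) * g (snd z)) \<le> f (fst z) * k (fst z - snd z) * d (snd z)"
          using kernel_facts(6) by (intro mult_left_mono) (auto simp: f_def)
        then show "(p * \<tau>) * (f (fst z) * k (fst z - snd z) * g (snd z)) \<le> f (fst z) * k (fst z - snd z) * d (snd z)"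
          by (simp add: mult_ac)
      qed
      finally show ?thesis .
    qed
    moreover have "\<bar>bform k d d\<bar> \<le> C * \<tau>\<^sup>2"
    proof -
      have "\<bar>bform k d d\<bar> \<le> (p * \<bar>\<tau>\<bar>) * (p * \<bar>\<tau>\<bar>) * (2 * (E * E + E * K + E * K))"
        by (rule bform_dominated(5)[OF _ _ w w d_le d_le pt0 pt0]) measurable
      also have "\<dots> = C * \<tau>\<^sup>2" by (simp add: C_def power2_eq_square mult_ac)
      finally show ?thesis .
    qed
    ultimately show "D u + 2 * p * \<tau> * bform k (\<lambda>x. \<bar>u x\<bar> powr p) (\<lambda>x. \<bar>u x\<bar> powr (p - 2) * u x * \<phi> x) - C * \<tau>\<^sup>2 \<le> D (\<lambda>x. u x + \<tau> * \<phi> x)"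
      unfolding D_eq f_def[abs_def, symmetric] g_def[abs_def, symmetric] by (simp add: abs_le_iff)
  qed
qed

end

section \<open>Algebra of the Sobolev norm\<close>

lemma hnorm_lincomb:
  assumes u: "wgrad u g" and v: "wgrad v h"
  shows "hnorm (\<lambda>x. u x + t * v x) (\<lambda>x. g x + t *\<^sub>R h x) = hnorm u g + 2 * t * hinner u g v h + t\<^sup>2 * hnorm v h"
  using L2_norm_lincomb[OF pair_L2[OF wgradD(1,2)[OF u]] pair_L2[OF wgradD(1,2)[OF v]], of t]
  by (simp add: hnorm_def hinner_def norm_Pair)

lemma hnorm_scale: "hnorm (\<lambda>x. c * u x) (\<lambda>x. c *\<^sub>R g x) = c\<^sup>2 * hnorm u g"
  unfolding hnorm_def by (simp add: power_mult_distrib flip: distrib_left)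

lemma hinner_self: "hinner v h v h = hnorm v h"
  by (simp add: hinner_def hnorm_def power2_norm_eq_inner power2_eq_square[of "v _"])

lemma hinner_scale: "hinner (\<lambda>x. c * u x) (\<lambda>x. c *\<^sub>R g x) v h = c * hinner u g v h"
  unfolding hinner_def by (simp add: mult.assoc flip: distrib_left)

lemma wgrad_add_scaled: "wgrad u g \<Longrightarrow> wgrad v h \<Longrightarrow> wgrad (\<lambda>x. u x + t * v x) (\<lambda>x. g x + t *\<^sub>R h x)"
  using wgrad_lincomb[of u g v h 1 t] by simp

lemma wgrad_scale: "wgrad u g \<Longrightarrow> wgrad (\<lambda>x. c * u x) (\<lambda>x. c *\<^sub>R g x)"
  using wgrad_lincomb[of u g u g c 0] by simp

lemma hnorm_eq_0: "wgrad u g \<Longrightarrow> hnorm u g = 0 \<Longrightarrow> AE x in lborel. u x = 0"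
  unfolding hnorm_def
  by (subst (asm) integral_nonneg_eq_0_iff_AE[OF hnorm_integrable])
     (auto elim!: eventually_mono simp: add_nonneg_eq_0_iff)

text \<open>For N \<le> 2 there is no upper limit; otherwise s lies strictly below 2 N / (N - 2).
  The extra room serves the uniform integrability in \<open>mass_limit_nonzero\<close>.\<close>

lemma subcritical_above:
  fixes N s :: real
  assumes "(N - 2) * s < 2 * N" "N > 0"
  obtains s' where "s < s'" "(N - 2) * s' < 2 * N"
proof (cases "N \<le> 2")
  case True
  have "(N - 2) * (\<bar>s\<bar> + 1) \<le> 0" using True by (intro mult_nonpos_nonneg) auto
  then show ?thesis using that[of "\<bar>s\<bar> + 1"] assms(2) by linarith
next
  case False
  then have "s < 2 * N / (N - 2)" using assms(1) by (simp add: pos_less_divide_eq mult.commute)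
  then obtain s' where "s < s'" "s' < 2 * N / (N - 2)" using dense by blast
  then show ?thesis using that[of s'] False by (simp add: pos_less_divide_eq mult.commute)
qed

section \<open>Maximisation on the unit ball and the Euler equation\<close>

context choquard_kernel
begin

text \<open>For a bump that is positive on the unit box, vanishing of \<open>D\<close> would mean
  that almost all pairs of points of the box coincide, since k is positive off the origin. As points
  are null sets, the box itself would be null.\<close>

lemma D_positive: obtains \<phi> \<psi> where "wgrad \<phi> \<psi>" "D \<phi> > 0"
proof -
  define \<phi> where "\<phi> = (box_approx 0 One 1 :: 'a \<Rightarrow> real)"
  let ?Q = "box 0 One :: 'a set"
  have w: "wgrad \<phi> (gradient \<phi>)" unfolding \<phi>_def by (rule wgrad_test[OF box_approx_test])
  have pos: "\<phi> x > 0" if "x \<in> ?Q" for x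
    using that box_bump_pos_iff[of 0 One x] by (simp add: \<phi>_def box_approx_def)
  obtain A where A: "adm A \<phi>"
    using sobolev_adm[of "hnorm \<phi> (gradient \<phi>) + 1"] w hnorm_nonneg[of \<phi> "gradient \<phi>"]
    by (metis add_nonneg_pos less_add_one less_imp_le zero_less_one)
  note [measurable] = admD[OF A]
  have int: "integrable lborel2 (\<lambda>z. \<bar>\<phi> (fst z)\<bar> powr p * k (fst z - snd z) * \<bar>\<phi> (snd z)\<bar> powr p)"
    by (rule bform_dominated(3)[OF _ _ A A, where c = 1 and d = 1]) auto
  have "D \<phi> \<noteq> 0"
  proof
    assume "D \<phi> = 0"
    then have "AE z in lborel2. \<bar>\<phi> (fst z)\<bar> powr p * k (fst z - snd z) * \<bar>\<phi> (snd z)\<bar> powr p = 0"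
      unfolding D_def bform_def
      by (subst (asm) integral_nonneg_eq_0_iff_AE[OF int]) (auto intro!: AE_I2 mult_nonneg_nonneg kernel_facts)
    then have "AE z in lborel2. \<not> (fst z \<in> ?Q \<and> snd z \<in> ?Q \<and> fst z \<noteq> snd z)"
    proof eventually_elim
      case (elim z)
      show ?case
      proof
        assume z: "fst z \<in> ?Q \<and> snd z \<in> ?Q \<and> fst z \<noteq> snd z"
        then have "0 < k (fst z - snd z)" by (intro k_pos) simp
        with elim pos[of "fst z"] pos[of "snd z"] z show False by simp
      qed
    qed
    then have ae: "AE x in lborel. AE y in lborel. \<not> (x \<in> ?Q \<and> y \<in> ?Q \<and> x \<noteq> y)"
      using lborel_pair.AE_pair by fastforce
    have *: "AE x in lborel. x \<notin> ?Q"
      using ae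
    proof eventually_elim
      case (elim x)
      show ?case
      proof
        assume x: "x \<in> ?Q"
        have "AE y in lborel. y \<notin> ?Q"
          using elim AE_lborel_singleton[of x] by eventually_elim (use x in auto)
        then have "?Q \<in> null_sets lborel" by (subst (asm) AE_iff_null_sets[symmetric]) auto
        moreover have "emeasure lborel ?Q = 1" by (subst emeasure_lborel_box) auto
        ultimately show False by auto
      qed
    qed
    then have "?Q \<in> null_sets lborel" by (subst (asm) AE_iff_null_sets[symmetric]) auto
    moreover have "emeasure lborel ?Q = 1" by (subst emeasure_lborel_box) auto
    ultimately show False by auto
  qed
  then show ?thesis using that[OF w] D_nonneg[of \<phi>] by linarith
qed

definition mass :: "('a \<Rightarrow> real) \<Rightarrow> 'a \<Rightarrow> ennreal" where
  "mass u c = (\<integral>\<^sup>+x. indicator unit_cube x * ennreal (\<bar>u (x + c)\<bar> powr (p * t1) + \<bar>u (x + c)\<bar> powr (p * t2)) \<partial>lborel)"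

text \<open>If every translate of the unit cube carried little mass, the Lions estimate would make
  both global masses small, and \<open>D_bound\<close> would push \<open>D u\<close> below
  \<delta>.\<close>

lemma nonvanishing:
  assumes \<delta>: "\<delta> > 0"
  obtains \<eta> where "\<eta> > 0" "\<And>(u :: 'a \<Rightarrow> real) g. wgrad u g \<Longrightarrow> hnorm u g \<le> 1 \<Longrightarrow> D u \<ge> \<delta> \<Longrightarrow> \<exists>c. mass u c > ennreal \<eta>"
proof -
  obtain C1 where C1: "C1 > 0" "\<And>(u :: 'a \<Rightarrow> real) g \<eta>. wgrad u g \<Longrightarrow> \<eta> > 0 \<Longrightarrow>
     (\<And>c. (\<integral>\<^sup>+x. indicator unit_cube x * ennreal (\<bar>u (x + c)\<bar> powr (p * t1)) \<partial>lborel) \<le> ennreal \<eta>) \<Longrightarrow>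
     (\<integral>\<^sup>+x. ennreal (\<bar>u x\<bar> powr (p * t1)) \<partial>lborel) \<le> ennreal (C1 * \<eta> powr (1 - 2 / (p * t1)) * hnorm u g)"
    by (rule lions_lemma[OF s1]) blast
  obtain C2 where C2: "C2 > 0" "\<And>(u :: 'a \<Rightarrow> real) g \<eta>. wgrad u g \<Longrightarrow> \<eta> > 0 \<Longrightarrow>
     (\<And>c. (\<integral>\<^sup>+x. indicator unit_cube x * ennreal (\<bar>u (x + c)\<bar> powr (p * t2)) \<partial>lborel) \<le> ennreal \<eta>) \<Longrightarrow>
     (\<integral>\<^sup>+x. ennreal (\<bar>u x\<bar> powr (p * t2)) \<partial>lborel) \<le> ennreal (C2 * \<eta> powr (1 - 2 / (p * t2)) * hnorm u g)"
    by (rule lions_lemma[OF s2]) blast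
  have K0: "K \<ge> 0" by (rule kernel_facts)
  \<comment> \<open>The threshold for both masses: as a \<le> 1, the bound 2 (a^2 + 2 a K) is at
    most 2 a (1 + 2 K) \<le> \<delta> / 2.\<close>
  define a where "a = min 1 (\<delta> / (4 * (1 + 2 * K)))"
  have a: "a > 0" "a \<le> 1" using \<delta> K0 by (auto simp: a_def)
  have "a \<le> \<delta> / (4 * (1 + 2 * K))" by (simp add: a_def)
  then have "a * (4 * (1 + 2 * K)) \<le> \<delta>" using K0 by (simp add: pos_le_divide_eq)
  moreover have "a * (4 * (1 + 2 * K)) = 4 * a + 8 * (a * K)" by (simp add: algebra_simps)
  moreover have "a * a \<le> a" using a by (intro mult_left_le) auto
  ultimately have small: "2 * (a * a + a * K + a * K) < \<delta>" using a(1) \<delta> by (smt (verit))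
  define e1 e2 where "e1 = 1 - 2 / (p * t1)" and "e2 = 1 - 2 / (p * t2)"
  have e: "e1 > 0" "e2 > 0" using s1 s2 by (auto simp: e1_def e2_def)
  \<comment> \<open>Chosen for C1 \<eta>^e1 \<le> a and C2 \<eta>^e2 \<le> a; the exponents are
    positive because p t1 and p t2 exceed 2.\<close>
  define \<eta> where "\<eta> = min ((a / C1) powr (1 / e1)) ((a / C2) powr (1 / e2))"
  have \<eta>: "\<eta> > 0" using a C1(1) C2(1) by (simp add: \<eta>_def)
  have "\<eta> powr e1 \<le> ((a / C1) powr (1 / e1)) powr e1" "\<eta> powr e2 \<le> ((a / C2) powr (1 / e2)) powr e2"
    using \<eta> e by (intro powr_mono2; simp add: \<eta>_def)+
  moreover have "((a / C1) powr (1 / e1)) powr e1 = a / C1" "((a / C2) powr (1 / e2)) powr e2 = a / C2"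
    using e a C1(1) C2(1) by (simp_all add: powr_powr)
  ultimately have "\<eta> powr e1 \<le> a / C1" "\<eta> powr e2 \<le> a / C2" by simp_all
  then have \<eta>e: "C1 * \<eta> powr e1 \<le> a" "C2 * \<eta> powr e2 \<le> a"
    using C1(1) C2(1) by (simp_all add: pos_le_divide_eq mult.commute)
  show ?thesis
  proof (rule that[OF \<eta>], rule ccontr)
    fix u :: "'a \<Rightarrow> real" and g
    assume u: "wgrad u g" and h: "hnorm u g \<le> 1" and Du: "D u \<ge> \<delta>" and "\<not> (\<exists>c. mass u c > ennreal \<eta>)"
    then have m: "mass u c \<le> ennreal \<eta>" for c by (simp add: not_less)
    have m1: "(\<integral>\<^sup>+x. indicator unit_cube x * ennreal (\<bar>u (x + c)\<bar> powr (p * t1)) \<partial>lborel) \<le> ennreal \<eta>" for c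
      by (rule order_trans[OF _ m[of c]]) (auto simp: mass_def intro!: nn_integral_mono mult_left_mono ennreal_leI)
    have m2: "(\<integral>\<^sup>+x. indicator unit_cube x * ennreal (\<bar>u (x + c)\<bar> powr (p * t2)) \<partial>lborel) \<le> ennreal \<eta>" for c
      by (rule order_trans[OF _ m[of c]]) (auto simp: mass_def intro!: nn_integral_mono mult_left_mono ennreal_leI)
    have le: "C * x * hnorm u g \<le> a" if "C * x \<le> a" for C x
    proof -
      have "C * x * hnorm u g \<le> a * 1" using that h a hnorm_nonneg[of u g] by (intro mult_mono) auto
      then show ?thesis by simp
    qed
    have "adm a u"
      unfolding adm_def
      using a wgradD(3)[OF u] order_trans[OF C1(2)[OF u \<eta> m1] ennreal_leI[OF le[OF \<eta>e(1)[unfolded e1_def]]]]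
        order_trans[OF C2(2)[OF u \<eta> m2] ennreal_leI[OF le[OF \<eta>e(2)[unfolded e2_def]]]] by auto
    from D_bound[OF this] small Du show False by linarith
  qed
qed

text \<open>The unit cube has finite measure, so boundedness in a higher, still subcritical power
  gives uniform integrability of the two lower powers there. Vitali's theorem then drives the mass
  to 0.\<close>

lemma mass_limit_nonzero:
  fixes u :: "nat \<Rightarrow> 'a \<Rightarrow> real"
  assumes u: "\<And>n. wgrad (u n) (g n)" "\<And>n. hnorm (u n) (g n) \<le> 1" and m: "\<And>n. mass (u n) 0 > ennreal \<eta>" "\<eta> > 0"
    and ae: "AE x in lborel. (\<lambda>n. u n x) \<longlonglongrightarrow> 0"
  shows False
proof -
  have um [measurable]: "u n \<in> borel_measurable borel" for n by (rule wgradD(3)[OF u(1)])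
  define M where "M = max (p * t1) (p * t2)"
  have "(real DIM('a) - 2) * M < 2 * real DIM('a)" "M > 2" using s1 s2 by (auto simp: M_def max_def)
  then obtain s where s: "M < s" "(real DIM('a) - 2) * s < 2 * real DIM('a)"
    using subcritical_above[of "real DIM('a)" M] by auto
  have s2': "s > 2" using s \<open>M > 2\<close> by linarith
  have ps: "0 < p * t1" "p * t1 < s" "0 < p * t2" "p * t2 < s" using s s1 s2 by (auto simp: M_def)
  obtain C where C: "C > 0" "\<And>(u :: 'a \<Rightarrow> real) g h. wgrad u g \<Longrightarrow> hnorm u g \<le> h \<Longrightarrow> h > 0 \<Longrightarrow>
     (\<integral>\<^sup>+x. ennreal (\<bar>u x\<bar> powr s) \<partial>lborel) \<le> ennreal (C * h powr (s / 2))"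
    by (rule lions_lemma[OF s2' s(2)]) blast
  have us: "(\<integral>\<^sup>+x. ennreal (\<bar>u n x\<bar> powr s) \<partial>lborel) \<le> ennreal C" for n
    using C(2)[OF u(1) u(2), of n] by simp
  let ?F = "\<lambda>n x. indicator unit_cube x * (\<bar>u n x\<bar> powr (p * t1) + \<bar>u n x\<bar> powr (p * t2)) :: real"
  have cube_int: "integrable lborel (\<lambda>x. indicator (unit_cube :: 'a set) x * c)" for c :: real
    by (intro integrable_mult_left integrable_real_indicator) (simp_all add: emeasure_cube_of)
  have bnd: "\<exists>W. integrable lborel W \<and> (\<forall>x. W x \<ge> 0) \<and> (\<forall>n. (\<integral>\<^sup>+x. ennreal (\<bar>?F n x\<bar> - W x) \<partial>lborel) \<le> ennreal e)"
    if e: "e > 0" for e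
  proof -
    \<comment> \<open>Each of the two powers is absorbed with coefficient d, and C bounds the higher
      mass: 2 d C = e.\<close>
    define d where "d = e / (2 * C)"
    have d: "d > 0" "2 * d * C = e" using e C by (simp_all add: d_def)
    obtain A1 where A1: "A1 \<ge> 0" "\<And>X. X \<ge> 0 \<Longrightarrow> X powr (p * t1) \<le> d * X powr s + A1" using powr_absorb[OF ps(1,2) d(1)] by blast
    obtain A2 where A2: "A2 \<ge> 0" "\<And>X. X \<ge> 0 \<Longrightarrow> X powr (p * t2) \<le> d * X powr s + A2" using powr_absorb[OF ps(3,4) d(1)] by blast
    show ?thesis
    proof (intro exI[of _ "\<lambda>x. indicator unit_cube x * (A1 + A2)"] conjI allI)
      show "integrable lborel (\<lambda>x. indicator (unit_cube :: 'a set) x * (A1 + A2))" by (rule cube_int)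
      show "0 \<le> indicator (unit_cube :: 'a set) x * (A1 + A2)" for x using A1 A2 by simp
      fix n
      have "(\<integral>\<^sup>+x. ennreal (\<bar>?F n x\<bar> - indicator unit_cube x * (A1 + A2)) \<partial>lborel) \<le> (\<integral>\<^sup>+x. ennreal (2 * d) * ennreal (\<bar>u n x\<bar> powr s) \<partial>lborel)"
      proof (intro nn_integral_mono)
        fix x
        have "\<bar>?F n x\<bar> - indicator unit_cube x * (A1 + A2) \<le> 2 * d * \<bar>u n x\<bar> powr s"
          using A1(2)[of "\<bar>u n x\<bar>"] A2(2)[of "\<bar>u n x\<bar>"] d by (auto split: split_indicator)
        then show "ennreal (\<bar>?F n x\<bar> - indicator unit_cube x * (A1 + A2)) \<le> ennreal (2 * d) * ennreal (\<bar>u n x\<bar> powr s)"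
          using d by (simp add: ennreal_mult[symmetric] ennreal_leI)
      qed
      also have "\<dots> \<le> ennreal (2 * d) * ennreal C"
        by (subst nn_integral_cmult) (auto intro!: mult_left_mono us)
      also have "\<dots> = ennreal e" using d C by (simp add: ennreal_mult[symmetric])
      finally show "(\<integral>\<^sup>+x. ennreal (\<bar>?F n x\<bar> - indicator unit_cube x * (A1 + A2)) \<partial>lborel) \<le> ennreal e" .
    qed
  qed
  have F_int: "integrable lborel (?F n)" for n
  proof -
    obtain W where W: "integrable lborel W" "\<forall>x. W x \<ge> 0" "\<forall>n. (\<integral>\<^sup>+x. ennreal (\<bar>?F n x\<bar> - W x) \<partial>lborel) \<le> ennreal 1" using bnd[of 1] by auto
    note [measurable] = borel_measurable_integrable[OF W(1)]
    have "(\<integral>\<^sup>+x. ennreal (norm (?F n x)) \<partial>lborel) \<le> (\<integral>\<^sup>+x. ennreal (\<bar>?F n x\<bar> - W x) + ennreal (W x) \<partial>lborel)"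
    proof (intro nn_integral_mono)
      fix x
      have "ennreal (norm (?F n x)) \<le> ennreal (max 0 (\<bar>?F n x\<bar> - W x) + W x)" by (intro ennreal_leI) auto
      also have "\<dots> = ennreal (\<bar>?F n x\<bar> - W x) + ennreal (W x)" using W(2) by (simp add: max_def ennreal_neg)
      finally show "ennreal (norm (?F n x)) \<le> ennreal (\<bar>?F n x\<bar> - W x) + ennreal (W x)" .
    qed
    also have "\<dots> = (\<integral>\<^sup>+x. ennreal (\<bar>?F n x\<bar> - W x) \<partial>lborel) + (\<integral>\<^sup>+x. ennreal (W x) \<partial>lborel)"
      by (intro nn_integral_add) measurable
    also have "\<dots> < \<infinity>"
    proof -
      have "(\<integral>\<^sup>+x. ennreal (\<bar>?F n x\<bar> - W x) \<partial>lborel) < \<infinity>" using W(3) by (auto intro: order_le_less_trans)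
      moreover have "(\<integral>\<^sup>+x. ennreal (W x) \<partial>lborel) < \<infinity>" using nn_integral_eq_integral[OF W(1)] W(2) by simp
      ultimately show ?thesis by simp
    qed
    finally show ?thesis by (intro integrableI_bounded) measurable
  qed
  have "(\<lambda>n. \<integral>x. ?F n x \<partial>lborel) \<longlonglongrightarrow> (\<integral>x. (0::real) \<partial>(lborel :: 'a measure))"
  proof (rule vitali_convergence(2)[OF F_int _ _ bnd])
    show "AE x in lborel. (\<lambda>n. ?F n x) \<longlonglongrightarrow> 0"
      using ae
    proof eventually_elim
      case (elim x)
      have "(\<lambda>n. ?F n x) \<longlonglongrightarrow> indicator unit_cube x * (\<bar>0\<bar> powr (p * t1) + \<bar>0\<bar> powr (p * t2))"
        by (intro tendsto_intros tendsto_abs_powr elim ps)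
      then show ?case by simp
    qed
  qed auto
  then obtain n where n: "(\<integral>x. ?F n x \<partial>lborel) < \<eta>"
    using order_tendstoD(2)[of _ 0 sequentially \<eta>] m(2) by (fastforce simp: eventually_sequentially)
  have "mass (u n) 0 = (\<integral>\<^sup>+x. ennreal (?F n x) \<partial>lborel)"
    unfolding mass_def by (intro nn_integral_cong) (auto split: split_indicator)
  also have "\<dots> = ennreal (\<integral>x. ?F n x \<partial>lborel)" by (intro nn_integral_eq_integral F_int) auto
  finally show False using m(1)[of n] n m(2) by (simp add: ennreal_less_iff)
qed

lemma groundstate_exists:
  obtains w \<psi> where "wgrad w \<psi>" "hnorm w \<psi> > 0" "hnorm w \<psi> = D w"
    "\<And>\<phi> \<zeta>. wgrad \<phi> \<zeta> \<Longrightarrow> hinner w \<psi> \<phi> \<zeta> = bform k (\<lambda>x. \<bar>w x\<bar> powr p) (\<lambda>x. \<bar>w x\<bar> powr (p - 2) * w x * \<phi> x)"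
    "\<And>\<phi> \<zeta>. wgrad \<phi> \<zeta> \<Longrightarrow> hnorm \<phi> \<zeta> > 0 \<Longrightarrow> hnorm \<phi> \<zeta> = D \<phi> \<Longrightarrow> hnorm w \<psi> \<le> hnorm \<phi> \<zeta>"
proof -
  define X where "X = {D u | u g. wgrad u g \<and> hnorm u g \<le> 1}"
  define S where "S = Sup X"
  obtain A1 where A1: "\<And>(u :: 'a \<Rightarrow> real) g. wgrad u g \<Longrightarrow> hnorm u g \<le> 1 \<Longrightarrow> adm A1 u"
    using sobolev_adm[of 1] by auto
  have bdd: "bdd_above X"
  proof (rule bdd_aboveI)
    fix y assume "y \<in> X"
    then obtain u g where "y = D u" "wgrad u g" "hnorm u g \<le> 1" unfolding X_def by blast
    then show "y \<le> 2 * (A1 * A1 + A1 * K + A1 * K)" using D_bound[OF A1] by blast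
  qed
  have D_zero: "D u = 0" if u: "wgrad u g" "hnorm u g = 0" for u g
  proof -
    have [measurable]: "u \<in> borel_measurable borel" by (rule wgradD(3)[OF u(1)])
    have "D u = bform k (\<lambda>x. 0) (\<lambda>x. 0)"
      unfolding D_def using hnorm_eq_0[OF u] by (intro bform_cong_AE) (auto elim: eventually_mono)
    then show ?thesis by (simp add: bform_def)
  qed
  have normalise: "wgrad (\<lambda>x. (1 / sqrt (hnorm u g)) * u x) (\<lambda>x. (1 / sqrt (hnorm u g)) *\<^sub>R g x)
      \<and> hnorm (\<lambda>x. (1 / sqrt (hnorm u g)) * u x) (\<lambda>x. (1 / sqrt (hnorm u g)) *\<^sub>R g x) = 1
      \<and> D (\<lambda>x. (1 / sqrt (hnorm u g)) * u x) = D u / hnorm u g powr p"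
    if u: "wgrad u g" "hnorm u g > 0" for u g
  proof (intro conjI wgrad_scale u)
    show "hnorm (\<lambda>x. (1 / sqrt (hnorm u g)) * u x) (\<lambda>x. (1 / sqrt (hnorm u g)) *\<^sub>R g x) = 1"
      unfolding hnorm_scale using u(2) by (simp add: power_divide)
    have "\<bar>1 / sqrt (hnorm u g)\<bar> powr (2 * p) = 1 / hnorm u g powr p"
      using u(2) by (simp add: powr_divide powr_half_sqrt[symmetric] powr_powr)
    then show "D (\<lambda>x. (1 / sqrt (hnorm u g)) * u x) = D u / hnorm u g powr p"
      unfolding D_scale by simp
  qed
  have D_le: "D u \<le> S * hnorm u g powr p" if u: "wgrad u g" for u g
  proof (cases "hnorm u g = 0")
    case True
    then show ?thesis using D_zero[OF u] by simp
  next
    case False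
    then have pos: "hnorm u g > 0" using hnorm_nonneg[of u g] by linarith
    have "D u / hnorm u g powr p \<in> X"
      unfolding X_def using normalise[OF u pos] by (intro CollectI exI conjI) (rule sym, blast, blast, simp)
    then have "D u / hnorm u g powr p \<le> S" unfolding S_def using bdd by (rule cSup_upper)
    then show ?thesis using pos by (simp add: pos_divide_le_eq)
  qed
  have S: "S > 0"
  proof -
    obtain \<phi> \<zeta> where \<phi>: "wgrad \<phi> \<zeta>" "D \<phi> > 0" by (rule D_positive)
    have "S * hnorm \<phi> \<zeta> powr p > 0" using D_le[OF \<phi>(1)] \<phi>(2) by linarith
    then show ?thesis by (metis mult_nonpos_nonneg not_le powr_ge_zero)
  qed
  have Xne: "X \<noteq> {}" using D_positive normalise S unfolding X_def S_def
    by (metis (mono_tags, lifting) Collect_empty_eq order_refl D_zero hnorm_nonneg less_le)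
  \<comment> \<open>The bound S / 2 holds for every n, so that one \<eta> from
    \<open>nonvanishing\<close> works for the whole sequence.\<close>
  have "\<exists>u g. wgrad u g \<and> hnorm u g \<le> 1 \<and> D u > max (S - 1 / real (Suc n)) (S / 2)" for n
  proof -
    have "max (S - 1 / real (Suc n)) (S / 2) < Sup X" using S unfolding S_def[symmetric] by simp
    then obtain y where "y \<in> X" "max (S - 1 / real (Suc n)) (S / 2) < y"
      using less_cSup_iff[OF Xne bdd] by blast
    then show ?thesis unfolding X_def by blast
  qed
  then obtain u0 g0 where u0: "\<And>n. wgrad (u0 n) (g0 n)" "\<And>n. hnorm (u0 n) (g0 n) \<le> 1"
    "\<And>n. D (u0 n) > max (S - 1 / real (Suc n)) (S / 2)" by metis
  obtain \<eta> where \<eta>: "\<eta> > 0" "\<And>(u :: 'a \<Rightarrow> real) g. wgrad u g \<Longrightarrow> hnorm u g \<le> 1 \<Longrightarrow> D u \<ge> S / 2 \<Longrightarrow> \<exists>c. mass u c > ennreal \<eta>"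
    using nonvanishing[of "S / 2"] S by auto
  have "\<exists>c. mass (u0 n) c > ennreal \<eta>" for n
    using u0(3)[of n] by (intro \<eta>(2)[OF u0(1,2)]) auto
  then obtain c where c: "\<And>n. mass (u0 n) (c n) > ennreal \<eta>" by metis
  define u g where "u n x = u0 n (x + c n)" and "g n x = g0 n (x + c n)" for n x
  have u: "wgrad (u n) (g n)" "hnorm (u n) (g n) \<le> 1" for n
    using wgrad_translate[OF u0(1)] hnorm_translate[OF u0(1)] u0(2) by (simp_all add: u_def[abs_def] g_def[abs_def])
  have Du: "D (u n) = D (u0 n)" for n
    using bform_translate[of "\<lambda>x. \<bar>u0 n x\<bar> powr p" "\<lambda>x. \<bar>u0 n x\<bar> powr p" "c n"] wgradD(3)[OF u0(1)]
    by (simp add: D_def u_def[abs_def])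
  have um: "mass (u n) 0 > ennreal \<eta>" for n using c[of n] by (simp add: mass_def u_def)
  have "(\<lambda>n. D (u n)) \<longlonglongrightarrow> S"
  proof (rule tendsto_sandwich[OF _ _ _ tendsto_const])
    show "\<forall>\<^sub>F n in sequentially. S - 1 / real (Suc n) \<le> D (u n)"
      using u0(3) by (intro always_eventually allI) (simp add: Du less_imp_le)
    show "\<forall>\<^sub>F n in sequentially. D (u n) \<le> S"
    proof (intro always_eventually allI)
      fix n
      have "D (u n) \<in> X" unfolding X_def using u by blast
      then show "D (u n) \<le> S" unfolding S_def using bdd by (rule cSup_upper)
    qed
    show "(\<lambda>n. S - 1 / real (Suc n)) \<longlonglongrightarrow> S"
      using tendsto_diff[OF tendsto_const LIMSEQ_inverse_real_of_nat, of S] by (simp add: inverse_eq_divide)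
  qed
  then have D_lim: "(\<lambda>n. D (u (r n))) \<longlonglongrightarrow> S" if "strict_mono r" for r
    using LIMSEQ_subseq_LIMSEQ[OF _ that, of "\<lambda>n. D (u n)" S] by (simp add: o_def)
  show ?thesis
  proof (rule weak_compactness[of u g 1, OF u])
    fix r :: "nat \<Rightarrow> nat" and v h
    assume r: "strict_mono r" and v: "wgrad v h" and ae: "AE x in lborel. (\<lambda>n. u (r n) x) \<longlonglongrightarrow> v x"
      and h1: "hnorm v h \<le> 1"
      and weak: "\<And>\<phi> \<psi>. wgrad \<phi> \<psi> \<Longrightarrow> (\<lambda>n. hinner (u (r n)) (g (r n)) \<phi> \<psi>) \<longlonglongrightarrow> hinner v h \<phi> \<psi>"
    have hpos: "hnorm v h > 0"
    proof (rule ccontr)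
      assume "\<not> hnorm v h > 0"
      then have "hnorm v h = 0" using hnorm_nonneg[of v h] by linarith
      then have "AE x in lborel. v x = 0" by (rule hnorm_eq_0[OF v])
      with ae have "AE x in lborel. (\<lambda>n. u (r n) x) \<longlonglongrightarrow> 0" by eventually_elim simp
      then show False using mass_limit_nonzero[of "\<lambda>n. u (r n)" "\<lambda>n. g (r n)" \<eta>] u um \<eta>(1) by blast
    qed
    have EL: "bform k (\<lambda>x. \<bar>v x\<bar> powr p) (\<lambda>x. \<bar>v x\<bar> powr (p - 2) * v x * \<phi> x) = S * hinner v h \<phi> \<psi>"
      if \<phi>: "wgrad \<phi> \<psi>" for \<phi> \<psi>
    proof -
      obtain B where B: "adm B \<phi>"
        using sobolev_adm[of "hnorm \<phi> \<psi> + 1"] \<phi> hnorm_nonneg[of \<phi> \<psi>]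
        by (metis add_nonneg_pos less_add_one less_imp_le zero_less_one)
      define H where "H = hnorm \<phi> \<psi>"
      define a where "a = hinner v h \<phi> \<psi>"
      define b where "b = bform k (\<lambda>x. \<bar>v x\<bar> powr p) (\<lambda>x. \<bar>v x\<bar> powr (p - 2) * v x * \<phi> x)"
      define an where "an n = hinner (u (r n)) (g (r n)) \<phi> \<psi>" for n
      define bn where "bn n = bform k (\<lambda>x. \<bar>u (r n) x\<bar> powr p) (\<lambda>x. \<bar>u (r n) x\<bar> powr (p - 2) * u (r n) x * \<phi> x)" for n
      have a_lim: "an \<longlonglongrightarrow> a" unfolding an_def[abs_def] a_def by (rule weak[OF \<phi>])
      have b_lim: "bn \<longlonglongrightarrow> b" unfolding bn_def[abs_def] b_def
        by (rule D_convergence[OF A1[OF u] B wgradD(3)[OF v] ae])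
      obtain C where C: "C \<ge> 0" "\<And>u \<phi> (\<tau> :: real). adm A1 u \<Longrightarrow> adm B \<phi> \<Longrightarrow> \<bar>\<tau>\<bar> \<le> 1 \<Longrightarrow>
        D u + 2 * p * \<tau> * bform k (\<lambda>x. \<bar>u x\<bar> powr p) (\<lambda>x. \<bar>u x\<bar> powr (p - 2) * u x * \<phi> x) - C * \<tau>\<^sup>2 \<le> D (\<lambda>x. u x + \<tau> * \<phi> x)"
        by (rule D_expansion[of A1 B]) blast
      \<comment> \<open>For each n, \<open>D_expansion\<close> bounds \<open>D\<close> at u n plus
        \<tau> \<phi> from below and the definition of S bounds it from above. What depends on n are
        scalars with known limits, except the squared norm of u n, which is replaced by its bound
        1.\<close>
      have ineq: "S + 2 * p * \<tau> * b - C * \<tau>\<^sup>2 \<le> S * (1 + 2 * \<tau> * a + \<tau>\<^sup>2 * H) powr p" if \<tau>: "\<bar>\<tau>\<bar> \<le> 1" for \<tau>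
      proof (rule LIMSEQ_le)
        show "(\<lambda>n. D (u (r n)) + 2 * p * \<tau> * bn n - C * \<tau>\<^sup>2) \<longlonglongrightarrow> S + 2 * p * \<tau> * b - C * \<tau>\<^sup>2"
          by (intro tendsto_intros D_lim[OF r] b_lim)
        have nn: "0 \<le> hnorm (\<lambda>x. u (r n) x + \<tau> * \<phi> x) (\<lambda>x. g (r n) x + \<tau> *\<^sub>R \<psi> x)" for n by (rule hnorm_nonneg)
        have le: "hnorm (\<lambda>x. u (r n) x + \<tau> * \<phi> x) (\<lambda>x. g (r n) x + \<tau> *\<^sub>R \<psi> x) \<le> 1 + 2 * \<tau> * an n + \<tau>\<^sup>2 * H" for n
          unfolding hnorm_lincomb[OF u(1) \<phi>] an_def H_def using u(2)[of "r n"] by simp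
        have "0 \<le> 1 + 2 * \<tau> * an n + \<tau>\<^sup>2 * H" for n using order_trans[OF nn le] .
        then show "(\<lambda>n. S * (1 + 2 * \<tau> * an n + \<tau>\<^sup>2 * H) powr p) \<longlonglongrightarrow> S * (1 + 2 * \<tau> * a + \<tau>\<^sup>2 * H) powr p"
          using p by (intro tendsto_intros tendsto_powr' a_lim) auto
        show "\<exists>N. \<forall>n\<ge>N. D (u (r n)) + 2 * p * \<tau> * bn n - C * \<tau>\<^sup>2 \<le> S * (1 + 2 * \<tau> * an n + \<tau>\<^sup>2 * H) powr p"
        proof (intro exI allI impI)
          fix n
          have "D (u (r n)) + 2 * p * \<tau> * bn n - C * \<tau>\<^sup>2 \<le> D (\<lambda>x. u (r n) x + \<tau> * \<phi> x)"
            unfolding bn_def by (rule C(2)[OF A1[OF u] B \<tau>])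
          also have "\<dots> \<le> S * hnorm (\<lambda>x. u (r n) x + \<tau> * \<phi> x) (\<lambda>x. g (r n) x + \<tau> *\<^sub>R \<psi> x) powr p"
            by (rule D_le[OF wgrad_add_scaled[OF u(1) \<phi>]])
          also have "\<dots> \<le> S * (1 + 2 * \<tau> * an n + \<tau>\<^sup>2 * H) powr p"
            using S p nn le by (intro mult_left_mono powr_mono2) auto
          finally show "D (u (r n)) + 2 * p * \<tau> * bn n - C * \<tau>\<^sup>2 \<le> S * (1 + 2 * \<tau> * an n + \<tau>\<^sup>2 * H) powr p" .
        qed
      qed
      \<comment> \<open>Nonnegative for |\<tau>| \<le> 1 and zero at \<tau> = 0, so the derivative
        vanishes at this interior minimum.\<close>
      define G where "G \<tau> = S * (1 + 2 * \<tau> * a + \<tau>\<^sup>2 * H) powr p - (S + 2 * p * \<tau> * b - C * \<tau>\<^sup>2)" for \<tau>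
      have base: "DERIV (\<lambda>\<tau>. 1 + 2 * \<tau> * a + \<tau>\<^sup>2 * H) 0 :> 2 * a"
        by (auto intro!: derivative_eq_intros)
      have "DERIV (\<lambda>\<tau>. (1 + 2 * \<tau> * a + \<tau>\<^sup>2 * H) powr p) 0 :> p * (2 * a)"
        using DERIV_fun_powr[OF base, of p] by simp
      then have dG: "DERIV G 0 :> S * (p * (2 * a)) - 2 * p * b"
        unfolding G_def[abs_def] by (auto intro!: derivative_eq_intros)
      have "S * (p * (2 * a)) - 2 * p * b = 0"
        by (rule DERIV_local_min[OF dG, of 1]) (use ineq in \<open>auto simp: G_def\<close>)
      then have "p * (S * a - b) = 0" by (simp add: algebra_simps)
      then show ?thesis using p by (simp add: a_def b_def)
    qed
    have Dv: "D v = S * hnorm v h"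
    proof -
      have "\<bar>v x\<bar> powr (p - 2) * v x * v x = \<bar>v x\<bar> powr p" for x
      proof (cases "v x = 0")
        case False
        have "v x * v x = \<bar>v x\<bar> powr 2" using False by (simp add: powr_numeral power2_eq_square)
        then have "\<bar>v x\<bar> powr (p - 2) * v x * v x = \<bar>v x\<bar> powr (p - 2) * \<bar>v x\<bar> powr 2"
          by (simp only: mult.assoc)
        also have "\<dots> = \<bar>v x\<bar> powr p" by (simp only: powr_add[symmetric]) simp
        finally show ?thesis .
      qed simp
      then show ?thesis using EL[OF v] by (simp add: D_def hinner_self)
    qed
    \<comment> \<open>From S H = D v \<le> S H^p with p > 1 a squared norm 0 < H < 1 is excluded:
      nothing is lost in the weak limit.\<close>
    have H1: "hnorm v h = 1"
    proof -
      let ?H = "hnorm v h"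
      have "S * ?H \<le> S * ?H powr p" using D_le[OF v] Dv by simp
      then have "?H \<le> ?H powr p" using S by simp
      also have "\<dots> = ?H * ?H powr (p - 1)" using hpos by (simp add: powr_diff)
      finally have "1 \<le> ?H powr (p - 1)" using hpos by simp
      moreover have "?H powr (p - 1) < 1" if "?H < 1" using powr_less_mono2[of "p - 1" ?H 1] that hpos p by simp
      ultimately show ?thesis using h1 by linarith
    qed
    \<comment> \<open>The scaling that puts a multiple of v on the constraint set: its squared norm
      cc^2 and its \<open>D\<close>, which is cc^(2 p) S, agree when cc^(2 p - 2) S = 1.\<close>
    define cc where "cc = S powr (- 1 / (2 * p - 2))"
    have cc: "cc > 0" using S by (simp add: cc_def)
    have cS: "cc powr (2 * p - 2) * S = 1"
    proof -
      have "cc powr (2 * p - 2) = S powr (- 1 / (2 * p - 2) * (2 * p - 2))"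
        unfolding cc_def by (rule powr_powr)
      also have "- 1 / (2 * p - 2) * (2 * p - 2) = - 1" using p by simp
      finally show ?thesis using S by (simp add: powr_minus)
    qed
    have c2: "cc\<^sup>2 = S powr (- 1 / (p - 1))"
    proof -
      have "cc\<^sup>2 = cc powr 2" using cc by (simp add: powr_numeral)
      also have "\<dots> = S powr ((- 1 / (2 * p - 2)) * 2)" by (simp add: cc_def powr_powr)
      also have "(- 1 / (2 * p - 2)) * 2 = - 1 / (p - 1)" using p by (simp add: field_simps)
      finally show ?thesis .
    qed
    define w \<zeta> where "w x = cc * v x" and "\<zeta> x = cc *\<^sub>R h x" for x
    have w: "wgrad w \<zeta>" unfolding w_def[abs_def] \<zeta>_def[abs_def] by (rule wgrad_scale[OF v])
    have hw: "hnorm w \<zeta> = cc\<^sup>2" unfolding w_def[abs_def] \<zeta>_def[abs_def] hnorm_scale H1 by simp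
    have Dw: "D w = cc\<^sup>2"
    proof -
      have "D w = cc powr (2 * p) * S" unfolding w_def[abs_def] D_scale Dv H1 using cc by simp
      also have "cc powr (2 * p) = cc powr (2 * p - 2) * cc powr 2" by (simp flip: powr_add)
      also have "\<dots> * S = (cc powr (2 * p - 2) * S) * cc powr 2" by simp
      also have "\<dots> = cc\<^sup>2" unfolding cS using cc by (simp add: powr_numeral)
      finally show ?thesis .
    qed
    show thesis
    proof (rule that[of w \<zeta>])
      show "wgrad w \<zeta>" "hnorm w \<zeta> > 0" "hnorm w \<zeta> = D w" using w hw Dw cc by auto
    next
      fix \<phi> :: "'a \<Rightarrow> real" and \<psi> assume \<phi>: "wgrad \<phi> \<psi>"
      have e1: "cc powr p * (cc powr (p - 2) * cc) = cc powr (2 * p - 2) * cc"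
        by (simp add: mult.assoc[symmetric] flip: powr_add)
      have "bform k (\<lambda>x. \<bar>w x\<bar> powr p) (\<lambda>x. \<bar>w x\<bar> powr (p - 2) * w x * \<phi> x)
        = (\<integral>z. (cc powr p * (cc powr (p - 2) * cc)) * (\<bar>v (fst z)\<bar> powr p * k (fst z - snd z) * (\<bar>v (snd z)\<bar> powr (p - 2) * v (snd z) * \<phi> (snd z))) \<partial>lborel2)"
        unfolding bform_def w_def using cc
        by (intro Bochner_Integration.integral_cong refl) (simp add: abs_mult powr_mult mult_ac)
      also have "\<dots> = (cc powr (2 * p - 2) * cc) * (S * hinner v h \<phi> \<psi>)"
        unfolding e1 by (simp add: EL[OF \<phi>, symmetric] bform_def)
      also have "\<dots> = (cc powr (2 * p - 2) * S) * (cc * hinner v h \<phi> \<psi>)" by simp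
      also have "\<dots> = hinner w \<zeta> \<phi> \<psi>"
        unfolding cS w_def[abs_def] \<zeta>_def[abs_def] hinner_scale by simp
      finally show "hinner w \<zeta> \<phi> \<psi> = bform k (\<lambda>x. \<bar>w x\<bar> powr p) (\<lambda>x. \<bar>w x\<bar> powr (p - 2) * w x * \<phi> x)" ..
    next
      fix \<phi> :: "'a \<Rightarrow> real" and \<psi> assume \<phi>: "wgrad \<phi> \<psi>" "hnorm \<phi> \<psi> > 0" "hnorm \<phi> \<psi> = D \<phi>"
      let ?H = "hnorm \<phi> \<psi>"
      \<comment> \<open>On the constraint set the sharp inequality reads H \<le> S H^p, which bounds
        H below by S^(-1 / (p - 1)) = cc^2.\<close>
      have "?H \<le> S * ?H powr p" using D_le[OF \<phi>(1)] \<phi>(3) by simp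
      also have "\<dots> = ?H * (S * ?H powr (p - 1))" using \<phi>(2) by (simp add: powr_diff)
      finally have "1 \<le> S * ?H powr (p - 1)" using \<phi>(2) by simp
      then have "1 / S \<le> ?H powr (p - 1)" using S by (simp add: pos_divide_le_eq mult.commute)
      then have "(1 / S) powr (1 / (p - 1)) \<le> (?H powr (p - 1)) powr (1 / (p - 1))"
        using S p by (intro powr_mono2) auto
      also have "\<dots> = ?H" using \<phi>(2) p by (simp add: powr_powr)
      also have "(1 / S) powr (1 / (p - 1)) = cc\<^sup>2"
        unfolding c2 using S by (simp add: powr_divide powr_minus_divide)
      finally show "hnorm w \<zeta> \<le> hnorm \<phi> \<psi>" unfolding hw .
    qed
  qed
qed

end

section \<open>The Riesz potential\<close>

text \<open>Integrability of powers of the norm is obtained from dyadic annuli, on which the power is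
  comparable to a constant.\<close>

lemma powr_of_power: "0 < x \<Longrightarrow> (x ^ m) powr a = (x powr a) ^ m" for x a :: real
  by (induction m) (auto simp: powr_mult)

lemma emeasure_ball_scale:
  fixes x :: "'a::euclidean_space"
  assumes "r > 0"
  shows "emeasure lborel (ball (0::'a) r) = ennreal (r ^ DIM('a)) * emeasure lborel (ball (0::'a) 1)"
proof -
  have "emeasure lborel (ball (0::'a) r) = ennreal (unit_ball_vol DIM('a) * r ^ DIM('a))"
    using assms by (intro emeasure_ball) auto
  moreover have "emeasure lborel (ball (0::'a) 1) = ennreal (unit_ball_vol DIM('a))"
    by (subst emeasure_ball) auto
  ultimately show ?thesis using assms by (simp add: ennreal_mult mult.commute)
qed

text \<open>Each shell is enlarged to the ball containing it, so that only volumes of balls enter;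
  for radii in geometric progression this costs a constant factor.\<close>

lemma dyadic_shell_integrable:
  fixes f :: "'a::euclidean_space \<Rightarrow> real"
  assumes [measurable]: "f \<in> borel_measurable borel" and nn: "\<And>x. f x \<ge> 0"
    and R: "\<And>j. R j > 0" and cover: "\<And>x. f x \<noteq> 0 \<Longrightarrow> \<exists>j. norm x < R j \<and> f x \<le> c j"
    and c: "\<And>j. c j \<ge> 0" and sum: "summable (\<lambda>j. c j * R j ^ DIM('a))"
  shows "integrable lborel f"
proof (rule integrableI_nonneg)
  have "(\<integral>\<^sup>+x. ennreal (f x) \<partial>lborel) \<le> (\<integral>\<^sup>+x. (\<Sum>j. ennreal (c j) * indicator (ball (0::'a) (R j)) x) \<partial>lborel)"
  proof (intro nn_integral_mono)
    fix x
    show "ennreal (f x) \<le> (\<Sum>j. ennreal (c j) * indicator (ball 0 (R j)) x)"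
    proof (cases "f x = 0")
      case False
      then obtain j where j: "norm x < R j" "f x \<le> c j" using cover by blast
      then have "ennreal (f x) \<le> ennreal (c j) * indicator (ball 0 (R j)) x" by (simp add: ennreal_leI)
      also have "\<dots> \<le> (\<Sum>j. ennreal (c j) * indicator (ball 0 (R j)) x)"
        by (rule ennreal_le_suminf[of "\<lambda>j. ennreal (c j) * indicator (ball 0 (R j)) x"])
      finally show ?thesis .
    qed simp
  qed
  also have "\<dots> = (\<Sum>j. ennreal (c j) * emeasure lborel (ball (0::'a) (R j)))"
  proof -
    have [measurable]: "ball (0::'a) r \<in> sets borel" for r by simp
    show ?thesis
      by (subst nn_integral_suminf, measurable) (simp add: nn_integral_cmult_indicator)
  qed
  also have "\<dots> = (\<Sum>j. ennreal (c j * R j ^ DIM('a)) * emeasure lborel (ball (0::'a) 1))"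
  proof -
    have "ennreal (c j) * emeasure lborel (ball (0::'a) (R j)) = ennreal (c j * R j ^ DIM('a)) * emeasure lborel (ball (0::'a) 1)" for j
      unfolding emeasure_ball_scale[OF R[of j], where 'a = 'a] using c[of j] R[of j]
      by (subst ennreal_mult) (auto simp: mult.assoc)
    then show ?thesis by simp
  qed
  also have "\<dots> = (\<Sum>j. ennreal (c j * R j ^ DIM('a))) * emeasure lborel (ball (0::'a) 1)"
    by simp
  also have "(\<Sum>j. ennreal (c j * R j ^ DIM('a))) = ennreal (\<Sum>j. c j * R j ^ DIM('a))"
    using c R sum by (intro suminf_ennreal2) (auto simp: less_imp_le)
  also have "ennreal (\<Sum>j. c j * R j ^ DIM('a)) * emeasure lborel (ball (0::'a) 1) < \<infinity>"
    by (simp add: emeasure_ball ennreal_mult_less_top)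
  finally show "(\<integral>\<^sup>+x. ennreal (f x) \<partial>lborel) < \<infinity>" .
qed (use nn in auto)

lemma powr_near_integrable:
  fixes a :: real
  assumes a: "0 \<le> a" "a < DIM('a)"
  shows "integrable lborel (\<lambda>x::'a::euclidean_space. if norm x < 1 then norm x powr - a else 0)"
proof (rule dyadic_shell_integrable[where R = "\<lambda>j. (1/2) ^ j" and c = "\<lambda>j. (2 powr a) ^ Suc j"])
  let ?N = "DIM('a)"
  fix x :: 'a assume nz: "(if norm x < 1 then norm x powr - a else 0) \<noteq> 0"
  then have x: "norm x < 1" "x \<noteq> 0" by (auto split: if_splits)
  \<comment> \<open>The least such j places x in the shell between the radii 2^-(j+1) and
    2^-j.\<close>
  define P where "P j \<longleftrightarrow> (1/2) ^ Suc j \<le> norm x" for j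
  obtain n where "(1/2) ^ n < norm x" using real_arch_pow_inv[of "norm x" "1/2"] x by auto
  moreover have "(1/2) ^ Suc n \<le> (1/2 :: real) ^ n" by simp
  ultimately have "P n" unfolding P_def by linarith
  define j where "j = (LEAST j. P j)"
  have Pj: "P j" unfolding j_def using \<open>P n\<close> by (rule LeastI)
  have "norm x < (1/2) ^ j"
  proof (cases j)
    case (Suc i)
    then have "\<not> P i" unfolding j_def using not_less_Least[of i P] by simp
    then show ?thesis using Suc by (simp add: P_def not_le)
  qed (use x in simp)
  moreover have "norm x powr - a \<le> (2 powr a) ^ Suc j"
  proof -
    have "norm x powr - a \<le> ((1/2) ^ Suc j) powr - a"
      using Pj a x unfolding P_def by (intro powr_mono2') auto
    also have "\<dots> = ((1/2) powr - a) ^ Suc j" by (rule powr_of_power) simp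
    also have "(1/2) powr - a = 2 powr a" by (simp add: powr_minus_divide powr_divide)
    finally show ?thesis .
  qed
  ultimately show "\<exists>j. norm x < (1/2) ^ j \<and> (if norm x < 1 then norm x powr - a else 0) \<le> (2 powr a) ^ Suc j"
    using x by auto
next
  have "2 powr a < 2 powr real DIM('a)" using a by (intro powr_less_mono) auto
  then have q: "2 powr a / 2 ^ DIM('a) < 1" by (simp add: powr_realpow)
  have "summable (\<lambda>j. 2 powr a * (2 powr a / 2 ^ DIM('a)) ^ j)"
    using q by (intro summable_mult summable_geometric) simp
  then show "summable (\<lambda>j. (2 powr a) ^ Suc j * ((1/2) ^ j) ^ DIM('a))"
    by (simp add: power_divide power_mult[symmetric] mult.commute[of _ "DIM('a)"])
qed auto

lemma powr_far_integrable:
  fixes b :: real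
  assumes b: "b > DIM('a)"
  shows "integrable lborel (\<lambda>x::'a::euclidean_space. if norm x < 1 then 0 else norm x powr - b)"
proof (rule dyadic_shell_integrable[where R = "\<lambda>j. 2 ^ Suc j" and c = "\<lambda>j. (2 powr - b) ^ j"])
  fix x :: 'a assume nz: "(if norm x < 1 then 0 else norm x powr - b) \<noteq> 0"
  then have x: "norm x \<ge> 1" by (auto split: if_splits)
  define P where "P j \<longleftrightarrow> norm x < 2 ^ Suc j" for j
  obtain n where n: "norm x < 2 ^ n" using real_arch_pow[of 2 "norm x"] by auto
  have "(2::real) ^ n \<le> 2 ^ Suc n" by simp
  with n have "P n" unfolding P_def by linarith
  define j where "j = (LEAST j. P j)"
  have Pj: "P j" unfolding j_def using \<open>P n\<close> by (rule LeastI)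
  have "2 ^ j \<le> norm x"
  proof (cases j)
    case (Suc i)
    then have "\<not> P i" unfolding j_def using not_less_Least[of i P] by simp
    then show ?thesis using Suc by (simp add: P_def not_less)
  qed (use x in simp)
  then have "norm x powr - b \<le> (2 ^ j) powr - b"
    using b by (intro powr_mono2') auto
  also have "\<dots> = (2 powr - b) ^ j"
    by (rule powr_of_power) simp
  finally show "\<exists>j. norm x < 2 ^ Suc j \<and> (if norm x < 1 then 0 else norm x powr - b) \<le> (2 powr - b) ^ j"
    using Pj x unfolding P_def by auto
next
  have "2 powr real DIM('a) < 2 powr b" using b by (intro powr_less_mono) auto
  then have q: "2 ^ DIM('a) * 2 powr - b < 1" by (simp add: powr_realpow powr_minus field_simps)
  have "summable (\<lambda>j. 2 ^ DIM('a) * (2 ^ DIM('a) * 2 powr - b) ^ j)"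
    using q by (intro summable_mult summable_geometric) simp
  moreover have "2 ^ DIM('a) * (2 ^ DIM('a) * 2 powr - b) ^ j = (2 powr - b) ^ j * (2 ^ Suc j) ^ DIM('a)" for j
    by (simp add: power_mult_distrib power_mult[symmetric] mult.commute)
  ultimately show "summable (\<lambda>j. (2 powr - b) ^ j * (2 ^ Suc j) ^ DIM('a))" by simp
qed auto

lemma riesz_measurable: "(riesz_potential \<alpha> :: 'a::euclidean_space \<Rightarrow> real) \<in> borel_measurable borel"
  unfolding riesz_potential_def[abs_def] by measurable

lemma riesz_constant:
  assumes "0 < \<alpha>" "\<alpha> < real DIM('a)"
  obtains c where "c > 0" "\<And>x :: 'a::euclidean_space. riesz_potential \<alpha> x = c * norm x powr - (real DIM('a) - \<alpha>)"
proof
  let ?c = "Gamma ((real DIM('a) - \<alpha>) / 2) / (Gamma (\<alpha> / 2) * pi powr (real DIM('a) / 2) * 2 powr \<alpha>)"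
  show "?c > 0" using assms by (intro divide_pos_pos mult_pos_pos Gamma_real_pos) auto
  show "riesz_potential \<alpha> x = ?c * norm x powr - (real DIM('a) - \<alpha>)" for x :: 'a
    unfolding riesz_potential_def powr_minus
    by (simp only: divide_inverse inverse_mult_distrib mult.assoc)
qed

text \<open>At t = 2 N / (N + \<alpha>) the kernel exponent t / (2 t - 2) equals N / (N - \<alpha>),
  the borderline power of the Riesz potential. The other inequalities are strict at t and persist
  nearby, so t1 is taken just above t and t2 just below.\<close>

lemma exponents_exist:
  fixes N \<alpha> p :: real
  assumes N: "N > 0" and \<alpha>: "0 < \<alpha>" "\<alpha> < N" and p: "1 < p"
    and lo: "(N - 2) / (N + \<alpha>) < 1 / p" and up: "1 / p < N / (N + \<alpha>)"
  obtains t1 t2 where "1 < t1" "t1 < 2" "1 < t2" "t2 < 2" "t2 < 2 * N / (N + \<alpha>)" "2 * N / (N + \<alpha>) < t1"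
    "2 < p * t1" "(N - 2) * (p * t1) < 2 * N" "2 < p * t2" "(N - 2) * (p * t2) < 2 * N"
proof -
  define t where "t = 2 * N / (N + \<alpha>)"
  have t: "1 < t" "t < 2" using \<alpha> N by (auto simp: t_def field_simps)
  have pt: "2 < p * t" using up p \<alpha> N by (simp add: t_def field_simps)
  have Nt: "(N - 2) * (p * t) < 2 * N"
  proof -
    have "(N - 2) * p < N + \<alpha>" using lo p \<alpha> N by (simp add: field_simps)
    then have "(N - 2) * p * (2 * N) < (N + \<alpha>) * (2 * N)" using N by (intro mult_strict_right_mono) auto
    then show ?thesis using \<alpha> N by (simp add: t_def field_simps)
  qed
  have ev: "\<forall>\<^sub>F x in at t. 1 < x \<and> x < 2 \<and> 2 < p * x \<and> (N - 2) * (p * x) < 2 * N"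
  proof -
    have l: "((\<lambda>x. x) \<longlongrightarrow> t) (at t)" "((\<lambda>x. p * x) \<longlongrightarrow> p * t) (at t)" "((\<lambda>x. (N - 2) * (p * x)) \<longlongrightarrow> (N - 2) * (p * t)) (at t)"
      by (intro tendsto_intros)+
    show ?thesis
      using order_tendstoD(1)[OF l(1) t(1)] order_tendstoD(2)[OF l(1) t(2)] order_tendstoD(1)[OF l(2) pt] order_tendstoD(2)[OF l(3) Nt]
      by eventually_elim auto
  qed
  then obtain d where d: "d > 0" "\<And>x. x \<noteq> t \<Longrightarrow> dist x t < d \<Longrightarrow> 1 < x \<and> x < 2 \<and> 2 < p * x \<and> (N - 2) * (p * x) < 2 * N"
    unfolding eventually_at by blast
  show ?thesis
    using d(2)[of "t + d / 2"] d(2)[of "t - d / 2"] d(1)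
    by (intro that[of "t + d / 2" "t - d / 2"]) (auto simp: dist_real_def t_def[symmetric])
qed

text \<open>The kernel exponent decreases in t. So t1 above the borderline makes the power of the
  potential integrable near the origin, and t2 below it makes the power integrable at
  infinity.\<close>

lemma riesz_choquard_kernel:
  fixes \<alpha> p :: real
  assumes \<alpha>: "0 < \<alpha>" "\<alpha> < real DIM('a::euclidean_space)" and p: "1 < p"
    and lo: "(real DIM('a) - 2) / (real DIM('a) + \<alpha>) < 1 / p" and up: "1 / p < real DIM('a) / (real DIM('a) + \<alpha>)"
  obtains k1 k2 t1 t2 where "choquard_kernel (riesz_potential \<alpha> :: 'a \<Rightarrow> real) k1 k2 t1 t2 p"
proof -
  define N where "N = real DIM('a)"
  have N: "N > 0" by (simp add: N_def)
  obtain t1 t2 where t: "1 < t1" "t1 < 2" "1 < t2" "t2 < 2" "t2 < 2 * N / (N + \<alpha>)" "2 * N / (N + \<alpha>) < t1"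
    "2 < p * t1" "(N - 2) * (p * t1) < 2 * N" "2 < p * t2" "(N - 2) * (p * t2) < 2 * N"
    by (rule exponents_exist[OF N \<alpha>(1) \<alpha>(2)[folded N_def] p lo[folded N_def] up[folded N_def]])
  obtain c where c: "c > 0" and I: "\<And>x :: 'a. riesz_potential \<alpha> x = c * norm x powr - (N - \<alpha>)"
    unfolding N_def using riesz_constant[OF \<alpha>] by blast
  define k1 k2 where "k1 x = (if norm x < 1 then riesz_potential \<alpha> x else 0)" and "k2 x = (if norm x < 1 then 0 else riesz_potential \<alpha> x)" for x :: 'a
  note [measurable] = riesz_measurable
  have I0: "riesz_potential \<alpha> x \<ge> 0" for x :: 'a using c by (simp add: I)
  have Na: "N - \<alpha> > 0" using \<alpha> by (simp add: N_def)
  have pw: "(riesz_potential \<alpha> x) powr r = c powr r * norm x powr - ((N - \<alpha>) * r)" for x :: 'a and r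
  proof -
    have "- ((N - \<alpha>) * r) = (\<alpha> - N) * r" by (simp add: algebra_simps)
    then show ?thesis using c by (simp add: I powr_mult powr_powr)
  qed
  define r1 r2 where "r1 = t1 / (2 * t1 - 2)" and "r2 = t2 / (2 * t2 - 2)"
  have "2 * N < t1 * (N + \<alpha>)" using t(6) \<alpha>(1) N by (simp add: pos_divide_less_eq)
  then have a1: "0 \<le> (N - \<alpha>) * r1" "(N - \<alpha>) * r1 < N"
    using t Na by (auto simp: r1_def pos_divide_less_eq algebra_simps)
  have "t2 * (N + \<alpha>) < 2 * N" using t(5) \<alpha>(1) N by (simp add: pos_less_divide_eq)
  then have a2: "(N - \<alpha>) * r2 > N"
    using t Na by (auto simp: r2_def pos_less_divide_eq algebra_simps)
  have "young_kernel t1 k1"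
    unfolding young_kernel_def
  proof (intro conjI allI t)
    show "k1 \<in> borel_measurable borel" unfolding k1_def[abs_def] by measurable
    show "0 \<le> k1 z" for z using I0 by (simp add: k1_def)
    have "integrable lborel (\<lambda>x::'a. c powr r1 * (if norm x < 1 then norm x powr - ((N - \<alpha>) * r1) else 0))"
      using a1 by (intro integrable_mult_right powr_near_integrable) (auto simp: N_def)
    also have "(\<lambda>x::'a. c powr r1 * (if norm x < 1 then norm x powr - ((N - \<alpha>) * r1) else 0)) = (\<lambda>z. k1 z powr (t1 / (2 * t1 - 2)))"
      unfolding r1_def[symmetric] by (rule ext) (simp add: k1_def pw)
    finally show "integrable lborel (\<lambda>z. k1 z powr (t1 / (2 * t1 - 2)))" .
  qed
  moreover have "young_kernel t2 k2"
    unfolding young_kernel_def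
  proof (intro conjI allI t)
    show "k2 \<in> borel_measurable borel" unfolding k2_def[abs_def] by measurable
    show "0 \<le> k2 z" for z using I0 by (simp add: k2_def)
    have "integrable lborel (\<lambda>x::'a. c powr r2 * (if norm x < 1 then 0 else norm x powr - ((N - \<alpha>) * r2)))"
      using a2 by (intro integrable_mult_right powr_far_integrable) (auto simp: N_def)
    also have "(\<lambda>x::'a. c powr r2 * (if norm x < 1 then 0 else norm x powr - ((N - \<alpha>) * r2))) = (\<lambda>z. k2 z powr (t2 / (2 * t2 - 2)))"
      unfolding r2_def[symmetric] by (rule ext) (simp add: k2_def pw)
    finally show "integrable lborel (\<lambda>z. k2 z powr (t2 / (2 * t2 - 2)))" .
  qed
  ultimately have "choquard_kernel (riesz_potential \<alpha> :: 'a \<Rightarrow> real) k1 k2 t1 t2 p"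
  proof (unfold_locales)
    show "riesz_potential \<alpha> z = k1 z + k2 z" for z :: 'a by (simp add: k1_def k2_def)
    show "riesz_potential \<alpha> (- z) = riesz_potential \<alpha> z" for z :: 'a by (simp add: I)
    show "0 < riesz_potential \<alpha> z" if "z \<noteq> 0" for z :: 'a using that c by (simp add: I)
  qed (rule p t(7,8,9,10)[unfolded N_def] | assumption)+
  then show ?thesis by (rule that)
qed

section \<open>Lebesgue measurable representatives\<close>

lemma lebesgue_borel_representative:
  fixes f :: "'a::euclidean_space \<Rightarrow> 'b::euclidean_space"
  assumes f: "f \<in> borel_measurable lebesgue"
  obtains f' where "f' \<in> borel_measurable borel" "AE x in lborel. f x = f' x"
proof -
  have "\<exists>h. h \<in> borel_measurable borel \<and> (AE x in lborel. f x \<bullet> b = h x)" for b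
  proof -
    have "(\<lambda>x. f x \<bullet> b) \<in> borel_measurable lebesgue" using f by (intro borel_measurable_inner) auto
    from completion_ex_borel_measurable_real[OF this] show ?thesis by auto
  qed
  then obtain h where h: "\<And>b. h b \<in> borel_measurable borel" "\<And>b. AE x in lborel. f x \<bullet> b = h b x" by metis
  have "AE x in lborel. \<forall>b\<in>Basis. f x \<bullet> b = h b x" by (intro AE_finite_allI h) auto
  then have "AE x in lborel. f x = (\<Sum>b\<in>Basis. h b x *\<^sub>R b)"
  proof eventually_elim
    case (elim x)
    have "f x = (\<Sum>b\<in>Basis. (f x \<bullet> b) *\<^sub>R b)" by (simp add: euclidean_representation)
    also have "\<dots> = (\<Sum>b\<in>Basis. h b x *\<^sub>R b)" using elim by (intro sum.cong) auto
    finally show ?case .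
  qed
  moreover have "(\<lambda>x. \<Sum>b\<in>Basis. h b x *\<^sub>R b) \<in> borel_measurable borel"
    using h(1) by (intro borel_measurable_sum borel_measurable_scaleR) auto
  ultimately show ?thesis using that by blast
qed

lemma lebesgue_integral_transfer:
  fixes f :: "'a::euclidean_space \<Rightarrow> 'b::euclidean_space"
  assumes f: "f \<in> borel_measurable lebesgue" and f': "f' \<in> borel_measurable borel" and ae: "AE x in lborel. f x = f' x"
  shows "(\<integral>x. f x \<partial>lebesgue) = (\<integral>x. f' x \<partial>lborel)" "integrable lebesgue f \<longleftrightarrow> integrable lborel f'"
proof -
  have f'2: "f' \<in> borel_measurable lebesgue" using f' by (intro measurable_completion) simp
  have ae': "AE x in lebesgue. f x = f' x" using ae by (rule AE_completion)
  show "(\<integral>x. f x \<partial>lebesgue) = (\<integral>x. f' x \<partial>lborel)"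
    using integral_cong_AE[OF f f'2 ae'] f' by (simp add: integral_completion)
  show "integrable lebesgue f \<longleftrightarrow> integrable lborel f'"
    using integrable_cong_AE[OF f f'2 ae'] f' by (simp add: integrable_completion)
qed

lemma locally_integrable_measurable:
  fixes f :: "'a::euclidean_space \<Rightarrow> 'b::euclidean_space"
  assumes "locally_integrable f" shows "f \<in> borel_measurable lebesgue"
proof (rule borel_measurable_LIMSEQ_metric)
  show "(\<lambda>x. indicator (cball 0 (real n)) x *\<^sub>R f x) \<in> borel_measurable lebesgue" for n
    using assms compact_cball[of "0::'a" "real n"] unfolding locally_integrable_def set_integrable_def
    by (intro borel_measurable_integrable) blast
  fix x :: 'a
  obtain N where N: "norm x \<le> real N" using real_arch_simple by blast
  show "(\<lambda>n. indicator (cball 0 (real n)) x *\<^sub>R f x) \<longlonglongrightarrow> f x"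
    using N by (intro tendsto_eventually) (auto simp: eventually_sequentially intro!: exI[of _ N])
qed

lemma test_times_locally_integrable:
  fixes g :: "'a::euclidean_space \<Rightarrow> 'b::euclidean_space"
  assumes g: "locally_integrable g" and \<phi>: "\<phi> \<in> test_functions"
  shows "integrable lebesgue (\<lambda>x. \<phi> x *\<^sub>R g x)"
proof -
  obtain R where R: "\<And>x. norm x \<ge> R \<Longrightarrow> \<phi> x = 0" using test_support[OF \<phi>] by metis
  have "bounded (\<phi> ` cball 0 R)"
    using test_continuous[OF \<phi>] by (intro compact_imp_bounded compact_continuous_image) (auto intro: continuous_on_subset)
  then obtain B where "\<forall>y\<in>\<phi> ` cball 0 R. norm y \<le> B" unfolding bounded_iff by blast
  then have B: "norm (\<phi> x) \<le> B" if "x \<in> cball 0 R" for x using that by blast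
  have i: "integrable lebesgue (\<lambda>x. \<bar>B\<bar> *\<^sub>R (indicator (cball 0 R) x *\<^sub>R g x))"
    using g compact_cball[of "0::'a" R] unfolding locally_integrable_def set_integrable_def
    by (intro integrable_scaleR_right) blast
  have \<phi>m: "\<phi> \<in> borel_measurable lebesgue" using test_measurable[OF \<phi>] by (intro measurable_completion) simp
  show ?thesis
  proof (rule Bochner_Integration.integrable_bound[OF i])
    show "(\<lambda>x. \<phi> x *\<^sub>R g x) \<in> borel_measurable lebesgue"
      by (intro borel_measurable_scaleR \<phi>m locally_integrable_measurable g)
    show "AE x in lebesgue. norm (\<phi> x *\<^sub>R g x) \<le> norm (\<bar>B\<bar> *\<^sub>R (indicator (cball 0 R) x *\<^sub>R g x))"
    proof (rule AE_I2)
      fix x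
      show "norm (\<phi> x *\<^sub>R g x) \<le> norm (\<bar>B\<bar> *\<^sub>R (indicator (cball 0 R) x *\<^sub>R g x))"
        using B[of x] R[of x] by (cases "norm x \<le> R") (auto intro!: mult_right_mono)
    qed
  qed
qed

text \<open>\<open>weak_gradient\<close> is a choice among all weak gradients, of which only local
  integrability is known in advance. This version of \<open>wgrad_unique\<close> makes it agree with
  the square integrable one.\<close>

lemma weak_gradient_unique:
  assumes g: "has_weak_gradient u g" and h: "has_weak_gradient u h"
  shows "AE x in lborel. g x = (h x :: 'a::euclidean_space)"
proof -
  have gl: "locally_integrable g" "locally_integrable h" using g h by (auto simp: has_weak_gradient_def)
  define f where "f x = g x - h x" for x
  have fm: "f \<in> borel_measurable lebesgue"
    unfolding f_def[abs_def] by (intro borel_measurable_diff locally_integrable_measurable gl)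
  obtain f' where f': "f' \<in> borel_measurable borel" "AE x in lborel. f x = f' x"
    by (rule lebesgue_borel_representative[OF fm])
  note [measurable] = f'(1)
  have "AE x in lborel. f' x = 0"
  proof (rule AE_zero_if_test_integrals_zero)
    fix a b :: 'a
    have "integrable lebesgue (\<lambda>x. indicator (cbox a b) x *\<^sub>R g x)" "integrable lebesgue (\<lambda>x. indicator (cbox a b) x *\<^sub>R h x)"
      using gl unfolding locally_integrable_def set_integrable_def by (blast intro: compact_cbox)+
    from Bochner_Integration.integrable_diff[OF this]
    have "integrable lebesgue (\<lambda>x. indicator (cbox a b) x *\<^sub>R f x)" by (simp add: f_def scaleR_diff_right)
    moreover have "(\<lambda>x. indicator (cbox a b) x *\<^sub>R f x) \<in> borel_measurable lebesgue" using calculation by (rule borel_measurable_integrable)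
    moreover have "(\<lambda>x. indicator (cbox a b) x *\<^sub>R f' x) \<in> borel_measurable borel" by measurable
    moreover have "AE x in lborel. indicator (cbox a b) x *\<^sub>R f x = indicator (cbox a b) x *\<^sub>R f' x" using f'(2) by eventually_elim simp
    ultimately have "integrable lborel (\<lambda>x. indicator (cbox a b) x *\<^sub>R f' x)"
      using lebesgue_integral_transfer(2) by blast
    then have "integrable lborel (\<lambda>x. indicator (box a b) x *\<^sub>R (indicator (cbox a b) x *\<^sub>R f' x))"
      by (rule integrable_mult_indicator[rotated]) simp
    also have "(\<lambda>x. indicator (box a b) x *\<^sub>R (indicator (cbox a b) x *\<^sub>R f' x)) = (\<lambda>x. indicator (box a b) x *\<^sub>R f' x)"
      using box_subset_cbox[of a b] by (auto simp: fun_eq_iff indicator_def)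
    finally show "integrable lborel (\<lambda>x. indicator (box a b) x *\<^sub>R f' x)" .
  next
    fix \<phi> :: "'a \<Rightarrow> real" assume \<phi>: "\<phi> \<in> test_functions"
    note [measurable] = test_measurable[OF \<phi>]
    have i: "integrable lebesgue (\<lambda>x. \<phi> x *\<^sub>R g x)" "integrable lebesgue (\<lambda>x. \<phi> x *\<^sub>R h x)"
      by (intro test_times_locally_integrable gl \<phi>)+
    have m: "(\<lambda>x. \<phi> x *\<^sub>R f x) \<in> borel_measurable lebesgue"
      using Bochner_Integration.integrable_diff[OF i] unfolding f_def
      by (intro borel_measurable_integrable) (simp add: scaleR_diff_right)
    have "(\<integral>x. \<phi> x *\<^sub>R f' x \<partial>lborel) = (\<integral>x. \<phi> x *\<^sub>R f x \<partial>lebesgue)"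
      by (rule lebesgue_integral_transfer(1)[OF m, symmetric]) (use f'(2) in \<open>auto elim: eventually_mono\<close>)
    also have "\<dots> = (\<integral>x. \<phi> x *\<^sub>R g x \<partial>lebesgue) - (\<integral>x. \<phi> x *\<^sub>R h x \<partial>lebesgue)"
      using i by (simp add: f_def scaleR_diff_right)
    also have "\<dots> = 0"
    proof -
      have "- (\<integral>x. \<phi> x *\<^sub>R g x \<partial>lebesgue) = - (\<integral>x. \<phi> x *\<^sub>R h x \<partial>lebesgue)"
        using g h \<phi> unfolding has_weak_gradient_def by metis
      then show ?thesis by simp
    qed
    finally show "(\<integral>x. \<phi> x *\<^sub>R f' x \<partial>lborel) = 0" .
  qed (rule f'(1))
  with f'(2) show ?thesis by eventually_elim (simp add: f_def)
qed

lemma L2_locally_integrable: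
  fixes u :: "'a::euclidean_space \<Rightarrow> 'b::euclidean_space"
  assumes u: "u \<in> L2 lborel" shows "locally_integrable u"
  unfolding locally_integrable_def set_integrable_def
proof (intro allI impI)
  fix C :: "'a set" assume C: "compact C"
  have "C \<in> sets lborel" using C by (simp add: borel_compact)
  moreover have "emeasure lborel C < \<infinity>" using C by (rule emeasure_compact_finite)
  ultimately have i: "integrable lborel (\<lambda>x. indicator C x *\<^sub>R u x)"
    by (intro L2_mult indicator_L2 u)
  then show "integrable lebesgue (\<lambda>x. indicator C x *\<^sub>R u x)"
    by (subst integrable_completion) (auto dest: borel_measurable_integrable)
qed

lemma L2_square_integrable: "u \<in> L2 lborel \<Longrightarrow> square_integrable u"
  unfolding L2_def square_integrable_def
  by (auto simp: integrable_completion intro: measurable_completion)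

lemma square_integrable_L2:
  assumes u: "square_integrable u" and u': "u' \<in> borel_measurable borel" "AE x in lborel. u x = u' x"
  shows "u' \<in> L2 lborel"
proof -
  have "integrable lborel (\<lambda>x. (norm (u' x))\<^sup>2)"
  proof (rule lebesgue_integral_transfer(2)[THEN iffD1, of "\<lambda>x. (norm (u x))\<^sup>2"])
    show "integrable lebesgue (\<lambda>x. (norm (u x))\<^sup>2)" using u by (simp add: square_integrable_def)
    then show "(\<lambda>x. (norm (u x))\<^sup>2) \<in> borel_measurable lebesgue" by (rule borel_measurable_integrable)
  qed (use u' in \<open>auto elim: eventually_mono\<close>)
  then show ?thesis using u' by (simp add: L2_def)
qed

lemma wgrad_has_weak_gradient:
  assumes u: "wgrad u g" shows "has_weak_gradient u g"
  unfolding has_weak_gradient_def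
proof (intro conjI ballI L2_locally_integrable wgradD(1,2)[OF u])
  fix \<phi> :: "'a \<Rightarrow> real" assume \<phi>: "\<phi> \<in> test_functions"
  note [measurable] = wgradD(3,4)[OF u] test_measurable[OF \<phi>] gradient_measurable[OF \<phi>]
  show "(\<integral>x. u x *\<^sub>R gradient \<phi> x \<partial>lebesgue) = - (\<integral>x. \<phi> x *\<^sub>R g x \<partial>lebesgue)"
    using wgradD(5)[OF u \<phi>] by (simp add: integral_completion)
qed

lemma wgrad_W12:
  assumes u: "wgrad u g"
  shows "u \<in> W12" "AE x in lborel. weak_gradient u x = g x" "weak_gradient u \<in> borel_measurable lebesgue"
proof -
  have h: "has_weak_gradient u g" by (rule wgrad_has_weak_gradient[OF u])
  then show "u \<in> W12" unfolding W12_def using L2_square_integrable[OF wgradD(1)[OF u]] L2_square_integrable[OF wgradD(2)[OF u]] by auto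
  have "has_weak_gradient u (weak_gradient u)" unfolding weak_gradient_def using h by (rule someI[of "has_weak_gradient u"])
  then show "AE x in lborel. weak_gradient u x = g x" "weak_gradient u \<in> borel_measurable lebesgue"
    using weak_gradient_unique[OF _ h] locally_integrable_measurable by (auto simp: has_weak_gradient_def)
qed

text \<open>Function and gradient are replaced by Borel functions equal to them almost everywhere;
  integrals against test functions do not change, so the new pair satisfies
  \<open>wgrad\<close>.\<close>

lemma W12_representative:
  assumes u: "u \<in> W12"
  obtains v h where "wgrad v h" "AE x in lborel. u x = v x" "AE x in lborel. weak_gradient u x = h x"
    "u \<in> borel_measurable lebesgue" "weak_gradient u \<in> borel_measurable lebesgue"
proof -
  obtain g where us: "square_integrable u" and g: "has_weak_gradient u g" "square_integrable g"
    using u by (auto simp: W12_def)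
  have G: "has_weak_gradient u (weak_gradient u)" unfolding weak_gradient_def using g(1) by (rule someI[of "has_weak_gradient u"])
  have um: "u \<in> borel_measurable lebesgue" and gm: "g \<in> borel_measurable lebesgue"
    using us g by (auto simp: square_integrable_def)
  obtain v where v: "v \<in> borel_measurable borel" "AE x in lborel. u x = v x"
    by (rule lebesgue_borel_representative[OF um])
  obtain h where h: "h \<in> borel_measurable borel" "AE x in lborel. g x = h x"
    by (rule lebesgue_borel_representative[OF gm])
  have "wgrad v h"
    unfolding wgrad_def
  proof (intro conjI ballI square_integrable_L2[OF us v] square_integrable_L2[OF g(2) h])
    fix \<phi> :: "'a \<Rightarrow> real" assume \<phi>: "\<phi> \<in> test_functions"
    note [measurable] = v(1) h(1) test_measurable[OF \<phi>] gradient_measurable[OF \<phi>]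
    have \<phi>m: "\<phi> \<in> borel_measurable lebesgue" "gradient \<phi> \<in> borel_measurable lebesgue"
      by (intro measurable_completion; simp)+
    have "(\<integral>x. u x *\<^sub>R gradient \<phi> x \<partial>lebesgue) = (\<integral>x. v x *\<^sub>R gradient \<phi> x \<partial>lborel)"
      by (rule lebesgue_integral_transfer(1)) (use um \<phi>m v(2) in \<open>auto elim: eventually_mono intro!: borel_measurable_scaleR\<close>)
    moreover have "(\<integral>x. \<phi> x *\<^sub>R g x \<partial>lebesgue) = (\<integral>x. \<phi> x *\<^sub>R h x \<partial>lborel)"
      by (rule lebesgue_integral_transfer(1)) (use gm \<phi>m h(2) in \<open>auto elim: eventually_mono intro!: borel_measurable_scaleR\<close>)
    ultimately show "(\<integral>x. v x *\<^sub>R gradient \<phi> x \<partial>lborel) = - (\<integral>x. \<phi> x *\<^sub>R h x \<partial>lborel)"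
      using g(1) \<phi> by (simp add: has_weak_gradient_def)
  qed
  moreover have "AE x in lborel. weak_gradient u x = h x"
    using weak_gradient_unique[OF G g(1)] h(2) by eventually_elim simp
  moreover have "weak_gradient u \<in> borel_measurable lebesgue"
    using G by (auto simp: has_weak_gradient_def intro: locally_integrable_measurable)
  ultimately show ?thesis using that v(2) um by blast
qed

lemma W12_norm_sq_eq:
  assumes "wgrad v h" "AE x in lborel. u x = v x" "AE x in lborel. weak_gradient u x = h x"
    "u \<in> borel_measurable lebesgue" "weak_gradient u \<in> borel_measurable lebesgue"
  shows "W12_norm_sq u = hnorm v h"
proof -
  note [measurable] = wgradD(3,4)[OF assms(1)] assms(4,5)
  have "W12_norm_sq u = (\<integral>x. (norm (h x))\<^sup>2 + \<bar>v x\<bar>\<^sup>2 \<partial>lborel)"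
    unfolding W12_norm_sq_def
    by (rule lebesgue_integral_transfer(1), measurable) (use assms(2,3) in eventually_elim, simp)
  then show ?thesis by (simp add: hnorm_def add.commute)
qed

section \<open>The functional on Lebesgue measurable functions\<close>

context choquard_kernel
begin

lemma convolution_representative:
  assumes u: "u \<in> borel_measurable lebesgue" and v[measurable]: "v \<in> borel_measurable borel" and ae: "AE x in lborel. u x = v x"
  shows "convolution k u x = (\<integral>y. k (x - y) * v y \<partial>lborel)"
  unfolding convolution_def
proof (rule lebesgue_integral_transfer(1))
  have "(\<lambda>y. k (x - y)) \<in> borel_measurable borel" by measurable
  then have "(\<lambda>y. k (x - y)) \<in> borel_measurable lebesgue" by (intro measurable_completion) simp
  then show "(\<lambda>y. k (x - y) * u y) \<in> borel_measurable lebesgue" using u by (intro borel_measurable_times)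
  show "AE y in lborel. k (x - y) * u y = k (x - y) * v y" using ae by eventually_elim simp
qed measurable

text \<open>The convolution is the inner integral in Fubini's theorem, so the factor outside it
  becomes the first argument of \<open>bform\<close>, and integrability on the product is required
  in that order.\<close>

lemma integral_convolution:
  fixes u :: "'a \<Rightarrow> real"
  assumes u: "u \<in> borel_measurable lebesgue" and f[measurable]: "f \<in> borel_measurable borel" and uf: "AE x in lborel. u x = f x"
    and v: "v \<in> borel_measurable lebesgue" and g[measurable]: "g \<in> borel_measurable borel" and vg: "AE x in lborel. v x = g x"
    and int: "integrable lborel2 (\<lambda>z. g (fst z) * k (fst z - snd z) * f (snd z))"
  shows "(\<integral>x. convolution k u x * v x \<partial>lebesgue) = bform k g f"
proof -
  let ?C = "\<lambda>x. \<integral>y. k (x - y) * f y \<partial>lborel"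
  have C: "convolution k u = ?C" by (rule ext) (rule convolution_representative[OF u f uf])
  have Cm [measurable]: "?C \<in> borel_measurable borel" by measurable
  have "?C \<in> borel_measurable lebesgue" by (intro measurable_completion) simp
  then have "(\<integral>x. convolution k u x * v x \<partial>lebesgue) = (\<integral>x. ?C x * g x \<partial>lborel)"
    unfolding C using v vg
    by (intro lebesgue_integral_transfer(1) borel_measurable_times) (auto elim: eventually_mono)
  also have "\<dots> = (\<integral>x. \<integral>y. g x * k (x - y) * f y \<partial>lborel \<partial>lborel)"
  proof (intro Bochner_Integration.integral_cong refl)
    fix x
    have "?C x * g x = (\<integral>y. g x * (k (x - y) * f y) \<partial>lborel)"
      by (subst integral_mult_right_zero) (rule mult.commute)
    then show "?C x * g x = (\<integral>y. g x * k (x - y) * f y \<partial>lborel)" by (simp add: mult.assoc)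
  qed
  also have "\<dots> = bform k g f"
    unfolding bform_def using lborel_pair.integral_fst'[OF int] by simp
  finally show ?thesis .
qed

lemma choquard_term_eq:
  assumes p\<alpha>: "k = riesz_potential \<alpha>" and v: "wgrad v h" and u: "u \<in> borel_measurable lebesgue" "AE x in lborel. u x = v x"
  shows "choquard_term \<alpha> p u = D v"
proof -
  note [measurable] = wgradD(3)[OF v] u(1)
  obtain A where A: "adm A v"
    using sobolev_adm[of "hnorm v h + 1"] v hnorm_nonneg[of v h]
    by (metis add_nonneg_pos less_add_one less_imp_le zero_less_one)
  have int: "integrable lborel2 (\<lambda>z. \<bar>v (fst z)\<bar> powr p * k (fst z - snd z) * \<bar>v (snd z)\<bar> powr p)"
    by (rule bform_dominated(3)[OF _ _ A A, where c = 1 and d = 1]) auto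
  have m: "(\<lambda>x. \<bar>u x\<bar> powr p) \<in> borel_measurable lebesgue" by measurable
  have ae: "AE x in lborel. \<bar>u x\<bar> powr p = \<bar>v x\<bar> powr p" using u(2) by eventually_elim simp
  show ?thesis
    unfolding choquard_term_def D_def p\<alpha>[symmetric]
    by (rule integral_convolution[OF m _ ae m _ ae int]) measurable
qed

end

text \<open>Every dimension N \<ge> 1 occurs as \<open>CARD('n)\<close>. The infimum is formed in
  the extended reals, where it is meaningful for every set.\<close>

theorem theorem1:
  fixes \<alpha> p :: real
  assumes "0 < \<alpha>" and "\<alpha> < real CARD('n::finite)"
    and "1 < p"
    and "(real CARD('n) - 2) / (real CARD('n) + \<alpha>) < 1 / p"
    and "1 / p < real CARD('n) / (real CARD('n) + \<alpha>)"
  shows "\<exists>u :: real ^ 'n \<Rightarrow> real. u \<in> W12 \<and> choquard_weak_solution \<alpha> p u \<and>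
    ereal (energy \<alpha> p u) =
      (INF v \<in> {v :: real ^ 'n \<Rightarrow> real. v \<in> W12 \<and> \<not> (AE x in lebesgue. v x = 0) \<and>
                  W12_norm_sq v = choquard_term \<alpha> p v}. ereal (energy \<alpha> p v))"
proof -
  have dim: "DIM(real ^ 'n) = CARD('n)" by simp
  obtain k1 k2 t1 t2 where "choquard_kernel (riesz_potential \<alpha> :: real ^ 'n \<Rightarrow> real) k1 k2 t1 t2 p"
    by (rule riesz_choquard_kernel[of \<alpha> p, where 'a = "real ^ 'n", unfolded dim, OF assms])
  then interpret choquard_kernel "riesz_potential \<alpha> :: real ^ 'n \<Rightarrow> real" k1 k2 t1 t2 p .
  obtain w \<psi> where w: "wgrad w \<psi>" and pos: "hnorm w \<psi> > 0" and nehari: "hnorm w \<psi> = D w"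
    and EL: "\<And>\<phi> \<zeta>. wgrad \<phi> \<zeta> \<Longrightarrow> hinner w \<psi> \<phi> \<zeta> = bform (riesz_potential \<alpha>) (\<lambda>x. \<bar>w x\<bar> powr p) (\<lambda>x. \<bar>w x\<bar> powr (p - 2) * w x * \<phi> x)"
    and min: "\<And>\<phi> \<zeta>. wgrad \<phi> \<zeta> \<Longrightarrow> hnorm \<phi> \<zeta> > 0 \<Longrightarrow> hnorm \<phi> \<zeta> = D \<phi> \<Longrightarrow> hnorm w \<psi> \<le> hnorm \<phi> \<zeta>"
    using groundstate_exists by blast
  note [measurable] = wgradD(3,4)[OF w]
  have wm: "w \<in> borel_measurable lebesgue" using wgradD(3)[OF w] by (intro measurable_completion) simp
  have norm_w: "W12_norm_sq w = hnorm w \<psi>"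
    by (rule W12_norm_sq_eq[OF w _ wgrad_W12(2)[OF w] wm wgrad_W12(3)[OF w]]) simp
  have term_w: "choquard_term \<alpha> p w = D w"
    by (rule choquard_term_eq[OF refl w wm]) simp
  have solution: "choquard_weak_solution \<alpha> p w"
    unfolding choquard_weak_solution_def
  proof (intro ballI)
    fix \<phi> :: "real ^ 'n \<Rightarrow> real" assume \<phi>: "\<phi> \<in> test_functions"
    have \<phi>w: "wgrad \<phi> (gradient \<phi>)" by (rule wgrad_test[OF \<phi>])
    note [measurable] = wgradD(3,4)[OF \<phi>w]
    have \<phi>m: "\<phi> \<in> borel_measurable lebesgue" "gradient \<phi> \<in> borel_measurable lebesgue" "w \<in> borel_measurable lebesgue"
      by (intro measurable_completion; simp)+
    have "(\<integral>x. weak_gradient w x \<bullet> gradient \<phi> x + w x * \<phi> x \<partial>lebesgue) = (\<integral>x. \<psi> x \<bullet> gradient \<phi> x + w x * \<phi> x \<partial>lborel)"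
    proof (rule lebesgue_integral_transfer(1))
      show "(\<lambda>x. weak_gradient w x \<bullet> gradient \<phi> x + w x * \<phi> x) \<in> borel_measurable lebesgue"
        by (intro borel_measurable_add borel_measurable_inner borel_measurable_times wgrad_W12(3)[OF w] \<phi>m)
      show "AE x in lborel. weak_gradient w x \<bullet> gradient \<phi> x + w x * \<phi> x = \<psi> x \<bullet> gradient \<phi> x + w x * \<phi> x"
        using wgrad_W12(2)[OF w] by eventually_elim simp
    qed measurable
    also have "\<dots> = hinner w \<psi> \<phi> (gradient \<phi>)" by (simp add: hinner_def add.commute)
    also have "\<dots> = bform (riesz_potential \<alpha>) (\<lambda>x. \<bar>w x\<bar> powr p) (\<lambda>x. \<bar>w x\<bar> powr (p - 2) * w x * \<phi> x)"
      by (rule EL[OF \<phi>w])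
    \<comment> \<open>The symmetry of the kernel moves the test function to the outer variable,
      where the equation has it.\<close>
    also have "\<dots> = bform (riesz_potential \<alpha>) (\<lambda>x. \<bar>w x\<bar> powr (p - 2) * w x * \<phi> x) (\<lambda>x. \<bar>w x\<bar> powr p)"
      by (rule bform_sym) measurable
    also have "\<dots> = (\<integral>x. convolution (riesz_potential \<alpha>) (\<lambda>y. \<bar>w y\<bar> powr p) x * (\<bar>w x\<bar> powr (p - 2) * w x * \<phi> x) \<partial>lebesgue)"
    proof (rule integral_convolution[symmetric])
      show "(\<lambda>y. \<bar>w y\<bar> powr p) \<in> borel_measurable lebesgue" "(\<lambda>x. \<bar>w x\<bar> powr (p - 2) * w x * \<phi> x) \<in> borel_measurable lebesgue"
        by (intro measurable_completion, measurable)+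
      obtain A where A: "\<And>(u :: real ^ 'n \<Rightarrow> real) g. wgrad u g \<Longrightarrow> hnorm u g \<le> hnorm w \<psi> + hnorm \<phi> (gradient \<phi>) \<Longrightarrow> adm A u"
        using sobolev_adm[of "hnorm w \<psi> + hnorm \<phi> (gradient \<phi>)"] pos hnorm_nonneg[of \<phi> "gradient \<phi>"] by (metis add_pos_nonneg)
      have aw: "adm A w" using hnorm_nonneg[of \<phi> "gradient \<phi>"] by (intro A[OF w]) simp
      have a\<phi>: "adm A \<phi>" using pos by (intro A[OF \<phi>w]) simp
      show "integrable lborel2 (\<lambda>z. (\<bar>w (fst z)\<bar> powr (p - 2) * w (fst z) * \<phi> (fst z)) * riesz_potential \<alpha> (fst z - snd z) * \<bar>w (snd z)\<bar> powr p)"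
        by (rule signed_integrable[OF aw a\<phi>])
    qed simp_all
    finally show "(\<integral>x. weak_gradient w x \<bullet> gradient \<phi> x + w x * \<phi> x \<partial>lebesgue) =
      (\<integral>x. convolution (riesz_potential \<alpha>) (\<lambda>y. \<bar>w y\<bar> powr p) x * (\<bar>w x\<bar> powr (p - 2) * w x) * \<phi> x \<partial>lebesgue)"
      by (simp add: mult.assoc)
  qed
  let ?V = "{v :: real ^ 'n \<Rightarrow> real. v \<in> W12 \<and> \<not> (AE x in lebesgue. v x = 0) \<and> W12_norm_sq v = choquard_term \<alpha> p v}"
  \<comment> \<open>On the constraint set the energy is a multiple of the squared norm, with a
    positive factor since p > 1, so minimal norm means minimal energy.\<close>
  have energy_eq: "energy \<alpha> p v = (1 / 2 - 1 / (2 * p)) * W12_norm_sq v" if "W12_norm_sq v = choquard_term \<alpha> p v" for v :: "real ^ 'n \<Rightarrow> real"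
    unfolding energy_def that[symmetric] by (simp add: left_diff_distrib)
  have zero_D: "D v = 0" if v: "wgrad v h" "AE x in lborel. v x = 0" for v h
  proof -
    note [measurable] = wgradD(3)[OF v(1)]
    have "D v = bform (riesz_potential \<alpha>) (\<lambda>x :: real ^ 'n. 0) (\<lambda>x. 0)"
      unfolding D_def by (rule bform_cong_AE) (use v in \<open>auto elim: eventually_mono\<close>)
    then show ?thesis by (simp add: bform_def)
  qed
  have "w \<in> ?V"
  proof -
    have "\<not> (AE x in lebesgue. w x = 0)"
      using zero_D[OF w] pos nehari by (auto simp: AE_completion_iff)
    then show ?thesis using wgrad_W12(1)[OF w] norm_w term_w nehari by simp
  qed
  moreover have "energy \<alpha> p w \<le> energy \<alpha> p v" if v: "v \<in> ?V" for v
  proof -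
    obtain v' h where v': "wgrad v' h" "AE x in lborel. v x = v' x" "AE x in lborel. weak_gradient v x = h x"
      "v \<in> borel_measurable lebesgue" "weak_gradient v \<in> borel_measurable lebesgue"
      using W12_representative v by blast
    have n: "W12_norm_sq v = hnorm v' h" by (rule W12_norm_sq_eq[OF v'])
    have d: "choquard_term \<alpha> p v = D v'" by (rule choquard_term_eq[OF refl v'(1,4,2)])
    have "hnorm v' h \<noteq> 0"
    proof
      assume "hnorm v' h = 0"
      then have "AE x in lborel. v' x = 0" by (rule hnorm_eq_0[OF v'(1)])
      with v'(2) have "AE x in lborel. v x = 0" by eventually_elim simp
      then have "AE x in lebesgue. v x = 0" by (rule AE_completion)
      with v show False by simp
    qed
    then have "hnorm w \<psi> \<le> hnorm v' h"
      using v n d hnorm_nonneg[of v' h] by (intro min[OF v'(1)]) auto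
    then have "(1 / 2 - 1 / (2 * p)) * W12_norm_sq w \<le> (1 / 2 - 1 / (2 * p)) * W12_norm_sq v"
      unfolding norm_w n using assms(3) by (intro mult_left_mono) (auto simp: field_simps)
    then show ?thesis
      using v norm_w term_w nehari by (simp add: energy_eq)
  qed
  ultimately have "ereal (energy \<alpha> p w) = (INF v \<in> ?V. ereal (energy \<alpha> p v))"
    by (intro antisym INF_greatest INF_lower) auto
  then show ?thesis using wgrad_W12(1)[OF w] solution by blast
qed

end
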